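(* Let $W\in R=k[x_1,\dots,x_n]$ be a potential and let $G$ be a symmetry group of $W$, i.e. a finite subgroup of the group of automorphisms of $R$ that leave $W$ invariant. Let $A_G=\bigoplus_{g\in G}{}_gI_W$ with its structure of a separable Frobenius algebra. Then there is an equivalence of categories $$\mathrm{hmf}(R,W)^G\cong\mathrm{mod}(A_G)$$ between the category of $G$-equivariant matrix factorisations of $W$ and the category $\mathrm{mod}(A_G)=\mathcal{LG}_{\mathrm{eq}}\big((0,I),(W,A_G)\big)$ of left $A_G$-modules and module maps.
   Context: Here $k=\mathbb C$ or $k=\mathbb C[t_1,\dots,t_d]$ (more generally any commutative noetherian $\mathbb Q$-algebra). A potential is $W\in R=k[x_1,\dots,x_n]$ such that $\mathrm{Jac}(W)=R/(\partial_{x_1}W,\dots,\partial_{x_n}W)$ is a finitely generated free $k$-module and the $\partial_{x_i}W$ form a regular sequence. A matrix factorisation of $W$ is a $\mathbb Z_2$-graded free $R$-module $X$ with an odd $R$-linear $d_X$, $d_X^2=W\cdot1_X$; morphisms are even $R$-linear maps commuting with the differentials, modulo homotopy ($\phi\sim\psi$ if $\psi-\phi=d_Y\lambda+\lambda d_X$ for an odd $R$-linear $\lambda$). $\mathrm{HMF}(R,W)$ is the resulting category, $\mathrm{hmf}(R,W)$ the full subcategory of finite-rank matrix factorisations, and $\mathrm{hmf}(R,W)^\omega$ the full subcategory of $\mathrm{HMF}(R,W)$ of objects isomorphic to direct summands of finite-rank ones. The bicategory $\mathcal{LG}$: objects are potentials $(R,W)$; $\mathcal{LG}((R,W),(S,V))=\mathrm{hmf}(S\otimes_kR,V-W)^\omega$;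 composition of $X:W\to V$ and $Y:V\to U$ is $Y\otimes X=Y\otimes_SX$ with $d=d_Y\otimes1+1\otimes d_X$. The unit is $I=I_W=\bigwedge(\bigoplus_{i=1}^nR^{\mathrm e}\theta_i)$, $R^{\mathrm e}=R\otimes_kR=k[x,x']$, with differential $\sum_i((x_i-x_i')\theta_i^*+\partial_{[i]}W\,\theta_i\wedge(-))$, where $\partial_{[i]}W=\frac{W(x'_1,\dots,x'_{i-1},x_i,\dots,x_n)-W(x'_1,\dots,x'_i,x_{i+1},\dots,x_n)}{x_i-x'_i}$. The left unit isomorphism $\lambda_X:I\otimes X\to X$ (invertible up to homotopy) projects $I$ to $\theta$-degree $0$ and uses the multiplication of the ring. $0$ denotes the trivial object $(k,0)$, so that $\mathcal{LG}(0,W)=\mathrm{hmf}(R,W)^\omega$. The bicategory $\mathcal{LG}_{\mathrm{eq}}$ has as objects pairs $(W,A)$ with $A\in\mathcal{LG}(W,W)$ a separable Frobenius algebra (an algebra and coalgebra with $(1_A\otimes\mu)(\Delta\otimes1_A)=\Delta\mu=(\mu\otimes1_A)(1_A\otimes\Delta)$ and $\mu\Delta=1_A$), as 1-morphisms $(W,A)\to(V,B)$ the 1-morphisms in $\mathcal{LG}(W,V)$ with a $B$-$A$-bimodule structure, and as 2-morphisms bimodule maps. Thus objects of $\mathcal{LG}_{\mathrm{eq}}((0,I),(W,A_G))$ are objects $X$ of $\mathrm{hmf}(R,W)^\omega$ with an associative and unital action $A_G\otimes X\to X$, and morphisms are module maps. Twisting: for $g\in G$ and an $R$-module $X$, ${}_gX$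 is the same set with $R$-action $(r,m)\mapsto g^{-1}(r).m$; this gives a functor ${}_g(-)$ on matrix factorisations of $W$. On $I_W$ and other 1-morphisms ${}_g(-)$ twists the left $R$-action, and ${}_gI\otimes X={}_g(I\otimes X)$. $\mathrm{hmf}(R,W)^G$: objects are objects $X\in\mathrm{hmf}(R,W)$ together with isomorphisms $\{\varphi_g:{}_gX\to X\}_{g\in G}$ such that $\varphi_e=1_X$ and $\varphi_{gh}=\varphi_g\circ{}_g(\varphi_h)$; morphisms are morphisms $\Psi:X\to Y$ in $\mathrm{hmf}(R,W)$ with $\Psi\circ\varphi_g^{(X)}=\varphi_g^{(Y)}\circ{}_g\Psi$ for all $g\in G$. Structure on $A_G=\bigoplus_{g\in G}{}_gI$: multiplication $\mu=\sum_{g,h}\mu_{g,h}$ with $\mu_{g,h}={}_g(\lambda_{{}_hI}):{}_gI\otimes{}_hI\to{}_{gh}I$; unit the inclusion $I={}_eI\hookrightarrow A_G$; comultiplication $\Delta=\frac1{|G|}\sum_{g,h}{}_g(\lambda_{{}_hI}^{-1})$; counit $|G|$ times the projection $A_G\to I$.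
   Formalization: Since hmf(R,W) need not equal hmf(R,W)^ω (so the claim fails for trivial G), the equivalence is proved with underlying objects in hmf^ω on both sides, with finite-rank objects on both sides, and as displayed when every object of hmf^ω is isomorphic to a finite-rank one. *)

theory Defs
  imports "HOL-Algebra.Bij" "HOL-Algebra.Free_Abelian_Groups" "HOL-Algebra.Module"
    "HOL-Algebra.Ring_Divisibility" "HOL-Library.Poly_Mapping"
begin

text \<open>
  Conventions.  The base ring \<open>k\<close> is a type of class \<^class>\<open>comm_ring_1\<close>.  All polynomial rings
  \<open>k[x\<^sub>0,\<dots>,x\<^sub>n\<^sub>-\<^sub>1]\<close> are subrings of one type of polynomials in countably many variables.  Modules are
  HOL-Algebra modules, and the type of the elements of a matrix factorisation plays the role of
  a universe: a category of matrix factorisations consists of those whose underlying set lies in the given type.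

  A 1-morphism from a potential in \<open>l\<close> variables to one in \<open>n\<close> variables is a matrix factorisation
  over \<open>k[x\<^sub>0,\<dots>,x\<^sub>n\<^sub>+\<^sub>l\<^sub>-\<^sub>1]\<close>; the variables below \<open>n\<close> act from the left, the others from the right.
  In particular \<open>R\<^sup>e\<close> is the polynomial ring in \<open>n + n\<close> variables with \<open>x'\<^sub>i = x\<^sub>n\<^sub>+\<^sub>i\<close>, and a
  1-morphism from the trivial object \<open>(k,0)\<close> is a matrix factorisation over \<open>R\<close> itself.
\<close>

section \<open>Polynomial rings and potentials\<close>

type_synonym 'k mpoly = "(nat \<Rightarrow>\<^sub>0 nat) \<Rightarrow>\<^sub>0 'k"

definition polys :: "nat \<Rightarrow> 'k::comm_ring_1 mpoly set" where
  "polys n = {p. \<forall>a \<in> Poly_Mapping.keys p. Poly_Mapping.keys a \<subseteq> {..<n}}"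

definition PR :: "nat \<Rightarrow> 'k::comm_ring_1 mpoly ring" where
  "PR n = \<lparr>carrier = polys n, monoid.mult = (*), one = 1, ring.zero = 0, add = (+)\<rparr>"

definition Const :: "'k::comm_ring_1 \<Rightarrow> 'k mpoly" where
  "Const c = Poly_Mapping.single 0 c"

definition Var :: "nat \<Rightarrow> 'k::comm_ring_1 mpoly" where
  "Var i = Poly_Mapping.single (Poly_Mapping.single i 1) 1"

definition subst :: "(nat \<Rightarrow> 'k mpoly) \<Rightarrow> 'k::comm_ring_1 mpoly \<Rightarrow> 'k mpoly" where
  "subst \<sigma> p = (\<Sum>a\<in>Poly_Mapping.keys p. Const (Poly_Mapping.lookup p a) *
     (\<Prod>i\<in>Poly_Mapping.keys a. \<sigma> i ^ Poly_Mapping.lookup a i))"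

definition pd :: "nat \<Rightarrow> 'k::comm_ring_1 mpoly \<Rightarrow> 'k mpoly" where
  "pd i p = (\<Sum>a\<in>Poly_Mapping.keys p. Poly_Mapping.single (a - Poly_Mapping.single i 1)
     (of_nat (Poly_Mapping.lookup a i) * Poly_Mapping.lookup p a))"

definition kring :: "'k::comm_ring_1 ring" where
  "kring = \<lparr>carrier = UNIV, monoid.mult = (*), one = 1, ring.zero = 0, add = (+)\<rparr>"

definition noetherian_Q_algebra :: "'k::comm_ring_1 itself \<Rightarrow> bool" where
  "noetherian_Q_algebra _ \<longleftrightarrow> noetherian_ring (kring :: 'k ring) \<and>
     (\<forall>m::nat. m > 0 \<longrightarrow> (of_nat m :: 'k) dvd 1)"

definition is_basis :: "('r, 'e) ring_scheme \<Rightarrow> ('r, 'm, 'f) module_scheme \<Rightarrow> 'm set \<Rightarrow> bool" where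
  "is_basis R M B \<longleftrightarrow> B \<subseteq> carrier M \<and>
     (\<forall>m\<in>carrier M. \<exists>!c. c \<in> B \<rightarrow>\<^sub>E carrier R \<and> finite {b\<in>B. c b \<noteq> \<zero>\<^bsub>R\<^esub>} \<and>
        m = (\<Oplus>\<^bsub>M\<^esub>b\<in>{b\<in>B. c b \<noteq> \<zero>\<^bsub>R\<^esub>}. c b \<odot>\<^bsub>M\<^esub> b))"

definition pd_ideal :: "nat \<Rightarrow> nat \<Rightarrow> 'k::comm_ring_1 mpoly \<Rightarrow> 'k mpoly set" where
  "pd_ideal n i W = Idl\<^bsub>PR n\<^esub> ((\<lambda>j. pd j W) ` {..<i})"

definition Jac :: "nat \<Rightarrow> 'k::comm_ring_1 mpoly \<Rightarrow> ('k, 'k mpoly set) module" where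
  "Jac n W = (let J = pd_ideal n n W; Q = PR n Quot J in
     \<lparr>carrier = carrier Q, monoid.mult = monoid.mult Q, one = one Q, ring.zero = ring.zero Q, add = add Q,
      module.smult = (\<lambda>c C. (J +>\<^bsub>PR n\<^esub> Const c) \<otimes>\<^bsub>Q\<^esub> C)\<rparr>)"

definition pd_regular_sequence :: "nat \<Rightarrow> 'k::comm_ring_1 mpoly \<Rightarrow> bool" where
  "pd_regular_sequence n W \<longleftrightarrow>
     (\<forall>i<n. \<forall>f\<in>polys n. pd i W * f \<in> pd_ideal n i W \<longrightarrow> f \<in> pd_ideal n i W) \<and>
     pd_ideal n n W \<noteq> polys n"

definition potential :: "nat \<Rightarrow> 'k::comm_ring_1 mpoly \<Rightarrow> bool" where
  "potential n W \<longleftrightarrow> W \<in> polys n \<and>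
     (\<exists>B. finite B \<and> is_basis (kring :: 'k ring) (Jac n W) B) \<and>
     pd_regular_sequence n W"

text \<open>Automorphisms of \<open>R\<close> are automorphisms of \<open>k\<close>-algebras.\<close>

definition symmetry_group ::
    "nat \<Rightarrow> 'k::comm_ring_1 mpoly \<Rightarrow> ('k mpoly \<Rightarrow> 'k mpoly) set \<Rightarrow> bool" where
  "symmetry_group n W G \<longleftrightarrow> finite G \<and> subgroup G (BijGroup (polys n)) \<and>
     (\<forall>g\<in>G. g \<in> ring_hom (PR n) (PR n) \<and> (\<forall>c. g (Const c) = Const c) \<and> g W = W)"


section \<open>Matrix factorisations and their homotopy category\<close>

record ('r, 'm) mf = "('r, 'm) module" +
  evens :: "'m set"
  odds :: "'m set"
  diff :: "'m \<Rightarrow> 'm"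

text \<open>Graded freeness means that there is a basis of homogeneous elements.\<close>

definition homogeneous_basis :: "nat \<Rightarrow> ('k::comm_ring_1 mpoly, 'm) mf \<Rightarrow> 'm set \<Rightarrow> bool" where
  "homogeneous_basis n X B \<longleftrightarrow> is_basis (PR n) X B \<and> B \<subseteq> evens X \<union> odds X"

definition linear_maps ::
    "nat \<Rightarrow> ('k::comm_ring_1 mpoly, 'm) mf \<Rightarrow> ('k mpoly, 'p) mf \<Rightarrow> ('m \<Rightarrow> 'p) set" where
  "linear_maps n X Y = {\<alpha> \<in> carrier X \<rightarrow>\<^sub>E carrier Y.
     (\<forall>a\<in>carrier X. \<forall>b\<in>carrier X. \<alpha> (a \<oplus>\<^bsub>X\<^esub> b) = \<alpha> a \<oplus>\<^bsub>Y\<^esub> \<alpha> b) \<and>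
     (\<forall>r\<in>polys n. \<forall>a\<in>carrier X. \<alpha> (r \<odot>\<^bsub>X\<^esub> a) = r \<odot>\<^bsub>Y\<^esub> \<alpha> a)}"

definition HMF :: "nat \<Rightarrow> 'k::comm_ring_1 mpoly \<Rightarrow> ('k mpoly, 'm) mf set" where
  "HMF n W = {X. module (PR n) X \<and> submodule (evens X) (PR n) X \<and> submodule (odds X) (PR n) X \<and>
     (\<forall>m\<in>carrier X. \<exists>!(a, b). a \<in> evens X \<and> b \<in> odds X \<and> m = a \<oplus>\<^bsub>X\<^esub> b) \<and>
     (\<exists>B. homogeneous_basis n X B) \<and>
     restrict (diff X) (carrier X) \<in> linear_maps n X X \<and>
     diff X ` evens X \<subseteq> odds X \<and> diff X ` odds X \<subseteq> evens X \<and>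
     (\<forall>m\<in>carrier X. diff X (diff X m) = W \<odot>\<^bsub>X\<^esub> m)}"

definition mf_maps ::
    "nat \<Rightarrow> ('k::comm_ring_1 mpoly, 'm) mf \<Rightarrow> ('k mpoly, 'p) mf \<Rightarrow> ('m \<Rightarrow> 'p) set" where
  "mf_maps n X Y = {\<alpha> \<in> linear_maps n X Y. \<alpha> ` evens X \<subseteq> evens Y \<and> \<alpha> ` odds X \<subseteq> odds Y \<and>
     (\<forall>m\<in>carrier X. \<alpha> (diff X m) = diff Y (\<alpha> m))}"

definition homotopic ::
    "nat \<Rightarrow> ('k::comm_ring_1 mpoly, 'm) mf \<Rightarrow> ('k mpoly, 'p) mf \<Rightarrow> ('m \<Rightarrow> 'p) \<Rightarrow> ('m \<Rightarrow> 'p) \<Rightarrow> bool" where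
  "homotopic n X Y \<alpha> \<psi> \<longleftrightarrow> (\<exists>h \<in> linear_maps n X Y.
     h ` evens X \<subseteq> odds Y \<and> h ` odds X \<subseteq> evens Y \<and>
     (\<forall>m\<in>carrier X. \<psi> m \<ominus>\<^bsub>Y\<^esub> \<alpha> m = diff Y (h m) \<oplus>\<^bsub>Y\<^esub> h (diff X m)))"

text \<open>A morphism of the homotopy category is a homotopy class, i.e. a set of maps.\<close>

definition hclass ::
    "nat \<Rightarrow> ('k::comm_ring_1 mpoly, 'm) mf \<Rightarrow> ('k mpoly, 'p) mf \<Rightarrow> ('m \<Rightarrow> 'p) \<Rightarrow> ('m \<Rightarrow> 'p) set" where
  "hclass n X Y \<alpha> = {\<psi> \<in> mf_maps n X Y. homotopic n X Y \<alpha> \<psi>}"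

definition hHom ::
    "nat \<Rightarrow> ('k::comm_ring_1 mpoly, 'm) mf \<Rightarrow> ('k mpoly, 'p) mf \<Rightarrow> ('m \<Rightarrow> 'p) set set" where
  "hHom n X Y = hclass n X Y ` mf_maps n X Y"

definition hid :: "nat \<Rightarrow> ('k::comm_ring_1 mpoly, 'm) mf \<Rightarrow> ('m \<Rightarrow> 'm) set" where
  "hid n X = hclass n X X (\<lambda>m\<in>carrier X. m)"

text \<open>\<open>hcomp n X Z \<Psi> \<Phi>\<close> is \<open>\<Psi> \<circ> \<Phi> : X \<rightarrow> Z\<close>.\<close>

definition hcomp :: "nat \<Rightarrow> ('k::comm_ring_1 mpoly, 'm) mf \<Rightarrow> ('k mpoly, 'q) mf \<Rightarrow>
    ('p \<Rightarrow> 'q) set \<Rightarrow> ('m \<Rightarrow> 'p) set \<Rightarrow> ('m \<Rightarrow> 'q) set" where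
  "hcomp n X Z \<Psi> \<Phi> = (\<Union>\<psi>\<in>\<Psi>. \<Union>\<alpha>\<in>\<Phi>. hclass n X Z (compose (carrier X) \<psi> \<alpha>))"

definition hinverse :: "nat \<Rightarrow> ('k::comm_ring_1 mpoly, 'm) mf \<Rightarrow> ('k mpoly, 'p) mf \<Rightarrow>
    ('m \<Rightarrow> 'p) set \<Rightarrow> ('p \<Rightarrow> 'm) set \<Rightarrow> bool" where
  "hinverse n X Y \<Phi> \<Psi> \<longleftrightarrow> \<Psi> \<in> hHom n Y X \<and> hcomp n X X \<Psi> \<Phi> = hid n X \<and> hcomp n Y Y \<Phi> \<Psi> = hid n Y"

definition hiso :: "nat \<Rightarrow> ('k::comm_ring_1 mpoly, 'm) mf \<Rightarrow> ('k mpoly, 'p) mf \<Rightarrow>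
    ('m \<Rightarrow> 'p) set \<Rightarrow> bool" where
  "hiso n X Y \<Phi> \<longleftrightarrow> \<Phi> \<in> hHom n X Y \<and> (\<exists>\<Psi>. hinverse n X Y \<Phi> \<Psi>)"

definition hinv :: "nat \<Rightarrow> ('k::comm_ring_1 mpoly, 'm) mf \<Rightarrow> ('k mpoly, 'p) mf \<Rightarrow>
    ('m \<Rightarrow> 'p) set \<Rightarrow> ('p \<Rightarrow> 'm) set" where
  "hinv n X Y \<Phi> = (THE \<Psi>. hinverse n X Y \<Phi> \<Psi>)"

text \<open>Direct sum over a finite index set.\<close>

definition mf_dsum :: "'j set \<Rightarrow> ('j \<Rightarrow> ('r, 'm) mf) \<Rightarrow> ('r, 'j \<Rightarrow> 'm) mf" where
  "mf_dsum J F =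
     \<lparr>carrier = (\<Pi>\<^sub>E j\<in>J. carrier (F j)), monoid.mult = undefined, one = undefined,
      ring.zero = (\<lambda>j\<in>J. \<zero>\<^bsub>F j\<^esub>), add = (\<lambda>a b. \<lambda>j\<in>J. a j \<oplus>\<^bsub>F j\<^esub> b j),
      module.smult = (\<lambda>r a. \<lambda>j\<in>J. r \<odot>\<^bsub>F j\<^esub> a j),
      evens = (\<Pi>\<^sub>E j\<in>J. evens (F j)), odds = (\<Pi>\<^sub>E j\<in>J. odds (F j)),
      diff = (\<lambda>a. \<lambda>j\<in>J. diff (F j) (a j))\<rparr>"

definition hmf :: "nat \<Rightarrow> 'k::comm_ring_1 mpoly \<Rightarrow> ('k mpoly, 'm) mf set" where
  "hmf n W = {X \<in> HMF n W. \<exists>B. finite B \<and> homogeneous_basis n X B}"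

text \<open>The objects of \<open>hmf(R,W)\<^sup>\<omega>\<close>: \<open>X\<close> such that \<open>X \<oplus> Z\<close> is isomorphic to \<open>Y\<close> for some \<open>Z\<close> and some
  \<open>Y\<close> of finite rank.\<close>

definition hmf_omega :: "nat \<Rightarrow> 'k::comm_ring_1 mpoly \<Rightarrow> ('k mpoly, 'm) mf set" where
  "hmf_omega n W = {X \<in> HMF n W. \<exists>Z \<in> HMF n W. \<exists>Y \<in> hmf n W. \<exists>\<Phi>.
     hiso n (mf_dsum UNIV (\<lambda>b::bool. if b then X else Z)) (Y :: ('k mpoly, 'm) mf) \<Phi>}"

text \<open>Restriction of scalars along \<open>\<sigma>\<close>.  Maps \<open>X \<rightarrow> Y\<close> are also maps \<open>twist \<sigma> X \<rightarrow> twist \<sigma> Y\<close>: the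
  twisting functor is the identity on underlying maps, hence on homotopy classes.\<close>

definition twist :: "('r \<Rightarrow> 'r) \<Rightarrow> ('r, 'm) mf \<Rightarrow> ('r, 'm) mf" where
  "twist \<sigma> X = X\<lparr>module.smult := (\<lambda>r m. \<sigma> r \<odot>\<^bsub>X\<^esub> m)\<rparr>"

definition ginv :: "nat \<Rightarrow> ('k::comm_ring_1 mpoly \<Rightarrow> 'k mpoly) \<Rightarrow> 'k mpoly \<Rightarrow> 'k mpoly" where
  "ginv n g = inv\<^bsub>BijGroup (polys n)\<^esub> g"


section \<open>Composition of 1-morphisms\<close>

text \<open>
  The tensor product \<open>Y \<otimes>\<^sub>R X\<close> of a 1-morphism \<open>Y : W \<rightarrow> W\<close> over \<open>R\<^sup>e\<close> and a 1-morphism \<open>X\<close> with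
  target \<open>W\<close>, where \<open>R = PR n\<close> acts on \<open>Y\<close> from the right through the primed variables and on \<open>X\<close>
  from the left through the first \<open>n\<close> variables.
\<close>

definition primed :: "nat \<Rightarrow> 'k::comm_ring_1 mpoly \<Rightarrow> 'k mpoly" where
  "primed n f = subst (\<lambda>i. Var (n + i)) f"

definition tensor_relators ::
    "nat \<Rightarrow> ('k::comm_ring_1 mpoly, 'y) mf \<Rightarrow> ('k mpoly, 'x) mf \<Rightarrow> ('y \<times> 'x \<Rightarrow>\<^sub>0 int) set" where
  "tensor_relators n Y X =
     {frag_of (y \<oplus>\<^bsub>Y\<^esub> y', x) - frag_of (y, x) - frag_of (y', x) | y y' x.
        y \<in> carrier Y \<and> y' \<in> carrier Y \<and> x \<in> carrier X} \<union>
     {frag_of (y, x \<oplus>\<^bsub>X\<^esub> x') - frag_of (y, x) - frag_of (y, x') | y x x'.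
        y \<in> carrier Y \<and> x \<in> carrier X \<and> x' \<in> carrier X} \<union>
     {frag_of (primed n s \<odot>\<^bsub>Y\<^esub> y, x) - frag_of (y, s \<odot>\<^bsub>X\<^esub> x) | y x s.
        y \<in> carrier Y \<and> x \<in> carrier X \<and> s \<in> polys n}"

definition tensor_kernel ::
    "nat \<Rightarrow> ('k::comm_ring_1 mpoly, 'y) mf \<Rightarrow> ('k mpoly, 'x) mf \<Rightarrow> ('y \<times> 'x \<Rightarrow>\<^sub>0 int) set" where
  "tensor_kernel n Y X =
     generate (free_Abelian_group (carrier Y \<times> carrier X)) (tensor_relators n Y X)"

definition tensor_group ::
    "nat \<Rightarrow> ('k::comm_ring_1 mpoly, 'y) mf \<Rightarrow> ('k mpoly, 'x) mf \<Rightarrow> ('y \<times> 'x \<Rightarrow>\<^sub>0 int) set ring" where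
  "tensor_group n Y X =
     (let Q = free_Abelian_group (carrier Y \<times> carrier X) Mod tensor_kernel n Y X in
      \<lparr>carrier = carrier Q, monoid.mult = undefined, one = undefined, ring.zero = one Q, add = monoid.mult Q\<rparr>)"

definition pure :: "nat \<Rightarrow> ('k::comm_ring_1 mpoly, 'y) mf \<Rightarrow> ('k mpoly, 'x) mf \<Rightarrow>
    'y \<Rightarrow> 'x \<Rightarrow> ('y \<times> 'x \<Rightarrow>\<^sub>0 int) set" where
  "pure n Y X y x = tensor_kernel n Y X
     #>\<^bsub>free_Abelian_group (carrier Y \<times> carrier X)\<^esub> frag_of (y, x)"

text \<open>The additive map on the tensor product induced by a balanced biadditive \<open>\<beta>\<close>.\<close>

definition tensor_lift :: "nat \<Rightarrow> ('k::comm_ring_1 mpoly, 'y) mf \<Rightarrow> ('k mpoly, 'x) mf \<Rightarrow>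
    ('z, 'e) ring_scheme \<Rightarrow> ('y \<Rightarrow> 'x \<Rightarrow> 'z) \<Rightarrow> ('y \<times> 'x \<Rightarrow>\<^sub>0 int) set \<Rightarrow> 'z" where
  "tensor_lift n Y X N \<beta> = (let Q = tensor_group n Y X in
     THE h. h \<in> carrier Q \<rightarrow>\<^sub>E carrier N \<and>
       (\<forall>s\<in>carrier Q. \<forall>t\<in>carrier Q. h (s \<oplus>\<^bsub>Q\<^esub> t) = h s \<oplus>\<^bsub>N\<^esub> h t) \<and>
       (\<forall>y\<in>carrier Y. \<forall>x\<in>carrier X. h (pure n Y X y x) = \<beta> y x))"

text \<open>The Koszul sign operator \<open>y \<mapsto> (-1)\<^bsup>|y|\<^esup> y\<close>.\<close>

definition koszul :: "('r, 'm) mf \<Rightarrow> 'm \<Rightarrow> 'm" where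
  "koszul Y y = (THE z. \<exists>a\<in>evens Y. \<exists>b\<in>odds Y. y = a \<oplus>\<^bsub>Y\<^esub> b \<and> z = a \<ominus>\<^bsub>Y\<^esub> b)"

definition left_part :: "nat \<Rightarrow> (nat \<Rightarrow>\<^sub>0 nat) \<Rightarrow> 'k::comm_ring_1 mpoly" where
  "left_part n a = (\<Prod>i\<in>Poly_Mapping.keys a \<inter> {..<n}. Var i ^ Poly_Mapping.lookup a i)"

definition right_part :: "nat \<Rightarrow> (nat \<Rightarrow>\<^sub>0 nat) \<Rightarrow> 'k::comm_ring_1 mpoly" where
  "right_part n a = (\<Prod>i\<in>Poly_Mapping.keys a \<inter> {n..}. Var i ^ Poly_Mapping.lookup a i)"

text \<open>A monomial acts on \<open>y \<otimes> x\<close> by its first \<open>n\<close> variables on \<open>y\<close> and by the others on \<open>x\<close>; the latter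
  have the same indices in \<open>X\<close> and in \<open>Y \<otimes>\<^sub>R X\<close>.\<close>

definition tensor :: "nat \<Rightarrow> ('k::comm_ring_1 mpoly, 'y) mf \<Rightarrow> ('k mpoly, 'x) mf \<Rightarrow>
    ('k mpoly, ('y \<times> 'x \<Rightarrow>\<^sub>0 int) set) mf" where
  "tensor n Y X = (let Q = tensor_group n Y X; p = pure n Y X in
     \<lparr>carrier = carrier Q, monoid.mult = undefined, one = undefined, ring.zero = \<zero>\<^bsub>Q\<^esub>, add = add Q,
      module.smult = (\<lambda>f. tensor_lift n Y X Q (\<lambda>y x. \<Oplus>\<^bsub>Q\<^esub>a\<in>Poly_Mapping.keys f.
        p ((Const (Poly_Mapping.lookup f a) * left_part n a) \<odot>\<^bsub>Y\<^esub> y) (right_part n a \<odot>\<^bsub>X\<^esub> x))),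
      evens = generate (add_monoid Q)
        ({p y x | y x. y \<in> evens Y \<and> x \<in> evens X} \<union> {p y x | y x. y \<in> odds Y \<and> x \<in> odds X}),
      odds = generate (add_monoid Q)
        ({p y x | y x. y \<in> evens Y \<and> x \<in> odds X} \<union> {p y x | y x. y \<in> odds Y \<and> x \<in> evens X}),
      diff = tensor_lift n Y X Q (\<lambda>y x. p (diff Y y) x \<oplus>\<^bsub>Q\<^esub> p (koszul Y y) (diff X x))\<rparr>)"

text \<open>\<open>\<alpha> \<otimes> \<psi>\<close> for even maps \<open>\<alpha> : Y \<rightarrow> Y'\<close> and \<open>\<psi> : X \<rightarrow> X'\<close>.\<close>

definition tensor_map :: "nat \<Rightarrow> ('k::comm_ring_1 mpoly, 'y) mf \<Rightarrow> ('k mpoly, 'x) mf \<Rightarrow>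
    ('k mpoly, 'v) mf \<Rightarrow> ('k mpoly, 'w) mf \<Rightarrow> ('y \<Rightarrow> 'v) \<Rightarrow> ('x \<Rightarrow> 'w) \<Rightarrow>
    ('y \<times> 'x \<Rightarrow>\<^sub>0 int) set \<Rightarrow> ('v \<times> 'w \<Rightarrow>\<^sub>0 int) set" where
  "tensor_map n Y X Y' X' \<alpha> \<psi> =
     tensor_lift n Y X (tensor n Y' X') (\<lambda>y x. pure n Y' X' (\<alpha> y) (\<psi> x))"

text \<open>\<open>1\<^sub>Y \<otimes> \<Psi>\<close> and \<open>\<Phi> \<otimes> 1\<^sub>X\<close> for homotopy classes \<open>\<Psi>\<close> and \<open>\<Phi>\<close>; here \<open>X\<close> and \<open>X'\<close> are 1-morphisms
  from the trivial object, so that the tensor products are over \<open>PR n\<close>.\<close>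

definition whisker_left :: "nat \<Rightarrow> ('k::comm_ring_1 mpoly, 'y) mf \<Rightarrow> ('k mpoly, 'x) mf \<Rightarrow>
    ('k mpoly, 'w) mf \<Rightarrow> ('x \<Rightarrow> 'w) set \<Rightarrow>
    (('y \<times> 'x \<Rightarrow>\<^sub>0 int) set \<Rightarrow> ('y \<times> 'w \<Rightarrow>\<^sub>0 int) set) set" where
  "whisker_left n Y X X' \<Psi> = (\<Union>\<psi>\<in>\<Psi>. hclass n (tensor n Y X) (tensor n Y X')
     (tensor_map n Y X Y X' (\<lambda>y. y) \<psi>))"

definition whisker_right :: "nat \<Rightarrow> ('k::comm_ring_1 mpoly, 'y) mf \<Rightarrow> ('k mpoly, 'v) mf \<Rightarrow>
    ('k mpoly, 'x) mf \<Rightarrow> ('y \<Rightarrow> 'v) set \<Rightarrow>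
    (('y \<times> 'x \<Rightarrow>\<^sub>0 int) set \<Rightarrow> ('v \<times> 'x \<Rightarrow>\<^sub>0 int) set) set" where
  "whisker_right n Y Y' X \<Phi> = (\<Union>\<alpha>\<in>\<Phi>. hclass n (tensor n Y X) (tensor n Y' X)
     (tensor_map n Y X Y' X \<alpha> (\<lambda>x. x)))"

text \<open>\<open>(z \<otimes> y) \<otimes> x \<mapsto> z \<otimes> (y \<otimes> x)\<close>\<close>

definition assoc_map :: "nat \<Rightarrow> ('k::comm_ring_1 mpoly, 'z) mf \<Rightarrow> ('k mpoly, 'y) mf \<Rightarrow>
    ('k mpoly, 'x) mf \<Rightarrow> (('z \<times> 'y \<Rightarrow>\<^sub>0 int) set \<times> 'x \<Rightarrow>\<^sub>0 int) set \<Rightarrow>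
    ('z \<times> ('y \<times> 'x \<Rightarrow>\<^sub>0 int) set \<Rightarrow>\<^sub>0 int) set" where
  "assoc_map n Z Y X = (let T = tensor n Z (tensor n Y X) in
     tensor_lift n (tensor n Z Y) X T
       (\<lambda>t x. tensor_lift n Z Y T (\<lambda>z y. pure n Z (tensor n Y X) z (pure n Y X y x)) t))"


section \<open>The unit 1-morphism\<close>

definition mixed :: "nat \<Rightarrow> nat \<Rightarrow> 'k::comm_ring_1 mpoly \<Rightarrow> 'k mpoly" where
  "mixed n i W = subst (\<lambda>j. if j < i then Var (n + j) else Var j) W"

text \<open>The difference quotient \<open>\<partial>\<^bsub>[i]\<^esub>W\<close> (variables numbered from \<open>0\<close>).\<close>

definition diff_quot :: "nat \<Rightarrow> nat \<Rightarrow> 'k::comm_ring_1 mpoly \<Rightarrow> 'k mpoly" where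
  "diff_quot n i W = (THE q. q \<in> polys (n + n) \<and>
     (Var i - Var (n + i)) * q = mixed n i W - mixed n (Suc i) W)"

text \<open>
  An element of the exterior algebra is given by its coefficients with respect to the basis
  \<open>\<theta>\<^sub>S = \<theta>\<^bsub>i\<^sub>1\<^esub> \<and> \<dots> \<and> \<theta>\<^bsub>i\<^sub>r\<^esub>\<close> for \<open>S = {i\<^sub>1 < \<dots> < i\<^sub>r}\<close>.
\<close>

type_synonym 'k ext = "nat set \<Rightarrow> 'k mpoly"

definition theta_sign :: "nat \<Rightarrow> nat set \<Rightarrow> 'k::comm_ring_1 mpoly" where
  "theta_sign i S = (-1) ^ card {j\<in>S. j < i}"

definition theta_contract :: "nat \<Rightarrow> 'k::comm_ring_1 ext \<Rightarrow> 'k ext" where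
  "theta_contract i \<omega> = (\<lambda>S. if i \<in> S then 0 else theta_sign i S * \<omega> (insert i S))"

definition theta_wedge :: "nat \<Rightarrow> 'k::comm_ring_1 ext \<Rightarrow> 'k ext" where
  "theta_wedge i \<omega> = (\<lambda>S. if i \<in> S then theta_sign i S * \<omega> (S - {i}) else 0)"

definition unit_carrier :: "nat \<Rightarrow> 'k::comm_ring_1 ext set" where
  "unit_carrier n = {\<omega>. \<forall>S. if S \<subseteq> {..<n} then \<omega> S \<in> polys (n + n) else \<omega> S = 0}"

definition I_mf :: "nat \<Rightarrow> 'k::comm_ring_1 mpoly \<Rightarrow> ('k mpoly, 'k ext) mf" where
  "I_mf n W =
     \<lparr>carrier = unit_carrier n, monoid.mult = undefined, one = undefined,
      ring.zero = (\<lambda>S. 0), add = (\<lambda>\<omega> \<eta> S. \<omega> S + \<eta> S), module.smult = (\<lambda>r \<omega> S. r * \<omega> S),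
      evens = {\<omega> \<in> unit_carrier n. \<forall>S. odd (card S) \<longrightarrow> \<omega> S = 0},
      odds = {\<omega> \<in> unit_carrier n. \<forall>S. even (card S) \<longrightarrow> \<omega> S = 0},
      diff = (\<lambda>\<omega> S. \<Sum>i<n. (Var i - Var (n + i)) * theta_contract i \<omega> S
                           + diff_quot n i W * theta_wedge i \<omega> S)\<rparr>"

text \<open>The multiplication \<open>R\<^sup>e \<rightarrow> R\<close>.\<close>

definition collapse :: "nat \<Rightarrow> 'k::comm_ring_1 mpoly \<Rightarrow> 'k mpoly" where
  "collapse n f = subst (\<lambda>i. if i < n then Var i else Var (i - n)) f"

definition lam :: "nat \<Rightarrow> 'k::comm_ring_1 mpoly \<Rightarrow> ('k mpoly, 'x) mf \<Rightarrow>
    ('k ext \<times> 'x \<Rightarrow>\<^sub>0 int) set \<Rightarrow> 'x" where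
  "lam n W X = tensor_lift n (I_mf n W) X X (\<lambda>\<omega> x. collapse n (\<omega> {}) \<odot>\<^bsub>X\<^esub> x)"


section \<open>The Frobenius algebra \<open>A\<^sub>G\<close>\<close>

text \<open>The algebra and coalgebra structure maps are 2-morphisms, i.e. homotopy classes.\<close>

record (overloaded) ('k, 'a) frobenius =
  obj :: "('k mpoly, 'a) mf"
  fmult :: "(('a \<times> 'a \<Rightarrow>\<^sub>0 int) set \<Rightarrow> 'a) set"
  funit :: "('k ext \<Rightarrow> 'a) set"
  fcomult :: "('a \<Rightarrow> ('a \<times> 'a \<Rightarrow>\<^sub>0 int) set) set"
  fcounit :: "('a \<Rightarrow> 'k ext) set"

text \<open>\<open>on_left n g = g \<otimes> 1\<close> on \<open>R\<^sup>e = R \<otimes> R\<close>.\<close>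

definition on_left :: "nat \<Rightarrow> ('k::comm_ring_1 mpoly \<Rightarrow> 'k mpoly) \<Rightarrow> 'k mpoly \<Rightarrow> 'k mpoly" where
  "on_left n g f = subst (\<lambda>i. if i < n then g (Var i) else Var i) f"

definition gI :: "nat \<Rightarrow> 'k::comm_ring_1 mpoly \<Rightarrow> ('k mpoly \<Rightarrow> 'k mpoly) \<Rightarrow> ('k mpoly, 'k ext) mf" where
  "gI n W g = twist (on_left n (ginv n g)) (I_mf n W)"

type_synonym 'k AG = "('k mpoly \<Rightarrow> 'k mpoly) \<Rightarrow> 'k ext"

definition AG_mf :: "nat \<Rightarrow> 'k::comm_ring_1 mpoly \<Rightarrow> ('k mpoly \<Rightarrow> 'k mpoly) set \<Rightarrow> ('k mpoly, 'k AG) mf" where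
  "AG_mf n W G = mf_dsum G (gI n W)"

definition AG_incl :: "nat \<Rightarrow> 'k::comm_ring_1 mpoly \<Rightarrow> ('k mpoly \<Rightarrow> 'k mpoly) set \<Rightarrow>
    ('k mpoly \<Rightarrow> 'k mpoly) \<Rightarrow> 'k ext \<Rightarrow> 'k AG" where
  "AG_incl n W G g = (\<lambda>\<omega>\<in>unit_carrier n. \<lambda>h\<in>G. if h = g then \<omega> else \<zero>\<^bsub>I_mf n W\<^esub>)"

text \<open>\<open>\<mu>\<^bsub>g,h\<^esub> = \<^sub>g(\<lambda>)\<close> has the same underlying map as \<open>\<lambda> : I \<otimes> \<^sub>hI \<rightarrow> \<^sub>hI\<close>.\<close>

definition AG_mult :: "nat \<Rightarrow> 'k::comm_ring_1 mpoly \<Rightarrow> ('k mpoly \<Rightarrow> 'k mpoly) set \<Rightarrow>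
    ('k AG \<times> 'k AG \<Rightarrow>\<^sub>0 int) set \<Rightarrow> 'k AG" where
  "AG_mult n W G = (let A = AG_mf n W G in
     tensor_lift n A A A (\<lambda>a b. \<lambda>u\<in>G.
       finsum (I_mf n W)
         (\<lambda>(g, h). lam n W (gI n W h) (pure n (I_mf n W) (gI n W h) (a g) (b h)))
         {(g, h). g \<in> G \<and> h \<in> G \<and> g \<otimes>\<^bsub>BijGroup (polys n)\<^esub> h = u}))"

text \<open>The parameter \<open>j h\<close> is a representative of \<open>\<lambda>\<^sup>-\<^sup>1 : \<^sub>hI \<rightarrow> I \<otimes> \<^sub>hI\<close>.\<close>

definition AG_comult :: "nat \<Rightarrow> 'k::comm_ring_1 mpoly \<Rightarrow> ('k mpoly \<Rightarrow> 'k mpoly) set \<Rightarrow>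
    (('k mpoly \<Rightarrow> 'k mpoly) \<Rightarrow> 'k ext \<Rightarrow> ('k ext \<times> 'k ext \<Rightarrow>\<^sub>0 int) set) \<Rightarrow>
    'k AG \<Rightarrow> ('k AG \<times> 'k AG \<Rightarrow>\<^sub>0 int) set" where
  "AG_comult n W G j = (let A = AG_mf n W G; AA = tensor n A A in
     (\<lambda>a\<in>carrier A. Const (THE c. of_nat (card G) * c = 1) \<odot>\<^bsub>AA\<^esub>
       (finsum AA
         (\<lambda>(g, h). tensor_map n (gI n W g) (gI n W h) A A (AG_incl n W G g) (AG_incl n W G h)
            (j h (a (g \<otimes>\<^bsub>BijGroup (polys n)\<^esub> h))))
         (G \<times> G))))"

definition AG :: "nat \<Rightarrow> 'k::comm_ring_1 mpoly \<Rightarrow> ('k mpoly \<Rightarrow> 'k mpoly) set \<Rightarrow> ('k, 'k AG) frobenius" where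
  "AG n W G = (let A = AG_mf n W G; AA = tensor n A A; I = I_mf n W;
       e = \<one>\<^bsub>BijGroup (polys n)\<^esub>; J = (\<lambda>h. tensor n I (gI n W h)) in
     \<lparr>obj = A,
      fmult = hclass (n + n) AA A (AG_mult n W G),
      funit = hclass (n + n) I A (AG_incl n W G e),
      fcomult = (\<Union>j\<in>{j. \<forall>h\<in>G. j h \<in> hinv (n + n) (J h) (gI n W h)
          (hclass (n + n) (J h) (gI n W h) (lam n W (gI n W h)))}.
        hclass (n + n) A AA (AG_comult n W G j)),
      fcounit = hclass (n + n) A I (\<lambda>a\<in>carrier A. Const (of_nat (card G)) \<odot>\<^bsub>I\<^esub> a e)\<rparr>)"


section \<open>Categories and equivalences\<close>

text \<open>Hom-sets need not be disjoint, so composition takes the three objects as arguments: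
  \<open>Cmp C x y z g f\<close> is the composite of \<open>f : x \<rightarrow> y\<close> and \<open>g : y \<rightarrow> z\<close>.\<close>

record ('o, 'a) cat =
  Ob :: "'o set"
  Hom :: "'o \<Rightarrow> 'o \<Rightarrow> 'a set"
  Idt :: "'o \<Rightarrow> 'a"
  Cmp :: "'o \<Rightarrow> 'o \<Rightarrow> 'o \<Rightarrow> 'a \<Rightarrow> 'a \<Rightarrow> 'a"

definition is_category :: "('o, 'a) cat \<Rightarrow> bool" where
  "is_category C \<longleftrightarrow>
     (\<forall>x\<in>Ob C. Idt C x \<in> Hom C x x) \<and>
     (\<forall>x\<in>Ob C. \<forall>y\<in>Ob C. \<forall>z\<in>Ob C. \<forall>f\<in>Hom C x y. \<forall>g\<in>Hom C y z. Cmp C x y z g f \<in> Hom C x z) \<and>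
     (\<forall>x\<in>Ob C. \<forall>y\<in>Ob C. \<forall>f\<in>Hom C x y.
        Cmp C x x y f (Idt C x) = f \<and> Cmp C x y y (Idt C y) f = f) \<and>
     (\<forall>w\<in>Ob C. \<forall>x\<in>Ob C. \<forall>y\<in>Ob C. \<forall>z\<in>Ob C.
        \<forall>f\<in>Hom C w x. \<forall>g\<in>Hom C x y. \<forall>h\<in>Hom C y z.
        Cmp C w y z h (Cmp C w x y g f) = Cmp C w x z (Cmp C x y z h g) f)"

type_synonym ('o, 'a, 'p, 'b) ftor = "('o \<Rightarrow> 'p) \<times> ('o \<Rightarrow> 'o \<Rightarrow> 'a \<Rightarrow> 'b)"

definition is_functor :: "('o, 'a) cat \<Rightarrow> ('p, 'b) cat \<Rightarrow> ('o, 'a, 'p, 'b) ftor \<Rightarrow> bool" where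
  "is_functor C D F \<longleftrightarrow>
     (\<forall>x\<in>Ob C. fst F x \<in> Ob D) \<and>
     (\<forall>x\<in>Ob C. \<forall>y\<in>Ob C. \<forall>f\<in>Hom C x y. snd F x y f \<in> Hom D (fst F x) (fst F y)) \<and>
     (\<forall>x\<in>Ob C. snd F x x (Idt C x) = Idt D (fst F x)) \<and>
     (\<forall>x\<in>Ob C. \<forall>y\<in>Ob C. \<forall>z\<in>Ob C. \<forall>f\<in>Hom C x y. \<forall>g\<in>Hom C y z.
        snd F x z (Cmp C x y z g f) =
        Cmp D (fst F x) (fst F y) (fst F z) (snd F y z g) (snd F x y f))"

definition functor_id :: "('o, 'a, 'o, 'a) ftor" where
  "functor_id = (\<lambda>x. x, \<lambda>x y f. f)"

definition functor_comp ::
    "('p, 'b, 'q, 'c) ftor \<Rightarrow> ('o, 'a, 'p, 'b) ftor \<Rightarrow> ('o, 'a, 'q, 'c) ftor" where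
  "functor_comp H F = (\<lambda>x. fst H (fst F x), \<lambda>x y f. snd H (fst F x) (fst F y) (snd F x y f))"

definition iso_in :: "('o, 'a) cat \<Rightarrow> 'o \<Rightarrow> 'o \<Rightarrow> 'a \<Rightarrow> bool" where
  "iso_in C x y f \<longleftrightarrow> f \<in> Hom C x y \<and>
     (\<exists>g\<in>Hom C y x. Cmp C x y x g f = Idt C x \<and> Cmp C y x y f g = Idt C y)"

definition naturally_isomorphic :: "('o, 'a) cat \<Rightarrow> ('p, 'b) cat \<Rightarrow>
    ('o, 'a, 'p, 'b) ftor \<Rightarrow> ('o, 'a, 'p, 'b) ftor \<Rightarrow> bool" where
  "naturally_isomorphic C D F H \<longleftrightarrow> (\<exists>\<tau>.
     (\<forall>x\<in>Ob C. iso_in D (fst F x) (fst H x) (\<tau> x)) \<and>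
     (\<forall>x\<in>Ob C. \<forall>y\<in>Ob C. \<forall>f\<in>Hom C x y.
        Cmp D (fst F x) (fst F y) (fst H y) (\<tau> y) (snd F x y f) =
        Cmp D (fst F x) (fst H x) (fst H y) (snd H x y f) (\<tau> x)))"

definition equivalent_categories :: "('o, 'a) cat \<Rightarrow> ('p, 'b) cat \<Rightarrow> bool" where
  "equivalent_categories C D \<longleftrightarrow> is_category C \<and> is_category D \<and>
     (\<exists>F H. is_functor C D F \<and> is_functor D C H \<and>
        naturally_isomorphic C C (functor_comp H F) functor_id \<and>
        naturally_isomorphic D D (functor_comp F H) functor_id)"


section \<open>Equivariant matrix factorisations and modules\<close>

text \<open>
  \<open>hmf(R,W)\<close> need not be idempotent complete, e.g. for \<open>W = y\<^sup>2 - x\<^sup>2(x + 1)\<close> over the complex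
  numbers.  Both categories below therefore take the class \<open>\<O>\<close> of admissible underlying matrix
  factorisations, \<^const>\<open>hmf\<close> or \<^const>\<open>hmf_omega\<close>, as a parameter.
\<close>

text \<open>
  As \<open>\<^sub>g(\<alpha>\<^sub>h)\<close> and \<open>\<alpha>\<^sub>h\<close> are the same set of maps, the functor \<open>\<^sub>g(-)\<close> is visible only in the
  source and target of composites.
\<close>

definition equivariant :: "nat \<Rightarrow> ('k::comm_ring_1 mpoly \<Rightarrow> 'k mpoly) set \<Rightarrow> ('k mpoly, 'm) mf set \<Rightarrow>
    (('k mpoly, 'm) mf \<times> (('k mpoly \<Rightarrow> 'k mpoly) \<Rightarrow> ('m \<Rightarrow> 'm) set), ('m \<Rightarrow> 'm) set) cat" where
  "equivariant n G \<O> = (let Gr = BijGroup (polys n); tw = (\<lambda>g. twist (ginv n g)) in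
     \<lparr>Ob = {(X, \<alpha>). X \<in> \<O> \<and> \<alpha> \<in> extensional G \<and>
        (\<forall>g\<in>G. hiso n (tw g X) X (\<alpha> g)) \<and>
        \<alpha> \<one>\<^bsub>Gr\<^esub> = hid n X \<and>
        (\<forall>g\<in>G. \<forall>h\<in>G. \<alpha> (g \<otimes>\<^bsub>Gr\<^esub> h) = hcomp n (tw (g \<otimes>\<^bsub>Gr\<^esub> h) X) X (\<alpha> g) (\<alpha> h))},
      Hom = (\<lambda>(X, \<alpha>) (Y, \<psi>). {\<Psi> \<in> hHom n X Y.
        \<forall>g\<in>G. hcomp n (tw g X) Y \<Psi> (\<alpha> g) = hcomp n (tw g X) Y (\<psi> g) \<Psi>}),
      Idt = (\<lambda>(X, \<alpha>). hid n X),
      Cmp = (\<lambda>(X, _) _ (Z, _) \<Psi> \<Phi>. hcomp n X Z \<Psi> \<Phi>)\<rparr>)"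

text \<open>
  The \<open>A\<close>-\<open>I\<close>-bimodules from the trivial object; the right action of its unit \<open>I = k\<close> carries no data.
\<close>

definition left_modules :: "nat \<Rightarrow> 'k::comm_ring_1 mpoly \<Rightarrow> ('k, 'a) frobenius \<Rightarrow> ('k mpoly, 'm) mf set \<Rightarrow>
    (('k mpoly, 'm) mf \<times> (('a \<times> 'm \<Rightarrow>\<^sub>0 int) set \<Rightarrow> 'm) set, ('m \<Rightarrow> 'm) set) cat" where
  "left_modules n W F \<O> = (let A = obj F; AA = tensor n A A; I = I_mf n W in
     \<lparr>Ob = {(X, \<rho>). X \<in> \<O> \<and> \<rho> \<in> hHom n (tensor n A X) X \<and>
        hcomp n (tensor n AA X) X \<rho> (whisker_right n AA A X (fmult F)) =
        hcomp n (tensor n AA X) X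
          (hcomp n (tensor n A (tensor n A X)) X \<rho> (whisker_left n A (tensor n A X) X \<rho>))
          (hclass n (tensor n AA X) (tensor n A (tensor n A X)) (assoc_map n A A X)) \<and>
        hcomp n (tensor n I X) X \<rho> (whisker_right n I A X (funit F)) =
        hclass n (tensor n I X) X (lam n W X)},
      Hom = (\<lambda>(X, \<rho>) (Y, \<sigma>). {\<Psi> \<in> hHom n X Y.
        hcomp n (tensor n A X) Y \<Psi> \<rho> = hcomp n (tensor n A X) Y \<sigma> (whisker_left n A X Y \<Psi>)}),
      Idt = (\<lambda>(X, \<rho>). hid n X),
      Cmp = (\<lambda>(X, _) _ (Z, _) \<Psi> \<Phi>. hcomp n X Z \<Psi> \<Phi>)\<rparr>)"

end

theory Submission
  imports Defs
begin

text \<open>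
  Projection of \<open>I\<close> to \<open>\<theta>\<close>-degree \<open>0\<close>, followed by the multiplication of the ring, induces a map
  \<open>A\<^sub>G \<otimes> X \<rightarrow> \<Oplus>\<^sub>g \<^sub>gX\<close>. Along a homogeneous basis of \<open>X\<close> the Koszul contraction gives a homotopy on its
  kernel, correct to leading order for the filtration by \<open>\<theta>\<close>-degree; correcting it makes the kernel
  contractible, so that the map is a homotopy equivalence. Hence a map \<open>A\<^sub>G \<otimes> X \<rightarrow> X\<close> in the homotopy
  category is the same as a family \<open>\<^sub>gX \<rightarrow> X\<close>. Applying this to \<open>I \<otimes> X\<close> and to
  \<open>A\<^sub>G \<otimes> A\<^sub>G \<otimes> X \<simeq> \<Oplus>\<^sub>g\<^sub>h \<^sub>g(\<^sub>hX)\<close>, the unit and associativity laws of a module become the two laws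
  of an equivariant structure, and module maps become equivariant maps.
\<close>

section \<open>Polynomials and substitution\<close>

text \<open>The obstacle is that the Koszul contraction takes quotients by x_i - x'_i and commutes
  with the left variables only, so it acts on a tensor product with X only after a basis of X has
  been chosen; this is where freeness of X enters. The basis in turn is not respected by d_X. Both
  defects are harmless for reasons of degree: the contraction and the part of the differential of I
  that carries the difference quotients raise the theta-degree by one, d_X keeps it, and degrees
  above n vanish, so the error is nilpotent. The correction also uses that the differential squares
  to the scalar W. The inclusions of gX along the basis become chain maps with the help of the
  contraction, while projecting them back stays strictly the identity; homotopies are compared by
  evaluating on these sections. The resulting functor keeps the underlying factorisation and the
  classes of maps, so full faithfulness is an equality of Hom sets. A module comes without inverses
  of its components; the unit and associativity laws make the component at g^(-1) an inverse up to
  homotopy.\<close>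

lemma polys_0 [simp]: "0 \<in> polys n"
  and polys_1 [simp]: "1 \<in> polys n"
  and polys_Const [simp]: "Const c \<in> polys n"
  by (auto simp: polys_def Const_def)

lemma polys_Var [simp]: "i < n \<Longrightarrow> Var i \<in> polys n"
  by (auto simp: polys_def Var_def)

lemma polys_add [simp]: "p \<in> polys n \<Longrightarrow> q \<in> polys n \<Longrightarrow> p + q \<in> polys n"
  using Poly_Mapping.keys_add[of p q] by (auto simp: polys_def)

lemma polys_uminus [simp]: "p \<in> polys n \<Longrightarrow> - p \<in> polys n"
  by (auto simp: polys_def)

lemma polys_diff [simp]: "p \<in> polys n \<Longrightarrow> q \<in> polys n \<Longrightarrow> p - q \<in> polys n"
  using polys_add[of p n "-q"] by simp

lemma polys_mult [simp]:
  assumes "p \<in> polys n" "q \<in> polys n" shows "p * q \<in> polys n"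
proof -
  have "Poly_Mapping.keys c \<subseteq> {..<n}" if "c \<in> Poly_Mapping.keys (p * q)" for c
  proof -
    from that Poly_Mapping.keys_mult[of p q] obtain a b where
      "a \<in> Poly_Mapping.keys p" "b \<in> Poly_Mapping.keys q" "c = a + b" by blast
    then show ?thesis
      using assms Poly_Mapping.keys_add[of a b] unfolding polys_def by blast
  qed
  then show ?thesis by (simp add: polys_def)
qed

lemma polys_power [simp]: "p \<in> polys n \<Longrightarrow> p ^ m \<in> polys n"
  by (induction m) auto

lemma polys_sum [simp]: "(\<And>i. i \<in> I \<Longrightarrow> f i \<in> polys n) \<Longrightarrow> sum f I \<in> polys n"
  by (induction I rule: infinite_finite_induct) auto

lemma polys_prod [simp]: "(\<And>i. i \<in> I \<Longrightarrow> f i \<in> polys n) \<Longrightarrow> prod f I \<in> polys n"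
  by (induction I rule: infinite_finite_induct) auto

lemma polys_mono: "p \<in> polys m \<Longrightarrow> m \<le> n \<Longrightarrow> p \<in> polys n"
  by (fastforce simp: polys_def)

lemma Const_0 [simp]: "Const 0 = 0" by (simp add: Const_def)
lemma Const_1 [simp]: "Const 1 = 1" by (simp add: Const_def)
lemma Const_add: "Const (a + b) = Const a + Const b" by (simp add: Const_def single_add)
lemma Const_mult: "Const (a * b) = Const a * Const b" by (simp add: Const_def mult_single)

definition monom_subst :: "(nat \<Rightarrow> 'k::comm_ring_1 mpoly) \<Rightarrow> (nat \<Rightarrow>\<^sub>0 nat) \<Rightarrow> 'k mpoly" where
  "monom_subst \<sigma> a = (\<Prod>i\<in>Poly_Mapping.keys a. \<sigma> i ^ Poly_Mapping.lookup a i)"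

lemma monom_subst_superset:
  "finite K \<Longrightarrow> Poly_Mapping.keys a \<subseteq> K \<Longrightarrow>
    monom_subst \<sigma> a = (\<Prod>i\<in>K. \<sigma> i ^ Poly_Mapping.lookup a i)"
  unfolding monom_subst_def by (rule prod.mono_neutral_left) (auto simp: in_keys_iff)

lemma monom_subst_add: "monom_subst \<sigma> (a + b) = monom_subst \<sigma> a * monom_subst \<sigma> b"
proof -
  let ?K = "Poly_Mapping.keys a \<union> Poly_Mapping.keys b"
  have "monom_subst \<sigma> c = (\<Prod>i\<in>?K. \<sigma> i ^ Poly_Mapping.lookup c i)"
    if "c \<in> {a, b, a + b}" for c
    using that Poly_Mapping.keys_add[of a b] by (intro monom_subst_superset) auto
  then show ?thesis by (simp add: lookup_add power_add prod.distrib)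
qed

lemma monom_subst_0 [simp]: "monom_subst \<sigma> 0 = 1"
  by (simp add: monom_subst_def)

text \<open>The support of p + q can be smaller than the union of the two supports; sums over a
  common finite superset make \<open>subst_add\<close> a termwise computation.\<close>

lemma subst_superset:
  "finite K \<Longrightarrow> Poly_Mapping.keys p \<subseteq> K \<Longrightarrow>
    subst \<sigma> p = (\<Sum>a\<in>K. Const (Poly_Mapping.lookup p a) * monom_subst \<sigma> a)"
  unfolding subst_def monom_subst_def
  by (rule sum.mono_neutral_left) (auto simp: in_keys_iff)

lemma subst_add [simp]: "subst \<sigma> (p + q) = subst \<sigma> p + subst \<sigma> q"
proof -
  let ?K = "Poly_Mapping.keys p \<union> Poly_Mapping.keys q"
  have "subst \<sigma> r = (\<Sum>a\<in>?K. Const (Poly_Mapping.lookup r a) * monom_subst \<sigma> a)"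
    if "r \<in> {p, q, p + q}" for r
    using that Poly_Mapping.keys_add[of p q] by (intro subst_superset) auto
  then show ?thesis by (simp add: lookup_add Const_add distrib_right sum.distrib)
qed

lemma subst_0 [simp]: "subst \<sigma> 0 = 0" by (simp add: subst_def)

lemma subst_uminus [simp]: "subst \<sigma> (- p) = - subst \<sigma> p"
  using subst_add[of \<sigma> p "-p"] by (simp add: minus_unique)

lemma subst_diff [simp]: "subst \<sigma> (p - q) = subst \<sigma> p - subst \<sigma> q"
  using subst_add[of \<sigma> p "-q"] by simp

lemma subst_single: "subst \<sigma> (Poly_Mapping.single a c) = Const c * monom_subst \<sigma> a"
  using subst_superset[of "{a}" "Poly_Mapping.single a c" \<sigma>] by simp

lemma subst_Const [simp]: "subst \<sigma> (Const c) = Const c"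
  using subst_single[of \<sigma> 0 c] by (simp add: Const_def)

lemma subst_1 [simp]: "subst \<sigma> 1 = 1"
  using subst_Const[of \<sigma> 1] by simp

lemma subst_Var [simp]: "subst \<sigma> (Var i) = \<sigma> i"
  by (simp add: Var_def subst_single monom_subst_def)

lemma mpoly_eq_sum_single:
  "(\<Sum>a\<in>Poly_Mapping.keys p. Poly_Mapping.single a (Poly_Mapping.lookup p a)) = p"
  by (rule poly_mapping_eqI)
    (simp add: lookup_sum lookup_single when_def in_keys_iff)

lemma mpoly_single_induct [case_names single add]:
  assumes "\<And>a c. P (Poly_Mapping.single a c)" and "\<And>p q. P p \<Longrightarrow> P q \<Longrightarrow> P (p + q)"
  shows "P (p :: 'k::comm_ring_1 mpoly)"
proof -
  have "P 0" using assms(1)[of undefined 0] by simp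
  then have "P (\<Sum>a\<in>K. Poly_Mapping.single a (c a))" for K c
    by (induction K rule: infinite_finite_induct) (auto intro: assms)
  from this[of "Poly_Mapping.lookup p" "Poly_Mapping.keys p"] show ?thesis
    by (simp add: mpoly_eq_sum_single)
qed

lemma subst_mult [simp]: "subst \<sigma> (p * q) = subst \<sigma> p * subst \<sigma> q"
proof (induction p rule: mpoly_single_induct)
  case (single a c)
  show ?case
    by (induction q rule: mpoly_single_induct)
      (simp_all add: mult_single subst_single Const_mult monom_subst_add algebra_simps)
qed (simp add: distrib_right)

lemma subst_power [simp]: "subst \<sigma> (p ^ m) = subst \<sigma> p ^ m"
  by (induction m) auto

lemma subst_sum: "subst \<sigma> (sum f I) = (\<Sum>i\<in>I. subst \<sigma> (f i))"
  by (induction I rule: infinite_finite_induct) auto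

lemma single_power:
  "Poly_Mapping.single (Poly_Mapping.single i (1::nat)) (1::'k::comm_ring_1) ^ m =
    Poly_Mapping.single (Poly_Mapping.single i m) 1"
  by (induction m) (simp_all add: mult_single flip: single_add)

lemma monom_subst_Var: "monom_subst Var a = Poly_Mapping.single a (1::'k::comm_ring_1)"
proof -
  have "(\<Prod>i\<in>K. Poly_Mapping.single (f i) (1::'k)) = Poly_Mapping.single (\<Sum>i\<in>K. f i) 1"
    if "finite K" for K and f :: "nat \<Rightarrow> nat \<Rightarrow>\<^sub>0 nat"
    using that by induction (simp_all add: mult_single)
  moreover have "(\<Sum>i\<in>Poly_Mapping.keys a. Poly_Mapping.single i (Poly_Mapping.lookup a i)) = a"
    by (rule poly_mapping_eqI) (simp add: lookup_sum lookup_single when_def in_keys_iff)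
  ultimately show ?thesis by (simp add: monom_subst_def Var_def single_power[unfolded One_nat_def])
qed

lemma subst_Var_id: "subst Var p = p"
  by (induction p rule: mpoly_single_induct)
    (simp_all add: subst_single monom_subst_Var Const_def mult_single)

text \<open>The ring is generated over k by its variables. Many later identities between ring maps,
  and linearity of maps on tensor products, are checked on constants and variables through this
  rule.\<close>

lemma polys_induct [consumes 1, case_names Const Var add mult]:
  assumes p: "p \<in> polys n"
    and C: "\<And>c. P (Const c)" and V: "\<And>i. i < n \<Longrightarrow> P (Var i)"
    and A: "\<And>p q. p \<in> polys n \<Longrightarrow> q \<in> polys n \<Longrightarrow> P p \<Longrightarrow> P q \<Longrightarrow> P (p + q)"
    and M: "\<And>p q. p \<in> polys n \<Longrightarrow> q \<in> polys n \<Longrightarrow> P p \<Longrightarrow> P q \<Longrightarrow> P (p * q)"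
  shows "P p"
proof -
  let ?Q = "\<lambda>p. p \<in> polys n \<and> P p"
  have 0: "?Q 0" and 1: "?Q 1" using C[of 0] C[of 1] by auto
  have pow: "?Q (Var i ^ m)" if "i < n" for i m
    using that by (induction m) (use 1 V M in auto)
  have prd: "?Q (\<Prod>i\<in>K. Var i ^ f i)" if "K \<subseteq> {..<n}" for K f
    using that by (induction K rule: infinite_finite_induct) (use 1 pow M in auto)
  have "?Q (\<Sum>a\<in>K. Const (c a) * monom_subst Var a)" if "K \<subseteq> Poly_Mapping.keys p" for K c
    using that
  proof (induction K rule: infinite_finite_induct)
    case (insert a K)
    have "?Q (monom_subst Var a)"
      unfolding monom_subst_def by (rule prd) (use p insert in \<open>auto simp: polys_def\<close>)
    then have "?Q (Const (c a) * monom_subst Var a)" using C M by auto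
    then show ?case using insert A by auto
  qed (use 0 in auto)
  from this[of "Poly_Mapping.keys p" "Poly_Mapping.lookup p"] show ?thesis
    using subst_Var_id[of p] subst_superset[of "Poly_Mapping.keys p" p Var] by simp
qed

lemma subst_in_polys:
  "p \<in> polys n \<Longrightarrow> (\<And>i. i < n \<Longrightarrow> \<sigma> i \<in> polys m) \<Longrightarrow> subst \<sigma> p \<in> polys m"
  by (induction p rule: polys_induct) auto

lemma subst_cong: "p \<in> polys n \<Longrightarrow> (\<And>i. i < n \<Longrightarrow> \<sigma> i = \<tau> i) \<Longrightarrow> subst \<sigma> p = subst \<tau> p"
  by (induction p rule: polys_induct) auto

lemma subst_id: "p \<in> polys n \<Longrightarrow> (\<And>i. i < n \<Longrightarrow> \<sigma> i = Var i) \<Longrightarrow> subst \<sigma> p = p"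
  by (metis subst_cong subst_Var_id)

lemma primed_polys [simp]: "f \<in> polys n \<Longrightarrow> primed n f \<in> polys (n + n)"
  unfolding primed_def by (rule subst_in_polys) auto

lemma primed_simps [simp]: "primed n (p + q) = primed n p + primed n q"
  "primed n (p * q) = primed n p * primed n q" "primed n (Const c) = Const c"
  "primed n (Var i) = Var (n + i)" "primed n 1 = 1" "primed n 0 = 0"
  by (simp_all add: primed_def)

lemma collapse_polys [simp]: "f \<in> polys (n + n) \<Longrightarrow> collapse n f \<in> polys n"
  unfolding collapse_def by (rule subst_in_polys) auto

lemma collapse_simps [simp]: "collapse n (p + q) = collapse n p + collapse n q"
  "collapse n (p * q) = collapse n p * collapse n q" "collapse n (Const c) = Const c"
  "collapse n (Var i) = (if i < n then Var i else Var (i - n))"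
  "collapse n 0 = 0" "collapse n 1 = 1" "collapse n (- p) = - collapse n p"
  "collapse n (p - q) = collapse n p - collapse n q"
  by (simp_all add: collapse_def)

lemma collapse_sum: "collapse n (sum f I) = (\<Sum>i\<in>I. collapse n (f i))"
  by (simp add: collapse_def subst_sum)

lemma collapse_left: "f \<in> polys n \<Longrightarrow> collapse n f = f"
  unfolding collapse_def by (rule subst_id) auto

lemma collapse_primed: "f \<in> polys n \<Longrightarrow> collapse n (primed n f) = f"
  by (induction f rule: polys_induct) auto


section \<open>Difference quotients\<close>

text \<open>Exponents are natural numbers with truncated subtraction, hence the separate case where
  x_i does not occur in the monomial \<open>b\<close>.\<close>

lemma lookup_Var_mult:
  "Poly_Mapping.lookup (Var i * f) b =
    (if Poly_Mapping.lookup b i = 0 then 0 else Poly_Mapping.lookup f (b - Poly_Mapping.single i 1))"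
proof (induction f rule: mpoly_single_induct)
  case (single a c)
  have "Poly_Mapping.single i 1 + a = b \<longleftrightarrow>
      Poly_Mapping.lookup b i \<noteq> 0 \<and> a = b - Poly_Mapping.single i (1::nat)"
    by (auto simp: poly_mapping_eq_iff fun_eq_iff lookup_add lookup_minus lookup_single when_def
        split: if_splits)
  then show ?case by (auto simp: Var_def mult_single lookup_single when_def)
qed (simp add: distrib_left lookup_add)

text \<open>The coefficient of \<open>f\<close> at a monomial of maximal degree in \<open>x\<^sub>i\<close> survives in the product.\<close>

lemma Var_diff_nonzerodivisor:
  assumes "(Var i - Var j) * f = (0 :: 'k::comm_ring_1 mpoly)" and ij: "i \<noteq> j"
  shows "f = 0"
proof (rule ccontr)
  assume "f \<noteq> 0"
  then have "Poly_Mapping.keys f \<noteq> {}" by simp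
  define d where "d = Max ((\<lambda>a. Poly_Mapping.lookup a i) ` Poly_Mapping.keys f)"
  have "d \<in> (\<lambda>a. Poly_Mapping.lookup a i) ` Poly_Mapping.keys f"
    unfolding d_def using \<open>Poly_Mapping.keys f \<noteq> {}\<close> by (intro Max_in) auto
  then obtain a where a: "a \<in> Poly_Mapping.keys f" "Poly_Mapping.lookup a i = d" by auto
  have le: "Poly_Mapping.lookup b i \<le> d" if "b \<in> Poly_Mapping.keys f" for b
    unfolding d_def using that by auto
  let ?b = "a + Poly_Mapping.single i 1"
  have "Poly_Mapping.lookup (Var i * f) ?b = Poly_Mapping.lookup f a"
    by (simp add: lookup_Var_mult lookup_add lookup_single)
  moreover have "Poly_Mapping.lookup (Var j * f) ?b = 0"
  proof -
    have "Poly_Mapping.lookup (?b - Poly_Mapping.single j 1) i = Suc d"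
      using ij a by (simp add: lookup_add lookup_minus lookup_single when_def)
    then have "?b - Poly_Mapping.single j 1 \<notin> Poly_Mapping.keys f" using le by force
    then show ?thesis by (simp add: lookup_Var_mult in_keys_iff)
  qed
  moreover have "Var i * f = Var j * f" using assms(1) by (simp add: left_diff_distrib)
  ultimately show False using a by (simp add: in_keys_iff)
qed

lemma Var_diff_cancel:
  "(Var i - Var j) * p = (Var i - Var j) * (q :: 'k::comm_ring_1 mpoly) \<Longrightarrow> i \<noteq> j \<Longrightarrow> p = q"
  using Var_diff_nonzerodivisor[of i j "p - q"] by (simp add: right_diff_distrib)

lemma Var_diff_ex1:
  "\<exists>q\<in>A. (Var i - Var j) * q = (r :: 'k::comm_ring_1 mpoly) \<Longrightarrow> i \<noteq> j \<Longrightarrow>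
    \<exists>!q. q \<in> A \<and> (Var i - Var j) * q = r"
  by (metis Var_diff_cancel)

text \<open>Congruence modulo a single element \<xi> is compatible with sums and products, so two
  substitutions that agree modulo \<xi> on the variables agree modulo \<xi> everywhere. Both kinds
  of difference quotient below exist for this reason.\<close>

lemma subst_diff_quotient_exists:
  assumes "p \<in> polys m"
    and "\<And>j. j < m \<Longrightarrow> \<sigma> j \<in> polys n \<and> \<tau> j \<in> polys n \<and> (\<exists>q\<in>polys n. \<xi> * q = \<sigma> j - \<tau> j)"
  shows "\<exists>q\<in>polys n. \<xi> * q = subst \<sigma> p - subst \<tau> p"
  using assms(1)
proof (induction p rule: polys_induct)
  case (Const c)
  show ?case by (rule bexI[of _ 0]) auto
next
  case (Var i)
  then show ?case using assms(2) by simp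
next
  case (add p q)
  then obtain r s where "r \<in> polys n" "\<xi> * r = subst \<sigma> p - subst \<tau> p"
    "s \<in> polys n" "\<xi> * s = subst \<sigma> q - subst \<tau> q" by blast
  then show ?case by (intro bexI[of _ "r + s"]) (simp_all add: distrib_left)
next
  case (mult p q)
  then obtain r s where rs: "r \<in> polys n" "\<xi> * r = subst \<sigma> p - subst \<tau> p"
    "s \<in> polys n" "\<xi> * s = subst \<sigma> q - subst \<tau> q" by blast
  \<comment> \<open>The quotient comes from ab - a'b' = a (b - b') + (a - a') b'.\<close>
  have "\<xi> * (subst \<sigma> p * s + r * subst \<tau> q) = subst \<sigma> p * (\<xi> * s) + (\<xi> * r) * subst \<tau> q"
    by (simp add: algebra_simps)
  also have "\<dots> = subst \<sigma> (p * q) - subst \<tau> (p * q)"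
    by (simp add: rs algebra_simps)
  finally show ?case
    by (rule bexI) (use mult.hyps rs subst_in_polys[of p m \<sigma> n] subst_in_polys[of q m \<tau> n] assms(2) in auto)
qed

lemma diff_quot:
  assumes "W \<in> polys n" "i < n"
  shows diff_quot_polys: "diff_quot n i W \<in> polys (n + n)"
    and diff_quot_eq: "(Var i - Var (n + i)) * diff_quot n i W = mixed n i W - mixed n (Suc i) W"
proof -
  let ?P = "\<lambda>q. q \<in> polys (n + n) \<and> (Var i - Var (n + i)) * q = mixed n i W - mixed n (Suc i) W"
  have "\<exists>q\<in>polys (n + n). (Var i - Var (n + i)) * q = mixed n i W - mixed n (Suc i) W"
    unfolding mixed_def
  proof (rule subst_diff_quotient_exists[OF assms(1)], intro conjI)
    fix j
    have "\<exists>q\<in>polys (n + n). (Var i - Var (n + i)) * q =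
        (if j < i then Var (n + j) else Var j) - (if j < Suc i then Var (n + j) else Var j)"
      \<comment> \<open>Passing from stage i to stage i + 1 changes only the image of x_i, from x_i
        to x'_i.\<close>
      by (rule bexI[of _ "if j = i then 1 else 0"]) (auto simp: less_Suc_eq)
    then show "\<exists>q\<in>polys (n + n). (Var i - Var (n + i)) * q =
        (if j < i then Var (n + j) else Var j) - (if j < Suc i then Var (n + j) else Var j)" .
  qed (use assms(2) in auto)
  then have "\<exists>!q. ?P q"
    by (rule Var_diff_ex1) (use assms(2) in auto)
  then have "?P (diff_quot n i W)" unfolding diff_quot_def by (rule theI')
  then show "diff_quot n i W \<in> polys (n + n)"
    "(Var i - Var (n + i)) * diff_quot n i W = mixed n i W - mixed n (Suc i) W" by auto
qed

text \<open>The products telescope from W(x) to W(x'); this is where the potential W - W' of the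
  unit comes from.\<close>

lemma sum_diff_quot:
  assumes "W \<in> polys n"
  shows "(\<Sum>i<n. (Var i - Var (n + i)) * diff_quot n i W) = W - primed n W"
proof -
  have "(\<Sum>i<n. (Var i - Var (n + i)) * diff_quot n i W) = (\<Sum>i<n. mixed n i W - mixed n (Suc i) W)"
    by (rule sum.cong) (auto simp: diff_quot_eq[OF assms])
  also have "\<dots> = mixed n 0 W - mixed n n W"
    by (rule sum_lessThan_telescope')
  also have "mixed n 0 W = W" by (simp add: mixed_def subst_Var_id)
  also have "mixed n n W = primed n W"
    unfolding mixed_def primed_def by (rule subst_cong[OF assms]) auto
  finally show ?thesis .
qed

text \<open>Substitutes x_j for x'_j when j < i. The family interpolates between the identity and
  \<open>collapse\<close>, and \<open>merge_quot\<close> collects its successive quotients, so that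
  f - \<open>collapse n f\<close> is the sum over i of (x_i - x'_i)
  \<open>merge_quot n i f\<close>.\<close>

definition merge :: "nat \<Rightarrow> nat \<Rightarrow> 'k::comm_ring_1 mpoly \<Rightarrow> 'k mpoly" where
  "merge n i f = subst (\<lambda>j. if n \<le> j \<and> j < n + i then Var (j - n) else Var j) f"

definition merge_quot :: "nat \<Rightarrow> nat \<Rightarrow> 'k::comm_ring_1 mpoly \<Rightarrow> 'k mpoly" where
  "merge_quot n i f = (THE q. q \<in> polys (n + n) \<and>
     (Var i - Var (n + i)) * q = merge n i f - merge n (Suc i) f)"

lemma merge_simps [simp]: "merge n i (p + q) = merge n i p + merge n i q"
  "merge n i (p * q) = merge n i p * merge n i q" "merge n i (p - q) = merge n i p - merge n i q"
  "merge n i (- p) = - merge n i p" "merge n i 0 = 0" "merge n i 1 = 1"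
  by (simp_all add: merge_def)

lemma merge_0: "merge n 0 f = f"
proof -
  have "(\<lambda>j. if n \<le> j \<and> j < n + 0 then Var (j - n) else Var j) = (Var :: nat \<Rightarrow> 'a mpoly)"
    by (rule ext) auto
  then show ?thesis by (simp only: merge_def subst_Var_id)
qed

lemma merge_n: "f \<in> polys (n + n) \<Longrightarrow> merge n n f = collapse n f"
  unfolding merge_def collapse_def by (rule subst_cong) auto

lemma merge_left: "f \<in> polys n \<Longrightarrow> merge n i f = f"
  unfolding merge_def by (rule subst_id) auto

lemma merge_quot:
  assumes "f \<in> polys (n + n)" "i < n"
  shows merge_quot_polys: "merge_quot n i f \<in> polys (n + n)"
    and merge_quot_eq: "(Var i - Var (n + i)) * merge_quot n i f = merge n i f - merge n (Suc i) f"
proof -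
  let ?P = "\<lambda>q. q \<in> polys (n + n) \<and> (Var i - Var (n + i)) * q = merge n i f - merge n (Suc i) f"
  have "\<exists>q\<in>polys (n + n). (Var i - Var (n + i)) * q = merge n i f - merge n (Suc i) f"
    unfolding merge_def
  proof (rule subst_diff_quotient_exists[OF assms(1)], intro conjI)
    fix j assume "j < n + n"
    have "\<exists>q\<in>polys (n + n). (Var i - Var (n + i)) * q =
        (if n \<le> j \<and> j < n + i then Var (j - n) else Var j) -
        (if n \<le> j \<and> j < n + Suc i then Var (j - n) else Var j)"
      \<comment> \<open>Here it is x'_i that changes, into x_i, so the quotient at this variable is
        -1.\<close>
      by (rule bexI[of _ "if j = n + i then - 1 else 0"]) (auto simp: less_Suc_eq)
    then show "\<exists>q\<in>polys (n + n). (Var i - Var (n + i)) * q =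
        (if n \<le> j \<and> j < n + i then Var (j - n) else Var j) -
        (if n \<le> j \<and> j < n + Suc i then Var (j - n) else Var j)" .
  qed auto
  then have "\<exists>!q. ?P q"
    by (rule Var_diff_ex1) (use assms(2) in auto)
  then have "?P (merge_quot n i f)" unfolding merge_quot_def by (rule theI')
  then show "merge_quot n i f \<in> polys (n + n)"
    "(Var i - Var (n + i)) * merge_quot n i f = merge n i f - merge n (Suc i) f" by auto
qed

lemma merge_quot_unique:
  assumes "f \<in> polys (n + n)" "i < n"
    and "(Var i - Var (n + i)) * q = merge n i f - merge n (Suc i) f"
  shows "merge_quot n i f = q"
  by (rule Var_diff_cancel[of i "n + i"]) (use assms merge_quot_eq in auto)

lemma merge_quot_add:
  assumes "f \<in> polys (n + n)" "g \<in> polys (n + n)" "i < n"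
  shows "merge_quot n i (f + g) = merge_quot n i f + merge_quot n i g"
  by (rule merge_quot_unique) (use assms in \<open>auto simp: merge_quot_eq distrib_left\<close>)

lemma merge_quot_0 [simp]: "i < n \<Longrightarrow> merge_quot n i 0 = 0"
  by (rule merge_quot_unique) auto

lemma merge_quot_sum:
  "(\<And>j. j \<in> J \<Longrightarrow> f j \<in> polys (n + n)) \<Longrightarrow> i < n \<Longrightarrow>
    merge_quot n i (sum f J) = (\<Sum>j\<in>J. merge_quot n i (f j))"
  by (induction J rule: infinite_finite_induct) (auto simp: merge_quot_add)

text \<open>A factor comes out of the quotient when the two consecutive substitutions agree on it.
  Unprimed polynomials qualify, whereas x'_i does not: this is why the Koszul contraction is linear
  over the left action only.\<close>

lemma merge_quot_mult:
  assumes "f \<in> polys (n + n)" "r \<in> polys (n + n)" "i < n" "merge n i r = s" "merge n (Suc i) r = s"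
  shows "merge_quot n i (r * f) = s * merge_quot n i f"
proof (rule merge_quot_unique)
  have "(Var i - Var (n + i)) * (s * merge_quot n i f) =
      s * ((Var i - Var (n + i)) * merge_quot n i f)" by (simp add: algebra_simps)
  then show "(Var i - Var (n + i)) * (s * merge_quot n i f) =
      merge n i (r * f) - merge n (Suc i) (r * f)"
    using assms by (simp add: merge_quot_eq right_diff_distrib)
qed (use assms in auto)

lemma merge_quot_left:
  "f \<in> polys (n + n) \<Longrightarrow> r \<in> polys n \<Longrightarrow> i < n \<Longrightarrow> merge_quot n i (r * f) = r * merge_quot n i f"
  by (rule merge_quot_mult) (auto simp: merge_left intro: polys_mono)

text \<open>This and the next two lemmas treat a factor x_j - x'_j: it is already merged to zero
  when j < i, untouched by both substitutions when j > i, and killed by the second substitution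
  alone when j = i. They supply the cancellations in
  \<open>koszul_contraction_homotopy\<close>.\<close>

lemma merge_quot_Var_diff_eq:
  assumes "f \<in> polys (n + n)" "i < n"
  shows "merge_quot n i ((Var i - Var (n + i)) * f) = merge n i f"
proof (rule merge_quot_unique)
  have *: "merge n i (Var i - Var (n + i)) = Var i - Var (n + i)"
    "merge n (Suc i) (Var i - Var (n + i)) = 0"
    using assms by (simp_all add: merge_def)
  then show "(Var i - Var (n + i)) * merge n i f =
      merge n i ((Var i - Var (n + i)) * f) - merge n (Suc i) ((Var i - Var (n + i)) * f)"
    by (simp only: merge_simps(2) *) simp
qed (use assms in auto)

lemma merge_quot_Var_diff_less:
  assumes "f \<in> polys (n + n)" "i < n" "j < i"
  shows "merge_quot n i ((Var j - Var (n + j)) * f) = 0"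
  using merge_quot_mult[of f n "Var j - Var (n + j)" i 0] assms by (simp add: merge_def)

lemma merge_quot_Var_diff_greater:
  assumes "f \<in> polys (n + n)" "i < j" "j < n"
  shows "merge_quot n i ((Var j - Var (n + j)) * f) = (Var j - Var (n + j)) * merge_quot n i f"
  using merge_quot_mult[of f n "Var j - Var (n + j)" i "Var j - Var (n + j)"] assms
  by (simp add: merge_def)

section \<open>Symmetries\<close>

text \<open>Covers g, its inverse and g \<otimes> 1 on R^e at once. The conditions are imposed on
  \<open>polys n\<close> only, because the elements of \<open>BijGroup\<close> are
  \<open>undefined\<close> outside it.\<close>

definition poly_endo :: "nat \<Rightarrow> ('k::comm_ring_1 mpoly \<Rightarrow> 'k mpoly) \<Rightarrow> bool" where
  "poly_endo n \<sigma> \<longleftrightarrow> (\<forall>p\<in>polys n. \<sigma> p \<in> polys n) \<and> (\<forall>c. \<sigma> (Const c) = Const c) \<and>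
     (\<forall>p\<in>polys n. \<forall>q\<in>polys n. \<sigma> (p + q) = \<sigma> p + \<sigma> q \<and> \<sigma> (p * q) = \<sigma> p * \<sigma> q)"

lemma poly_endoD:
  assumes "poly_endo n \<sigma>"
  shows "p \<in> polys n \<Longrightarrow> \<sigma> p \<in> polys n" "\<sigma> (Const c) = Const c"
    "p \<in> polys n \<Longrightarrow> q \<in> polys n \<Longrightarrow> \<sigma> (p + q) = \<sigma> p + \<sigma> q"
    "p \<in> polys n \<Longrightarrow> q \<in> polys n \<Longrightarrow> \<sigma> (p * q) = \<sigma> p * \<sigma> q"
    "\<sigma> 1 = 1"
  using assms Const_1 unfolding poly_endo_def by metis+

lemma symmetry_endo: "symmetry_group n W G \<Longrightarrow> g \<in> G \<Longrightarrow> poly_endo n g"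
  by (auto simp: symmetry_group_def poly_endo_def ring_hom_def PR_def)

lemma symmetry_ginv:
  assumes "symmetry_group n W G" "g \<in> G" shows "ginv n g \<in> G"
  using assms unfolding symmetry_group_def ginv_def
  by (simp add: subgroup.m_inv_closed)

lemma symmetry_mult:
  assumes "symmetry_group n W G" "g \<in> G" "h \<in> G"
  shows "g \<otimes>\<^bsub>BijGroup (polys n)\<^esub> h \<in> G"
    and "p \<in> polys n \<Longrightarrow> (g \<otimes>\<^bsub>BijGroup (polys n)\<^esub> h) p = g (h p)"
proof -
  have sub: "subgroup G (BijGroup (polys n))" using assms(1) by (simp add: symmetry_group_def)
  then show "g \<otimes>\<^bsub>BijGroup (polys n)\<^esub> h \<in> G" using assms by (simp add: subgroup.m_closed)
  have "g \<in> Bij (polys n)" "h \<in> Bij (polys n)"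
    using subgroup.subset[OF sub] assms by (auto simp: BijGroup_def)
  then show "(g \<otimes>\<^bsub>BijGroup (polys n)\<^esub> h) p = g (h p)" if "p \<in> polys n"
    using that by (simp add: BijGroup_def compose_def)
qed

lemma symmetry_one:
  assumes "symmetry_group n W G"
  shows "\<one>\<^bsub>BijGroup (polys n)\<^esub> \<in> G"
    and "p \<in> polys n \<Longrightarrow> \<one>\<^bsub>BijGroup (polys n)\<^esub> p = p"
proof -
  show "\<one>\<^bsub>BijGroup (polys n)\<^esub> \<in> G"
    using assms unfolding symmetry_group_def by (blast intro: subgroup.one_closed)
  show "p \<in> polys n \<Longrightarrow> \<one>\<^bsub>BijGroup (polys n)\<^esub> p = p" by (simp add: BijGroup_def)
qed

lemma symmetry_carrier:
  "symmetry_group n W G \<Longrightarrow> g \<in> G \<Longrightarrow> g \<in> carrier (BijGroup (polys n))"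
  unfolding symmetry_group_def by (meson subgroup.mem_carrier)

lemma ginv_left:
  assumes "symmetry_group n W G" "g \<in> G" "p \<in> polys n"
  shows "ginv n g (g p) = p"
proof -
  have "ginv n g \<otimes>\<^bsub>BijGroup (polys n)\<^esub> g = \<one>\<^bsub>BijGroup (polys n)\<^esub>"
    unfolding ginv_def using group.l_inv[OF group_BijGroup] symmetry_carrier assms by blast
  then show ?thesis
    using symmetry_mult(2)[OF assms(1) symmetry_ginv[OF assms(1,2)] assms(2,3)]
      symmetry_one(2)[OF assms(1,3)] by simp
qed

lemma ginv_right:
  assumes "symmetry_group n W G" "g \<in> G" "p \<in> polys n"
  shows "g (ginv n g p) = p"
proof -
  have "g \<otimes>\<^bsub>BijGroup (polys n)\<^esub> ginv n g = \<one>\<^bsub>BijGroup (polys n)\<^esub>"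
    unfolding ginv_def using group.r_inv[OF group_BijGroup] symmetry_carrier assms by blast
  then show ?thesis
    using symmetry_mult(2)[OF assms(1,2) symmetry_ginv[OF assms(1,2)] assms(3)]
      symmetry_one(2)[OF assms(1,3)] by simp
qed

lemma ginv_endo: "symmetry_group n W G \<Longrightarrow> g \<in> G \<Longrightarrow> poly_endo n (ginv n g)"
  using symmetry_ginv symmetry_endo by blast

lemma ginv_W:
  assumes "symmetry_group n W G" "g \<in> G" shows "ginv n g W = W"
  using symmetry_ginv[OF assms] assms(1) by (auto simp: symmetry_group_def)

text \<open>The reversed order of the inverses is what turns the twist by gh into the iterated twist
  g(hX).\<close>

lemma ginv_mult:
  assumes "symmetry_group n W G" "g \<in> G" "h \<in> G" "p \<in> polys n"
  shows "ginv n (g \<otimes>\<^bsub>BijGroup (polys n)\<^esub> h) p = ginv n h (ginv n g p)"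
proof -
  have "ginv n (g \<otimes>\<^bsub>BijGroup (polys n)\<^esub> h) = ginv n h \<otimes>\<^bsub>BijGroup (polys n)\<^esub> ginv n g"
    unfolding ginv_def
    using group.inv_mult_group[OF group_BijGroup] symmetry_carrier assms by blast
  then show ?thesis using symmetry_mult(2)[OF assms(1)] symmetry_ginv[OF assms(1)] assms by simp
qed

lemma ginv_one:
  fixes p :: "'k::comm_ring_1 mpoly"
  assumes "p \<in> polys n" shows "ginv n \<one>\<^bsub>BijGroup (polys n)\<^esub> p = p"
proof -
  have "ginv n \<one>\<^bsub>BijGroup (polys n)\<^esub> = \<one>\<^bsub>BijGroup (polys n :: 'k mpoly set)\<^esub>"
    unfolding ginv_def by (rule monoid.inv_one[OF group.is_monoid[OF group_BijGroup]])
  then have "ginv n \<one>\<^bsub>BijGroup (polys n)\<^esub> p = \<one>\<^bsub>BijGroup (polys n)\<^esub> p" by simp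
  then show ?thesis using assms by (simp add: BijGroup_def)
qed

lemma on_left_endo: "poly_endo n g \<Longrightarrow> poly_endo (n + n) (on_left n g)"
  unfolding poly_endo_def on_left_def
  by (auto intro!: subst_in_polys polys_mono[of "g (Var _)" n "n + n"])

lemma on_left_left:
  assumes "poly_endo n g" "f \<in> polys n" shows "on_left n g f = g f"
  using assms(2) unfolding on_left_def
  by (induction f rule: polys_induct) (use poly_endoD[OF assms(1)] in auto)

lemma on_left_primed: "f \<in> polys n \<Longrightarrow> on_left n g (primed n f) = primed n f"
  unfolding on_left_def by (induction f rule: polys_induct) auto

lemma on_left_one:
  assumes "f \<in> polys (n + n)" shows "on_left n (ginv n \<one>\<^bsub>BijGroup (polys n)\<^esub>) f = f"
  unfolding on_left_def by (rule subst_id[OF assms]) (auto simp: ginv_one)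

section \<open>Additive maps\<close>

text \<open>Linearity is kept apart from additivity because one underlying map is linear for several
  twisted actions, and because maps on a tensor product are compared as additive maps on
  generators.\<close>

definition additive :: "('a, 'c) ring_scheme \<Rightarrow> ('b, 'd) ring_scheme \<Rightarrow> ('a \<Rightarrow> 'b) \<Rightarrow> bool" where
  "additive X Y f \<longleftrightarrow> f \<in> carrier X \<rightarrow> carrier Y \<and>
     (\<forall>a\<in>carrier X. \<forall>b\<in>carrier X. f (a \<oplus>\<^bsub>X\<^esub> b) = f a \<oplus>\<^bsub>Y\<^esub> f b)"

lemma additiveI:
  "(\<And>a. a \<in> carrier X \<Longrightarrow> f a \<in> carrier Y) \<Longrightarrow>
   (\<And>a b. a \<in> carrier X \<Longrightarrow> b \<in> carrier X \<Longrightarrow> f (a \<oplus>\<^bsub>X\<^esub> b) = f a \<oplus>\<^bsub>Y\<^esub> f b) \<Longrightarrow> additive X Y f"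
  by (simp add: additive_def)

lemma additive_closed: "additive X Y f \<Longrightarrow> a \<in> carrier X \<Longrightarrow> f a \<in> carrier Y"
  and additive_add: "additive X Y f \<Longrightarrow> a \<in> carrier X \<Longrightarrow> b \<in> carrier X \<Longrightarrow>
    f (a \<oplus>\<^bsub>X\<^esub> b) = f a \<oplus>\<^bsub>Y\<^esub> f b"
  by (auto simp: additive_def)

lemma additive_zero:
  assumes "abelian_group X" "abelian_group Y" "additive X Y f"
  shows "f \<zero>\<^bsub>X\<^esub> = \<zero>\<^bsub>Y\<^esub>"
proof -
  interpret X: abelian_group X by fact
  interpret Y: abelian_group Y by fact
  have "f \<zero>\<^bsub>X\<^esub> \<oplus>\<^bsub>Y\<^esub> f \<zero>\<^bsub>X\<^esub> = f \<zero>\<^bsub>X\<^esub>"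
    using additive_add[OF assms(3), of "\<zero>\<^bsub>X\<^esub>" "\<zero>\<^bsub>X\<^esub>"] by simp
  then show ?thesis using additive_closed[OF assms(3), of "\<zero>\<^bsub>X\<^esub>"]
    by (simp add: Y.add.l_cancel_one)
qed

lemma additive_neg:
  assumes "abelian_group X" "abelian_group Y" "additive X Y f" "a \<in> carrier X"
  shows "f (\<ominus>\<^bsub>X\<^esub> a) = \<ominus>\<^bsub>Y\<^esub> f a"
proof -
  interpret X: abelian_group X by fact
  interpret Y: abelian_group Y by fact
  have "f (\<ominus>\<^bsub>X\<^esub> a) \<oplus>\<^bsub>Y\<^esub> f a = \<zero>\<^bsub>Y\<^esub>"
    using additive_add[OF assms(3), of "\<ominus>\<^bsub>X\<^esub> a" a] assms(4) additive_zero[OF assms(1-3)]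
    by (simp add: X.l_neg)
  then show ?thesis using additive_closed[OF assms(3)] assms(4)
    by (simp add: Y.minus_equality)
qed

lemma additive_minus:
  assumes "abelian_group X" "abelian_group Y" "additive X Y f" "a \<in> carrier X" "b \<in> carrier X"
  shows "f (a \<ominus>\<^bsub>X\<^esub> b) = f a \<ominus>\<^bsub>Y\<^esub> f b"
  unfolding a_minus_def using additive_neg[OF assms(1-3,5)] assms
  by (simp add: additive_add abelian_group.a_inv_closed)

lemma additive_finsum:
  assumes "abelian_group X" "abelian_group Y" "additive X Y f" "\<And>i. i \<in> I \<Longrightarrow> g i \<in> carrier X"
  shows "f (finsum X g I) = finsum Y (\<lambda>i. f (g i)) I"
proof -
  interpret X: abelian_group X by fact
  interpret Y: abelian_group Y by fact
  show ?thesis using assms(4)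
  proof (induction I rule: infinite_finite_induct)
    case (insert i I)
    then have "g \<in> I \<rightarrow> carrier X" "(\<lambda>i. f (g i)) \<in> I \<rightarrow> carrier Y"
      by (auto intro: additive_closed[OF assms(3)])
    with insert show ?case
      by (simp add: additive_add[OF assms(3)] additive_closed[OF assms(3)])
  qed (simp_all add: additive_zero[OF assms(1-3)])
qed

lemma additive_id: "additive X X (\<lambda>x. x)"
  by (simp add: additive_def)

lemma additive_zero_map:
  assumes "abelian_group Y" shows "additive X Y (\<lambda>_. \<zero>\<^bsub>Y\<^esub>)"
proof -
  interpret Y: abelian_group Y by fact
  show ?thesis by (simp add: additive_def)
qed

lemma additive_compose:
  "additive X Y f \<Longrightarrow> additive Y Z g \<Longrightarrow> additive X Z (\<lambda>x. g (f x))"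
  by (auto simp: additive_def Pi_def)

lemma additive_plus:
  assumes "abelian_group Y" "additive X Y f" "additive X Y g"
  shows "additive X Y (\<lambda>x. f x \<oplus>\<^bsub>Y\<^esub> g x)"
proof -
  interpret Y: abelian_group Y by fact
  show ?thesis using assms(2,3) by (auto simp: additive_def Pi_def Y.a_ac)
qed

lemma additive_uminus:
  assumes "abelian_group Y" "additive X Y f"
  shows "additive X Y (\<lambda>x. \<ominus>\<^bsub>Y\<^esub> f x)"
proof -
  interpret Y: abelian_group Y by fact
  show ?thesis using assms(2) by (auto simp: additive_def Pi_def Y.minus_add)
qed


section \<open>Graded modules with an odd endomorphism\<close>

lemma PR_simps [simp]: "carrier (PR n) = polys n" "\<zero>\<^bsub>PR n\<^esub> = 0" "\<one>\<^bsub>PR n\<^esub> = 1"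
  "p \<oplus>\<^bsub>PR n\<^esub> q = p + q" "p \<otimes>\<^bsub>PR n\<^esub> q = p * q"
  by (auto simp: PR_def)

lemma cring_PR: "cring (PR n :: 'k::comm_ring_1 mpoly ring)"
proof (rule cringI)
  show "abelian_group (PR n :: 'k mpoly ring)"
  proof (rule abelian_groupI)
    fix x :: "'k mpoly" assume "x \<in> carrier (PR n)"
    then show "\<exists>y\<in>carrier (PR n). y \<oplus>\<^bsub>PR n\<^esub> x = \<zero>\<^bsub>PR n\<^esub>" by (intro bexI[of _ "- x"]) auto
  qed (auto simp: algebra_simps)
qed (auto intro!: comm_monoidI simp: algebra_simps)

text \<open>No condition on the square of the differential: iterated tensor products enter only as
  objects of a homotopy category.\<close>

locale premf =
  fixes N :: nat and X :: "('k::comm_ring_1 mpoly, 'm) mf" (structure)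
  assumes mod: "module (PR N) X"
    and evens: "submodule (evens X) (PR N) X"
    and odds: "submodule (odds X) (PR N) X"
    and decomp: "\<forall>m\<in>carrier X. \<exists>!(a, b). a \<in> evens X \<and> b \<in> odds X \<and> m = a \<oplus>\<^bsub>X\<^esub> b"
    and diff_linear: "restrict (diff X) (carrier X) \<in> linear_maps N X X"
    and diff_evens_image: "diff X ` evens X \<subseteq> odds X"
    and diff_odds_image: "diff X ` odds X \<subseteq> evens X"
begin

sublocale mm: module "PR N" X by (rule mod)

lemma ab: "abelian_group X" ..

lemmas add_closed [simp] = mm.M.a_closed
lemmas zero_closed [simp] = mm.M.zero_closed
lemmas neg_closed [simp] = mm.M.a_inv_closed
lemmas minus_closed [simp] = mm.M.minus_closed
lemmas ac = mm.M.a_ac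
text \<open>Normalisation by associativity and commutativity may put other summands between x and
  its negative. These rules cancel across the gap, so that \<open>ab_simps\<close> settles the
  identities between sums that occur below.\<close>

lemma cancel_neg_aux:
  assumes "x \<in> carrier X" "y \<in> carrier X" "z \<in> carrier X" "w \<in> carrier X"
  shows "x \<oplus> (y \<oplus> (z \<oplus> (\<ominus> x \<oplus> w))) = y \<oplus> (z \<oplus> w)"
proof -
  have "x \<oplus> (y \<oplus> (z \<oplus> (\<ominus> x \<oplus> w))) = (x \<oplus> \<ominus> x) \<oplus> (y \<oplus> (z \<oplus> w))"
    using assms by (simp only: ac add_closed neg_closed)
  then show ?thesis using assms by (simp add: mm.M.r_neg)
qed

lemma cancel_neg_aux':
  assumes "x \<in> carrier X" "y \<in> carrier X" "z \<in> carrier X" "w \<in> carrier X"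
  shows "\<ominus> x \<oplus> (y \<oplus> (z \<oplus> (x \<oplus> w))) = y \<oplus> (z \<oplus> w)"
  using cancel_neg_aux[of "\<ominus> x" y z w] assms by (simp add: mm.M.minus_minus)

lemma cancel_neg:
  "x \<in> carrier X \<Longrightarrow> y \<in> carrier X \<Longrightarrow>
    x \<oplus> (y \<oplus> \<ominus> x) = y"
  "x \<in> carrier X \<Longrightarrow> y \<in> carrier X \<Longrightarrow>
    \<ominus> x \<oplus> (y \<oplus> x) = y"
  "x \<in> carrier X \<Longrightarrow> y \<in> carrier X \<Longrightarrow> z \<in> carrier X \<Longrightarrow>
    x \<oplus> (y \<oplus> (\<ominus> x \<oplus> z)) = y \<oplus> z"
  "x \<in> carrier X \<Longrightarrow> y \<in> carrier X \<Longrightarrow> z \<in> carrier X \<Longrightarrow>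
    \<ominus> x \<oplus> (y \<oplus> (x \<oplus> z)) = y \<oplus> z"
  "x \<in> carrier X \<Longrightarrow> y \<in> carrier X \<Longrightarrow> z \<in> carrier X \<Longrightarrow>
    x \<oplus> (y \<oplus> (z \<oplus> \<ominus> x)) = y \<oplus> z"
  "x \<in> carrier X \<Longrightarrow> y \<in> carrier X \<Longrightarrow> z \<in> carrier X \<Longrightarrow>
    \<ominus> x \<oplus> (y \<oplus> (z \<oplus> x)) = y \<oplus> z"
  using cancel_neg_aux[of x y z "\<zero>"] cancel_neg_aux[of x y "\<zero>" z]
    cancel_neg_aux[of x y "\<zero>" "\<zero>"] cancel_neg_aux'[of x y z "\<zero>"]
    cancel_neg_aux'[of x y "\<zero>" z] cancel_neg_aux'[of x y "\<zero>" "\<zero>"] by simp_all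

lemmas ab_simps = cancel_neg cancel_neg_aux cancel_neg_aux' mm.M.a_ac mm.M.minus_eq mm.M.minus_add mm.M.minus_minus mm.M.r_neg mm.M.l_neg
  mm.M.r_neg1 mm.M.r_neg2

lemma smult_closed [simp]: "r \<in> polys N \<Longrightarrow> m \<in> carrier X \<Longrightarrow> r \<odot> m \<in> carrier X"
  using mm.smult_closed by simp

lemma smult_add: "r \<in> polys N \<Longrightarrow> a \<in> carrier X \<Longrightarrow> b \<in> carrier X \<Longrightarrow>
    r \<odot> (a \<oplus> b) = r \<odot> a \<oplus> r \<odot> b"
  using mm.smult_r_distr by simp

lemma add_smult: "r \<in> polys N \<Longrightarrow> s \<in> polys N \<Longrightarrow> a \<in> carrier X \<Longrightarrow>
    (r + s) \<odot> a = r \<odot> a \<oplus> s \<odot> a"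
  using mm.smult_l_distr by simp

lemma smult_smult: "r \<in> polys N \<Longrightarrow> s \<in> polys N \<Longrightarrow> a \<in> carrier X \<Longrightarrow> (r * s) \<odot> a = r \<odot> (s \<odot> a)"
  using mm.smult_assoc1 by simp

lemma smult_commute: "r \<in> polys N \<Longrightarrow> s \<in> polys N \<Longrightarrow> a \<in> carrier X \<Longrightarrow> r \<odot> (s \<odot> a) = s \<odot> (r \<odot> a)"
  by (metis smult_smult mult.commute)

lemma one_smult [simp]: "a \<in> carrier X \<Longrightarrow> 1 \<odot> a = a"
  using mm.smult_one by simp

lemma zero_smult [simp]: "a \<in> carrier X \<Longrightarrow> 0 \<odot> a = \<zero>"
  using mm.smult_l_null by simp

lemma smult_zero [simp]: "r \<in> polys N \<Longrightarrow> r \<odot> \<zero> = \<zero>"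
  using mm.smult_r_null by simp

lemma smult_additive: "r \<in> polys N \<Longrightarrow> additive X X (\<lambda>m. r \<odot> m)"
  by (rule additiveI) (auto simp: smult_add)

lemma neg_smult:
  assumes "r \<in> polys N" "a \<in> carrier X" shows "(- r) \<odot> a = \<ominus> (r \<odot> a)"
proof -
  have "(- r) \<odot> a \<oplus> r \<odot> a = \<zero>" using add_smult[of "-r" r a] assms by simp
  then show ?thesis using assms by (metis mm.M.minus_equality polys_uminus smult_closed)
qed

lemma diff_smult_eq: "r \<in> polys N \<Longrightarrow> s \<in> polys N \<Longrightarrow> a \<in> carrier X \<Longrightarrow>
    (r - s) \<odot> a = r \<odot> a \<ominus> s \<odot> a"
  using add_smult[of r "-s" a] by (simp add: neg_smult a_minus_def)

lemma smult_neg: "r \<in> polys N \<Longrightarrow> a \<in> carrier X \<Longrightarrow> r \<odot> (\<ominus> a) = \<ominus> (r \<odot> a)"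
  using additive_neg[OF ab ab smult_additive] by simp

lemma evens_carrier [simp]: "a \<in> evens X \<Longrightarrow> a \<in> carrier X"
  using mm.submoduleE(1)[OF evens] by auto

lemma odds_carrier [simp]: "a \<in> odds X \<Longrightarrow> a \<in> carrier X"
  using mm.submoduleE(1)[OF odds] by auto

lemma evens_add [simp]: "a \<in> evens X \<Longrightarrow> b \<in> evens X \<Longrightarrow> a \<oplus> b \<in> evens X"
  and evens_neg [simp]: "a \<in> evens X \<Longrightarrow> \<ominus> a \<in> evens X"
  and evens_smult [simp]: "r \<in> polys N \<Longrightarrow> a \<in> evens X \<Longrightarrow> r \<odot> a \<in> evens X"
  using mm.submoduleE[OF evens] by auto

lemma odds_add [simp]: "a \<in> odds X \<Longrightarrow> b \<in> odds X \<Longrightarrow> a \<oplus> b \<in> odds X"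
  and odds_neg [simp]: "a \<in> odds X \<Longrightarrow> \<ominus> a \<in> odds X"
  and odds_smult [simp]: "r \<in> polys N \<Longrightarrow> a \<in> odds X \<Longrightarrow> r \<odot> a \<in> odds X"
  using mm.submoduleE[OF odds] by auto

lemma evens_minus [simp]: "a \<in> evens X \<Longrightarrow> b \<in> evens X \<Longrightarrow> a \<ominus> b \<in> evens X"
  and odds_minus [simp]: "a \<in> odds X \<Longrightarrow> b \<in> odds X \<Longrightarrow> a \<ominus> b \<in> odds X"
  by (auto simp: a_minus_def)

lemma evens_zero [simp]: "\<zero> \<in> evens X"
proof -
  obtain a where "a \<in> evens X" using mm.submoduleE(2)[OF evens] by auto
  then show ?thesis using evens_smult[of 0 a] by simp
qed

lemma odds_zero [simp]: "\<zero> \<in> odds X"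
proof -
  obtain a where "a \<in> odds X" using mm.submoduleE(2)[OF odds] by auto
  then show ?thesis using odds_smult[of 0 a] by simp
qed

lemma decomp_unique:
  assumes "a \<in> evens X" "b \<in> odds X" "a' \<in> evens X" "b' \<in> odds X" "a \<oplus> b = a' \<oplus> b'"
  shows "a = a'" "b = b'"
proof -
  have "\<exists>!(c, d). c \<in> evens X \<and> d \<in> odds X \<and> a \<oplus> b = c \<oplus> d"
    using decomp assms by simp
  then have "(a, b) = (a', b')" by (rule ex1E) (use assms in \<open>auto simp: split_def\<close>)
  then show "a = a'" "b = b'" by auto
qed

lemma even_odd_zero: "a \<in> evens X \<Longrightarrow> a \<in> odds X \<Longrightarrow> a = \<zero>"
  using decomp_unique[of a "\<zero>" "\<zero>" a] by simp

definition evp where "evp m = (THE a. a \<in> evens X \<and> (\<exists>b\<in>odds X. m = a \<oplus> b))"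
definition odp where "odp m = (THE b. b \<in> odds X \<and> (\<exists>a\<in>evens X. m = a \<oplus> b))"

lemma evp_eq: "a \<in> evens X \<Longrightarrow> b \<in> odds X \<Longrightarrow> evp (a \<oplus> b) = a"
  unfolding evp_def by (rule the_equality) (use decomp_unique in blast)+

lemma odp_eq: "a \<in> evens X \<Longrightarrow> b \<in> odds X \<Longrightarrow> odp (a \<oplus> b) = b"
  unfolding odp_def by (rule the_equality) (use decomp_unique in blast)+

lemma decompE:
  assumes "m \<in> carrier X"
  obtains a b where "a \<in> evens X" "b \<in> odds X" "m = a \<oplus> b"
  using decomp assms by blast

lemma evp_evens [simp]: "m \<in> carrier X \<Longrightarrow> evp m \<in> evens X"
  and odp_odds [simp]: "m \<in> carrier X \<Longrightarrow> odp m \<in> odds X"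
  and evp_odp: "m \<in> carrier X \<Longrightarrow> evp m \<oplus> odp m = m"
  by (auto elim!: decompE simp: evp_eq odp_eq)

lemma evp_carrier [simp]: "m \<in> carrier X \<Longrightarrow> evp m \<in> carrier X"
  and odp_carrier [simp]: "m \<in> carrier X \<Longrightarrow> odp m \<in> carrier X"
  by simp_all

lemma evp_even [simp]: "a \<in> evens X \<Longrightarrow> evp a = a"
  and odp_even [simp]: "a \<in> evens X \<Longrightarrow> odp a = \<zero>"
  using evp_eq[of a "\<zero>"] odp_eq[of a "\<zero>"] by simp_all

lemma evp_odd [simp]: "a \<in> odds X \<Longrightarrow> evp a = \<zero>"
  and odp_odd [simp]: "a \<in> odds X \<Longrightarrow> odp a = a"
  using evp_eq[of "\<zero>" a] odp_eq[of "\<zero>" a] by simp_all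

lemma parts_add:
  assumes "m \<in> carrier X" "m' \<in> carrier X"
  shows "evp (m \<oplus> m') = evp m \<oplus> evp m'" "odp (m \<oplus> m') = odp m \<oplus> odp m'"
proof -
  have "m \<oplus> m' = (evp m \<oplus> odp m) \<oplus> (evp m' \<oplus> odp m')"
    using assms by (simp add: evp_odp)
  also have "\<dots> = (evp m \<oplus> evp m') \<oplus> (odp m \<oplus> odp m')"
    using assms by (simp add: ac)
  finally show "evp (m \<oplus> m') = evp m \<oplus> evp m'" "odp (m \<oplus> m') = odp m \<oplus> odp m'"
    using assms by (simp_all add: evp_eq odp_eq)
qed

lemma parts_smult:
  assumes "m \<in> carrier X" "r \<in> polys N"
  shows "evp (r \<odot> m) = r \<odot> evp m" "odp (r \<odot> m) = r \<odot> odp m"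
proof -
  have "r \<odot> m = r \<odot> (evp m \<oplus> odp m)" using assms by (simp add: evp_odp)
  also have "\<dots> = r \<odot> evp m \<oplus> r \<odot> odp m" using assms by (simp add: smult_add)
  finally show "evp (r \<odot> m) = r \<odot> evp m" "odp (r \<odot> m) = r \<odot> odp m"
    using assms by (simp_all add: evp_eq odp_eq)
qed

lemma koszul_eq: "m \<in> carrier X \<Longrightarrow> koszul X m = evp m \<ominus> odp m"
  unfolding koszul_def
proof (rule the_equality)
  assume "m \<in> carrier X"
  then show "\<exists>a\<in>evens X. \<exists>b\<in>odds X. m = a \<oplus> b \<and> evp m \<ominus> odp m = a \<ominus> b"
    by (intro bexI[of _ "evp m"] bexI[of _ "odp m"]) (auto simp: evp_odp)
qed (auto simp: evp_eq odp_eq)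

lemma koszul_closed [simp]: "m \<in> carrier X \<Longrightarrow> koszul X m \<in> carrier X"
  by (simp add: koszul_eq)

lemma koszul_even [simp]: "a \<in> evens X \<Longrightarrow> koszul X a = a"
  and koszul_odd [simp]: "a \<in> odds X \<Longrightarrow> koszul X a = \<ominus> a"
  by (simp_all add: koszul_eq a_minus_def)

lemma koszul_add: "m \<in> carrier X \<Longrightarrow> m' \<in> carrier X \<Longrightarrow>
    koszul X (m \<oplus> m') = koszul X m \<oplus> koszul X m'"
  by (simp add: koszul_eq parts_add ab_simps)

lemma koszul_additive: "additive X X (koszul X)"
  by (rule additiveI) (auto simp: koszul_add)

lemma koszul_smult: "m \<in> carrier X \<Longrightarrow> r \<in> polys N \<Longrightarrow> koszul X (r \<odot> m) = r \<odot> koszul X m"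
  by (simp add: koszul_eq parts_smult a_minus_def smult_add smult_neg)

lemma koszul_koszul [simp]: "m \<in> carrier X \<Longrightarrow> koszul X (koszul X m) = m"
  by (elim decompE) (simp add: koszul_add)

lemma diff_closed [simp]: "m \<in> carrier X \<Longrightarrow> diff X m \<in> carrier X"
  and diff_add: "m \<in> carrier X \<Longrightarrow> m' \<in> carrier X \<Longrightarrow> diff X (m \<oplus> m') = diff X m \<oplus> diff X m'"
  and diff_smult: "m \<in> carrier X \<Longrightarrow> r \<in> polys N \<Longrightarrow> diff X (r \<odot> m) = r \<odot> diff X m"
  using diff_linear by (auto simp: linear_maps_def PiE_iff)

lemma diff_additive: "additive X X (diff X)"
  by (rule additiveI) (auto simp: diff_add)

lemmas diff_zero [simp] = additive_zero[OF ab ab diff_additive]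
lemmas diff_neg = additive_neg[OF ab ab diff_additive]
lemmas diff_minus = additive_minus[OF ab ab diff_additive]

lemma diff_even [simp]: "a \<in> evens X \<Longrightarrow> diff X a \<in> odds X"
  and diff_odd [simp]: "a \<in> odds X \<Longrightarrow> diff X a \<in> evens X"
  using diff_evens_image diff_odds_image by auto

lemma minus_eq_iff: "a \<in> carrier X \<Longrightarrow> b \<in> carrier X \<Longrightarrow> c \<in> carrier X \<Longrightarrow>
    a \<ominus> b = c \<longleftrightarrow> a = b \<oplus> c"
  by (metis mm.M.a_comm mm.M.add.inv_solve_right' mm.M.a_inv_closed a_minus_def)

end

text \<open>The Koszul sign rule: an odd map anticommutes with the parity sign. Applied to
  differentials and to homotopies it supplies the signs in tensor products.\<close>

lemma koszul_odd_map:
  assumes "premf N X" "premf M Y" "additive X Y f" "f ` evens X \<subseteq> odds Y" "f ` odds X \<subseteq> evens Y"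
    "m \<in> carrier X"
  shows "koszul Y (f m) = \<ominus>\<^bsub>Y\<^esub> f (koszul X m)"
proof -
  interpret X: premf N X by fact
  interpret Y: premf M Y by fact
  from assms(6) obtain a b where *: "a \<in> evens X" "b \<in> odds X" "m = a \<oplus>\<^bsub>X\<^esub> b" by (rule X.decompE)
  then have "f a \<in> odds Y" "f b \<in> evens Y" using assms by auto
  then show ?thesis
    using * by (simp add: X.koszul_add Y.koszul_add additive_add[OF assms(3)]
        additive_neg[OF X.ab Y.ab assms(3)] Y.mm.M.minus_add Y.mm.M.minus_minus)
qed

lemma koszul_even_map:
  assumes "premf N X" "premf M Y" "additive X Y f" "f ` evens X \<subseteq> evens Y" "f ` odds X \<subseteq> odds Y"
    "m \<in> carrier X"
  shows "koszul Y (f m) = f (koszul X m)"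
proof -
  interpret X: premf N X by fact
  interpret Y: premf M Y by fact
  from assms(6) obtain a b where *: "a \<in> evens X" "b \<in> odds X" "m = a \<oplus>\<^bsub>X\<^esub> b" by (rule X.decompE)
  then have "f a \<in> evens Y" "f b \<in> odds Y" using assms by auto
  then show ?thesis
    using * by (simp add: X.koszul_add Y.koszul_add additive_add[OF assms(3)]
        additive_neg[OF X.ab Y.ab assms(3)])
qed

lemma (in premf) koszul_diff: "m \<in> carrier X \<Longrightarrow> koszul X (diff X m) = \<ominus>\<^bsub>X\<^esub> diff X (koszul X m)"
  by (rule koszul_odd_map[OF premf_axioms premf_axioms diff_additive diff_evens_image diff_odds_image])

text \<open>Uniqueness of the homogeneous decomposition is replaced by the condition that even and
  odd elements meet in zero, which is easier to check on constructed modules.\<close>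

lemma premfI:
  fixes X (structure)
  assumes ab: "abelian_group X"
    and smult: "\<And>r m. r \<in> polys N \<Longrightarrow> m \<in> carrier X \<Longrightarrow> r \<odot> m \<in> carrier X"
    "\<And>r s m. r \<in> polys N \<Longrightarrow> s \<in> polys N \<Longrightarrow> m \<in> carrier X \<Longrightarrow> (r + s) \<odot> m = r \<odot> m \<oplus> s \<odot> m"
    "\<And>r m m'. r \<in> polys N \<Longrightarrow> m \<in> carrier X \<Longrightarrow> m' \<in> carrier X \<Longrightarrow> r \<odot> (m \<oplus> m') = r \<odot> m \<oplus> r \<odot> m'"
    "\<And>r s m. r \<in> polys N \<Longrightarrow> s \<in> polys N \<Longrightarrow> m \<in> carrier X \<Longrightarrow> (r * s) \<odot> m = r \<odot> (s \<odot> m)"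
    "\<And>m. m \<in> carrier X \<Longrightarrow> 1 \<odot> m = m"
    and ev: "evens X \<subseteq> carrier X" "\<zero> \<in> evens X"
    "\<And>a b. a \<in> evens X \<Longrightarrow> b \<in> evens X \<Longrightarrow> a \<oplus> b \<in> evens X"
    "\<And>r a. r \<in> polys N \<Longrightarrow> a \<in> evens X \<Longrightarrow> r \<odot> a \<in> evens X"
    and od: "odds X \<subseteq> carrier X" "\<zero> \<in> odds X"
    "\<And>a b. a \<in> odds X \<Longrightarrow> b \<in> odds X \<Longrightarrow> a \<oplus> b \<in> odds X"
    "\<And>r a. r \<in> polys N \<Longrightarrow> a \<in> odds X \<Longrightarrow> r \<odot> a \<in> odds X"
    and dec: "\<And>m. m \<in> carrier X \<Longrightarrow> \<exists>a\<in>evens X. \<exists>b\<in>odds X. m = a \<oplus> b"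
    "\<And>a. a \<in> evens X \<Longrightarrow> a \<in> odds X \<Longrightarrow> a = \<zero>"
    and d: "\<And>m. m \<in> carrier X \<Longrightarrow> diff X m \<in> carrier X"
    "\<And>m m'. m \<in> carrier X \<Longrightarrow> m' \<in> carrier X \<Longrightarrow> diff X (m \<oplus> m') = diff X m \<oplus> diff X m'"
    "\<And>r m. r \<in> polys N \<Longrightarrow> m \<in> carrier X \<Longrightarrow> diff X (r \<odot> m) = r \<odot> diff X m"
    "\<And>a. a \<in> evens X \<Longrightarrow> diff X a \<in> odds X" "\<And>a. a \<in> odds X \<Longrightarrow> diff X a \<in> evens X"
  shows "premf N X"
proof -
  have mod: "module (PR N) X"
    by (rule moduleI) (simp_all add: ab smult cring_PR)
  then interpret module "PR N" X .
  have neg: "\<ominus> a = (- 1) \<odot> a" if "a \<in> carrier X" for a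
  proof -
    have "(- 1) \<odot> a \<oplus> 1 \<odot> a = 0 \<odot> a" using smult(2)[of "-1" 1 a] that by simp
    then show ?thesis using that smult(5) smult(1)[of "-1" a] M.minus_equality smult_l_null
      by (simp add: M.minus_equality)
  qed
  show ?thesis
  proof (rule premf.intro)
    show "module (PR N) X" by (rule mod)
    show "submodule (evens X) (PR N) X"
    proof (rule submoduleI)
      fix a assume "a \<in> evens X"
      then show "\<ominus> a \<in> evens X" using ev(1) ev(4)[of "-1" a] neg[of a] by auto
    qed (use ev in auto)
    show "submodule (odds X) (PR N) X"
    proof (rule submoduleI)
      fix a assume "a \<in> odds X"
      then show "\<ominus> a \<in> odds X" using od(1) od(4)[of "-1" a] neg[of a] by auto
    qed (use od in auto)
    show "\<forall>m\<in>carrier X. \<exists>!(a, b). a \<in> evens X \<and> b \<in> odds X \<and> m = a \<oplus> b"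
    proof
      fix m assume "m \<in> carrier X"
      then obtain a b where ab: "a \<in> evens X" "b \<in> odds X" "m = a \<oplus> b" using dec by blast
      show "\<exists>!(a, b). a \<in> evens X \<and> b \<in> odds X \<and> m = a \<oplus> b"
      proof (rule ex1I[of _ "(a, b)"])
        fix p assume "case p of (c, d) \<Rightarrow> c \<in> evens X \<and> d \<in> odds X \<and> m = c \<oplus> d"
        then obtain c d where p: "p = (c, d)" "c \<in> evens X" "d \<in> odds X" "m = c \<oplus> d" by auto
        have car: "a \<in> carrier X" "b \<in> carrier X" "c \<in> carrier X" "d \<in> carrier X"
          using ab p ev od by auto
        have "(- 1) \<odot> d \<in> odds X" "(- 1) \<odot> a \<in> evens X" using ab p ev(4) od(4) by auto
        then have neg': "\<ominus> d \<in> odds X" "\<ominus> a \<in> evens X" using car neg by auto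
        \<comment> \<open>The difference of two decompositions is even when read as c - a and odd
          when read as b - d, hence zero.\<close>
        have "c \<oplus> \<ominus> a = \<ominus> a \<oplus> ((c \<oplus> d) \<oplus> \<ominus> d)"
          using car by (simp add: M.a_ac M.r_neg)
        also have "\<dots> = b \<oplus> \<ominus> d"
          unfolding p(4)[symmetric] ab(3) using car by (simp add: M.a_assoc M.r_neg1)
        finally have eq: "c \<oplus> \<ominus> a = b \<oplus> \<ominus> d" .
        have "c \<oplus> \<ominus> a = \<zero>" using eq ev(3) od(3) ab p neg' dec(2) by metis
        then have "c = a" using car by (metis M.minus_equality M.minus_minus M.a_inv_closed)
        moreover have "b \<oplus> \<ominus> d = \<zero>" using eq \<open>c \<oplus> \<ominus> a = \<zero>\<close> by simp
        then have "b = d" using car by (metis M.minus_equality M.minus_minus M.a_inv_closed)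
        ultimately show "p = (a, b)" using p by simp
      qed (use ab in auto)
    qed
    show "restrict (diff X) (carrier X) \<in> linear_maps N X X"
      using d smult(1) M.a_closed by (auto simp: linear_maps_def)
  qed (use d in auto)
qed


section \<open>Linear maps\<close>

lemma linear_mapsI:
  assumes "\<And>a. a \<in> carrier X \<Longrightarrow> f a \<in> carrier Y"
    "\<And>a b. a \<in> carrier X \<Longrightarrow> b \<in> carrier X \<Longrightarrow> f (a \<oplus>\<^bsub>X\<^esub> b) = f a \<oplus>\<^bsub>Y\<^esub> f b"
    "\<And>r a. r \<in> polys n \<Longrightarrow> a \<in> carrier X \<Longrightarrow> f (r \<odot>\<^bsub>X\<^esub> a) = r \<odot>\<^bsub>Y\<^esub> f a"
    "f \<in> extensional (carrier X)"
  shows "f \<in> linear_maps n X Y"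
  using assms by (auto simp: linear_maps_def PiE_iff)

lemma linear_maps_restrictI:
  assumes "premf n X" "additive X Y f"
    "\<And>r a. r \<in> polys n \<Longrightarrow> a \<in> carrier X \<Longrightarrow> f (r \<odot>\<^bsub>X\<^esub> a) = r \<odot>\<^bsub>Y\<^esub> f a"
  shows "restrict f (carrier X) \<in> linear_maps n X Y"
proof -
  interpret X: premf n X by fact
  show ?thesis using assms by (intro linear_mapsI) (auto simp: additive_def)
qed

lemma linear_maps_additive: "f \<in> linear_maps n X Y \<Longrightarrow> additive X Y f"
  by (auto simp: linear_maps_def additive_def)

lemma linear_maps_closed: "f \<in> linear_maps n X Y \<Longrightarrow> a \<in> carrier X \<Longrightarrow> f a \<in> carrier Y"
  and linear_maps_add: "f \<in> linear_maps n X Y \<Longrightarrow> a \<in> carrier X \<Longrightarrow> b \<in> carrier X \<Longrightarrow>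
    f (a \<oplus>\<^bsub>X\<^esub> b) = f a \<oplus>\<^bsub>Y\<^esub> f b"
  and linear_maps_smult: "f \<in> linear_maps n X Y \<Longrightarrow> r \<in> polys n \<Longrightarrow> a \<in> carrier X \<Longrightarrow>
    f (r \<odot>\<^bsub>X\<^esub> a) = r \<odot>\<^bsub>Y\<^esub> f a"
  and linear_maps_extensional: "f \<in> linear_maps n X Y \<Longrightarrow> f \<in> extensional (carrier X)"
  by (auto simp: linear_maps_def PiE_iff)

text \<open>Homotopies without the extensionality built into \<open>linear_maps\<close>, so that
  they can be written as lambda terms.\<close>

definition is_homotopy where
  "is_homotopy n X Y h \<longleftrightarrow> additive X Y h \<and>
     (\<forall>r\<in>polys n. \<forall>a\<in>carrier X. h (r \<odot>\<^bsub>X\<^esub> a) = r \<odot>\<^bsub>Y\<^esub> h a) \<and>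
     h ` evens X \<subseteq> odds Y \<and> h ` odds X \<subseteq> evens Y"

text \<open>The relation is given as a sum instead of a difference, a form that suits rewriting by
  \<open>ab_simps\<close>.\<close>

lemma homotopicI:
  assumes "premf n X" "premf n Y" "is_homotopy n X Y h"
    and "\<And>m. m \<in> carrier X \<Longrightarrow> \<alpha> m \<in> carrier Y"
    and "\<And>m. m \<in> carrier X \<Longrightarrow> \<psi> m = \<alpha> m \<oplus>\<^bsub>Y\<^esub> (diff Y (h m) \<oplus>\<^bsub>Y\<^esub> h (diff X m))"
  shows "homotopic n X Y \<alpha> \<psi>"
proof -
  interpret X: premf n X by fact
  interpret Y: premf n Y by fact
  have h: "additive X Y h" using assms(3) by (simp add: is_homotopy_def)
  have "restrict h (carrier X) \<in> linear_maps n X Y"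
    using assms by (intro linear_maps_restrictI) (auto simp: is_homotopy_def)
  then show ?thesis unfolding homotopic_def
    by (rule bexI[rotated])
      (use assms additive_closed[OF h] in \<open>auto simp: is_homotopy_def Y.minus_eq_iff\<close>)
qed

lemma homotopicE:
  assumes "premf n X" "premf n Y" "homotopic n X Y \<alpha> \<psi>"
    and "\<And>m. m \<in> carrier X \<Longrightarrow> \<alpha> m \<in> carrier Y" "\<And>m. m \<in> carrier X \<Longrightarrow> \<psi> m \<in> carrier Y"
  obtains h where "is_homotopy n X Y h"
    "\<And>m. m \<in> carrier X \<Longrightarrow> \<psi> m = \<alpha> m \<oplus>\<^bsub>Y\<^esub> (diff Y (h m) \<oplus>\<^bsub>Y\<^esub> h (diff X m))"
proof -
  interpret X: premf n X by fact
  interpret Y: premf n Y by fact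
  from assms(3) obtain h where h: "h \<in> linear_maps n X Y" "h ` evens X \<subseteq> odds Y" "h ` odds X \<subseteq> evens Y"
    and eq: "\<forall>m\<in>carrier X. \<psi> m \<ominus>\<^bsub>Y\<^esub> \<alpha> m = diff Y (h m) \<oplus>\<^bsub>Y\<^esub> h (diff X m)"
    unfolding homotopic_def by blast
  show ?thesis
  proof
    show "is_homotopy n X Y h"
      using h by (auto simp: is_homotopy_def linear_maps_additive linear_maps_smult)
    fix m assume "m \<in> carrier X"
    then show "\<psi> m = \<alpha> m \<oplus>\<^bsub>Y\<^esub> (diff Y (h m) \<oplus>\<^bsub>Y\<^esub> h (diff X m))"
      using eq assms(4,5) linear_maps_closed[OF h(1)]
      by (subst Y.minus_eq_iff[symmetric]) auto
  qed
qed

lemma mf_maps_linear: "\<alpha> \<in> mf_maps n X Y \<Longrightarrow> \<alpha> \<in> linear_maps n X Y"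
  and mf_maps_evens: "\<alpha> \<in> mf_maps n X Y \<Longrightarrow> a \<in> evens X \<Longrightarrow> \<alpha> a \<in> evens Y"
  and mf_maps_odds: "\<alpha> \<in> mf_maps n X Y \<Longrightarrow> a \<in> odds X \<Longrightarrow> \<alpha> a \<in> odds Y"
  and mf_maps_diff: "\<alpha> \<in> mf_maps n X Y \<Longrightarrow> a \<in> carrier X \<Longrightarrow> \<alpha> (diff X a) = diff Y (\<alpha> a)"
  by (auto simp: mf_maps_def)

lemmas mf_maps_closed = linear_maps_closed[OF mf_maps_linear]
lemmas mf_maps_add = linear_maps_add[OF mf_maps_linear]
lemmas mf_maps_smult = linear_maps_smult[OF mf_maps_linear]
lemmas mf_maps_additive = linear_maps_additive[OF mf_maps_linear]
lemmas mf_maps_ext = linear_maps_extensional[OF mf_maps_linear]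

lemma mf_maps_restrictI:
  assumes "premf n X" "additive X Y f"
    "\<And>r a. r \<in> polys n \<Longrightarrow> a \<in> carrier X \<Longrightarrow> f (r \<odot>\<^bsub>X\<^esub> a) = r \<odot>\<^bsub>Y\<^esub> f a"
    "\<And>a. a \<in> evens X \<Longrightarrow> f a \<in> evens Y" "\<And>a. a \<in> odds X \<Longrightarrow> f a \<in> odds Y"
    "\<And>m. m \<in> carrier X \<Longrightarrow> f (diff X m) = diff Y (f m)"
  shows "restrict f (carrier X) \<in> mf_maps n X Y"
proof -
  interpret X: premf n X by fact
  show ?thesis unfolding mf_maps_def using linear_maps_restrictI[OF assms(1-3)] assms by auto
qed

lemma mf_maps_extI:
  assumes "premf n X" "additive X Y f" "f \<in> extensional (carrier X)"
    "\<And>r a. r \<in> polys n \<Longrightarrow> a \<in> carrier X \<Longrightarrow> f (r \<odot>\<^bsub>X\<^esub> a) = r \<odot>\<^bsub>Y\<^esub> f a"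
    "\<And>a. a \<in> evens X \<Longrightarrow> f a \<in> evens Y" "\<And>a. a \<in> odds X \<Longrightarrow> f a \<in> odds Y"
    "\<And>m. m \<in> carrier X \<Longrightarrow> f (diff X m) = diff Y (f m)"
  shows "f \<in> mf_maps n X Y"
  using mf_maps_restrictI[OF assms(1,2,4-7)] assms(3) by (simp add: extensional_restrict)

lemma mf_maps_id: "premf n X \<Longrightarrow> (\<lambda>m\<in>carrier X. m) \<in> mf_maps n X X"
  by (rule mf_maps_restrictI) (auto intro: additiveI)

lemma mf_maps_compose:
  assumes "premf n X" "\<alpha> \<in> mf_maps n X Y" "\<beta> \<in> mf_maps n Y Z"
  shows "compose (carrier X) \<beta> \<alpha> \<in> mf_maps n X Z"
  unfolding compose_def
  by (rule mf_maps_restrictI)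
    (use assms in \<open>auto simp: mf_maps_smult mf_maps_closed mf_maps_evens mf_maps_odds mf_maps_diff
      intro: additive_compose mf_maps_additive\<close>)


section \<open>The homotopy category\<close>

lemma homotopic_refl:
  assumes "premf n X" "premf n Y" "\<alpha> \<in> mf_maps n X Y"
  shows "homotopic n X Y \<alpha> \<alpha>"
proof -
  interpret X: premf n X by fact
  interpret Y: premf n Y by fact
  show ?thesis
    by (rule homotopicI[OF assms(1,2), of "\<lambda>_. \<zero>\<^bsub>Y\<^esub>"])
      (auto simp: is_homotopy_def additive_def mf_maps_closed[OF assms(3)])
qed

lemma homotopic_sym:
  assumes "premf n X" "premf n Y" "\<alpha> \<in> mf_maps n X Y" "\<beta> \<in> mf_maps n X Y"
    "homotopic n X Y \<alpha> \<beta>"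
  shows "homotopic n X Y \<beta> \<alpha>"
proof -
  interpret X: premf n X by fact
  interpret Y: premf n Y by fact
  obtain h where h: "is_homotopy n X Y h"
    "\<And>m. m \<in> carrier X \<Longrightarrow> \<beta> m = \<alpha> m \<oplus>\<^bsub>Y\<^esub> (diff Y (h m) \<oplus>\<^bsub>Y\<^esub> h (diff X m))"
    using homotopicE[OF assms(1,2,5)] mf_maps_closed assms by metis
  have hc: "h m \<in> carrier Y" if "m \<in> carrier X" for m
    using h(1) that by (auto simp: is_homotopy_def additive_def)
  show ?thesis
  proof (rule homotopicI[OF assms(1,2), of "\<lambda>m. \<ominus>\<^bsub>Y\<^esub> h m"])
    show "is_homotopy n X Y (\<lambda>m. \<ominus>\<^bsub>Y\<^esub> h m)"
      using h(1) by (auto simp: is_homotopy_def Y.smult_neg hc image_subset_iff intro: additive_uminus[OF Y.ab])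
    fix m assume m: "m \<in> carrier X"
    then show "\<alpha> m = \<beta> m \<oplus>\<^bsub>Y\<^esub> (diff Y (\<ominus>\<^bsub>Y\<^esub> h m) \<oplus>\<^bsub>Y\<^esub> \<ominus>\<^bsub>Y\<^esub> h (diff X m))"
      using h(2)[OF m] hc[OF m] hc[of "diff X m"] mf_maps_closed[OF assms(3) m]
      by (simp add: Y.diff_neg Y.ab_simps)
  qed (auto simp: mf_maps_closed[OF assms(4)])
qed

lemma homotopic_trans:
  assumes "premf n X" "premf n Y" "\<alpha> \<in> mf_maps n X Y" "\<beta> \<in> mf_maps n X Y" "\<gamma> \<in> mf_maps n X Y"
    "homotopic n X Y \<alpha> \<beta>" "homotopic n X Y \<beta> \<gamma>"
  shows "homotopic n X Y \<alpha> \<gamma>"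
proof -
  interpret X: premf n X by fact
  interpret Y: premf n Y by fact
  obtain h where h: "is_homotopy n X Y h"
    "\<And>m. m \<in> carrier X \<Longrightarrow> \<beta> m = \<alpha> m \<oplus>\<^bsub>Y\<^esub> (diff Y (h m) \<oplus>\<^bsub>Y\<^esub> h (diff X m))"
    using homotopicE[OF assms(1,2,6)] mf_maps_closed assms by metis
  obtain k where k: "is_homotopy n X Y k"
    "\<And>m. m \<in> carrier X \<Longrightarrow> \<gamma> m = \<beta> m \<oplus>\<^bsub>Y\<^esub> (diff Y (k m) \<oplus>\<^bsub>Y\<^esub> k (diff X m))"
    using homotopicE[OF assms(1,2,7)] mf_maps_closed assms by metis
  have hc: "h m \<in> carrier Y" "k m \<in> carrier Y" if "m \<in> carrier X" for m
    using h(1) k(1) that by (auto simp: is_homotopy_def additive_def)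
  show ?thesis
  proof (rule homotopicI[OF assms(1,2), of "\<lambda>m. h m \<oplus>\<^bsub>Y\<^esub> k m"])
    show "is_homotopy n X Y (\<lambda>m. h m \<oplus>\<^bsub>Y\<^esub> k m)"
      using h(1) k(1)
      by (auto simp: is_homotopy_def Y.smult_add hc image_subset_iff intro: additive_plus[OF Y.ab])
    fix m assume m: "m \<in> carrier X"
    then show "\<gamma> m = \<alpha> m \<oplus>\<^bsub>Y\<^esub> (diff Y (h m \<oplus>\<^bsub>Y\<^esub> k m) \<oplus>\<^bsub>Y\<^esub> (h (diff X m) \<oplus>\<^bsub>Y\<^esub> k (diff X m)))"
      using h(2)[OF m] k(2)[OF m] hc[OF m] hc[of "diff X m"] mf_maps_closed[OF assms(3) m]
      by (simp add: Y.diff_add Y.ab_simps)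
  qed (auto simp: mf_maps_closed[OF assms(3)])
qed

lemma homotopic_compose:
  assumes "premf n X" "premf n Y" "premf n Z" "\<alpha> \<in> mf_maps n X Y" "\<alpha>' \<in> mf_maps n X Y"
    "\<beta> \<in> mf_maps n Y Z" "\<beta>' \<in> mf_maps n Y Z" "homotopic n X Y \<alpha> \<alpha>'" "homotopic n Y Z \<beta> \<beta>'"
  shows "homotopic n X Z (compose (carrier X) \<beta> \<alpha>) (compose (carrier X) \<beta>' \<alpha>')"
proof -
  interpret X: premf n X by fact
  interpret Y: premf n Y by fact
  interpret Z: premf n Z by fact
  obtain h where h: "is_homotopy n X Y h"
    "\<And>m. m \<in> carrier X \<Longrightarrow> \<alpha>' m = \<alpha> m \<oplus>\<^bsub>Y\<^esub> (diff Y (h m) \<oplus>\<^bsub>Y\<^esub> h (diff X m))"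
    using homotopicE[OF assms(1,2,8)] mf_maps_closed assms by metis
  obtain k where k: "is_homotopy n Y Z k"
    "\<And>m. m \<in> carrier Y \<Longrightarrow> \<beta>' m = \<beta> m \<oplus>\<^bsub>Z\<^esub> (diff Z (k m) \<oplus>\<^bsub>Z\<^esub> k (diff Y m))"
    using homotopicE[OF assms(2,3,9)] mf_maps_closed assms by metis
  have hc: "h m \<in> carrier Y" if "m \<in> carrier X" for m
    using h(1) that by (auto simp: is_homotopy_def additive_def)
  have kc: "k m \<in> carrier Z" if "m \<in> carrier Y" for m
    using k(1) that by (auto simp: is_homotopy_def additive_def)
  note \<alpha>c = mf_maps_closed[OF assms(4)] mf_maps_closed[OF assms(5)]
  note \<beta>c = mf_maps_closed[OF assms(6)] mf_maps_closed[OF assms(7)]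
  show ?thesis
  \<comment> \<open>From \<beta>'\<alpha>' - \<beta>\<alpha> = \<beta>(\<alpha>' - \<alpha>) +
    (\<beta>' - \<beta>)\<alpha>'.\<close>
  proof (rule homotopicI[OF assms(1,3), of "\<lambda>m. \<beta> (h m) \<oplus>\<^bsub>Z\<^esub> k (\<alpha>' m)"])
    show "is_homotopy n X Z (\<lambda>m. \<beta> (h m) \<oplus>\<^bsub>Z\<^esub> k (\<alpha>' m))"
      unfolding is_homotopy_def
    proof (intro conjI)
      have "additive X Y h" "additive Y Z k" using h(1) k(1) by (auto simp: is_homotopy_def)
      then show "additive X Z (\<lambda>m. \<beta> (h m) \<oplus>\<^bsub>Z\<^esub> k (\<alpha>' m))"
        using mf_maps_additive[OF assms(5)] mf_maps_additive[OF assms(6)]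
        by (blast intro: additive_plus[OF Z.ab additive_compose additive_compose])
    qed (use h(1) k(1) assms in \<open>auto simp: is_homotopy_def Z.smult_add hc kc \<alpha>c \<beta>c mf_maps_smult
        mf_maps_evens mf_maps_odds image_subset_iff\<close>)
    fix m assume m: "m \<in> carrier X"
    have "compose (carrier X) \<beta>' \<alpha>' m = \<beta>' (\<alpha>' m)" using m by (simp add: compose_def)
    also have "\<dots> = \<beta> (\<alpha>' m) \<oplus>\<^bsub>Z\<^esub> (diff Z (k (\<alpha>' m)) \<oplus>\<^bsub>Z\<^esub> k (diff Y (\<alpha>' m)))"
      using k(2) \<alpha>c m by simp
    also have "\<beta> (\<alpha>' m) = \<beta> (\<alpha> m) \<oplus>\<^bsub>Z\<^esub> (diff Z (\<beta> (h m)) \<oplus>\<^bsub>Z\<^esub> \<beta> (h (diff X m)))"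
      using m by (simp add: h(2) \<alpha>c hc mf_maps_add[OF assms(6)] mf_maps_diff[OF assms(6)])
    also have "diff Y (\<alpha>' m) = \<alpha>' (diff X m)" using m by (simp add: mf_maps_diff[OF assms(5)])
    finally show "compose (carrier X) \<beta>' \<alpha>' m = compose (carrier X) \<beta> \<alpha> m \<oplus>\<^bsub>Z\<^esub>
        (diff Z (\<beta> (h m) \<oplus>\<^bsub>Z\<^esub> k (\<alpha>' m)) \<oplus>\<^bsub>Z\<^esub> (\<beta> (h (diff X m)) \<oplus>\<^bsub>Z\<^esub> k (\<alpha>' (diff X m))))"
      using m by (simp add: compose_def hc kc \<alpha>c \<beta>c Z.diff_add Z.ac)
  qed (auto simp: compose_def \<alpha>c \<beta>c)
qed

lemma hclass_self: "premf n X \<Longrightarrow> premf n Y \<Longrightarrow> \<alpha> \<in> mf_maps n X Y \<Longrightarrow> \<alpha> \<in> hclass n X Y \<alpha>"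
  by (simp add: hclass_def homotopic_refl)

lemma hclass_eq:
  assumes "premf n X" "premf n Y" "\<alpha> \<in> mf_maps n X Y" "\<beta> \<in> mf_maps n X Y"
  shows "hclass n X Y \<alpha> = hclass n X Y \<beta> \<longleftrightarrow> homotopic n X Y \<alpha> \<beta>"
proof
  assume "hclass n X Y \<alpha> = hclass n X Y \<beta>"
  then have "\<beta> \<in> hclass n X Y \<alpha>" using hclass_self assms by blast
  then show "homotopic n X Y \<alpha> \<beta>" by (simp add: hclass_def)
next
  assume "homotopic n X Y \<alpha> \<beta>"
  then show "hclass n X Y \<alpha> = hclass n X Y \<beta>"
    unfolding hclass_def using homotopic_trans homotopic_sym assms by blast
qed

lemma hHomE:
  assumes "\<Phi> \<in> hHom n X Y" obtains \<alpha> where "\<alpha> \<in> mf_maps n X Y" "\<Phi> = hclass n X Y \<alpha>"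
  using assms by (auto simp: hHom_def)

lemma hHomI [intro]: "\<alpha> \<in> mf_maps n X Y \<Longrightarrow> hclass n X Y \<alpha> \<in> hHom n X Y"
  by (auto simp: hHom_def)

text \<open>Composition and whiskering of classes are unions over representatives; such a union is
  one class as soon as all its members coincide and there is at least one.\<close>

lemma UN_hclass_eq:
  assumes "\<And>a. a \<in> \<Phi> \<Longrightarrow> hclass n X Y (f a) = C" "a0 \<in> \<Phi>"
  shows "(\<Union>a\<in>\<Phi>. hclass n X Y (f a)) = C"
  using assms by auto

text \<open>By \<open>homotopic_compose\<close> every composite of representatives lies in the same
  class, so the union defining \<open>hcomp\<close> collapses.\<close>

lemma hcomp_hclass_subset:
  assumes "premf n X" "premf n Y" "premf n Z" "\<alpha> \<in> mf_maps n X Y" "\<beta> \<in> mf_maps n Y Z"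
    "\<alpha> \<in> \<Phi>" "\<Phi> \<subseteq> hclass n X Y \<alpha>"
  shows "hcomp n X Z (hclass n Y Z \<beta>) \<Phi> = hclass n X Z (compose (carrier X) \<beta> \<alpha>)"
proof -
  have "hclass n X Z (compose (carrier X) \<beta>' \<alpha>') = hclass n X Z (compose (carrier X) \<beta> \<alpha>)"
    if "\<beta>' \<in> hclass n Y Z \<beta>" "\<alpha>' \<in> \<Phi>" for \<alpha>' \<beta>'
  proof -
    have "\<alpha>' \<in> hclass n X Y \<alpha>" using that assms(7) by auto
    then show ?thesis
      using that assms homotopic_compose[of n X Y Z \<alpha> \<alpha>' \<beta> \<beta>']
        hclass_eq[OF assms(1,3) mf_maps_compose[OF assms(1,4,5)] mf_maps_compose[OF assms(1), of \<alpha>' Y \<beta>' Z]]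
      by (simp add: hclass_def)
  qed
  then show ?thesis
    unfolding hcomp_def using assms(6) hclass_self[OF assms(2,3,5)] by blast
qed

lemma hcomp_hclass:
  assumes "premf n X" "premf n Y" "premf n Z" "\<alpha> \<in> mf_maps n X Y" "\<beta> \<in> mf_maps n Y Z"
  shows "hcomp n X Z (hclass n Y Z \<beta>) (hclass n X Y \<alpha>) = hclass n X Z (compose (carrier X) \<beta> \<alpha>)"
  by (rule hcomp_hclass_subset) (use assms hclass_self in auto)

lemma compose_assoc_maps:
  "\<alpha> \<in> mf_maps n X Y \<Longrightarrow> compose (carrier X) \<gamma> (compose (carrier X) \<beta> \<alpha>) =
    compose (carrier X) (compose (carrier Y) \<gamma> \<beta>) \<alpha>"
  by (rule ext) (auto simp: compose_def mf_maps_closed)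

lemma hcomp_closed:
  assumes "premf n X" "premf n Y" "premf n Z" "\<Phi> \<in> hHom n X Y" "\<Psi> \<in> hHom n Y Z"
  shows "hcomp n X Z \<Psi> \<Phi> \<in> hHom n X Z"
  using assms by (auto elim!: hHomE simp: hcomp_hclass intro!: mf_maps_compose)

lemma hcomp_assoc:
  assumes "premf n V" "premf n X" "premf n Y" "premf n Z" "\<Phi> \<in> hHom n V X" "\<Psi> \<in> hHom n X Y"
    "\<Xi> \<in> hHom n Y Z"
  shows "hcomp n V Z \<Xi> (hcomp n V Y \<Psi> \<Phi>) = hcomp n V Z (hcomp n X Z \<Xi> \<Psi>) \<Phi>"
proof -
  obtain \<alpha> \<beta> \<gamma> where "\<alpha> \<in> mf_maps n V X" "\<Phi> = hclass n V X \<alpha>" "\<beta> \<in> mf_maps n X Y" "\<Psi> = hclass n X Y \<beta>"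
    "\<gamma> \<in> mf_maps n Y Z" "\<Xi> = hclass n Y Z \<gamma>"
    using assms by (auto elim!: hHomE)
  then show ?thesis
    using assms by (simp add: hcomp_hclass mf_maps_compose compose_assoc_maps)
qed

lemma hid_closed: "premf n X \<Longrightarrow> hid n X \<in> hHom n X X"
  unfolding hid_def by (rule hHomI) (rule mf_maps_id)

lemma compose_id_maps:
  assumes "\<alpha> \<in> mf_maps n X Y"
  shows "compose (carrier X) \<alpha> (\<lambda>m\<in>carrier X. m) = \<alpha>"
    "compose (carrier X) (\<lambda>m\<in>carrier Y. m) \<alpha> = \<alpha>"
  by (rule extensionalityI[of _ "carrier X"]; simp add: compose_def mf_maps_ext[OF assms] mf_maps_closed[OF assms])+

lemma hcomp_hid:
  assumes "premf n X" "premf n Y" "\<Phi> \<in> hHom n X Y"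
  shows "hcomp n X Y \<Phi> (hid n X) = \<Phi>" "hcomp n X Y (hid n Y) \<Phi> = \<Phi>"
proof -
  obtain \<alpha> where "\<alpha> \<in> mf_maps n X Y" "\<Phi> = hclass n X Y \<alpha>" using assms(3) by (rule hHomE)
  then show "hcomp n X Y \<Phi> (hid n X) = \<Phi>" "hcomp n X Y (hid n Y) \<Phi> = \<Phi>"
    using assms by (simp_all add: hid_def hcomp_hclass mf_maps_id compose_id_maps)
qed

lemma hisoI:
  assumes "premf n X" "premf n Y" "\<alpha> \<in> mf_maps n X Y" "\<beta> \<in> mf_maps n Y X"
    "homotopic n X X (compose (carrier X) \<beta> \<alpha>) (\<lambda>m\<in>carrier X. m)"
    "homotopic n Y Y (compose (carrier Y) \<alpha> \<beta>) (\<lambda>m\<in>carrier Y. m)"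
  shows "hiso n X Y (hclass n X Y \<alpha>)"
proof -
  have "hcomp n X X (hclass n Y X \<beta>) (hclass n X Y \<alpha>) = hid n X"
    "hcomp n Y Y (hclass n X Y \<alpha>) (hclass n Y X \<beta>) = hid n Y"
    unfolding hid_def using assms by (simp_all add: hcomp_hclass hclass_eq mf_maps_compose mf_maps_id)
  then show ?thesis unfolding hiso_def hinverse_def using assms(3,4) by blast
qed

lemma hisoE:
  assumes "premf n X" "premf n Y" "hiso n X Y \<Phi>"
  obtains \<alpha> \<beta> where "\<alpha> \<in> mf_maps n X Y" "\<beta> \<in> mf_maps n Y X" "\<Phi> = hclass n X Y \<alpha>"
    "homotopic n X X (compose (carrier X) \<beta> \<alpha>) (\<lambda>m\<in>carrier X. m)"
    "homotopic n Y Y (compose (carrier Y) \<alpha> \<beta>) (\<lambda>m\<in>carrier Y. m)"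
proof -
  from assms(3) obtain \<Psi> where "\<Phi> \<in> hHom n X Y" "\<Psi> \<in> hHom n Y X"
    and *: "hcomp n X X \<Psi> \<Phi> = hid n X" "hcomp n Y Y \<Phi> \<Psi> = hid n Y"
    by (auto simp: hiso_def hinverse_def)
  then obtain \<alpha> \<beta> where ab: "\<alpha> \<in> mf_maps n X Y" "\<Phi> = hclass n X Y \<alpha>" "\<beta> \<in> mf_maps n Y X" "\<Psi> = hclass n Y X \<beta>"
    by (auto elim!: hHomE)
  show ?thesis
    by (rule that[OF ab(1,3,2)])
      (use * ab assms in \<open>auto simp: hcomp_hclass hid_def hclass_eq mf_maps_compose mf_maps_id\<close>)
qed


section \<open>Twisting and direct sums\<close>

lemma twist_simps [simp]:
  "carrier (twist \<sigma> X) = carrier X" "\<zero>\<^bsub>twist \<sigma> X\<^esub> = \<zero>\<^bsub>X\<^esub>" "evens (twist \<sigma> X) = evens X"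
  "odds (twist \<sigma> X) = odds X" "diff (twist \<sigma> X) = diff X"
  "a \<oplus>\<^bsub>twist \<sigma> X\<^esub> b = a \<oplus>\<^bsub>X\<^esub> b" "r \<odot>\<^bsub>twist \<sigma> X\<^esub> a = \<sigma> r \<odot>\<^bsub>X\<^esub> a"
  by (simp_all add: twist_def)

lemma twist_group_simps [simp]:
  "a_inv (twist \<sigma> X) = a_inv X" "a_minus (twist \<sigma> X) = a_minus X" "finsum (twist \<sigma> X) = finsum X"
  "additive Z (twist \<sigma> X) = additive Z X" "additive (twist \<sigma> X) V = additive X V"
  "koszul (twist \<sigma> X) = koszul X"
  by (auto simp: a_inv_def a_minus_def finsum_def additive_def koszul_def fun_eq_iff twist_def)

lemma premf_twist:
  assumes "premf n X" "poly_endo n \<sigma>" shows "premf n (twist \<sigma> X)"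
proof -
  interpret X: premf n X by fact
  show ?thesis
  proof (rule premfI)
    show "abelian_group (twist \<sigma> X)"
      using X.ab by (simp add: abelian_group_def abelian_monoid_def abelian_group_axioms_def twist_def)
    fix m assume "m \<in> carrier (twist \<sigma> X)"
    then show "\<exists>a\<in>evens (twist \<sigma> X). \<exists>b\<in>odds (twist \<sigma> X). m = a \<oplus>\<^bsub>twist \<sigma> X\<^esub> b"
      using X.evp_odp[of m] X.evp_evens[of m] X.odp_odds[of m] by (metis twist_simps(1,3,4,6))
  qed (use poly_endoD[OF assms(2)] X.even_odd_zero in
      \<open>auto simp: X.add_smult X.smult_smult X.smult_add X.diff_add X.diff_smult\<close>)
qed

text \<open>\<open>twist\<close> stores the substitution on all polynomials, while maps and
  homotopies see it on \<open>polys n\<close> only. Twists that agree there are therefore exchanged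
  at the level of maps and classes rather than as equal records.\<close>

lemma maps_twist_cong:
  assumes "\<And>r. r \<in> polys n \<Longrightarrow> \<sigma> r = \<sigma>' r"
  shows "linear_maps n (twist \<sigma> X) Y = linear_maps n (twist \<sigma>' X) Y"
    "mf_maps n (twist \<sigma> X) Y = mf_maps n (twist \<sigma>' X) Y"
    "homotopic n (twist \<sigma> X) Y = homotopic n (twist \<sigma>' X) Y"
    "hclass n (twist \<sigma> X) Y = hclass n (twist \<sigma>' X) Y"
proof -
  show l: "linear_maps n (twist \<sigma> X) Y = linear_maps n (twist \<sigma>' X) Y"
    using assms by (auto simp: linear_maps_def)
  then show m: "mf_maps n (twist \<sigma> X) Y = mf_maps n (twist \<sigma>' X) Y"
    by (auto simp: mf_maps_def)
  from l show h: "homotopic n (twist \<sigma> X) Y = homotopic n (twist \<sigma>' X) Y"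
    by (auto simp: homotopic_def fun_eq_iff)
  from m h show "hclass n (twist \<sigma> X) Y = hclass n (twist \<sigma>' X) Y"
    by (auto simp: hclass_def fun_eq_iff)
qed

lemma twist_twist: "twist \<sigma> (twist \<tau> X) = twist (\<lambda>r. \<tau> (\<sigma> r)) X"
  by (simp add: twist_def)

text \<open>As r runs through \<open>polys n\<close> so does its image under \<sigma>, so the
  twisted linearity conditions are the original ones reindexed. This is why twisting acts as the
  identity on homotopy classes.\<close>

lemma maps_twist_both:
  assumes "\<sigma> ` polys n = polys n"
  shows "mf_maps n (twist \<sigma> X) (twist \<sigma> Y) = mf_maps n X Y"
    "homotopic n (twist \<sigma> X) (twist \<sigma> Y) = homotopic n X Y"
    "hclass n (twist \<sigma> X) (twist \<sigma> Y) = hclass n X Y"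
proof -
  have "(\<forall>r\<in>polys n. \<forall>a\<in>carrier X. \<alpha> (\<sigma> r \<odot>\<^bsub>X\<^esub> a) = \<sigma> r \<odot>\<^bsub>Y\<^esub> \<alpha> a) \<longleftrightarrow>
      (\<forall>r\<in>polys n. \<forall>a\<in>carrier X. \<alpha> (r \<odot>\<^bsub>X\<^esub> a) = r \<odot>\<^bsub>Y\<^esub> \<alpha> a)" for \<alpha>
    by (subst (2) assms[symmetric]) simp
  then have l: "linear_maps n (twist \<sigma> X) (twist \<sigma> Y) = linear_maps n X Y"
    by (simp add: linear_maps_def)
  then show m: "mf_maps n (twist \<sigma> X) (twist \<sigma> Y) = mf_maps n X Y" by (simp add: mf_maps_def)
  from l show h: "homotopic n (twist \<sigma> X) (twist \<sigma> Y) = homotopic n X Y"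
    by (simp add: homotopic_def fun_eq_iff)
  from m h show "hclass n (twist \<sigma> X) (twist \<sigma> Y) = hclass n X Y"
    by (simp add: hclass_def fun_eq_iff)
qed

text \<open>Coordinates in the twisted module are the old coordinates moved by the inverse \<tau> of
  \<sigma>; since both maps fix zero, supports stay the same.\<close>

lemma is_basis_twist:
  assumes B: "is_basis (PR n) X B" and X: "premf n X"
    and \<sigma>: "\<And>r. r \<in> polys n \<Longrightarrow> \<sigma> r \<in> polys n" "\<And>r. r \<in> polys n \<Longrightarrow> \<tau> r \<in> polys n"
    "\<And>r. r \<in> polys n \<Longrightarrow> \<sigma> (\<tau> r) = r" "\<And>r. r \<in> polys n \<Longrightarrow> \<tau> (\<sigma> r) = r" "\<sigma> 0 = 0" "\<tau> 0 = 0"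
  shows "is_basis (PR n) (twist \<sigma> X) B"
  unfolding is_basis_def
proof (intro conjI ballI)
  interpret X: premf n X by fact
  have BX: "B \<subseteq> carrier X" using B by (simp add: is_basis_def)
  then show "B \<subseteq> carrier (twist \<sigma> X)" by simp
  fix m assume "m \<in> carrier (twist \<sigma> X)"
  then have m: "m \<in> carrier X" by simp
  define P where "P c \<longleftrightarrow> c \<in> B \<rightarrow>\<^sub>E polys n \<and> finite {b\<in>B. c b \<noteq> 0} \<and>
    m = (\<Oplus>\<^bsub>X\<^esub>b\<in>{b\<in>B. c b \<noteq> 0}. c b \<odot>\<^bsub>X\<^esub> b)" for c
  define Q where "Q c \<longleftrightarrow> c \<in> B \<rightarrow>\<^sub>E polys n \<and> finite {b\<in>B. c b \<noteq> 0} \<and>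
    m = (\<Oplus>\<^bsub>X\<^esub>b\<in>{b\<in>B. c b \<noteq> 0}. \<sigma> (c b) \<odot>\<^bsub>X\<^esub> b)" for c
  have PQ: "Q c \<longleftrightarrow> P (\<lambda>b\<in>B. \<sigma> (c b))" if c: "c \<in> B \<rightarrow>\<^sub>E polys n" for c
  proof -
    have cp: "c b \<in> polys n" if "b \<in> B" for b using c that by auto
    have nz: "\<sigma> (c b) \<noteq> 0 \<longleftrightarrow> c b \<noteq> 0" if "b \<in> B" for b using \<sigma>(4)[OF cp[OF that]] \<sigma>(5,6) by auto
    have s: "{b\<in>B. (\<lambda>b\<in>B. \<sigma> (c b)) b \<noteq> 0} = {b\<in>B. c b \<noteq> 0}" using nz by auto
    have "(\<Oplus>\<^bsub>X\<^esub>b\<in>{b\<in>B. c b \<noteq> 0}. (\<lambda>b\<in>B. \<sigma> (c b)) b \<odot>\<^bsub>X\<^esub> b) = (\<Oplus>\<^bsub>X\<^esub>b\<in>{b\<in>B. c b \<noteq> 0}. \<sigma> (c b) \<odot>\<^bsub>X\<^esub> b)"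
      by (rule X.mm.M.finsum_cong') (use cp \<sigma>(1) BX in auto)
    then show ?thesis unfolding P_def Q_def s using c cp \<sigma>(1) by auto
  qed
  have ex: "\<exists>!c. P c" using B m by (simp add: is_basis_def P_def)
  then obtain c where c: "P c" by blast
  have cp: "c b \<in> polys n" if "b \<in> B" for b using c that by (auto simp: P_def)
  have "(\<lambda>b\<in>B. \<sigma> ((\<lambda>b\<in>B. \<tau> (c b)) b)) = c"
    using c cp \<sigma>(3) by (intro extensionalityI[of _ B]) (auto simp: P_def PiE_def)
  then have "Q (\<lambda>b\<in>B. \<tau> (c b))" using PQ[of "\<lambda>b\<in>B. \<tau> (c b)"] c cp \<sigma>(2) by auto
  moreover have "c' = (\<lambda>b\<in>B. \<tau> (c b))" if "Q c'" for c'
  proof -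
    have c': "c' \<in> B \<rightarrow>\<^sub>E polys n" using that by (simp add: Q_def)
    then have "(\<lambda>b\<in>B. \<sigma> (c' b)) = c" using PQ that ex c by blast
    then have "\<tau> (c b) = c' b" if "b \<in> B" for b
      using \<sigma>(4)[of "c' b"] PiE_mem[OF c' that] that by (auto dest: fun_cong[of _ _ b])
    then show ?thesis using c' by (intro extensionalityI[of _ B]) (auto simp: PiE_def)
  qed
  ultimately have "\<exists>!c. Q c" by blast
  then show "\<exists>!c. c \<in> B \<rightarrow>\<^sub>E carrier (PR n) \<and> finite {b \<in> B. c b \<noteq> \<zero>\<^bsub>PR n\<^esub>} \<and>
      m = (\<Oplus>\<^bsub>twist \<sigma> X\<^esub>b\<in>{b \<in> B. c b \<noteq> \<zero>\<^bsub>PR n\<^esub>}. c b \<odot>\<^bsub>twist \<sigma> X\<^esub> b)"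
    by (simp add: Q_def)
qed

section \<open>Direct sums\<close>

lemma mf_dsum_simps [simp]:
  "carrier (mf_dsum J F) = (\<Pi>\<^sub>E j\<in>J. carrier (F j))" "\<zero>\<^bsub>mf_dsum J F\<^esub> = (\<lambda>j\<in>J. \<zero>\<^bsub>F j\<^esub>)"
  "a \<oplus>\<^bsub>mf_dsum J F\<^esub> b = (\<lambda>j\<in>J. a j \<oplus>\<^bsub>F j\<^esub> b j)" "r \<odot>\<^bsub>mf_dsum J F\<^esub> a = (\<lambda>j\<in>J. r \<odot>\<^bsub>F j\<^esub> a j)"
  "evens (mf_dsum J F) = (\<Pi>\<^sub>E j\<in>J. evens (F j))" "odds (mf_dsum J F) = (\<Pi>\<^sub>E j\<in>J. odds (F j))"
  "diff (mf_dsum J F) a = (\<lambda>j\<in>J. diff (F j) (a j))"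
  by (simp_all add: mf_dsum_def)

lemma premf_mf_dsum:
  assumes "\<And>j. j \<in> J \<Longrightarrow> premf n (F j)"
  shows "premf n (mf_dsum J F)"
proof -
  have F: "premf n (F j)" if "j \<in> J" for j using that assms by blast
  note ab = premf.ab[OF F]
  note simps = premf.add_closed[OF F] premf.zero_closed[OF F] premf.smult_closed[OF F]
    premf.evens_carrier[OF F] premf.odds_carrier[OF F] premf.add_smult[OF F] premf.smult_add[OF F]
    premf.smult_smult[OF F] premf.one_smult[OF F] premf.diff_add[OF F] premf.diff_smult[OF F]
    premf.diff_closed[OF F] premf.diff_even[OF F] premf.diff_odd[OF F] premf.evens_add[OF F]
    premf.odds_add[OF F] premf.evens_zero[OF F] premf.odds_zero[OF F] premf.evens_smult[OF F]
    premf.odds_smult[OF F]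
  note eqI = extensionalityI[of _ J]
  show ?thesis
  proof (rule premfI)
    show "abelian_group (mf_dsum J F)"
    proof (rule abelian_groupI)
      fix x assume x: "x \<in> carrier (mf_dsum J F)"
      show "\<exists>y\<in>carrier (mf_dsum J F). y \<oplus>\<^bsub>mf_dsum J F\<^esub> x = \<zero>\<^bsub>mf_dsum J F\<^esub>"
        by (rule bexI[of _ "\<lambda>j\<in>J. \<ominus>\<^bsub>F j\<^esub> x j"])
          (use x ab in \<open>auto simp: PiE_iff abelian_group.l_neg abelian_group.a_inv_closed intro!: ext\<close>)
    qed (auto simp: PiE_iff simps abelian_monoid.a_ac[OF abelian_group.axioms(1)[OF ab]]
        abelian_monoid.l_zero[OF abelian_group.axioms(1)[OF ab]]
        abelian_monoid.r_zero[OF abelian_group.axioms(1)[OF ab]] intro!: eqI)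
    fix m assume m: "m \<in> carrier (mf_dsum J F)"
    then show "\<exists>a\<in>evens (mf_dsum J F). \<exists>b\<in>odds (mf_dsum J F). m = a \<oplus>\<^bsub>mf_dsum J F\<^esub> b"
      by (intro bexI[of _ "\<lambda>j\<in>J. premf.evp (F j) (m j)"] bexI[of _ "\<lambda>j\<in>J. premf.odp (F j) (m j)"])
        (auto simp: PiE_iff premf.evp_odp[OF F] premf.evp_evens[OF F] premf.odp_odds[OF F] intro!: eqI)
  next
    fix a assume "a \<in> evens (mf_dsum J F)" "a \<in> odds (mf_dsum J F)"
    then show "a = \<zero>\<^bsub>mf_dsum J F\<^esub>"
      by (auto simp: PiE_iff intro!: eqI premf.even_odd_zero[OF F])
  qed (auto simp: PiE_iff simps intro!: eqI)
qed

section \<open>Tensor products\<close>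

text \<open>The target is a bare additive group: the scalar action and the differential of a tensor
  product are themselves obtained by lifting balanced maps.\<close>

definition balanced :: "nat \<Rightarrow> ('k::comm_ring_1 mpoly, 'y) mf \<Rightarrow> ('k mpoly, 'x) mf \<Rightarrow>
    ('z, 'e) ring_scheme \<Rightarrow> ('y \<Rightarrow> 'x \<Rightarrow> 'z) \<Rightarrow> bool" where
  "balanced n Y X N \<beta> \<longleftrightarrow>
     (\<forall>x\<in>carrier X. additive Y N (\<lambda>y. \<beta> y x)) \<and> (\<forall>y\<in>carrier Y. additive X N (\<beta> y)) \<and>
     (\<forall>y\<in>carrier Y. \<forall>x\<in>carrier X. \<forall>s\<in>polys n. \<beta> (primed n s \<odot>\<^bsub>Y\<^esub> y) x = \<beta> y (s \<odot>\<^bsub>X\<^esub> x))"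

lemma balancedI:
  assumes "\<And>y x. y \<in> carrier Y \<Longrightarrow> x \<in> carrier X \<Longrightarrow> \<beta> y x \<in> carrier N"
    and "\<And>y y' x. y \<in> carrier Y \<Longrightarrow> y' \<in> carrier Y \<Longrightarrow> x \<in> carrier X \<Longrightarrow>
      \<beta> (y \<oplus>\<^bsub>Y\<^esub> y') x = \<beta> y x \<oplus>\<^bsub>N\<^esub> \<beta> y' x"
    and "\<And>y x x'. y \<in> carrier Y \<Longrightarrow> x \<in> carrier X \<Longrightarrow> x' \<in> carrier X \<Longrightarrow>
      \<beta> y (x \<oplus>\<^bsub>X\<^esub> x') = \<beta> y x \<oplus>\<^bsub>N\<^esub> \<beta> y x'"
    and "\<And>y x s. y \<in> carrier Y \<Longrightarrow> x \<in> carrier X \<Longrightarrow> s \<in> polys n \<Longrightarrow>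
      \<beta> (primed n s \<odot>\<^bsub>Y\<^esub> y) x = \<beta> y (s \<odot>\<^bsub>X\<^esub> x)"
  shows "balanced n Y X N \<beta>"
  using assms by (simp add: balanced_def additive_def)

lemma balancedD:
  assumes "balanced n Y X N \<beta>"
  shows "y \<in> carrier Y \<Longrightarrow> x \<in> carrier X \<Longrightarrow> \<beta> y x \<in> carrier N"
    "y \<in> carrier Y \<Longrightarrow> y' \<in> carrier Y \<Longrightarrow> x \<in> carrier X \<Longrightarrow> \<beta> (y \<oplus>\<^bsub>Y\<^esub> y') x = \<beta> y x \<oplus>\<^bsub>N\<^esub> \<beta> y' x"
    "y \<in> carrier Y \<Longrightarrow> x \<in> carrier X \<Longrightarrow> x' \<in> carrier X \<Longrightarrow> \<beta> y (x \<oplus>\<^bsub>X\<^esub> x') = \<beta> y x \<oplus>\<^bsub>N\<^esub> \<beta> y x'"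
    "y \<in> carrier Y \<Longrightarrow> x \<in> carrier X \<Longrightarrow> s \<in> polys n \<Longrightarrow>
      \<beta> (primed n s \<odot>\<^bsub>Y\<^esub> y) x = \<beta> y (s \<odot>\<^bsub>X\<^esub> x)"
  using assms by (auto simp: balanced_def additive_def)

text \<open>Seen as the image of the monomial under a substitution that sends the remaining
  variables to 1, the left part is multiplicative by \<open>monom_subst_add\<close>.\<close>

lemma left_part_eq:
  "left_part n a = (monom_subst (\<lambda>i. if i < n then Var i else 1) a :: 'k::comm_ring_1 mpoly)"
proof -
  have "(monom_subst (\<lambda>i. if i < n then Var i else 1) a :: 'k mpoly) =
      (\<Prod>i\<in>Poly_Mapping.keys a \<inter> {..<n}. (if i < n then Var i else 1) ^ Poly_Mapping.lookup a i)"
    unfolding monom_subst_def by (rule prod.mono_neutral_right) auto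
  also have "\<dots> = left_part n a" unfolding left_part_def by (rule prod.cong) auto
  finally show ?thesis by simp
qed

lemma right_part_eq:
  "right_part n a = (monom_subst (\<lambda>i. if i < n then 1 else Var i) a :: 'k::comm_ring_1 mpoly)"
proof -
  have "(monom_subst (\<lambda>i. if i < n then 1 else Var i) a :: 'k mpoly) =
      (\<Prod>i\<in>Poly_Mapping.keys a \<inter> {n..}. (if i < n then 1 else Var i) ^ Poly_Mapping.lookup a i)"
    unfolding monom_subst_def by (rule prod.mono_neutral_right) auto
  also have "\<dots> = right_part n a" unfolding right_part_def by (rule prod.cong) auto
  finally show ?thesis by simp
qed

lemma left_part_add: "left_part n (a + b) = left_part n a * left_part n b"
  and right_part_add: "right_part n (a + b) = right_part n a * right_part n b"
  by (simp_all add: left_part_eq right_part_eq monom_subst_add)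

lemma left_part_0 [simp]: "left_part n 0 = 1"
  and right_part_0 [simp]: "right_part n 0 = 1"
  by (simp_all add: left_part_eq right_part_eq)

lemma left_part_single: "left_part n (Poly_Mapping.single i (Suc 0)) = (if i < n then Var i else 1)"
  and right_part_single: "right_part n (Poly_Mapping.single i (Suc 0)) = (if i < n then 1 else Var i)"
  by (simp_all add: left_part_eq right_part_eq monom_subst_def)

lemma left_part_polys [simp]: "left_part n a \<in> polys n"
  unfolding left_part_def by (rule polys_prod) auto

lemma right_part_polys: "Poly_Mapping.keys a \<subseteq> {..<m} \<Longrightarrow> right_part n a \<in> polys m"
  unfolding right_part_def by (rule polys_prod) auto

lemma polys_single_induct [consumes 1, case_names single add]:
  assumes p: "p \<in> polys n"
    and S: "\<And>a c. Poly_Mapping.keys a \<subseteq> {..<n} \<Longrightarrow> P (Poly_Mapping.single a c)"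
    and A: "\<And>p q. p \<in> polys n \<Longrightarrow> q \<in> polys n \<Longrightarrow> P p \<Longrightarrow> P q \<Longrightarrow> P (p + q)"
  shows "P p"
proof -
  have in_polys: "Poly_Mapping.single a c \<in> polys n" if "Poly_Mapping.keys a \<subseteq> {..<n}" for a c
    using that by (simp add: polys_def)
  have "(\<Sum>a\<in>K. Poly_Mapping.single a (c a)) \<in> polys n \<and> P (\<Sum>a\<in>K. Poly_Mapping.single a (c a))"
    if "K \<subseteq> Poly_Mapping.keys p" for K c
    using that
  proof (induction K rule: infinite_finite_induct)
    case (insert a K)
    then have "Poly_Mapping.keys a \<subseteq> {..<n}" using p by (auto simp: polys_def)
    then have "Poly_Mapping.single a (c a) \<in> polys n" "P (Poly_Mapping.single a (c a))"
      using in_polys S by blast+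
    then show ?case using insert by (auto intro: A)
  qed (use S[of 0 0] in auto)
  from this[of "Poly_Mapping.keys p" "Poly_Mapping.lookup p"] show ?thesis
    by (simp add: mpoly_eq_sum_single)
qed

text \<open>X may carry further variables on the right: m = n for 1-morphisms out of the trivial
  object, m = n + n for products such as \<open>A\<close> \<otimes> \<open>A\<close>. The first n
  variables of X are those contracted with the primed variables of Y.\<close>

locale tensor_pair = Y: premf "n + n" Y + X: premf m X
  for n m :: nat and Y :: "('k::comm_ring_1 mpoly, 'y) mf" and X :: "('k mpoly, 'x) mf" +
  assumes n_le_m: "n \<le> m"
begin

abbreviation "F \<equiv> free_Abelian_group (carrier Y \<times> carrier X)"
abbreviation "K \<equiv> tensor_kernel n Y X"
abbreviation "T \<equiv> tensor n Y X"
abbreviation "p \<equiv> pure n Y X"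

lemma polys_m [simp]: "r \<in> polys n \<Longrightarrow> r \<in> polys m"
  using polys_mono n_le_m by blast

lemma polys_nn [simp]: "r \<in> polys n \<Longrightarrow> r \<in> polys (n + n)"
  using polys_mono[of r n "n + n"] by simp

sublocale F: comm_group F by (rule abelian_free_Abelian_group)

lemma relators_carrier: "tensor_relators n Y X \<subseteq> carrier F"
proof -
  have "Poly_Mapping.keys (frag_of a - frag_of b) \<subseteq> carrier Y \<times> carrier X"
    if "a \<in> carrier Y \<times> carrier X" "b \<in> carrier Y \<times> carrier X" for a b
    using keys_diff[of "frag_of a" "frag_of b"] that by auto
  moreover have "Poly_Mapping.keys (frag_of a - frag_of b - frag_of c) \<subseteq> carrier Y \<times> carrier X"
    if "a \<in> carrier Y \<times> carrier X" "b \<in> carrier Y \<times> carrier X" "c \<in> carrier Y \<times> carrier X" for a b c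
    using keys_diff[of "frag_of a" "frag_of b"] keys_diff[of "frag_of a - frag_of b" "frag_of c"] that
    by auto
  ultimately show ?thesis
    unfolding tensor_relators_def by auto
qed

lemma K_subgroup: "subgroup K F"
  unfolding tensor_kernel_def by (rule F.generate_is_subgroup[OF relators_carrier])

sublocale K: normal K F
  by (rule F.subgroup_imp_normal[OF K_subgroup])

sublocale Q: comm_group "F Mod K"
  by (rule F.abelian_FactGroup[OF K_subgroup])

lemma tensor_simps:
  "carrier T = carrier (F Mod K)" "\<zero>\<^bsub>T\<^esub> = \<one>\<^bsub>F Mod K\<^esub>" "add T = monoid.mult (F Mod K)"
  "carrier (tensor_group n Y X) = carrier (F Mod K)" "\<zero>\<^bsub>tensor_group n Y X\<^esub> = \<one>\<^bsub>F Mod K\<^esub>"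
  "add (tensor_group n Y X) = monoid.mult (F Mod K)"
  by (simp_all add: tensor_def tensor_group_def Let_def)

lemma tensor_group_simps: "carrier (tensor_group n Y X) = carrier T"
  "\<zero>\<^bsub>tensor_group n Y X\<^esub> = \<zero>\<^bsub>T\<^esub>" "add (tensor_group n Y X) = add T"
  by (simp_all add: tensor_simps del: one_FactGroup mult_FactGroup)

lemma T_ab: "abelian_group T"
proof (rule abelian_groupI)
  fix t assume "t \<in> carrier T"
  then show "\<exists>s\<in>carrier T. s \<oplus>\<^bsub>T\<^esub> t = \<zero>\<^bsub>T\<^esub>"
    unfolding tensor_simps using Q.l_inv Q.inv_closed by blast
qed (auto simp: tensor_simps Q.m_ac simp del: one_FactGroup mult_FactGroup)

sublocale T: abelian_group T by (rule T_ab)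

lemma coset_carrier: "u \<in> carrier F \<Longrightarrow> K #>\<^bsub>F\<^esub> u \<in> carrier T"
  using K.r_coset_hom_Mod by (simp add: tensor_simps hom_def Pi_iff)

lemma coset_add: "u \<in> carrier F \<Longrightarrow> v \<in> carrier F \<Longrightarrow>
    K #>\<^bsub>F\<^esub> (u + v) = (K #>\<^bsub>F\<^esub> u) \<oplus>\<^bsub>T\<^esub> (K #>\<^bsub>F\<^esub> v)"
  using K.r_coset_hom_Mod by (auto simp: tensor_simps hom_def simp del: mult_FactGroup)

lemma coset_0: "K #>\<^bsub>F\<^esub> 0 = \<zero>\<^bsub>T\<^esub>"
  using F.coset_mult_one[OF K.subset] by (simp add: tensor_simps)

lemma carrier_F_minus: "u \<in> carrier F \<Longrightarrow> - u \<in> carrier F"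
  by simp

lemma coset_minus:
  assumes "u \<in> carrier F" shows "K #>\<^bsub>F\<^esub> (- u) = \<ominus>\<^bsub>T\<^esub> (K #>\<^bsub>F\<^esub> u)"
proof -
  have "(K #>\<^bsub>F\<^esub> (- u)) \<oplus>\<^bsub>T\<^esub> (K #>\<^bsub>F\<^esub> u) = \<zero>\<^bsub>T\<^esub>"
    using coset_add[of "- u" u] assms coset_0 by simp
  then show ?thesis using coset_carrier carrier_F_minus assms by (simp add: T.minus_equality)
qed

lemma frag_of_carrier: "y \<in> carrier Y \<Longrightarrow> x \<in> carrier X \<Longrightarrow> frag_of (y, x) \<in> carrier F"
  by simp

lemma pure_closed [simp]: "y \<in> carrier Y \<Longrightarrow> x \<in> carrier X \<Longrightarrow> p y x \<in> carrier T"
  unfolding pure_def by (rule coset_carrier[OF frag_of_carrier])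

lemma relator_zero:
  assumes "u \<in> tensor_relators n Y X" shows "K #>\<^bsub>F\<^esub> u = \<zero>\<^bsub>T\<^esub>"
proof -
  have "u \<in> K" unfolding tensor_kernel_def using assms by (rule generate.incl)
  then show ?thesis using F.coset_join2[OF _ K_subgroup] relators_carrier assms
    by (auto simp: tensor_simps)
qed

lemma coset_diff:
  assumes "u \<in> carrier F" "v \<in> carrier F"
  shows "u - v \<in> carrier F" "K #>\<^bsub>F\<^esub> (u - v) = (K #>\<^bsub>F\<^esub> u) \<ominus>\<^bsub>T\<^esub> (K #>\<^bsub>F\<^esub> v)"
proof -
  have "u + - v \<in> carrier F" using F.m_closed[OF assms(1) carrier_F_minus[OF assms(2)]] by simp
  then show "u - v \<in> carrier F" by simp
  show "K #>\<^bsub>F\<^esub> (u - v) = (K #>\<^bsub>F\<^esub> u) \<ominus>\<^bsub>T\<^esub> (K #>\<^bsub>F\<^esub> v)"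
    using coset_add[OF assms(1) carrier_F_minus[OF assms(2)]] coset_minus[OF assms(2)]
    by (simp add: a_minus_def)
qed

lemma T_minus_eqD:
  assumes "a \<ominus>\<^bsub>T\<^esub> b = c" "a \<in> carrier T" "b \<in> carrier T"
  shows "a = b \<oplus>\<^bsub>T\<^esub> c"
proof -
  have "b \<oplus>\<^bsub>T\<^esub> (a \<oplus>\<^bsub>T\<^esub> \<ominus>\<^bsub>T\<^esub> b) = a \<oplus>\<^bsub>T\<^esub> (b \<oplus>\<^bsub>T\<^esub> \<ominus>\<^bsub>T\<^esub> b)"
    using assms(2,3) T.a_lcomm T.a_inv_closed by blast
  then show ?thesis using assms by (simp add: a_minus_def T.r_neg)
qed

lemma T_minus_zeroD:
  "a \<ominus>\<^bsub>T\<^esub> b = \<zero>\<^bsub>T\<^esub> \<Longrightarrow> a \<in> carrier T \<Longrightarrow> b \<in> carrier T \<Longrightarrow> a = b"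
  using T_minus_eqD[of a b "\<zero>\<^bsub>T\<^esub>"] by simp

lemma pure_add_left:
  assumes "y \<in> carrier Y" "y' \<in> carrier Y" "x \<in> carrier X"
  shows "p (y \<oplus>\<^bsub>Y\<^esub> y') x = p y x \<oplus>\<^bsub>T\<^esub> p y' x"
proof -
  have "K #>\<^bsub>F\<^esub> (frag_of (y \<oplus>\<^bsub>Y\<^esub> y', x) - frag_of (y, x) - frag_of (y', x)) = \<zero>\<^bsub>T\<^esub>"
    by (rule relator_zero) (use assms in \<open>auto simp: tensor_relators_def\<close>)
  then have "p (y \<oplus>\<^bsub>Y\<^esub> y') x \<ominus>\<^bsub>T\<^esub> p y x \<ominus>\<^bsub>T\<^esub> p y' x = \<zero>\<^bsub>T\<^esub>"
    using assms by (simp add: coset_diff frag_of_carrier pure_def del: carrier_free_Abelian_group_iff)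
  then have "p (y \<oplus>\<^bsub>Y\<^esub> y') x \<ominus>\<^bsub>T\<^esub> p y x = p y' x" by (rule T_minus_zeroD) (use assms in auto)
  then show ?thesis by (rule T_minus_eqD) (use assms in auto)
qed

lemma pure_add_right:
  assumes "y \<in> carrier Y" "x \<in> carrier X" "x' \<in> carrier X"
  shows "p y (x \<oplus>\<^bsub>X\<^esub> x') = p y x \<oplus>\<^bsub>T\<^esub> p y x'"
proof -
  have "K #>\<^bsub>F\<^esub> (frag_of (y, x \<oplus>\<^bsub>X\<^esub> x') - frag_of (y, x) - frag_of (y, x')) = \<zero>\<^bsub>T\<^esub>"
    by (rule relator_zero) (use assms in \<open>auto simp: tensor_relators_def\<close>)
  then have "p y (x \<oplus>\<^bsub>X\<^esub> x') \<ominus>\<^bsub>T\<^esub> p y x \<ominus>\<^bsub>T\<^esub> p y x' = \<zero>\<^bsub>T\<^esub>"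
    using assms by (simp add: coset_diff frag_of_carrier pure_def del: carrier_free_Abelian_group_iff)
  then have "p y (x \<oplus>\<^bsub>X\<^esub> x') \<ominus>\<^bsub>T\<^esub> p y x = p y x'" by (rule T_minus_zeroD) (use assms in auto)
  then show ?thesis by (rule T_minus_eqD) (use assms in auto)
qed

lemma pure_balanced:
  assumes "y \<in> carrier Y" "x \<in> carrier X" "s \<in> polys n"
  shows "p (primed n s \<odot>\<^bsub>Y\<^esub> y) x = p y (s \<odot>\<^bsub>X\<^esub> x)"
proof -
  have "K #>\<^bsub>F\<^esub> (frag_of (primed n s \<odot>\<^bsub>Y\<^esub> y, x) - frag_of (y, s \<odot>\<^bsub>X\<^esub> x)) = \<zero>\<^bsub>T\<^esub>"
    by (rule relator_zero) (use assms in \<open>auto simp: tensor_relators_def\<close>)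
  then have "p (primed n s \<odot>\<^bsub>Y\<^esub> y) x \<ominus>\<^bsub>T\<^esub> p y (s \<odot>\<^bsub>X\<^esub> x) = \<zero>\<^bsub>T\<^esub>"
    using assms by (simp add: coset_diff frag_of_carrier pure_def del: carrier_free_Abelian_group_iff)
  then show ?thesis by (rule T_minus_zeroD) (use assms in auto)
qed

lemma pure_additive_left: "x \<in> carrier X \<Longrightarrow> additive Y T (\<lambda>y. p y x)"
  and pure_additive_right: "y \<in> carrier Y \<Longrightarrow> additive X T (p y)"
  by (rule additiveI; simp add: pure_add_left pure_add_right)+

lemma pure_neg_left: "y \<in> carrier Y \<Longrightarrow> x \<in> carrier X \<Longrightarrow> p (\<ominus>\<^bsub>Y\<^esub> y) x = \<ominus>\<^bsub>T\<^esub> p y x"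
  by (rule additive_neg[OF Y.ab T_ab pure_additive_left])

lemma pure_neg_right: "y \<in> carrier Y \<Longrightarrow> x \<in> carrier X \<Longrightarrow> p y (\<ominus>\<^bsub>X\<^esub> x) = \<ominus>\<^bsub>T\<^esub> p y x"
  by (rule additive_neg[OF X.ab T_ab pure_additive_right])

lemma pure_zero_left [simp]: "x \<in> carrier X \<Longrightarrow> p \<zero>\<^bsub>Y\<^esub> x = \<zero>\<^bsub>T\<^esub>"
  by (rule additive_zero[OF Y.ab T_ab pure_additive_left])

lemma pure_zero_right [simp]: "y \<in> carrier Y \<Longrightarrow> p y \<zero>\<^bsub>X\<^esub> = \<zero>\<^bsub>T\<^esub>"
  by (rule additive_zero[OF X.ab T_ab pure_additive_right])

text \<open>A sign can be moved into the left factor, so no closure under negation is asked of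
  P.\<close>

lemma tensor_induct [consumes 1, case_names pure add]:
  assumes t: "t \<in> carrier T"
    and pure: "\<And>y x. y \<in> carrier Y \<Longrightarrow> x \<in> carrier X \<Longrightarrow> P (p y x)"
    and add: "\<And>s t. s \<in> carrier T \<Longrightarrow> t \<in> carrier T \<Longrightarrow> P s \<Longrightarrow> P t \<Longrightarrow> P (s \<oplus>\<^bsub>T\<^esub> t)"
  shows "P t"
proof -
  obtain u where u: "u \<in> carrier F" "t = K #>\<^bsub>F\<^esub> u"
    using t by (auto simp: tensor_simps carrier_FactGroup)
  \<comment> \<open>Induction on the free group passes through differences, hence the claim is
    carried for u and -u together.\<close>
  from u(1) have "P (K #>\<^bsub>F\<^esub> u) \<and> P (K #>\<^bsub>F\<^esub> (- u))"
    unfolding carrier_free_Abelian_group_iff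
  proof (induction u rule: free_Abelian_group_induct[consumes 1])
    case 1
    have "P \<zero>\<^bsub>T\<^esub>" using pure[of "\<zero>\<^bsub>Y\<^esub>" "\<zero>\<^bsub>X\<^esub>"] by simp
    then show ?case by (simp add: coset_0)
  next
    case (2 u v)
    then have uv: "u \<in> carrier F" "v \<in> carrier F" by auto
    then have "K #>\<^bsub>F\<^esub> (u - v) = (K #>\<^bsub>F\<^esub> u) \<oplus>\<^bsub>T\<^esub> (K #>\<^bsub>F\<^esub> (- v))"
      "K #>\<^bsub>F\<^esub> (- (u - v)) = (K #>\<^bsub>F\<^esub> (- u)) \<oplus>\<^bsub>T\<^esub> (K #>\<^bsub>F\<^esub> v)"
      using coset_add[of u "- v"] coset_add[of "- u" v] carrier_F_minus by auto
    then show ?case using 2 add coset_carrier carrier_F_minus uv by simp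
  next
    case (3 a)
    then obtain y x where a: "a = (y, x)" "y \<in> carrier Y" "x \<in> carrier X" by auto
    then have "K #>\<^bsub>F\<^esub> (- frag_of a) = \<ominus>\<^bsub>T\<^esub> p y x"
      by (simp add: coset_minus frag_of_carrier pure_def del: carrier_free_Abelian_group_iff)
    also have "\<dots> = p (\<ominus>\<^bsub>Y\<^esub> y) x" using a by (simp add: pure_neg_left)
    finally have "K #>\<^bsub>F\<^esub> (- frag_of a) = p (\<ominus>\<^bsub>Y\<^esub> y) x" .
    then show ?case using a pure[of y x] pure[of "\<ominus>\<^bsub>Y\<^esub> y" x] by (simp add: pure_def)
  qed
  then show ?thesis using u by simp
qed

lemma tensor_additive_eqI:
  assumes "abelian_group N" "additive T N f" "additive T N g" "t \<in> carrier T"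
    and "\<And>y x. y \<in> carrier Y \<Longrightarrow> x \<in> carrier X \<Longrightarrow> f (p y x) = g (p y x)"
  shows "f t = g t"
  using assms(4)
proof (induction t rule: tensor_induct)
  case (add s t)
  then show ?case using assms(2,3) by (simp add: additive_add)
qed (rule assms(5))

text \<open>The universal property: the induced map on the free group kills the relators and so
  factors through the quotient, and pure tensors generate. It also shows that the definite
  description defining \<open>tensor_lift\<close> has exactly one solution.\<close>

lemma tensor_lift:
  assumes N: "abelian_group N" and \<beta>: "balanced n Y X N \<beta>"
  shows tensor_lift_additive: "additive T N (tensor_lift n Y X N \<beta>)"
    and tensor_lift_pure: "y \<in> carrier Y \<Longrightarrow> x \<in> carrier X \<Longrightarrow> tensor_lift n Y X N \<beta> (p y x) = \<beta> y x"
    and tensor_lift_ext: "tensor_lift n Y X N \<beta> \<in> extensional (carrier T)"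
proof -
  interpret N: abelian_group N by (rule N)
  let ?H = "add_monoid N"
  let ?P = "\<lambda>h. h \<in> carrier T \<rightarrow>\<^sub>E carrier N \<and>
       (\<forall>s\<in>carrier T. \<forall>t\<in>carrier T. h (s \<oplus>\<^bsub>T\<^esub> t) = h s \<oplus>\<^bsub>N\<^esub> h t) \<and>
       (\<forall>y\<in>carrier Y. \<forall>x\<in>carrier X. h (p y x) = \<beta> y x)"
  have "(\<lambda>(y, x). \<beta> y x) ` (carrier Y \<times> carrier X) \<subseteq> carrier ?H"
    using balancedD(1)[OF \<beta>] by auto
  then obtain h where h: "h \<in> hom F ?H"
    and h_frag: "\<And>a. a \<in> carrier Y \<times> carrier X \<Longrightarrow> h (frag_of a) = (case a of (y, x) \<Rightarrow> \<beta> y x)"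
    using comm_group.free_Abelian_group_universal[OF N.a_comm_group] by metis
  interpret h: group_hom F ?H h
    by (rule group_hom.intro) (use h N.a_group F.is_group in \<open>auto simp: group_hom_axioms_def\<close>)
  have h_diff: "h (u - v) = h u \<ominus>\<^bsub>N\<^esub> h v" if "u \<in> carrier F" "v \<in> carrier F" for u v
  proof -
    have "h (u - v) = h (u \<otimes>\<^bsub>F\<^esub> inv\<^bsub>F\<^esub> v)" using that by simp
    also have "\<dots> = h u \<otimes>\<^bsub>?H\<^esub> inv\<^bsub>?H\<^esub> (h v)"
      using that F.inv_closed h.hom_mult h.hom_inv by metis
    finally show ?thesis by (simp add: a_minus_def a_inv_def)
  qed
  have "tensor_relators n Y X \<subseteq> kernel F ?H h"
  proof
    fix u assume u: "u \<in> tensor_relators n Y X"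
    have sum: "a \<oplus>\<^bsub>N\<^esub> b \<ominus>\<^bsub>N\<^esub> a \<ominus>\<^bsub>N\<^esub> b = \<zero>\<^bsub>N\<^esub>" if "a \<in> carrier N" "b \<in> carrier N" for a b
    proof -
      have "a \<oplus>\<^bsub>N\<^esub> b \<oplus>\<^bsub>N\<^esub> \<ominus>\<^bsub>N\<^esub> a = b \<oplus>\<^bsub>N\<^esub> (a \<oplus>\<^bsub>N\<^esub> \<ominus>\<^bsub>N\<^esub> a)"
        using that N.a_comm N.a_assoc N.a_inv_closed by metis
      then show ?thesis using that by (simp add: a_minus_def N.r_neg)
    qed
    have A: "h (frag_of (y \<oplus>\<^bsub>Y\<^esub> y', x) - frag_of (y, x) - frag_of (y', x)) = \<zero>\<^bsub>N\<^esub>"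
      if "y \<in> carrier Y" "y' \<in> carrier Y" "x \<in> carrier X" for y y' x
      using that by (simp add: h_diff coset_diff frag_of_carrier h_frag balancedD[OF \<beta>] sum
          del: carrier_free_Abelian_group_iff)
    have B: "h (frag_of (y, x \<oplus>\<^bsub>X\<^esub> x') - frag_of (y, x) - frag_of (y, x')) = \<zero>\<^bsub>N\<^esub>"
      if "y \<in> carrier Y" "x \<in> carrier X" "x' \<in> carrier X" for y x x'
      using that by (simp add: h_diff coset_diff frag_of_carrier h_frag balancedD[OF \<beta>] sum
          del: carrier_free_Abelian_group_iff)
    have C: "h (frag_of (primed n s \<odot>\<^bsub>Y\<^esub> y, x) - frag_of (y, s \<odot>\<^bsub>X\<^esub> x)) = \<zero>\<^bsub>N\<^esub>"
      if "y \<in> carrier Y" "x \<in> carrier X" "s \<in> polys n" for y x s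
      using that by (simp add: h_diff coset_diff frag_of_carrier h_frag balancedD[OF \<beta>] a_minus_def N.r_neg
          del: carrier_free_Abelian_group_iff)
    from u have "h u = \<zero>\<^bsub>N\<^esub>"
      unfolding tensor_relators_def by (elim UnE CollectE exE conjE) (simp_all only: A B C)
    then show "u \<in> kernel F ?H h"
      using subsetD[OF relators_carrier u] by (simp add: kernel_def del: carrier_free_Abelian_group_iff)
  qed
  then have "K \<subseteq> kernel F ?H h"
    unfolding tensor_kernel_def by (rule F.generate_subgroup_incl[OF _ h.subgroup_kernel])
  then obtain g where g: "g \<in> hom (F Mod K) ?H" "\<And>u. u \<in> carrier F \<Longrightarrow> g (K #>\<^bsub>F\<^esub> u) = h u"
    using h.FactGroup_universal_kernel[OF K.normal_axioms] by metis
  have "?P (restrict g (carrier T))"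
  proof (intro conjI ballI)
    show "restrict g (carrier T) \<in> carrier T \<rightarrow>\<^sub>E carrier N"
      using g(1) by (auto simp: hom_def tensor_simps)
    fix s t assume "s \<in> carrier T" "t \<in> carrier T"
    then show "restrict g (carrier T) (s \<oplus>\<^bsub>T\<^esub> t) = restrict g (carrier T) s \<oplus>\<^bsub>N\<^esub> restrict g (carrier T) t"
      using g(1) T.a_closed[of s t] by (auto simp: hom_def tensor_simps simp del: mult_FactGroup)
  next
    fix y x assume "y \<in> carrier Y" "x \<in> carrier X"
    then show "restrict g (carrier T) (p y x) = \<beta> y x"
      using pure_closed[of y x] g(2)[OF frag_of_carrier[of y x]] h_frag[of "(y, x)"]
      by (simp add: pure_def)
  qed
  moreover have "h1 = h2" if "?P h1" "?P h2" for h1 h2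
  proof (rule extensionalityI[of _ "carrier T"])
    fix t assume "t \<in> carrier T"
    then show "h1 t = h2 t"
      by (rule tensor_additive_eqI[OF N, rotated 2])
        (use that in \<open>auto simp: additive_def PiE_iff\<close>)
  qed (use that in \<open>auto simp: PiE_iff\<close>)
  ultimately have "\<exists>!h. ?P h" by blast
  then have "?P (THE h. ?P h)" by (rule theI')
  then have *: "?P (tensor_lift n Y X N \<beta>)"
    unfolding tensor_lift_def Let_def tensor_group_simps .
  then show "additive T N (tensor_lift n Y X N \<beta>)"
    "tensor_lift n Y X N \<beta> \<in> extensional (carrier T)"
    "y \<in> carrier Y \<Longrightarrow> x \<in> carrier X \<Longrightarrow> tensor_lift n Y X N \<beta> (p y x) = \<beta> y x"
    by (auto simp: additive_def PiE_iff)
qed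

lemma tensor_lift_group: "tensor_lift n Y X (tensor_group n Y X) \<beta> = tensor_lift n Y X T \<beta>"
  by (simp add: tensor_lift_def Let_def tensor_group_simps)

lemma smult_T: "f \<odot>\<^bsub>T\<^esub> t = tensor_lift n Y X T (\<lambda>y x. \<Oplus>\<^bsub>T\<^esub>a\<in>Poly_Mapping.keys f.
    p ((Const (Poly_Mapping.lookup f a) * left_part n a) \<odot>\<^bsub>Y\<^esub> y) (right_part n a \<odot>\<^bsub>X\<^esub> x)) t"
proof -
  have fs: "finsum (tensor_group n Y X) = finsum T"
    by (simp add: finsum_def tensor_group_simps fun_eq_iff finprod_def)
  have "f \<odot>\<^bsub>T\<^esub> t = tensor_lift n Y X (tensor_group n Y X)
      (\<lambda>y x. finsum (tensor_group n Y X) (\<lambda>a. p ((Const (Poly_Mapping.lookup f a) * left_part n a) \<odot>\<^bsub>Y\<^esub> y)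
        (right_part n a \<odot>\<^bsub>X\<^esub> x)) (Poly_Mapping.keys f)) t"
    by (simp add: tensor_def Let_def)
  then show ?thesis by (simp only: tensor_lift_group fs)
qed

lemma diff_T: "diff T = tensor_lift n Y X T (\<lambda>y x. p (diff Y y) x \<oplus>\<^bsub>T\<^esub> p (koszul Y y) (diff X x))"
proof -
  have "diff T = tensor_lift n Y X (tensor_group n Y X) (\<lambda>y x. p (diff Y y) x
      \<oplus>\<^bsub>tensor_group n Y X\<^esub> p (koszul Y y) (diff X x))"
    by (simp add: tensor_def Let_def)
  then show ?thesis by (simp only: tensor_lift_group tensor_group_simps)
qed

end

context tensor_pair
begin

section \<open>The scalar action on a tensor product\<close>

lemma balanced_finsum:
  assumes N: "abelian_group N" and \<beta>: "\<And>i. i \<in> I \<Longrightarrow> balanced n Y X N (\<beta> i)"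
  shows "balanced n Y X N (\<lambda>y x. \<Oplus>\<^bsub>N\<^esub>i\<in>I. \<beta> i y x)"
proof -
  interpret N: abelian_group N by fact
  note \<beta>D = balancedD[OF \<beta>]
  show ?thesis
  proof (rule balancedI)
    fix y x assume yx: "y \<in> carrier Y" "x \<in> carrier X"
    then show "(\<Oplus>\<^bsub>N\<^esub>i\<in>I. \<beta> i y x) \<in> carrier N" by (intro N.finsum_closed) (auto simp: \<beta>D(1))
    fix y' assume y': "y' \<in> carrier Y"
    have "(\<Oplus>\<^bsub>N\<^esub>i\<in>I. \<beta> i (y \<oplus>\<^bsub>Y\<^esub> y') x) = (\<Oplus>\<^bsub>N\<^esub>i\<in>I. \<beta> i y x \<oplus>\<^bsub>N\<^esub> \<beta> i y' x)"
      using yx y' by (intro N.finsum_cong') (auto simp: \<beta>D(1,2))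
    also have "\<dots> = (\<Oplus>\<^bsub>N\<^esub>i\<in>I. \<beta> i y x) \<oplus>\<^bsub>N\<^esub> (\<Oplus>\<^bsub>N\<^esub>i\<in>I. \<beta> i y' x)"
      using yx y' by (intro N.finsum_addf) (auto simp: \<beta>D(1))
    finally show "(\<Oplus>\<^bsub>N\<^esub>i\<in>I. \<beta> i (y \<oplus>\<^bsub>Y\<^esub> y') x) =
        (\<Oplus>\<^bsub>N\<^esub>i\<in>I. \<beta> i y x) \<oplus>\<^bsub>N\<^esub> (\<Oplus>\<^bsub>N\<^esub>i\<in>I. \<beta> i y' x)" .
  next
    fix y x x' assume yx: "y \<in> carrier Y" "x \<in> carrier X" "x' \<in> carrier X"
    have "(\<Oplus>\<^bsub>N\<^esub>i\<in>I. \<beta> i y (x \<oplus>\<^bsub>X\<^esub> x')) = (\<Oplus>\<^bsub>N\<^esub>i\<in>I. \<beta> i y x \<oplus>\<^bsub>N\<^esub> \<beta> i y x')"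
      using yx by (intro N.finsum_cong') (auto simp: \<beta>D(1,3))
    also have "\<dots> = (\<Oplus>\<^bsub>N\<^esub>i\<in>I. \<beta> i y x) \<oplus>\<^bsub>N\<^esub> (\<Oplus>\<^bsub>N\<^esub>i\<in>I. \<beta> i y x')"
      using yx by (intro N.finsum_addf) (auto simp: \<beta>D(1))
    finally show "(\<Oplus>\<^bsub>N\<^esub>i\<in>I. \<beta> i y (x \<oplus>\<^bsub>X\<^esub> x')) =
        (\<Oplus>\<^bsub>N\<^esub>i\<in>I. \<beta> i y x) \<oplus>\<^bsub>N\<^esub> (\<Oplus>\<^bsub>N\<^esub>i\<in>I. \<beta> i y x')" .
  next
    fix y x and s :: "'k mpoly"
    assume yx: "y \<in> carrier Y" "x \<in> carrier X" "s \<in> polys n"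
    then show "(\<Oplus>\<^bsub>N\<^esub>i\<in>I. \<beta> i (primed n s \<odot>\<^bsub>Y\<^esub> y) x) = (\<Oplus>\<^bsub>N\<^esub>i\<in>I. \<beta> i y (s \<odot>\<^bsub>X\<^esub> x))"
      by (intro N.finsum_cong') (auto simp: \<beta>D(1,4))
  qed
qed

lemma polys_keys: "f \<in> polys m \<Longrightarrow> a \<in> Poly_Mapping.keys f \<Longrightarrow> Poly_Mapping.keys a \<subseteq> {..<m}"
  by (simp add: polys_def)

lemma smult_term_balanced:
  assumes "Poly_Mapping.keys a \<subseteq> {..<m}"
  shows "balanced n Y X T (\<lambda>y x. p ((Const c * left_part n a) \<odot>\<^bsub>Y\<^esub> y) (right_part n a \<odot>\<^bsub>X\<^esub> x))"
  using assms
  by (intro balancedI)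
    (auto simp: right_part_polys Y.smult_add X.smult_add pure_add_left pure_add_right
      Y.smult_commute[of "Const c * left_part n a"] X.smult_commute[of "right_part n a"] pure_balanced)

lemma smult_balanced:
  assumes "f \<in> polys m"
  shows "balanced n Y X T (\<lambda>y x. \<Oplus>\<^bsub>T\<^esub>a\<in>Poly_Mapping.keys f.
    p ((Const (Poly_Mapping.lookup f a) * left_part n a) \<odot>\<^bsub>Y\<^esub> y) (right_part n a \<odot>\<^bsub>X\<^esub> x))"
  by (rule balanced_finsum[OF T_ab smult_term_balanced]) (use assms polys_keys in blast)

text \<open>The index set S is left open so that f, g and f + g can be expanded over the same
  monomials in \<open>smult_distrib\<close>.\<close>

lemma smult_pure:
  assumes "f \<in> polys m" "y \<in> carrier Y" "x \<in> carrier X"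
    and "finite S" "Poly_Mapping.keys f \<subseteq> S" "\<And>a. a \<in> S \<Longrightarrow> Poly_Mapping.keys a \<subseteq> {..<m}"
  shows "f \<odot>\<^bsub>T\<^esub> p y x = (\<Oplus>\<^bsub>T\<^esub>a\<in>S.
    p ((Const (Poly_Mapping.lookup f a) * left_part n a) \<odot>\<^bsub>Y\<^esub> y) (right_part n a \<odot>\<^bsub>X\<^esub> x))"
  unfolding smult_T tensor_lift_pure[OF T_ab smult_balanced[OF assms(1)] assms(2,3)]
  by (rule T.add.finprod_mono_neutral_cong_left)
    (use assms in \<open>auto simp: right_part_polys in_keys_iff\<close>)

lemma smult_additive: "f \<in> polys m \<Longrightarrow> additive T T (\<lambda>t. f \<odot>\<^bsub>T\<^esub> t)"
  unfolding smult_T using tensor_lift_additive[OF T_ab smult_balanced] by simp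

lemma single_polys: "Poly_Mapping.keys a \<subseteq> {..<k} \<Longrightarrow> Poly_Mapping.single a c \<in> polys k"
  by (simp add: polys_def)

lemma smult_single:
  assumes "Poly_Mapping.keys a \<subseteq> {..<m}" "y \<in> carrier Y" "x \<in> carrier X"
  shows "Poly_Mapping.single a c \<odot>\<^bsub>T\<^esub> p y x =
    p ((Const c * left_part n a) \<odot>\<^bsub>Y\<^esub> y) (right_part n a \<odot>\<^bsub>X\<^esub> x)"
  using smult_pure[of "Poly_Mapping.single a c" y x "{a}"] assms
  by (simp add: single_polys right_part_polys)

lemma smult_distrib:
  assumes "f \<in> polys m" "g \<in> polys m" "t \<in> carrier T"
  shows "(f + g) \<odot>\<^bsub>T\<^esub> t = f \<odot>\<^bsub>T\<^esub> t \<oplus>\<^bsub>T\<^esub> g \<odot>\<^bsub>T\<^esub> t"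
proof (rule tensor_additive_eqI[OF T_ab _ _ assms(3)])
  show "additive T T (\<lambda>t. (f + g) \<odot>\<^bsub>T\<^esub> t)" "additive T T (\<lambda>t. f \<odot>\<^bsub>T\<^esub> t \<oplus>\<^bsub>T\<^esub> g \<odot>\<^bsub>T\<^esub> t)"
    using assms by (auto intro!: additive_plus[OF T_ab] smult_additive)
  fix y x assume yx: "y \<in> carrier Y" "x \<in> carrier X"
  let ?S = "Poly_Mapping.keys f \<union> Poly_Mapping.keys g"
  have S: "finite ?S" "\<And>a. a \<in> ?S \<Longrightarrow> Poly_Mapping.keys a \<subseteq> {..<m}"
    using polys_keys[OF assms(1)] polys_keys[OF assms(2)] by auto
  have fg: "Poly_Mapping.keys (f + g) \<subseteq> ?S" by (rule Poly_Mapping.keys_add)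
  have "(f + g) \<odot>\<^bsub>T\<^esub> p y x = (\<Oplus>\<^bsub>T\<^esub>a\<in>?S.
      p ((Const (Poly_Mapping.lookup (f + g) a) * left_part n a) \<odot>\<^bsub>Y\<^esub> y) (right_part n a \<odot>\<^bsub>X\<^esub> x))"
    by (rule smult_pure) (use assms yx S fg in auto)
  also have "\<dots> = (\<Oplus>\<^bsub>T\<^esub>a\<in>?S.
      p ((Const (Poly_Mapping.lookup f a) * left_part n a) \<odot>\<^bsub>Y\<^esub> y) (right_part n a \<odot>\<^bsub>X\<^esub> x) \<oplus>\<^bsub>T\<^esub>
      p ((Const (Poly_Mapping.lookup g a) * left_part n a) \<odot>\<^bsub>Y\<^esub> y) (right_part n a \<odot>\<^bsub>X\<^esub> x))"
    using S yx by (intro T.finsum_cong')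
      (auto simp: right_part_polys lookup_add Const_add distrib_right Y.add_smult pure_add_left)
  also have "\<dots> = f \<odot>\<^bsub>T\<^esub> p y x \<oplus>\<^bsub>T\<^esub> g \<odot>\<^bsub>T\<^esub> p y x"
    using S yx assms smult_pure[of f y x ?S] smult_pure[of g y x ?S]
    by (subst T.finsum_addf) (simp_all add: right_part_polys)
  finally show "(f + g) \<odot>\<^bsub>T\<^esub> p y x = f \<odot>\<^bsub>T\<^esub> p y x \<oplus>\<^bsub>T\<^esub> g \<odot>\<^bsub>T\<^esub> p y x" .
qed

lemma smult_closed_T: "f \<in> polys m \<Longrightarrow> t \<in> carrier T \<Longrightarrow> f \<odot>\<^bsub>T\<^esub> t \<in> carrier T"
  using additive_closed[OF smult_additive] by simp

lemma smult_assoc: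
  assumes "f \<in> polys m" "g \<in> polys m" "t \<in> carrier T"
  shows "(f * g) \<odot>\<^bsub>T\<^esub> t = f \<odot>\<^bsub>T\<^esub> (g \<odot>\<^bsub>T\<^esub> t)"
proof (rule tensor_additive_eqI[OF T_ab _ _ assms(3)])
  show "additive T T (\<lambda>t. (f * g) \<odot>\<^bsub>T\<^esub> t)" "additive T T (\<lambda>t. f \<odot>\<^bsub>T\<^esub> (g \<odot>\<^bsub>T\<^esub> t))"
    using assms by (auto intro: additive_compose smult_additive)
  fix y x assume yx: "y \<in> carrier Y" "x \<in> carrier X"
  show "(f * g) \<odot>\<^bsub>T\<^esub> p y x = f \<odot>\<^bsub>T\<^esub> (g \<odot>\<^bsub>T\<^esub> p y x)"
    using assms(1)
  proof (induction f rule: polys_single_induct)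
    case (single a c)
    note f = single
    show ?case using assms(2)
    proof (induction g rule: polys_single_induct)
      case (single b d)
      then have "Poly_Mapping.keys (a + b) \<subseteq> {..<m}" using f Poly_Mapping.keys_add[of a b] by auto
      moreover have "(Const (c * d) * left_part n (a + b)) \<odot>\<^bsub>Y\<^esub> y =
          (Const c * left_part n a) \<odot>\<^bsub>Y\<^esub> ((Const d * left_part n b) \<odot>\<^bsub>Y\<^esub> y)"
        using yx by (simp add: Const_mult left_part_add Y.smult_smult[symmetric] ac_simps)
      ultimately show ?case
        using f single yx
        by (simp add: mult_single smult_single right_part_polys right_part_add X.smult_smult)
    next
      case (add g h)
      then show ?case
        using f yx by (simp add: distrib_left smult_distrib single_polys smult_closed_T
            additive_add[OF smult_additive])
    qed
  next
    case (add f h)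
    then show ?case using assms(2) yx by (simp add: distrib_right smult_distrib smult_closed_T)
  qed
qed

lemma smult_Const: "y \<in> carrier Y \<Longrightarrow> x \<in> carrier X \<Longrightarrow> Const c \<odot>\<^bsub>T\<^esub> p y x = p (Const c \<odot>\<^bsub>Y\<^esub> y) x"
  using smult_single[of 0 y x c] by (simp add: Const_def)

lemma smult_Var:
  assumes "i < m" "y \<in> carrier Y" "x \<in> carrier X"
  shows "Var i \<odot>\<^bsub>T\<^esub> p y x = (if i < n then p (Var i \<odot>\<^bsub>Y\<^esub> y) x else p y (Var i \<odot>\<^bsub>X\<^esub> x))"
  using smult_single[of "Poly_Mapping.single i 1" y x 1] assms
  by (simp add: Var_def[of i, symmetric, unfolded One_nat_def] left_part_single right_part_single)

lemma smult_left:
  assumes "f \<in> polys n" "y \<in> carrier Y" "x \<in> carrier X"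
  shows "f \<odot>\<^bsub>T\<^esub> p y x = p (f \<odot>\<^bsub>Y\<^esub> y) x"
  using assms(1,2)
proof (induction f arbitrary: y rule: polys_induct)
  case (Const c)
  then show ?case using assms by (simp add: smult_Const)
next
  case (Var i)
  then show ?case using assms n_le_m by (simp add: smult_Var)
next
  case (add f g)
  then show ?case using assms by (simp add: smult_distrib Y.add_smult pure_add_left)
next
  case (mult f g)
  then show ?case using assms by (simp add: smult_assoc Y.smult_smult)
qed

text \<open>The polynomials that commute with u are closed under sums and products. Constants and
  variables below n act on the left factor of a pure tensor and the remaining variables on the right
  one, which gives the three conditions.\<close>

lemma additive_polys_commute:
  assumes N: "premf m N" and u: "additive T N u"
    and const: "\<And>c y x. y \<in> carrier Y \<Longrightarrow> x \<in> carrier X \<Longrightarrow>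
      u (p (Const c \<odot>\<^bsub>Y\<^esub> y) x) = Const c \<odot>\<^bsub>N\<^esub> u (p y x)"
    and left: "\<And>i y x. i < n \<Longrightarrow> y \<in> carrier Y \<Longrightarrow> x \<in> carrier X \<Longrightarrow>
      u (p (Var i \<odot>\<^bsub>Y\<^esub> y) x) = Var i \<odot>\<^bsub>N\<^esub> u (p y x)"
    and right: "\<And>i y x. n \<le> i \<Longrightarrow> i < m \<Longrightarrow> y \<in> carrier Y \<Longrightarrow> x \<in> carrier X \<Longrightarrow>
      u (p y (Var i \<odot>\<^bsub>X\<^esub> x)) = Var i \<odot>\<^bsub>N\<^esub> u (p y x)"
    and f: "f \<in> polys m" and t: "t \<in> carrier T"
  shows "u (f \<odot>\<^bsub>T\<^esub> t) = f \<odot>\<^bsub>N\<^esub> u t"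
proof -
  interpret N: premf m N by fact
  have base: "u (f \<odot>\<^bsub>T\<^esub> t) = f \<odot>\<^bsub>N\<^esub> u t"
    if f: "f \<in> polys m" and t: "t \<in> carrier T"
      and pu: "\<And>y x. y \<in> carrier Y \<Longrightarrow> x \<in> carrier X \<Longrightarrow> u (f \<odot>\<^bsub>T\<^esub> p y x) = f \<odot>\<^bsub>N\<^esub> u (p y x)" for f t
  proof (rule tensor_additive_eqI[OF N.ab _ _ t, of "\<lambda>t. u (f \<odot>\<^bsub>T\<^esub> t)" "\<lambda>t. f \<odot>\<^bsub>N\<^esub> u t"])
    show "additive T N (\<lambda>t. u (f \<odot>\<^bsub>T\<^esub> t))" by (rule additive_compose[OF smult_additive[OF f] u])
    show "additive T N (\<lambda>t. f \<odot>\<^bsub>N\<^esub> u t)" by (rule additive_compose[OF u N.smult_additive[OF f]])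
  qed (rule pu)
  show ?thesis using f t
  proof (induction f arbitrary: t rule: polys_induct)
    case (Const c)
    show ?case by (rule base) (use Const in \<open>auto simp: smult_Const const\<close>)
  next
    case (Var i)
    show ?case by (rule base) (use Var in \<open>auto simp: smult_Var left right\<close>)
  next
    case (add f g)
    then show ?case
      by (simp add: smult_distrib N.add_smult additive_add[OF u] smult_closed_T additive_closed[OF u])
  next
    case (mult f g)
    then show ?case
      by (simp add: smult_assoc N.smult_smult smult_closed_T additive_closed[OF u])
  qed
qed

section \<open>The grading on a tensor product\<close>

lemma evens_T: "evens T = generate (add_monoid (tensor_group n Y X))
    ({p y x | y x. y \<in> evens Y \<and> x \<in> evens X} \<union> {p y x | y x. y \<in> odds Y \<and> x \<in> odds X})"
  and odds_T: "odds T = generate (add_monoid (tensor_group n Y X))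
    ({p y x | y x. y \<in> evens Y \<and> x \<in> odds X} \<union> {p y x | y x. y \<in> odds Y \<and> x \<in> evens X})"
  by (simp_all add: tensor_def Let_def)

lemma inv_tensor_group: "inv\<^bsub>add_monoid (tensor_group n Y X)\<^esub> t = \<ominus>\<^bsub>T\<^esub> t"
  by (simp add: a_inv_def m_inv_def tensor_group_simps)

text \<open>A generated subgroup also contains the inverses of its generators; closure of the
  generating set under negation reduces that case to the case of a generator.\<close>

lemma generate_T_induct:
  assumes t: "t \<in> generate (add_monoid (tensor_group n Y X)) S"
    and S: "\<And>s. s \<in> S \<Longrightarrow> s \<in> carrier T" "\<And>s. s \<in> S \<Longrightarrow> P s" "\<And>s. s \<in> S \<Longrightarrow> \<ominus>\<^bsub>T\<^esub> s \<in> S"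
    and z: "P \<zero>\<^bsub>T\<^esub>"
    and add: "\<And>s t. s \<in> carrier T \<Longrightarrow> t \<in> carrier T \<Longrightarrow> P s \<Longrightarrow> P t \<Longrightarrow> P (s \<oplus>\<^bsub>T\<^esub> t)"
  shows "t \<in> carrier T \<and> P t"
  using t
proof (induction rule: generate.induct)
  case (inv h)
  then show ?case unfolding inv_tensor_group using S by blast
qed (use S z add in \<open>auto simp: tensor_group_simps\<close>)

lemma neg_pure_mem:
  assumes "s \<in> {p y x | y x. y \<in> A \<and> x \<in> B}" "A \<subseteq> carrier Y" "B \<subseteq> carrier X"
    "\<And>a. a \<in> A \<Longrightarrow> \<ominus>\<^bsub>Y\<^esub> a \<in> A"
  shows "\<ominus>\<^bsub>T\<^esub> s \<in> {p y x | y x. y \<in> A \<and> x \<in> B}"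
proof -
  obtain y x where "s = p y x" "y \<in> A" "x \<in> B" using assms(1) by blast
  moreover from this have "\<ominus>\<^bsub>T\<^esub> s = p (\<ominus>\<^bsub>Y\<^esub> y) x"
    using pure_neg_left[of y x] assms(2,3) by (metis subsetD)
  ultimately show ?thesis using assms(4) by blast
qed

lemma evens_T_induct [consumes 1, case_names even odd add]:
  assumes t: "t \<in> evens T"
    and "\<And>y x. y \<in> evens Y \<Longrightarrow> x \<in> evens X \<Longrightarrow> P (p y x)"
    and "\<And>y x. y \<in> odds Y \<Longrightarrow> x \<in> odds X \<Longrightarrow> P (p y x)"
    and "\<And>s t. s \<in> carrier T \<Longrightarrow> t \<in> carrier T \<Longrightarrow> P s \<Longrightarrow> P t \<Longrightarrow> P (s \<oplus>\<^bsub>T\<^esub> t)"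
  shows "P t"
proof -
  have "t \<in> carrier T \<and> P t"
  proof (rule generate_T_induct[OF t[unfolded evens_T]], goal_cases)
    case (3 s)
    then show ?case
      using neg_pure_mem[of s "evens Y" "evens X"] neg_pure_mem[of s "evens Y" "odds X"]
        neg_pure_mem[of s "odds Y" "evens X"] neg_pure_mem[of s "odds Y" "odds X"]
        Y.evens_neg Y.odds_neg Y.evens_carrier Y.odds_carrier X.evens_carrier X.odds_carrier
      by (auto simp only: Un_iff subset_iff)
  next
    case 4
    show ?case using assms(2)[of "\<zero>\<^bsub>Y\<^esub>" "\<zero>\<^bsub>X\<^esub>"] by simp
  qed (use assms in auto)
  then show ?thesis by simp
qed

lemma odds_T_induct [consumes 1, case_names even odd add]:
  assumes t: "t \<in> odds T"
    and "\<And>y x. y \<in> evens Y \<Longrightarrow> x \<in> odds X \<Longrightarrow> P (p y x)"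
    and "\<And>y x. y \<in> odds Y \<Longrightarrow> x \<in> evens X \<Longrightarrow> P (p y x)"
    and "\<And>s t. s \<in> carrier T \<Longrightarrow> t \<in> carrier T \<Longrightarrow> P s \<Longrightarrow> P t \<Longrightarrow> P (s \<oplus>\<^bsub>T\<^esub> t)"
  shows "P t"
proof -
  have "t \<in> carrier T \<and> P t"
  proof (rule generate_T_induct[OF t[unfolded odds_T]], goal_cases)
    case (3 s)
    then show ?case
      using neg_pure_mem[of s "evens Y" "evens X"] neg_pure_mem[of s "evens Y" "odds X"]
        neg_pure_mem[of s "odds Y" "evens X"] neg_pure_mem[of s "odds Y" "odds X"]
        Y.evens_neg Y.odds_neg Y.evens_carrier Y.odds_carrier X.evens_carrier X.odds_carrier
      by (auto simp only: Un_iff subset_iff)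
  next
    case 4
    show ?case using assms(2)[of "\<zero>\<^bsub>Y\<^esub>" "\<zero>\<^bsub>X\<^esub>"] by simp
  qed (use assms in auto)
  then show ?thesis by simp
qed

lemma pure_parity [simp]:
  "y \<in> evens Y \<Longrightarrow> x \<in> evens X \<Longrightarrow> p y x \<in> evens T"
  "y \<in> odds Y \<Longrightarrow> x \<in> odds X \<Longrightarrow> p y x \<in> evens T"
  "y \<in> evens Y \<Longrightarrow> x \<in> odds X \<Longrightarrow> p y x \<in> odds T"
  "y \<in> odds Y \<Longrightarrow> x \<in> evens X \<Longrightarrow> p y x \<in> odds T"
  unfolding evens_T odds_T by (rule generate.incl; blast)+

lemma T_parity_add:
  "s \<in> evens T \<Longrightarrow> t \<in> evens T \<Longrightarrow> s \<oplus>\<^bsub>T\<^esub> t \<in> evens T"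
  "s \<in> odds T \<Longrightarrow> t \<in> odds T \<Longrightarrow> s \<oplus>\<^bsub>T\<^esub> t \<in> odds T"
  unfolding evens_T odds_T
  using generate.eng[of s "add_monoid (tensor_group n Y X)" _ t] by (simp_all add: tensor_group_simps)

lemma T_evens_carrier: "t \<in> evens T \<Longrightarrow> t \<in> carrier T"
  by (induction rule: evens_T_induct) auto

lemma T_odds_carrier: "t \<in> odds T \<Longrightarrow> t \<in> carrier T"
  by (induction rule: odds_T_induct) auto

text \<open>Constants and variables send pure tensors to pure tensors, a general polynomial does
  not; parity is therefore checked for the former and extended multiplicatively and additively in
  \<open>T_parity_smult\<close>.\<close>

lemma T_parity_smult_base:
  assumes "f = Const c \<or> (\<exists>i<m. f = Var i)"
  shows "t \<in> evens T \<Longrightarrow> f \<odot>\<^bsub>T\<^esub> t \<in> evens T" "t \<in> odds T \<Longrightarrow> f \<odot>\<^bsub>T\<^esub> t \<in> odds T"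
proof -
  have f: "f \<in> polys m" using assms by auto
  show "t \<in> evens T \<Longrightarrow> f \<odot>\<^bsub>T\<^esub> t \<in> evens T"
  proof (induction rule: evens_T_induct)
    case (add s t)
    then show ?case by (simp add: additive_add[OF smult_additive[OF f]] T_parity_add)
  qed (use assms in \<open>auto simp: smult_Const smult_Var\<close>)
  show "t \<in> odds T \<Longrightarrow> f \<odot>\<^bsub>T\<^esub> t \<in> odds T"
  proof (induction rule: odds_T_induct)
    case (add s t)
    then show ?case by (simp add: additive_add[OF smult_additive[OF f]] T_parity_add)
  qed (use assms in \<open>auto simp: smult_Const smult_Var\<close>)
qed

lemma T_parity_smult:
  assumes "f \<in> polys m"
  shows "t \<in> evens T \<Longrightarrow> f \<odot>\<^bsub>T\<^esub> t \<in> evens T" "t \<in> odds T \<Longrightarrow> f \<odot>\<^bsub>T\<^esub> t \<in> odds T"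
proof -
  have "(\<forall>t\<in>evens T. f \<odot>\<^bsub>T\<^esub> t \<in> evens T) \<and> (\<forall>t\<in>odds T. f \<odot>\<^bsub>T\<^esub> t \<in> odds T)"
    using assms
  proof (induction f rule: polys_induct)
    case (Const c)
    then show ?case using T_parity_smult_base[of "Const c" c] by blast
  next
    case (Var i)
    then show ?case using T_parity_smult_base[of "Var i"] by blast
  next
    case (add f g)
    then show ?case by (simp add: smult_distrib T_parity_add T_evens_carrier T_odds_carrier)
  next
    case (mult f g)
    then show ?case by (simp add: smult_assoc T_evens_carrier T_odds_carrier)
  qed
  then show "t \<in> evens T \<Longrightarrow> f \<odot>\<^bsub>T\<^esub> t \<in> evens T" "t \<in> odds T \<Longrightarrow> f \<odot>\<^bsub>T\<^esub> t \<in> odds T" by auto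
qed

text \<open>The projector onto the even part of the tensor product, obtained from the parity
  projectors of the factors. It fixes even tensors and kills odd ones, so that the two subgroups
  meet in zero.\<close>

lemma even_part_balanced: "balanced n Y X T (\<lambda>y x. p (Y.evp y) (X.evp x) \<oplus>\<^bsub>T\<^esub> p (Y.odp y) (X.odp x))"
  by (rule balancedI)
    (auto simp: Y.parts_add X.parts_add Y.parts_smult X.parts_smult pure_add_left pure_add_right
      pure_balanced T.a_ac)

lemma T_even_odd_zero:
  assumes "t \<in> evens T" "t \<in> odds T" shows "t = \<zero>\<^bsub>T\<^esub>"
proof -
  let ?e = "tensor_lift n Y X T (\<lambda>y x. p (Y.evp y) (X.evp x) \<oplus>\<^bsub>T\<^esub> p (Y.odp y) (X.odp x))"
  note e = tensor_lift_additive[OF T_ab even_part_balanced] tensor_lift_pure[OF T_ab even_part_balanced]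
  have "?e t = t" using assms(1)
    by (induction rule: evens_T_induct) (auto simp: e(2) additive_add[OF e(1)])
  moreover have "?e t = \<zero>\<^bsub>T\<^esub>" using assms(2)
    by (induction rule: odds_T_induct) (auto simp: e(2) additive_add[OF e(1)])
  ultimately show ?thesis by simp
qed

lemma T_decomp:
  assumes "t \<in> carrier T" shows "\<exists>a\<in>evens T. \<exists>b\<in>odds T. t = a \<oplus>\<^bsub>T\<^esub> b"
  using assms
proof (induction rule: tensor_induct)
  case (pure y x)
  have "p y x = p (Y.evp y \<oplus>\<^bsub>Y\<^esub> Y.odp y) (X.evp x \<oplus>\<^bsub>X\<^esub> X.odp x)"
    using pure by (simp add: Y.evp_odp X.evp_odp)
  also have "\<dots> = (p (Y.evp y) (X.evp x) \<oplus>\<^bsub>T\<^esub> p (Y.odp y) (X.odp x)) \<oplus>\<^bsub>T\<^esub>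
      (p (Y.evp y) (X.odp x) \<oplus>\<^bsub>T\<^esub> p (Y.odp y) (X.evp x))"
    using pure by (simp add: pure_add_left pure_add_right T.a_ac del: Y.evp_odp X.evp_odp)
  finally show ?case using pure
    by (intro bexI[of _ "p (Y.evp y) (X.evp x) \<oplus>\<^bsub>T\<^esub> p (Y.odp y) (X.odp x)"]
        bexI[of _ "p (Y.evp y) (X.odp x) \<oplus>\<^bsub>T\<^esub> p (Y.odp y) (X.evp x)"]) (auto simp: T_parity_add)
next
  case (add s t)
  then obtain a b c d where *: "a \<in> evens T" "b \<in> odds T" "s = a \<oplus>\<^bsub>T\<^esub> b"
    "c \<in> evens T" "d \<in> odds T" "t = c \<oplus>\<^bsub>T\<^esub> d" by blast
  then have "s \<oplus>\<^bsub>T\<^esub> t = (a \<oplus>\<^bsub>T\<^esub> c) \<oplus>\<^bsub>T\<^esub> (b \<oplus>\<^bsub>T\<^esub> d)"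
    by (simp add: T_evens_carrier T_odds_carrier T.a_ac)
  then show ?case using * T_parity_add by blast
qed

section \<open>The differential of a tensor product\<close>

lemma diff_balanced: "balanced n Y X T (\<lambda>y x. p (diff Y y) x \<oplus>\<^bsub>T\<^esub> p (koszul Y y) (diff X x))"
  by (rule balancedI)
    (auto simp: Y.diff_add X.diff_add Y.diff_smult X.diff_smult Y.koszul_add Y.koszul_smult
      pure_add_left pure_add_right pure_balanced T.a_ac)

lemmas diff_T_additive = tensor_lift_additive[OF T_ab diff_balanced, folded diff_T]
lemmas diff_pure = tensor_lift_pure[OF T_ab diff_balanced, folded diff_T]

lemma diff_T_smult_base:
  assumes "f = Const c \<or> (\<exists>i<m. f = Var i)" "t \<in> carrier T"
  shows "diff T (f \<odot>\<^bsub>T\<^esub> t) = f \<odot>\<^bsub>T\<^esub> diff T t"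
proof -
  have f: "f \<in> polys m" using assms by auto
  show ?thesis
  proof (rule tensor_additive_eqI[OF T_ab _ _ assms(2), of "\<lambda>t. diff T (f \<odot>\<^bsub>T\<^esub> t)" "\<lambda>t. f \<odot>\<^bsub>T\<^esub> diff T t"])
    show "additive T T (\<lambda>t. diff T (f \<odot>\<^bsub>T\<^esub> t))"
      by (rule additive_compose[OF smult_additive[OF f] diff_T_additive])
    show "additive T T (\<lambda>t. f \<odot>\<^bsub>T\<^esub> diff T t)"
      by (rule additive_compose[OF diff_T_additive smult_additive[OF f]])
  qed (use assms(1) in \<open>auto simp: smult_Const smult_Var diff_pure Y.diff_smult X.diff_smult
        Y.koszul_smult additive_add[OF smult_additive[OF f]]\<close>)
qed

lemma diff_T_smult:
  assumes "f \<in> polys m" "t \<in> carrier T"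
  shows "diff T (f \<odot>\<^bsub>T\<^esub> t) = f \<odot>\<^bsub>T\<^esub> diff T t"
  using assms
proof (induction f arbitrary: t rule: polys_induct)
  case (Const c)
  then show ?case using diff_T_smult_base[of "Const c" c] by simp
next
  case (Var i)
  then show ?case using diff_T_smult_base[of "Var i"] by blast
next
  case (add f g)
  then show ?case
    by (simp add: smult_distrib additive_add[OF diff_T_additive] smult_closed_T
        additive_closed[OF diff_T_additive])
next
  case (mult f g)
  then show ?case by (simp add: smult_assoc smult_closed_T additive_closed[OF diff_T_additive])
qed

lemma diff_T_parity:
  shows "t \<in> evens T \<Longrightarrow> diff T t \<in> odds T" "t \<in> odds T \<Longrightarrow> diff T t \<in> evens T"
proof -
  show "t \<in> evens T \<Longrightarrow> diff T t \<in> odds T"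
    by (induction rule: evens_T_induct)
      (auto simp: diff_pure T_parity_add additive_add[OF diff_T_additive])
  show "t \<in> odds T \<Longrightarrow> diff T t \<in> evens T"
    by (induction rule: odds_T_induct)
      (auto simp: diff_pure T_parity_add additive_add[OF diff_T_additive])
qed

lemma premf_T: "premf m T"
proof (rule premfI[OF T_ab])
  show "\<zero>\<^bsub>T\<^esub> \<in> evens T" using pure_parity(1)[of "\<zero>\<^bsub>Y\<^esub>" "\<zero>\<^bsub>X\<^esub>"] by simp
  show "\<zero>\<^bsub>T\<^esub> \<in> odds T" using pure_parity(3)[of "\<zero>\<^bsub>Y\<^esub>" "\<zero>\<^bsub>X\<^esub>"] by simp
  fix t assume t: "t \<in> carrier T"
  show "1 \<odot>\<^bsub>T\<^esub> t = t"
  proof (rule tensor_additive_eqI[OF T_ab smult_additive _ t])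
    fix y x assume "y \<in> carrier Y" "x \<in> carrier X"
    then show "1 \<odot>\<^bsub>T\<^esub> p y x = p y x" using smult_Const[of y x 1] by simp
  qed (auto intro: additiveI)
qed (auto simp: smult_closed_T smult_distrib smult_assoc T_parity_add T_parity_smult T_evens_carrier
    T_odds_carrier T_decomp T_even_odd_zero diff_T_smult diff_T_parity
    additive_add[OF smult_additive] additive_add[OF diff_T_additive] additive_closed[OF diff_T_additive])

sublocale TT: premf m T by (rule premf_T)

lemma koszul_pure:
  assumes "y \<in> carrier Y" "x \<in> carrier X"
  shows "koszul T (p y x) = p (koszul Y y) (koszul X x)"
proof -
  obtain a b c d where *: "a \<in> evens Y" "b \<in> odds Y" "y = a \<oplus>\<^bsub>Y\<^esub> b"
    "c \<in> evens X" "d \<in> odds X" "x = c \<oplus>\<^bsub>X\<^esub> d"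
    using assms by (metis Y.decompE X.decompE)
  then show ?thesis
    by (simp add: pure_add_left pure_add_right TT.koszul_add Y.koszul_add X.koszul_add
        pure_neg_left pure_neg_right T.minus_minus T.minus_add)
qed

end

section \<open>Functoriality and associativity of the tensor product\<close>

text \<open>This predicate and \<open>is_mf_map\<close> drop extensionality from
  \<open>linear_maps\<close> and \<open>mf_maps\<close>. Composites and sums can then be plain
  lambda terms, and restriction to the carrier recovers an element of
  \<open>mf_maps\<close>.\<close>

definition is_linear where
  "is_linear N X Y f \<longleftrightarrow> additive X Y f \<and> (\<forall>r\<in>polys N. \<forall>a\<in>carrier X. f (r \<odot>\<^bsub>X\<^esub> a) = r \<odot>\<^bsub>Y\<^esub> f a)"

definition is_mf_map where
  "is_mf_map N X Y f \<longleftrightarrow> is_linear N X Y f \<and> f ` evens X \<subseteq> evens Y \<and> f ` odds X \<subseteq> odds Y \<and>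
     (\<forall>m\<in>carrier X. f (diff X m) = diff Y (f m))"

lemma is_linearD:
  assumes "is_linear N X Y f"
  shows "additive X Y f" "a \<in> carrier X \<Longrightarrow> f a \<in> carrier Y"
    "a \<in> carrier X \<Longrightarrow> b \<in> carrier X \<Longrightarrow> f (a \<oplus>\<^bsub>X\<^esub> b) = f a \<oplus>\<^bsub>Y\<^esub> f b"
    "r \<in> polys N \<Longrightarrow> a \<in> carrier X \<Longrightarrow> f (r \<odot>\<^bsub>X\<^esub> a) = r \<odot>\<^bsub>Y\<^esub> f a"
  using assms by (auto simp: is_linear_def additive_def)

lemma is_mf_mapD:
  assumes "is_mf_map N X Y f"
  shows "is_linear N X Y f" "a \<in> evens X \<Longrightarrow> f a \<in> evens Y" "a \<in> odds X \<Longrightarrow> f a \<in> odds Y"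
    "m \<in> carrier X \<Longrightarrow> f (diff X m) = diff Y (f m)"
    "f ` evens X \<subseteq> evens Y" "f ` odds X \<subseteq> odds Y"
  using assms by (auto simp: is_mf_map_def)

lemma is_mf_map_restrict:
  "is_mf_map N X Y f \<Longrightarrow> premf N X \<Longrightarrow> restrict f (carrier X) \<in> mf_maps N X Y"
  by (rule mf_maps_restrictI) (auto simp: is_mf_map_def is_linear_def)

lemma is_mf_map_ext:
  "is_mf_map N X Y f \<Longrightarrow> premf N X \<Longrightarrow> f \<in> extensional (carrier X) \<Longrightarrow> f \<in> mf_maps N X Y"
  using is_mf_map_restrict[of N X Y f] by (simp add: extensional_restrict)

lemma mf_maps_is_mf_map: "f \<in> mf_maps N X Y \<Longrightarrow> is_mf_map N X Y f"
  by (auto simp: mf_maps_def linear_maps_def is_mf_map_def is_linear_def additive_def)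

lemma is_mf_map_id: "is_mf_map N X X (\<lambda>x. x)"
  by (simp add: is_mf_map_def is_linear_def additive_def)

lemma is_mf_map_comp:
  "is_mf_map N X Y f \<Longrightarrow> is_mf_map N Y Z g \<Longrightarrow> is_mf_map N X Z (\<lambda>x. g (f x))"
  by (auto simp: is_mf_map_def is_linear_def additive_def image_subset_iff Pi_iff)

lemma is_homotopy_linear: "is_homotopy n X Y h \<Longrightarrow> is_linear n X Y h"
  by (simp add: is_homotopy_def is_linear_def)

lemma (in premf) koszul_linear: "is_linear N X X (koszul X)"
  by (simp add: is_linear_def koszul_additive koszul_smult)

locale tensor_pairs = A: tensor_pair n m Y X + B: tensor_pair n m Y' X'
  for n m :: nat and Y :: "('k::comm_ring_1 mpoly, 'y) mf" and X :: "('k mpoly, 'x) mf"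
    and Y' :: "('k mpoly, 'v) mf" and X' :: "('k mpoly, 'w) mf"
begin

abbreviation "tm \<equiv> tensor_map n Y X Y' X'"

lemma map_balanced:
  assumes "is_linear (n + n) Y Y' \<alpha>" "is_linear m X X' \<psi>"
  shows "balanced n Y X B.T (\<lambda>y x. B.p (\<alpha> y) (\<psi> x))"
  by (rule balancedI)
    (use assms in \<open>simp_all add: is_linearD B.pure_add_left B.pure_add_right B.pure_balanced\<close>)

lemma tensor_map:
  assumes "is_linear (n + n) Y Y' \<alpha>" "is_linear m X X' \<psi>"
  shows tensor_map_additive: "additive A.T B.T (tm \<alpha> \<psi>)"
    and tensor_map_pure: "y \<in> carrier Y \<Longrightarrow> x \<in> carrier X \<Longrightarrow> tm \<alpha> \<psi> (A.p y x) = B.p (\<alpha> y) (\<psi> x)"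
    and tensor_map_ext: "tm \<alpha> \<psi> \<in> extensional (carrier A.T)"
  unfolding tensor_map_def
  using A.tensor_lift[OF B.T_ab map_balanced[OF assms]] by auto

lemma tensor_map_linear:
  assumes "is_linear (n + n) Y Y' \<alpha>" "is_linear m X X' \<psi>"
  shows "is_linear m A.T B.T (tm \<alpha> \<psi>)"
  unfolding is_linear_def
proof (intro conjI ballI)
  fix r :: "'k mpoly" and t assume "r \<in> polys m" "t \<in> carrier A.T"
  then show "tm \<alpha> \<psi> (r \<odot>\<^bsub>A.T\<^esub> t) = r \<odot>\<^bsub>B.T\<^esub> tm \<alpha> \<psi> t"
    using A.n_le_m
    by (intro A.additive_polys_commute[OF B.premf_T tensor_map_additive[OF assms]])
      (simp_all add: tensor_map_pure[OF assms] is_linearD[OF assms(1)] is_linearD[OF assms(2)]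
        B.smult_Const B.smult_Var)
qed (rule tensor_map_additive[OF assms])

lemma tensor_map_even:
  assumes l: "is_linear (n + n) Y Y' \<alpha>" "is_linear m X X' \<psi>"
    and "\<alpha> ` evens Y \<subseteq> evens Y'" "\<alpha> ` odds Y \<subseteq> odds Y'" "\<psi> ` evens X \<subseteq> evens X'" "\<psi> ` odds X \<subseteq> odds X'"
  shows "tm \<alpha> \<psi> ` evens A.T \<subseteq> evens B.T" "tm \<alpha> \<psi> ` odds A.T \<subseteq> odds B.T"
proof -
  note a = additive_add[OF tensor_map_additive[OF l]]
  have "tm \<alpha> \<psi> t \<in> evens B.T" if "t \<in> evens A.T" for t using that
    by (induction rule: A.evens_T_induct) (use assms in \<open>auto simp: tensor_map_pure a image_subset_iff\<close>)
  then show "tm \<alpha> \<psi> ` evens A.T \<subseteq> evens B.T" by auto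
  have "tm \<alpha> \<psi> t \<in> odds B.T" if "t \<in> odds A.T" for t using that
    by (induction rule: A.odds_T_induct) (use assms in \<open>auto simp: tensor_map_pure a image_subset_iff\<close>)
  then show "tm \<alpha> \<psi> ` odds A.T \<subseteq> odds B.T" by auto
qed

lemma tensor_map_odd_right:
  assumes l: "is_linear (n + n) Y Y' \<alpha>" "is_linear m X X' \<psi>"
    and "\<alpha> ` evens Y \<subseteq> evens Y'" "\<alpha> ` odds Y \<subseteq> odds Y'" "\<psi> ` evens X \<subseteq> odds X'" "\<psi> ` odds X \<subseteq> evens X'"
  shows "tm \<alpha> \<psi> ` evens A.T \<subseteq> odds B.T" "tm \<alpha> \<psi> ` odds A.T \<subseteq> evens B.T"
proof -
  note a = additive_add[OF tensor_map_additive[OF l]]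
  have "tm \<alpha> \<psi> t \<in> odds B.T" if "t \<in> evens A.T" for t using that
    by (induction rule: A.evens_T_induct) (use assms in \<open>auto simp: tensor_map_pure a image_subset_iff\<close>)
  then show "tm \<alpha> \<psi> ` evens A.T \<subseteq> odds B.T" by auto
  have "tm \<alpha> \<psi> t \<in> evens B.T" if "t \<in> odds A.T" for t using that
    by (induction rule: A.odds_T_induct) (use assms in \<open>auto simp: tensor_map_pure a image_subset_iff\<close>)
  then show "tm \<alpha> \<psi> ` odds A.T \<subseteq> evens B.T" by auto
qed

lemma tensor_map_odd_left:
  assumes l: "is_linear (n + n) Y Y' \<alpha>" "is_linear m X X' \<psi>"
    and "\<alpha> ` evens Y \<subseteq> odds Y'" "\<alpha> ` odds Y \<subseteq> evens Y'" "\<psi> ` evens X \<subseteq> evens X'" "\<psi> ` odds X \<subseteq> odds X'"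
  shows "tm \<alpha> \<psi> ` evens A.T \<subseteq> odds B.T" "tm \<alpha> \<psi> ` odds A.T \<subseteq> evens B.T"
proof -
  note a = additive_add[OF tensor_map_additive[OF l]]
  have "tm \<alpha> \<psi> t \<in> odds B.T" if "t \<in> evens A.T" for t using that
    by (induction rule: A.evens_T_induct) (use assms in \<open>auto simp: tensor_map_pure a image_subset_iff\<close>)
  then show "tm \<alpha> \<psi> ` evens A.T \<subseteq> odds B.T" by auto
  have "tm \<alpha> \<psi> t \<in> evens B.T" if "t \<in> odds A.T" for t using that
    by (induction rule: A.odds_T_induct) (use assms in \<open>auto simp: tensor_map_pure a image_subset_iff\<close>)
  then show "tm \<alpha> \<psi> ` odds A.T \<subseteq> evens B.T" by auto
qed

lemma tensor_map_mf_map: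
  assumes \<alpha>: "is_mf_map (n + n) Y Y' \<alpha>" and \<psi>: "is_mf_map m X X' \<psi>"
  shows "is_mf_map m A.T B.T (tm \<alpha> \<psi>)"
  unfolding is_mf_map_def
proof (intro conjI ballI)
  note l = is_mf_mapD(1)[OF \<alpha>] is_mf_mapD(1)[OF \<psi>]
  note \<alpha>D = is_mf_mapD[OF \<alpha>] is_linearD[OF l(1)]
  note \<psi>D = is_mf_mapD[OF \<psi>] is_linearD[OF l(2)]
  note u = tensor_map_additive[OF l]
  show "is_linear m A.T B.T (tm \<alpha> \<psi>)" by (rule tensor_map_linear[OF l])
  show "tm \<alpha> \<psi> ` evens A.T \<subseteq> evens B.T" "tm \<alpha> \<psi> ` odds A.T \<subseteq> odds B.T"
    using tensor_map_even[OF l] \<alpha>D \<psi>D by auto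
  fix t assume t: "t \<in> carrier A.T"
  show "tm \<alpha> \<psi> (diff A.T t) = diff B.T (tm \<alpha> \<psi> t)"
  proof (rule A.tensor_additive_eqI[OF B.T_ab _ _ t, of "\<lambda>t. tm \<alpha> \<psi> (diff A.T t)" "\<lambda>t. diff B.T (tm \<alpha> \<psi> t)"])
    show "additive A.T B.T (\<lambda>t. tm \<alpha> \<psi> (diff A.T t))" by (rule additive_compose[OF A.diff_T_additive u])
    show "additive A.T B.T (\<lambda>t. diff B.T (tm \<alpha> \<psi> t))" by (rule additive_compose[OF u B.diff_T_additive])
    fix y x assume yx: "y \<in> carrier Y" "x \<in> carrier X"
    have "koszul Y' (\<alpha> y) = \<alpha> (koszul Y y)"
      by (rule koszul_even_map[OF A.Y.premf_axioms B.Y.premf_axioms]) (use \<alpha>D yx in auto)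
    then show "tm \<alpha> \<psi> (diff A.T (A.p y x)) = diff B.T (tm \<alpha> \<psi> (A.p y x))"
      using yx by (simp add: A.diff_pure B.diff_pure additive_add[OF u] tensor_map_pure[OF l] \<alpha>D(4,8) \<psi>D(4,8))
  qed
qed

lemma tensor_map_mf_maps:
  assumes "is_mf_map (n + n) Y Y' \<alpha>" "is_mf_map m X X' \<psi>"
  shows "tm \<alpha> \<psi> \<in> mf_maps m A.T B.T"
  by (rule is_mf_map_ext[OF tensor_map_mf_map[OF assms] A.premf_T
        tensor_map_ext[OF is_mf_mapD(1)[OF assms(1)] is_mf_mapD(1)[OF assms(2)]]])

text \<open>A homotopy h for the left factor gives h \<otimes> \<psi>. The terms containing d_X
  cancel because the odd map h anticommutes with the parity sign in the differential.\<close>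

lemma homotopic_right:
  assumes \<alpha>: "is_mf_map (n + n) Y Y' \<alpha>" and \<beta>: "is_mf_map (n + n) Y Y' \<beta>" and \<psi>: "is_mf_map m X X' \<psi>"
    and ho: "homotopic (n + n) Y Y' \<alpha> \<beta>"
  shows "homotopic m A.T B.T (tm \<alpha> \<psi>) (tm \<beta> \<psi>)"
proof -
  note la = is_mf_mapD(1)[OF \<alpha>] and lb = is_mf_mapD(1)[OF \<beta>] and lp = is_mf_mapD(1)[OF \<psi>]
  obtain h where h: "is_homotopy (n + n) Y Y' h"
    and eq: "\<And>m. m \<in> carrier Y \<Longrightarrow> \<beta> m = \<alpha> m \<oplus>\<^bsub>Y'\<^esub> (diff Y' (h m) \<oplus>\<^bsub>Y'\<^esub> h (diff Y m))"
    using homotopicE[OF A.Y.premf_axioms B.Y.premf_axioms ho] is_linearD(2)[OF la] is_linearD(2)[OF lb] by metis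
  note lh = is_homotopy_linear[OF h]
  let ?H = "tm h \<psi>"
  note H = tensor_map_additive[OF lh lp]
  show ?thesis
  proof (rule homotopicI[OF A.premf_T B.premf_T, of ?H])
    show "is_homotopy m A.T B.T ?H"
      using tensor_map_linear[OF lh lp] tensor_map_odd_left[OF lh lp] h is_mf_mapD[OF \<psi>]
      by (simp add: is_homotopy_def is_linear_def)
    show "tm \<alpha> \<psi> t \<in> carrier B.T" if "t \<in> carrier A.T" for t
      using additive_closed[OF tensor_map_additive[OF la lp] that] .
    fix t assume t: "t \<in> carrier A.T"
    show "tm \<beta> \<psi> t = tm \<alpha> \<psi> t \<oplus>\<^bsub>B.T\<^esub> (diff B.T (?H t) \<oplus>\<^bsub>B.T\<^esub> ?H (diff A.T t))"
    proof (rule A.tensor_additive_eqI[OF B.T_ab tensor_map_additive[OF lb lp] _ t,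
          of "\<lambda>t. tm \<alpha> \<psi> t \<oplus>\<^bsub>B.T\<^esub> (diff B.T (?H t) \<oplus>\<^bsub>B.T\<^esub> ?H (diff A.T t))"])
      show "additive A.T B.T (\<lambda>t. tm \<alpha> \<psi> t \<oplus>\<^bsub>B.T\<^esub> (diff B.T (?H t) \<oplus>\<^bsub>B.T\<^esub> ?H (diff A.T t)))"
        by (intro additive_plus[OF B.T_ab] tensor_map_additive[OF la lp]
            additive_compose[OF H B.diff_T_additive] additive_compose[OF A.diff_T_additive H])
      fix y x assume yx: "y \<in> carrier Y" "x \<in> carrier X"
      have k: "koszul Y' (h y) = \<ominus>\<^bsub>Y'\<^esub> h (koszul Y y)"
        by (rule koszul_odd_map[OF A.Y.premf_axioms B.Y.premf_axioms])
          (use h yx in \<open>auto simp: is_homotopy_def\<close>)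
      show "tm \<beta> \<psi> (A.p y x) = tm \<alpha> \<psi> (A.p y x) \<oplus>\<^bsub>B.T\<^esub>
          (diff B.T (?H (A.p y x)) \<oplus>\<^bsub>B.T\<^esub> ?H (diff A.T (A.p y x)))"
        using yx by (simp add: A.diff_pure B.diff_pure additive_add[OF H] tensor_map_pure[OF lh lp]
            tensor_map_pure[OF la lp] tensor_map_pure[OF lb lp] is_linearD(2)[OF la] is_linearD(2)[OF lp]
            is_linearD(2)[OF lh] is_mf_mapD(4)[OF \<psi>] k eq B.pure_add_left B.pure_neg_left B.TT.ab_simps)
    qed
  qed
qed

end

lemma homotopic_left:
  assumes "tensor_pair n m Y X" "tensor_pair n m Y X'"
    and \<alpha>: "is_mf_map m X X' \<alpha>" and \<beta>: "is_mf_map m X X' \<beta>" and ho: "homotopic m X X' \<alpha> \<beta>"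
  shows "homotopic m (tensor n Y X) (tensor n Y X')
    (tensor_map n Y X Y X' (\<lambda>y. y) \<alpha>) (tensor_map n Y X Y X' (\<lambda>y. y) \<beta>)"
proof -
  interpret A: tensor_pair n m Y X by fact
  interpret B: tensor_pair n m Y X' by fact
  interpret tensor_pairs n m Y X Y X' ..
  note la = is_mf_mapD(1)[OF \<alpha>] and lb = is_mf_mapD(1)[OF \<beta>]
    and li = is_mf_mapD(1)[OF is_mf_map_id[of "n + n" Y]]
  obtain h where h: "is_homotopy m X X' h"
    and eq: "\<And>x. x \<in> carrier X \<Longrightarrow> \<beta> x = \<alpha> x \<oplus>\<^bsub>X'\<^esub> (diff X' (h x) \<oplus>\<^bsub>X'\<^esub> h (diff X x))"
    using homotopicE[OF A.X.premf_axioms B.X.premf_axioms ho] is_linearD(2)[OF la] is_linearD(2)[OF lb] by metis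
  note lh = is_homotopy_linear[OF h] and lk = A.Y.koszul_linear
  \<comment> \<open>Moving the odd map h past an element of Y costs a sign; without it the terms
    containing d_Y would add instead of cancelling.\<close>
  let ?H = "tm (koszul Y) h"
  note H = tensor_map_additive[OF lk lh]
  show ?thesis
  proof (rule homotopicI[OF A.premf_T B.premf_T, of ?H])
    have "koszul Y ` evens Y \<subseteq> evens Y" "koszul Y ` odds Y \<subseteq> odds Y" by auto
    then show "is_homotopy m A.T B.T ?H"
      using tensor_map_linear[OF lk lh] tensor_map_odd_right[OF lk lh] h
      by (simp add: is_homotopy_def is_linear_def)
    show "tm (\<lambda>y. y) \<alpha> t \<in> carrier B.T" if "t \<in> carrier A.T" for t
      using additive_closed[OF tensor_map_additive[OF li la] that] .
    fix t assume t: "t \<in> carrier A.T"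
    show "tm (\<lambda>y. y) \<beta> t = tm (\<lambda>y. y) \<alpha> t \<oplus>\<^bsub>B.T\<^esub> (diff B.T (?H t) \<oplus>\<^bsub>B.T\<^esub> ?H (diff A.T t))"
    proof (rule A.tensor_additive_eqI[OF B.T_ab tensor_map_additive[OF li lb] _ t,
          of "\<lambda>t. tm (\<lambda>y. y) \<alpha> t \<oplus>\<^bsub>B.T\<^esub> (diff B.T (?H t) \<oplus>\<^bsub>B.T\<^esub> ?H (diff A.T t))"])
      show "additive A.T B.T (\<lambda>t. tm (\<lambda>y. y) \<alpha> t \<oplus>\<^bsub>B.T\<^esub> (diff B.T (?H t) \<oplus>\<^bsub>B.T\<^esub> ?H (diff A.T t)))"
        by (intro additive_plus[OF B.T_ab] tensor_map_additive[OF li la]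
            additive_compose[OF H B.diff_T_additive] additive_compose[OF A.diff_T_additive H])
      fix y x assume yx: "y \<in> carrier Y" "x \<in> carrier X"
      then show "tm (\<lambda>y. y) \<beta> (A.p y x) = tm (\<lambda>y. y) \<alpha> (A.p y x) \<oplus>\<^bsub>B.T\<^esub>
          (diff B.T (?H (A.p y x)) \<oplus>\<^bsub>B.T\<^esub> ?H (diff A.T (A.p y x)))"
        by (simp add: A.diff_pure B.diff_pure additive_add[OF H] tensor_map_pure[OF lk lh]
            tensor_map_pure[OF li la] tensor_map_pure[OF li lb] is_linearD(2)[OF la]
            is_linearD(2)[OF lh] eq A.Y.koszul_diff B.pure_add_right B.pure_neg_left B.TT.ab_simps)
    qed
  qed
qed

lemma whisker_left_hclass:
  assumes Y: "premf (n + n) Y" and X: "premf n X" and X': "premf n X'" and \<psi>: "\<psi> \<in> mf_maps n X X'"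
  shows "whisker_left n Y X X' (hclass n X X' \<psi>) =
    hclass n (tensor n Y X) (tensor n Y X') (tensor_map n Y X Y X' (\<lambda>y. y) \<psi>)"
proof -
  have t: "tensor_pair n n Y X" "tensor_pair n n Y X'"
    using assms by (simp_all add: tensor_pair_def tensor_pair_axioms_def)
  interpret A: tensor_pair n n Y X by (rule t)
  interpret B: tensor_pair n n Y X' by (rule t)
  interpret tensor_pairs n n Y X Y X' ..
  have m: "tm (\<lambda>y. y) \<psi>' \<in> mf_maps n A.T B.T" if "\<psi>' \<in> mf_maps n X X'" for \<psi>'
    by (rule tensor_map_mf_maps[OF is_mf_map_id mf_maps_is_mf_map[OF that]])
  show ?thesis unfolding whisker_left_def
  proof (rule UN_hclass_eq)
    show "\<psi> \<in> hclass n X X' \<psi>" by (rule hclass_self[OF X X' \<psi>])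
    fix \<psi>' assume "\<psi>' \<in> hclass n X X' \<psi>"
    then have *: "\<psi>' \<in> mf_maps n X X'" "homotopic n X X' \<psi> \<psi>'" by (auto simp: hclass_def)
    then have "homotopic n A.T B.T (tm (\<lambda>y. y) \<psi>) (tm (\<lambda>y. y) \<psi>')"
      by (intro homotopic_left[OF t]) (auto intro: mf_maps_is_mf_map \<psi>)
    then show "hclass n A.T B.T (tm (\<lambda>y. y) \<psi>') = hclass n A.T B.T (tm (\<lambda>y. y) \<psi>)"
      using hclass_eq[OF A.premf_T B.premf_T m[OF \<psi>] m[OF *(1)]] by simp
  qed
qed

lemma whisker_right_hclass:
  assumes Y: "premf (n + n) Y" and Y': "premf (n + n) Y'" and X: "premf n X"
    and \<psi>: "\<psi> \<in> mf_maps (n + n) Y Y'"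
  shows "whisker_right n Y Y' X (hclass (n + n) Y Y' \<psi>) =
    hclass n (tensor n Y X) (tensor n Y' X) (tensor_map n Y X Y' X \<psi> (\<lambda>x. x))"
proof -
  have t: "tensor_pair n n Y X" "tensor_pair n n Y' X"
    using assms by (simp_all add: tensor_pair_def tensor_pair_axioms_def)
  interpret A: tensor_pair n n Y X by (rule t)
  interpret B: tensor_pair n n Y' X by (rule t)
  interpret tensor_pairs n n Y X Y' X ..
  have m: "tm \<psi>' (\<lambda>x. x) \<in> mf_maps n A.T B.T" if "\<psi>' \<in> mf_maps (n + n) Y Y'" for \<psi>'
    by (rule tensor_map_mf_maps[OF mf_maps_is_mf_map[OF that] is_mf_map_id])
  show ?thesis unfolding whisker_right_def
  proof (rule UN_hclass_eq)
    show "\<psi> \<in> hclass (n + n) Y Y' \<psi>" by (rule hclass_self[OF Y Y' \<psi>])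
    fix \<psi>' assume "\<psi>' \<in> hclass (n + n) Y Y' \<psi>"
    then have *: "\<psi>' \<in> mf_maps (n + n) Y Y'" "homotopic (n + n) Y Y' \<psi> \<psi>'" by (auto simp: hclass_def)
    then have "homotopic n A.T B.T (tm \<psi> (\<lambda>x. x)) (tm \<psi>' (\<lambda>x. x))"
      by (intro homotopic_right mf_maps_is_mf_map is_mf_map_id) (use \<psi> in auto)
    then show "hclass n A.T B.T (tm \<psi>' (\<lambda>x. x)) = hclass n A.T B.T (tm \<psi> (\<lambda>x. x))"
      using hclass_eq[OF A.premf_T B.premf_T m[OF \<psi>] m[OF *(1)]] by simp
  qed
qed

text \<open>In a composite of two endomorphisms of W the primed variables of the product are those
  of the right factor. Constants can be moved across the tensor sign because \<open>primed\<close>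
  fixes them.\<close>

lemma (in tensor_pair) smult_primed:
  assumes "m = n + n" "s \<in> polys n" "y \<in> carrier Y" "x \<in> carrier X"
  shows "primed n s \<odot>\<^bsub>T\<^esub> p y x = p y (primed n s \<odot>\<^bsub>X\<^esub> x)"
  using assms(2,4)
proof (induction s arbitrary: x rule: polys_induct)
  case (Const c)
  then have "p y (Const c \<odot>\<^bsub>X\<^esub> x) = p (Const c \<odot>\<^bsub>Y\<^esub> y) x"
    using pure_balanced[of y x "Const c"] assms by simp
  then show ?case using Const assms by (simp add: smult_Const)
next
  case (Var i)
  then show ?case using assms by (simp add: smult_Var)
next
  case (add f g)
  then show ?case using assms by (simp add: smult_distrib X.add_smult pure_add_right)
next
  case (mult f g)
  then show ?case using assms by (simp add: smult_assoc X.smult_smult)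
qed

section \<open>The associator and its inverse\<close>

locale tensor_triple = Z: premf "n + n" Z + Y: premf "n + n" Y + X: premf n X
  for n :: nat and Z :: "('k::comm_ring_1 mpoly, 'z) mf" and Y :: "('k mpoly, 'y) mf"
    and X :: "('k mpoly, 'x) mf"
begin

sublocale ZY: tensor_pair n "n + n" Z Y
  by unfold_locales simp

sublocale YX: tensor_pair n n Y X
  by unfold_locales simp

sublocale L: tensor_pair n n "tensor n Z Y" X
  by (intro tensor_pair.intro ZY.premf_T X.premf_axioms tensor_pair_axioms.intro) simp

sublocale R: tensor_pair n n Z "tensor n Y X"
  by (intro tensor_pair.intro YX.premf_T Z.premf_axioms tensor_pair_axioms.intro) simp

text \<open>Triple pure tensors generate additively: apply the same fact to the outer and to the
  inner product.\<close>

lemma L_eqI: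
  assumes N: "abelian_group N" and f: "additive L.T N f" and g: "additive L.T N g" and t: "t \<in> carrier L.T"
    and eq: "\<And>z y x. z \<in> carrier Z \<Longrightarrow> y \<in> carrier Y \<Longrightarrow> x \<in> carrier X \<Longrightarrow>
      f (L.p (ZY.p z y) x) = g (L.p (ZY.p z y) x)"
  shows "f t = g t"
proof (rule L.tensor_additive_eqI[OF N f g t])
  fix s x assume s: "s \<in> carrier ZY.T" and x: "x \<in> carrier X"
  show "f (L.p s x) = g (L.p s x)"
    by (rule ZY.tensor_additive_eqI[OF N additive_compose[OF L.pure_additive_left[OF x] f]
          additive_compose[OF L.pure_additive_left[OF x] g] s]) (simp add: eq x)
qed

lemma R_eqI:
  assumes N: "abelian_group N" and f: "additive R.T N f" and g: "additive R.T N g" and t: "t \<in> carrier R.T"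
    and eq: "\<And>z y x. z \<in> carrier Z \<Longrightarrow> y \<in> carrier Y \<Longrightarrow> x \<in> carrier X \<Longrightarrow>
      f (R.p z (YX.p y x)) = g (R.p z (YX.p y x))"
  shows "f t = g t"
proof (rule R.tensor_additive_eqI[OF N f g t])
  fix z s assume z: "z \<in> carrier Z" and s: "s \<in> carrier YX.T"
  show "f (R.p z s) = g (R.p z s)"
    by (rule YX.tensor_additive_eqI[OF N additive_compose[OF R.pure_additive_right[OF z] f]
          additive_compose[OF R.pure_additive_right[OF z] g] s]) (simp add: eq z)
qed

lemma assoc_inner_balanced:
  assumes "x \<in> carrier X" shows "balanced n Z Y R.T (\<lambda>z y. R.p z (YX.p y x))"
  by (rule balancedI)
    (use assms in \<open>simp_all add: R.pure_add_left R.pure_add_right YX.pure_add_left R.pure_balanced YX.smult_left\<close>)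

abbreviation "assoc_inner x \<equiv> tensor_lift n Z Y R.T (\<lambda>z y. R.p z (YX.p y x))"

lemmas assoc_inner = tensor_pair.tensor_lift[OF ZY.tensor_pair_axioms R.T_ab assoc_inner_balanced]

lemma assoc_balanced: "balanced n ZY.T X R.T (\<lambda>t x. assoc_inner x t)"
proof (rule balancedI)
  fix t x assume t: "t \<in> carrier ZY.T" and x: "x \<in> carrier X"
  show "assoc_inner x t \<in> carrier R.T" by (rule additive_closed[OF assoc_inner(1)[OF x] t])
  show "assoc_inner x (t \<oplus>\<^bsub>ZY.T\<^esub> t') = assoc_inner x t \<oplus>\<^bsub>R.T\<^esub> assoc_inner x t'"
    if "t' \<in> carrier ZY.T" for t'
    by (rule additive_add[OF assoc_inner(1)[OF x] t that])
  show "assoc_inner (x \<oplus>\<^bsub>X\<^esub> x') t = assoc_inner x t \<oplus>\<^bsub>R.T\<^esub> assoc_inner x' t"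
    if x': "x' \<in> carrier X" for x'
    by (rule ZY.tensor_additive_eqI[OF R.T_ab assoc_inner(1) additive_plus[OF R.T_ab assoc_inner(1) assoc_inner(1)] t])
      (use x x' in \<open>simp_all add: assoc_inner(2) YX.pure_add_right R.pure_add_right\<close>)
  fix s :: "'k mpoly" assume s: "s \<in> polys n"
  have s': "primed n s \<in> polys (n + n)" using s by simp
  show "assoc_inner x (primed n s \<odot>\<^bsub>ZY.T\<^esub> t) = assoc_inner (s \<odot>\<^bsub>X\<^esub> x) t"
    by (rule ZY.tensor_additive_eqI[OF R.T_ab
          additive_compose[OF ZY.smult_additive[OF s'] assoc_inner(1)] assoc_inner(1) t])
      (use x s in \<open>simp_all add: assoc_inner(2) ZY.smult_primed YX.pure_balanced\<close>)
qed

abbreviation "assoc \<equiv> assoc_map n Z Y X"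

lemmas assoc_lift = tensor_pair.tensor_lift[OF L.tensor_pair_axioms R.T_ab assoc_balanced,
    folded assoc_map_def[unfolded Let_def]]

lemma assoc_pure:
  "z \<in> carrier Z \<Longrightarrow> y \<in> carrier Y \<Longrightarrow> x \<in> carrier X \<Longrightarrow> assoc (L.p (ZY.p z y) x) = R.p z (YX.p y x)"
  by (simp add: assoc_lift(2) assoc_inner(2))

lemma assoc_parity:
  "t \<in> evens ZY.T \<Longrightarrow> x \<in> evens X \<Longrightarrow> assoc (L.p t x) \<in> evens R.T"
  "t \<in> evens ZY.T \<Longrightarrow> x \<in> odds X \<Longrightarrow> assoc (L.p t x) \<in> odds R.T"
  by (induction t rule: ZY.evens_T_induct;
      simp add: assoc_pure L.pure_add_left additive_add[OF assoc_lift(1)])+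

lemma assoc_parity':
  "t \<in> odds ZY.T \<Longrightarrow> x \<in> evens X \<Longrightarrow> assoc (L.p t x) \<in> odds R.T"
  "t \<in> odds ZY.T \<Longrightarrow> x \<in> odds X \<Longrightarrow> assoc (L.p t x) \<in> evens R.T"
  by (induction t rule: ZY.odds_T_induct;
      simp add: assoc_pure L.pure_add_left additive_add[OF assoc_lift(1)])+

lemma assoc_mf_maps: "assoc \<in> mf_maps n L.T R.T"
proof (rule mf_maps_extI[OF L.premf_T assoc_lift(1) assoc_lift(3)])
  show "assoc t \<in> evens R.T" if "t \<in> evens L.T" for t using that
    by (induction rule: L.evens_T_induct)
      (simp_all add: assoc_parity assoc_parity' additive_add[OF assoc_lift(1)])
  show "assoc t \<in> odds R.T" if "t \<in> odds L.T" for t using that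
    by (induction rule: L.odds_T_induct)
      (simp_all add: assoc_parity assoc_parity' additive_add[OF assoc_lift(1)])
  fix t assume t: "t \<in> carrier L.T"
  show "assoc (r \<odot>\<^bsub>L.T\<^esub> t) = r \<odot>\<^bsub>R.T\<^esub> assoc t" if r: "r \<in> polys n" for r
    by (rule L_eqI[OF R.T_ab additive_compose[OF L.smult_additive[OF r] assoc_lift(1)]
          additive_compose[OF assoc_lift(1) R.smult_additive[OF r]] t])
      (use r in \<open>simp add: assoc_pure L.smult_left R.smult_left ZY.smult_left\<close>)
  show "assoc (diff L.T t) = diff R.T (assoc t)"
    by (rule L_eqI[OF R.T_ab additive_compose[OF L.diff_T_additive assoc_lift(1)]
          additive_compose[OF assoc_lift(1) R.diff_T_additive] t])
      (simp add: assoc_pure L.diff_pure R.diff_pure ZY.diff_pure YX.diff_pure ZY.koszul_pure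
        L.pure_add_left R.pure_add_right additive_add[OF assoc_lift(1)] R.TT.ac)
qed

lemma unassoc_inner_balanced:
  assumes "z \<in> carrier Z" shows "balanced n Y X L.T (\<lambda>y x. L.p (ZY.p z y) x)"
  by (rule balancedI)
    (use assms in \<open>simp_all add: L.pure_add_left L.pure_add_right ZY.pure_add_right
      ZY.smult_primed[symmetric] L.pure_balanced\<close>)

text \<open>Inverse of the associator. It carries sections built on \<open>A\<close> \<otimes>
  (\<open>A\<close> \<otimes> X) back to (\<open>A\<close> \<otimes> \<open>A\<close>) \<otimes> X,
  the source of both sides of the associativity law.\<close>

definition unassoc where
  "unassoc = tensor_lift n Z YX.T L.T (\<lambda>z. tensor_lift n Y X L.T (\<lambda>y x. L.p (ZY.p z y) x))"

abbreviation "unassoc_inner z \<equiv> tensor_lift n Y X L.T (\<lambda>y x. L.p (ZY.p z y) x)"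

lemmas unassoc_inner = tensor_pair.tensor_lift[OF YX.tensor_pair_axioms L.T_ab unassoc_inner_balanced]

lemma unassoc_balanced: "balanced n Z YX.T L.T (\<lambda>z. unassoc_inner z)"
proof (rule balancedI)
  fix z t assume z: "z \<in> carrier Z" and t: "t \<in> carrier YX.T"
  show "unassoc_inner z t \<in> carrier L.T" by (rule additive_closed[OF unassoc_inner(1)[OF z] t])
  show "unassoc_inner z (t \<oplus>\<^bsub>YX.T\<^esub> t') = unassoc_inner z t \<oplus>\<^bsub>L.T\<^esub> unassoc_inner z t'"
    if "t' \<in> carrier YX.T" for t'
    by (rule additive_add[OF unassoc_inner(1)[OF z] t that])
  show "unassoc_inner (z \<oplus>\<^bsub>Z\<^esub> z') t = unassoc_inner z t \<oplus>\<^bsub>L.T\<^esub> unassoc_inner z' t"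
    if z': "z' \<in> carrier Z" for z'
    by (rule YX.tensor_additive_eqI[OF L.T_ab unassoc_inner(1)
          additive_plus[OF L.T_ab unassoc_inner(1) unassoc_inner(1)] t])
      (use z z' in \<open>simp_all add: unassoc_inner(2) ZY.pure_add_left L.pure_add_left\<close>)
  fix s :: "'k mpoly" assume s: "s \<in> polys n"
  show "unassoc_inner (primed n s \<odot>\<^bsub>Z\<^esub> z) t = unassoc_inner z (s \<odot>\<^bsub>YX.T\<^esub> t)"
    by (rule YX.tensor_additive_eqI[OF L.T_ab unassoc_inner(1)
          additive_compose[OF YX.smult_additive[OF s] unassoc_inner(1)] t])
      (use z s in \<open>simp_all add: unassoc_inner(2) YX.smult_left ZY.pure_balanced\<close>)
qed

lemmas unassoc_lift = tensor_pair.tensor_lift[OF R.tensor_pair_axioms L.T_ab unassoc_balanced,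
    folded unassoc_def]

lemma unassoc_pure:
  "z \<in> carrier Z \<Longrightarrow> y \<in> carrier Y \<Longrightarrow> x \<in> carrier X \<Longrightarrow> unassoc (R.p z (YX.p y x)) = L.p (ZY.p z y) x"
  by (simp add: unassoc_lift(2) unassoc_inner(2))

lemma unassoc_parity:
  "t \<in> evens YX.T \<Longrightarrow> z \<in> evens Z \<Longrightarrow> unassoc (R.p z t) \<in> evens L.T"
  "t \<in> evens YX.T \<Longrightarrow> z \<in> odds Z \<Longrightarrow> unassoc (R.p z t) \<in> odds L.T"
  by (induction t rule: YX.evens_T_induct;
      simp add: unassoc_pure R.pure_add_right additive_add[OF unassoc_lift(1)])+

lemma unassoc_parity':
  "t \<in> odds YX.T \<Longrightarrow> z \<in> evens Z \<Longrightarrow> unassoc (R.p z t) \<in> odds L.T"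
  "t \<in> odds YX.T \<Longrightarrow> z \<in> odds Z \<Longrightarrow> unassoc (R.p z t) \<in> evens L.T"
  by (induction t rule: YX.odds_T_induct;
      simp add: unassoc_pure R.pure_add_right additive_add[OF unassoc_lift(1)])+

lemma unassoc_mf_maps: "unassoc \<in> mf_maps n R.T L.T"
proof (rule mf_maps_extI[OF R.premf_T unassoc_lift(1) unassoc_lift(3)])
  show "unassoc t \<in> evens L.T" if "t \<in> evens R.T" for t using that
    by (induction rule: R.evens_T_induct)
      (simp_all add: unassoc_parity unassoc_parity' additive_add[OF unassoc_lift(1)])
  show "unassoc t \<in> odds L.T" if "t \<in> odds R.T" for t using that
    by (induction rule: R.odds_T_induct)
      (simp_all add: unassoc_parity unassoc_parity' additive_add[OF unassoc_lift(1)])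
  fix t assume t: "t \<in> carrier R.T"
  show "unassoc (r \<odot>\<^bsub>R.T\<^esub> t) = r \<odot>\<^bsub>L.T\<^esub> unassoc t" if r: "r \<in> polys n" for r
    by (rule R_eqI[OF L.T_ab additive_compose[OF R.smult_additive[OF r] unassoc_lift(1)]
          additive_compose[OF unassoc_lift(1) L.smult_additive[OF r]] t])
      (use r in \<open>simp add: unassoc_pure L.smult_left R.smult_left ZY.smult_left\<close>)
  show "unassoc (diff R.T t) = diff L.T (unassoc t)"
    by (rule R_eqI[OF L.T_ab additive_compose[OF R.diff_T_additive unassoc_lift(1)]
          additive_compose[OF unassoc_lift(1) L.diff_T_additive] t])
      (simp add: unassoc_pure L.diff_pure R.diff_pure ZY.diff_pure YX.diff_pure ZY.koszul_pure
        L.pure_add_left R.pure_add_right additive_add[OF unassoc_lift(1)] L.TT.ac)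
qed

lemma assoc_unassoc: "t \<in> carrier R.T \<Longrightarrow> assoc (unassoc t) = t"
  by (rule R_eqI[OF R.T_ab additive_compose[OF unassoc_lift(1) assoc_lift(1)] additive_id])
    (simp_all add: unassoc_pure assoc_pure)

end

section \<open>The unit 1-morphism\<close>

lemma theta_sign_insert:
  assumes "finite S" "j \<notin> S"
  shows "theta_sign i (insert j S) = (if j < i then - theta_sign i S else theta_sign i S)"
proof -
  have "{k \<in> insert j S. k < i} = (if j < i then insert j {k \<in> S. k < i} else {k \<in> S. k < i})" by auto
  then show ?thesis using assms by (simp add: theta_sign_def)
qed

lemma theta_sign_remove:
  assumes "finite S" "j \<in> S"
  shows "theta_sign i (S - {j}) =
    (if j < i then - theta_sign i S else theta_sign i S :: 'k::comm_ring_1 mpoly)"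
  using theta_sign_insert[of "S - {j}" j i, where ?'a = 'k] assms
  by (simp add: insert_absorb split: if_splits)

lemma theta_sign_sq: "theta_sign i S * theta_sign i S = 1"
  by (simp add: theta_sign_def flip: power_add)

lemma theta_sign_sq': "theta_sign i S * (theta_sign i S * f) = f"
  by (simp add: theta_sign_sq flip: mult.assoc)

lemma theta_sign_polys [simp]: "theta_sign i S \<in> polys m"
  by (simp add: theta_sign_def)

lemma theta_sign_Min:
  assumes "\<And>j. j \<in> S \<Longrightarrow> i \<le> j" shows "theta_sign i S = 1"
proof -
  have "{j \<in> S. j < i} = {}" using assms by (auto simp: not_less)
  then show ?thesis unfolding theta_sign_def by (simp only: card.empty power_0)
qed

lemma unit_carrierD:
  assumes "\<omega> \<in> unit_carrier n"
  shows "\<omega> S \<in> polys (n + n)" "\<not> S \<subseteq> {..<n} \<Longrightarrow> \<omega> S = 0"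
  using assms by (auto simp: unit_carrier_def split: if_splits)

lemma unit_carrierI:
  "(\<And>S. S \<subseteq> {..<n} \<Longrightarrow> \<omega> S \<in> polys (n + n)) \<Longrightarrow> (\<And>S. \<not> S \<subseteq> {..<n} \<Longrightarrow> \<omega> S = 0) \<Longrightarrow>
    \<omega> \<in> unit_carrier n"
  by (simp add: unit_carrier_def)

lemma unit_carrier_filter:
  "\<omega> \<in> unit_carrier n \<Longrightarrow> (\<lambda>S. if P S then \<omega> S else 0) \<in> unit_carrier n"
  by (rule unit_carrierI) (simp_all add: unit_carrierD)

lemma unit_carrier_closed [simp]:
  "\<omega> \<in> unit_carrier n \<Longrightarrow> \<eta> \<in> unit_carrier n \<Longrightarrow> (\<lambda>S. \<omega> S + \<eta> S) \<in> unit_carrier n"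
  "r \<in> polys (n + n) \<Longrightarrow> \<omega> \<in> unit_carrier n \<Longrightarrow> (\<lambda>S. r * \<omega> S) \<in> unit_carrier n"
  "(\<lambda>S. 0) \<in> unit_carrier n"
  by (rule unit_carrierI; simp add: unit_carrierD)+

lemma unit_carrier_const:
  assumes "f \<in> polys n" shows "(\<lambda>S. if S = {} then f else 0) \<in> unit_carrier n"
proof (rule unit_carrierI)
  fix S :: "nat set"
  show "(if S = {} then f else 0) \<in> polys (n + n)" using polys_mono[OF assms, of "n + n"] by simp
  assume "\<not> S \<subseteq> {..<n}"
  then show "(if S = {} then f else 0) = 0" by (cases "S = {}") simp_all
qed

section \<open>The Koszul differential and its contraction\<close>

abbreviation xdiff :: "nat \<Rightarrow> nat \<Rightarrow> 'k::comm_ring_1 mpoly" where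
  "xdiff n i \<equiv> Var i - Var (n + i)"

text \<open>The Koszul differential of the sequence x_i - x'_i, lowering the theta-degree by one.
  \<open>koszul_diff1\<close> is the rest of the differential of I and raises the degree by one; it
  is treated as a perturbation.\<close>

definition koszul_diff0 :: "nat \<Rightarrow> 'k::comm_ring_1 ext \<Rightarrow> 'k ext" where
  "koszul_diff0 n \<omega> = (\<lambda>S. \<Sum>i<n. xdiff n i * theta_contract i \<omega> S)"

definition koszul_diff1 :: "nat \<Rightarrow> 'k::comm_ring_1 mpoly \<Rightarrow> 'k ext \<Rightarrow> 'k ext" where
  "koszul_diff1 n W \<omega> = (\<lambda>S. \<Sum>i<n. diff_quot n i W * theta_wedge i \<omega> S)"

text \<open>The contraction of the Koszul complex onto R: it takes the i-th quotient of a
  coefficient and multiplies by \<theta>_i on the left, for every i below all indices present. Hence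
  the coefficient at S arises from i = Min S alone, and no sign appears.\<close>

definition koszul_contraction :: "nat \<Rightarrow> 'k::comm_ring_1 ext \<Rightarrow> 'k ext" where
  "koszul_contraction n \<omega> = (\<lambda>S. if S = {} \<or> \<not> S \<subseteq> {..<n} then 0
     else merge_quot n (Min S) (\<omega> (S - {Min S})))"

lemma contract_carrier:
  assumes "\<omega> \<in> unit_carrier n"
  shows "theta_contract i \<omega> S \<in> polys (n + n)" "\<not> S \<subseteq> {..<n} \<Longrightarrow> theta_contract i \<omega> S = 0"
  using unit_carrierD[OF assms] by (auto simp: theta_contract_def)

lemma wedge_carrier:
  assumes "\<omega> \<in> unit_carrier n" "i < n"
  shows "theta_wedge i \<omega> S \<in> polys (n + n)" "\<not> S \<subseteq> {..<n} \<Longrightarrow> theta_wedge i \<omega> S = 0"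
proof -
  have "\<not> S \<subseteq> {..<n} \<Longrightarrow> \<not> S - {i} \<subseteq> {..<n}" using assms(2) by auto
  then show "theta_wedge i \<omega> S \<in> polys (n + n)" "\<not> S \<subseteq> {..<n} \<Longrightarrow> theta_wedge i \<omega> S = 0"
    using unit_carrierD[OF assms(1)] by (auto simp: theta_wedge_def)
qed

lemma I_simps [simp]:
  "carrier (I_mf n W) = unit_carrier n" "\<zero>\<^bsub>I_mf n W\<^esub> = (\<lambda>S. 0)"
  "\<omega> \<oplus>\<^bsub>I_mf n W\<^esub> \<eta> = (\<lambda>S. \<omega> S + \<eta> S)" "r \<odot>\<^bsub>I_mf n W\<^esub> \<omega> = (\<lambda>S. r * \<omega> S)"
  "evens (I_mf n W) = {\<omega> \<in> unit_carrier n. \<forall>S. odd (card S) \<longrightarrow> \<omega> S = 0}"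
  "odds (I_mf n W) = {\<omega> \<in> unit_carrier n. \<forall>S. even (card S) \<longrightarrow> \<omega> S = 0}"
  by (simp_all add: I_mf_def)

lemma I_diff: "diff (I_mf n W) \<omega> = (\<lambda>S. koszul_diff0 n \<omega> S + koszul_diff1 n W \<omega> S)"
  by (simp add: I_mf_def koszul_diff0_def koszul_diff1_def sum.distrib)

lemma koszul_diff0_carrier: "\<omega> \<in> unit_carrier n \<Longrightarrow> koszul_diff0 n \<omega> \<in> unit_carrier n"
  by (rule unit_carrierI)
    (auto simp: koszul_diff0_def contract_carrier intro!: polys_sum polys_mult polys_diff polys_Var)

lemma koszul_diff1_carrier: "W \<in> polys n \<Longrightarrow> \<omega> \<in> unit_carrier n \<Longrightarrow> koszul_diff1 n W \<omega> \<in> unit_carrier n"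
  by (rule unit_carrierI)
    (auto simp: koszul_diff1_def wedge_carrier diff_quot_polys intro!: polys_sum polys_mult)

lemma Min_less: "S \<subseteq> {..<n} \<Longrightarrow> S \<noteq> {} \<Longrightarrow> Min S < (n :: nat)"
  by (meson Min_in finite_lessThan finite_subset lessThan_iff subsetD)

lemma koszul_contraction_carrier: "\<omega> \<in> unit_carrier n \<Longrightarrow> koszul_contraction n \<omega> \<in> unit_carrier n"
proof (rule unit_carrierI)
  fix S assume "\<omega> \<in> unit_carrier n" "S \<subseteq> {..<n}"
  moreover from this have "S \<noteq> {} \<Longrightarrow> Min S < n" by (simp add: Min_less)
  ultimately show "koszul_contraction n \<omega> S \<in> polys (n + n)"
    by (auto simp: koszul_contraction_def intro: merge_quot_polys unit_carrierD)
qed (auto simp: koszul_contraction_def)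

lemma koszul_diff0_add: "koszul_diff0 n (\<lambda>S. \<omega> S + \<eta> S) = (\<lambda>S. koszul_diff0 n \<omega> S + koszul_diff0 n \<eta> S)"
  and koszul_diff1_add: "koszul_diff1 n W (\<lambda>S. \<omega> S + \<eta> S) = (\<lambda>S. koszul_diff1 n W \<omega> S + koszul_diff1 n W \<eta> S)"
  by (auto simp: koszul_diff0_def koszul_diff1_def theta_contract_def theta_wedge_def
      sum.distrib[symmetric] algebra_simps fun_eq_iff intro!: sum.cong)

lemma koszul_diff0_smult: "koszul_diff0 n (\<lambda>S. r * \<omega> S) = (\<lambda>S. r * koszul_diff0 n \<omega> S)"
  and koszul_diff1_smult: "koszul_diff1 n W (\<lambda>S. r * \<omega> S) = (\<lambda>S. r * koszul_diff1 n W \<omega> S)"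
  by (auto simp: koszul_diff0_def koszul_diff1_def theta_contract_def theta_wedge_def
      sum_distrib_left algebra_simps fun_eq_iff intro!: sum.cong)

lemma I_diff_carrier:
  assumes "W \<in> polys n" "\<omega> \<in> unit_carrier n"
  shows "diff (I_mf n W) \<omega> \<in> unit_carrier n"
  unfolding I_diff
  using unit_carrierD[OF koszul_diff0_carrier[OF assms(2)]]
    unit_carrierD[OF koszul_diff1_carrier[OF assms]]
  by (intro unit_carrierI) auto

lemma koszul_contraction_add:
  assumes "\<omega> \<in> unit_carrier n" "\<eta> \<in> unit_carrier n"
  shows "koszul_contraction n (\<lambda>S. \<omega> S + \<eta> S) = (\<lambda>S. koszul_contraction n \<omega> S + koszul_contraction n \<eta> S)"
  by (auto simp: koszul_contraction_def fun_eq_iff merge_quot_add Min_less unit_carrierD[OF assms(1)]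
      unit_carrierD[OF assms(2)])

lemma koszul_contraction_smult:
  assumes "\<omega> \<in> unit_carrier n" "r \<in> polys n"
  shows "koszul_contraction n (\<lambda>S. r * \<omega> S) = (\<lambda>S. r * koszul_contraction n \<omega> S)"
  by (auto simp: koszul_contraction_def fun_eq_iff merge_quot_left assms Min_less unit_carrierD[OF assms(1)])

lemma sum_antisym:
  fixes a :: "nat \<Rightarrow> nat \<Rightarrow> 'a::ab_group_add"
  assumes "\<And>i j. i < n \<Longrightarrow> j < n \<Longrightarrow> i \<noteq> j \<Longrightarrow> a i j + a j i = 0"
  shows "(\<Sum>i<n. \<Sum>j<n. a i j) = (\<Sum>i<n. a i i)"
  using assms
proof (induction n)
  case (Suc n)
  have "(\<Sum>i<Suc n. \<Sum>j<Suc n. a i j) = (\<Sum>i<n. \<Sum>j<n. a i j) + (\<Sum>j<n. a j n + a n j) + a n n"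
    by (simp add: sum.distrib algebra_simps)
  also have "(\<Sum>j<n. a j n + a n j) = 0" by (rule sum.neutral) (use Suc.prems in auto)
  finally show ?case using Suc by simp
qed simp

text \<open>The summands e_i of the differential satisfy Clifford relations: distinct ones
  anticommute, and e_i squares to (x_i - x'_i) times the i-th difference quotient. The remaining sum
  telescopes by \<open>sum_diff_quot\<close>.\<close>

lemma I_diff_diff:
  assumes "W \<in> polys n" and \<omega>: "\<omega> \<in> unit_carrier n"
  shows "diff (I_mf n W) (diff (I_mf n W) \<omega>) = (\<lambda>S. (W - primed n W) * \<omega> S)"
proof (rule ext)
  fix S
  define e where "e i \<eta> S = xdiff n i * theta_contract i \<eta> S + diff_quot n i W * theta_wedge i \<eta> S"
    for i S and \<eta> :: "'a ext"
  have d: "diff (I_mf n W) \<eta> = (\<lambda>S. \<Sum>i<n. e i \<eta> S)" for \<eta>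
    by (simp add: I_mf_def e_def)
  note dc = I_diff_carrier[OF assms(1)]
  show "diff (I_mf n W) (diff (I_mf n W) \<omega>) S = (W - primed n W) * \<omega> S"
  proof (cases "S \<subseteq> {..<n}")
    case False
    then show ?thesis using unit_carrierD(2)[OF dc[OF dc[OF \<omega>]]] unit_carrierD(2)[OF \<omega>] by simp
  next
    case True
    then have fin: "finite S" using finite_subset by blast
    have e_sum: "e i (\<lambda>S. \<Sum>j<n. f j S) S = (\<Sum>j<n. e i (f j) S)" for i and f :: "nat \<Rightarrow> 'a ext"
      by (simp add: e_def theta_contract_def theta_wedge_def sum_distrib_left)
    have "diff (I_mf n W) (diff (I_mf n W) \<omega>) S = (\<Sum>i<n. \<Sum>j<n. e i (e j \<omega>) S)"
      unfolding d e_sum ..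
    also have "\<dots> = (\<Sum>i<n. e i (e i \<omega>) S)"
    proof (rule sum_antisym)
      fix i j :: nat assume ij: "i \<noteq> j"
      have s: "insert i S - {j} = insert i (S - {j})" "insert j S - {i} = insert j (S - {i})"
        "insert i (insert j S) = insert j (insert i S)" "S - {i} - {j} = S - {j} - {i}" using ij by auto
      show "e i (e j \<omega>) S + e j (e i \<omega>) S = 0"
        by (cases "i \<in> S"; cases "j \<in> S"; cases "i < j")
          (use ij s in \<open>auto simp: e_def theta_contract_def theta_wedge_def theta_sign_insert
            theta_sign_remove fin\<close>)
    qed
    also have "\<dots> = (\<Sum>i<n. (xdiff n i * diff_quot n i W) * \<omega> S)"
    proof (rule sum.cong[OF refl])
      fix i
      have "i \<in> S \<Longrightarrow> insert i (S - {i}) = S" "i \<notin> S \<Longrightarrow> insert i S - {i} = S" by auto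
      then show "e i (e i \<omega>) S = (xdiff n i * diff_quot n i W) * \<omega> S"
        using theta_sign_sq'[of i S] by (cases "i \<in> S")
          (simp_all add: e_def theta_contract_def theta_wedge_def theta_sign_insert theta_sign_remove fin
            mult.left_commute mult.assoc)
    qed
    also have "\<dots> = (W - primed n W) * \<omega> S"
      by (simp add: sum_diff_quot[OF assms(1)] flip: sum_distrib_right)
    finally show ?thesis .
  qed
qed

lemma koszul_diff0_even: "\<omega> \<in> unit_carrier n \<Longrightarrow> (\<And>S. odd (card S) \<Longrightarrow> \<omega> S = 0) \<Longrightarrow>
    even (card S) \<Longrightarrow> koszul_diff0 n \<omega> S = 0"
  and koszul_diff0_odd: "\<omega> \<in> unit_carrier n \<Longrightarrow> (\<And>S. even (card S) \<Longrightarrow> \<omega> S = 0) \<Longrightarrow>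
    odd (card S) \<Longrightarrow> koszul_diff0 n \<omega> S = 0"
proof -
  assume \<omega>: "\<omega> \<in> unit_carrier n"
  {
    fix P :: "nat \<Rightarrow> bool" assume P: "\<And>S. P (card S) \<Longrightarrow> \<omega> S = 0" and S: "P (Suc (card S))"
    have "theta_contract i \<omega> S = 0" for i
    proof (cases "S \<subseteq> {..<n}")
      case True
      then have "finite S" using finite_subset by blast
      then show ?thesis using P[of "insert i S"] S by (simp add: theta_contract_def)
    qed (simp add: contract_carrier[OF \<omega>])
    then have "koszul_diff0 n \<omega> S = 0" by (simp add: koszul_diff0_def)
  }
  from this[of odd] this[of even]
  show "(\<And>S. odd (card S) \<Longrightarrow> \<omega> S = 0) \<Longrightarrow> even (card S) \<Longrightarrow> koszul_diff0 n \<omega> S = 0"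
    "(\<And>S. even (card S) \<Longrightarrow> \<omega> S = 0) \<Longrightarrow> odd (card S) \<Longrightarrow> koszul_diff0 n \<omega> S = 0" by auto
qed

lemma koszul_diff1_even: "\<omega> \<in> unit_carrier n \<Longrightarrow> (\<And>S. odd (card S) \<Longrightarrow> \<omega> S = 0) \<Longrightarrow>
    even (card S) \<Longrightarrow> koszul_diff1 n W \<omega> S = 0"
  and koszul_diff1_odd: "\<omega> \<in> unit_carrier n \<Longrightarrow> (\<And>S. even (card S) \<Longrightarrow> \<omega> S = 0) \<Longrightarrow>
    odd (card S) \<Longrightarrow> koszul_diff1 n W \<omega> S = 0"
proof -
  assume \<omega>: "\<omega> \<in> unit_carrier n"
  {
    fix b :: bool assume P: "\<And>S. even (card S) = b \<Longrightarrow> \<omega> S = 0" and S: "even (card S) = (\<not> b)"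
    have "theta_wedge i \<omega> S = 0" if "i < n" for i
    proof (cases "S \<subseteq> {..<n} \<and> i \<in> S")
      case True
      then have "finite S" using finite_subset by blast
      with True have "card S = Suc (card (S - {i}))" by (metis card_Suc_Diff1)
      then show ?thesis using P[of "S - {i}"] S by (auto simp: theta_wedge_def)
    next
      case False
      then show ?thesis
        using wedge_carrier(2)[OF \<omega> that, of S] by (cases "i \<in> S") (simp_all add: theta_wedge_def)
    qed
    then have "koszul_diff1 n W \<omega> S = 0" by (simp add: koszul_diff1_def)
  }
  from this[of False] this[of True]
  show "(\<And>S. odd (card S) \<Longrightarrow> \<omega> S = 0) \<Longrightarrow> even (card S) \<Longrightarrow> koszul_diff1 n W \<omega> S = 0"
    "(\<And>S. even (card S) \<Longrightarrow> \<omega> S = 0) \<Longrightarrow> odd (card S) \<Longrightarrow> koszul_diff1 n W \<omega> S = 0" by auto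
qed

lemma koszul_contraction_even: "\<omega> \<in> unit_carrier n \<Longrightarrow> (\<And>S. odd (card S) \<Longrightarrow> \<omega> S = 0) \<Longrightarrow>
    even (card S) \<Longrightarrow> koszul_contraction n \<omega> S = 0"
  and koszul_contraction_odd: "\<omega> \<in> unit_carrier n \<Longrightarrow> (\<And>S. even (card S) \<Longrightarrow> \<omega> S = 0) \<Longrightarrow>
    odd (card S) \<Longrightarrow> koszul_contraction n \<omega> S = 0"
proof -
  assume \<omega>: "\<omega> \<in> unit_carrier n"
  {
    fix b :: bool assume P: "\<And>S. even (card S) = b \<Longrightarrow> \<omega> S = 0" and S: "even (card S) = (\<not> b)"
    have "koszul_contraction n \<omega> S = 0"
    proof (cases "S \<subseteq> {..<n} \<and> S \<noteq> {}")
      case True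
      then have "finite S" using finite_subset by blast
      with True have "card S = Suc (card (S - {Min S}))" by (metis Min_in card_Suc_Diff1)
      then have "\<omega> (S - {Min S}) = 0" using P[of "S - {Min S}"] S by auto
      then show ?thesis using True by (simp add: koszul_contraction_def Min_less)
    qed (auto simp: koszul_contraction_def)
  }
  from this[of False] this[of True]
  show "(\<And>S. odd (card S) \<Longrightarrow> \<omega> S = 0) \<Longrightarrow> even (card S) \<Longrightarrow> koszul_contraction n \<omega> S = 0"
    "(\<And>S. even (card S) \<Longrightarrow> \<omega> S = 0) \<Longrightarrow> odd (card S) \<Longrightarrow> koszul_contraction n \<omega> S = 0" by auto
qed

text \<open>With \<mu> = Min S, the terms i < \<mu> of the first composite telescope to the
  difference of \<open>\<omega> S\<close> and \<open>merge n \<mu> (\<omega> S)\<close>, the term i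
  = \<mu> of the second composite restores the latter, and the terms i > \<mu> of the two composites
  cancel. For S empty there is only the telescoping sum, and what it misses is the collapsed
  coefficient.\<close>

lemma koszul_contraction_homotopy:
  assumes \<omega>: "\<omega> \<in> unit_carrier n"
  shows "koszul_diff0 n (koszul_contraction n \<omega>) S + koszul_contraction n (koszul_diff0 n \<omega>) S +
    (if S = {} then collapse n (\<omega> {}) else 0) = \<omega> S"
proof -
  note \<omega>P = unit_carrierD(1)[OF \<omega>]
  have quot: "xdiff n i * merge_quot n i f = merge n i f - merge n (Suc i) f"
    if "i < n" "f \<in> polys (n + n)" for i f using merge_quot_eq[OF that(2,1)] .
  have tele: "(\<Sum>i<l. merge n i f - merge n (Suc i) f) = f - merge n l f" for l f
    by (subst sum_lessThan_telescope') (simp add: merge_0)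
  show ?thesis
  proof (cases "S \<subseteq> {..<n}")
    case False
    then show ?thesis
      using unit_carrierD(2)[OF koszul_diff0_carrier[OF koszul_contraction_carrier[OF \<omega>]]]
        unit_carrierD(2)[OF koszul_contraction_carrier[OF koszul_diff0_carrier[OF \<omega>]]]
        unit_carrierD(2)[OF \<omega>] by auto
  next
    case True
    then have fin: "finite S" using finite_subset by blast
    show ?thesis
    proof (cases "S = {}")
      case True
      have "koszul_diff0 n (koszul_contraction n \<omega>) {} =
          (\<Sum>i<n. merge n i (\<omega> {}) - merge n (Suc i) (\<omega> {}))"
        unfolding koszul_diff0_def
        by (rule sum.cong) (auto simp: theta_contract_def theta_sign_def koszul_contraction_def quot \<omega>P)
      then show ?thesis using True tele[of "\<omega> {}" n] merge_n[OF \<omega>P[of "{}"]]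
        by (simp add: koszul_contraction_def)
    next
      case False
      define \<mu> where "\<mu> = Min S"
      have \<mu>: "\<mu> \<in> S" "\<mu> < n" "\<And>j. j \<in> S \<Longrightarrow> \<mu> \<le> j"
        using False fin True unfolding \<mu>_def by (auto simp: Min_less)
      have card: "insert \<mu> (S - {\<mu>}) = S" using \<mu>(1) by auto
      \<comment> \<open>The terms above \<mu>. They enter the two composites with opposite signs,
        because \<mu> is counted in one theta-sign and missing from the other.\<close>
      let ?rest = "\<Sum>i\<in>{\<mu><..<n}. if i \<in> S then 0 else
        xdiff n i * (theta_sign i S * merge_quot n \<mu> (\<omega> (insert i S - {\<mu>})))"
      have split: "{..<n} = {..<\<mu>} \<union> ({\<mu>} \<union> {\<mu><..<n})" using \<mu>(2) by auto
      have sum_split: "(\<Sum>i<n. f i) = (\<Sum>i<\<mu>. f i) + (f \<mu> + (\<Sum>i\<in>{\<mu><..<n}. f i))"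
        for f :: "nat \<Rightarrow> 'a mpoly"
        unfolding split by (subst sum.union_disjoint; auto)
      have "koszul_diff0 n (koszul_contraction n \<omega>) S =
          (\<Sum>i<\<mu>. merge n i (\<omega> S) - merge n (Suc i) (\<omega> S)) + (0 + ?rest)"
        unfolding koszul_diff0_def sum_split
      proof (intro arg_cong2[of _ _ _ _ "(+)"] sum.cong refl)
        fix i assume "i \<in> {..<\<mu>}"
        then have i: "i < \<mu>" "i < n" "i \<notin> S" using \<mu> by fastforce+
        have "theta_sign i S = (1 :: 'a mpoly)" using i \<mu>(3) by (intro theta_sign_Min) fastforce
        moreover have "Min (insert i S) = i" using i \<mu>(3) fin by (intro Min_eqI) fastforce+
        moreover have "insert i S - {i} = S" using i by auto
        moreover have "insert i S \<subseteq> {..<n}" using i True by auto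
        ultimately show "xdiff n i * theta_contract i (koszul_contraction n \<omega>) S =
            merge n i (\<omega> S) - merge n (Suc i) (\<omega> S)"
          using i by (simp add: theta_contract_def koszul_contraction_def quot \<omega>P)
      next
        show "xdiff n \<mu> * theta_contract \<mu> (koszul_contraction n \<omega>) S = 0"
          using \<mu> by (simp add: theta_contract_def)
      next
        fix i assume i: "i \<in> {\<mu><..<n}"
        have "Min (insert i S) = \<mu>" using i \<mu> fin by (intro Min_eqI) fastforce+
        moreover have "insert i S \<subseteq> {..<n}" using i True by auto
        ultimately show "xdiff n i * theta_contract i (koszul_contraction n \<omega>) S =
            (if i \<in> S then 0 else
              xdiff n i * (theta_sign i S * merge_quot n \<mu> (\<omega> (insert i S - {\<mu>}))))"
          by (simp add: theta_contract_def koszul_contraction_def)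
      qed
      moreover have "koszul_contraction n (koszul_diff0 n \<omega>) S = 0 + (merge n \<mu> (\<omega> S) + - ?rest)"
      proof -
        have "koszul_contraction n (koszul_diff0 n \<omega>) S =
            merge_quot n \<mu> (\<Sum>i<n. xdiff n i * theta_contract i \<omega> (S - {\<mu>}))"
          using False True by (simp add: koszul_contraction_def koszul_diff0_def \<mu>_def)
        also have "\<dots> = (\<Sum>i<n. merge_quot n \<mu> (xdiff n i * theta_contract i \<omega> (S - {\<mu>})))"
          by (rule merge_quot_sum) (use \<mu> contract_carrier[OF \<omega>] in auto)
        also have "\<dots> = (\<Sum>i<\<mu>. 0) + (merge n \<mu> (\<omega> S) + (\<Sum>i\<in>{\<mu><..<n}. - (if i \<in> S then 0 else
            xdiff n i * (theta_sign i S * merge_quot n \<mu> (\<omega> (insert i S - {\<mu>}))))))"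
          unfolding sum_split
        proof (intro arg_cong2[of _ _ _ _ "(+)"] sum.cong refl)
          fix i assume "i \<in> {..<\<mu>}"
          then show "merge_quot n \<mu> (xdiff n i * theta_contract i \<omega> (S - {\<mu>})) = 0"
            using \<mu> contract_carrier[OF \<omega>] by (intro merge_quot_Var_diff_less) auto
        next
          have "theta_contract \<mu> \<omega> (S - {\<mu>}) = \<omega> S"
            using theta_sign_Min[of "S - {\<mu>}" \<mu>, where ?'a = 'a] \<mu>(3) card by (simp add: theta_contract_def)
          then show "merge_quot n \<mu> (xdiff n \<mu> * theta_contract \<mu> \<omega> (S - {\<mu>})) = merge n \<mu> (\<omega> S)"
            using \<mu> \<omega>P by (simp add: merge_quot_Var_diff_eq)
        next
          fix i assume i: "i \<in> {\<mu><..<n}"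
          have "merge_quot n \<mu> (xdiff n i * theta_contract i \<omega> (S - {\<mu>})) =
              xdiff n i * merge_quot n \<mu> (theta_contract i \<omega> (S - {\<mu>}))"
            using i contract_carrier[OF \<omega>] by (intro merge_quot_Var_diff_greater) auto
          also have "merge_quot n \<mu> (theta_contract i \<omega> (S - {\<mu>})) =
              - (if i \<in> S then 0 else theta_sign i S * merge_quot n \<mu> (\<omega> (insert i S - {\<mu>})))"
          proof (cases "i \<in> S")
            case False
            have "insert i (S - {\<mu>}) = insert i S - {\<mu>}" using i by auto
            moreover have "(theta_sign i (S - {\<mu>}) :: 'a mpoly) = - theta_sign i S"
              using theta_sign_remove[OF fin \<mu>(1), of i] i by simp
            ultimately show ?thesis
              using i False merge_quot_left[OF \<omega>P[of "insert i S - {\<mu>}"], of "- theta_sign i S" \<mu>] \<mu>(2)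
              by (simp add: theta_contract_def)
          qed (use i \<mu> in \<open>simp add: theta_contract_def\<close>)
          finally show "merge_quot n \<mu> (xdiff n i * theta_contract i \<omega> (S - {\<mu>})) =
              - (if i \<in> S then 0 else
                xdiff n i * (theta_sign i S * merge_quot n \<mu> (\<omega> (insert i S - {\<mu>}))))"
            by simp
        qed
        finally show ?thesis by (simp add: sum_negf)
      qed
      ultimately show ?thesis using False tele[of "\<omega> S" \<mu>] by simp
    qed
  qed
qed

lemma premf_I:
  assumes W: "W \<in> polys n" shows "premf (n + n) (I_mf n W)"
proof (rule premfI)
  show "abelian_group (I_mf n W)"
  proof (rule abelian_groupI)
    fix x assume "x \<in> carrier (I_mf n W)"
    then show "\<exists>y\<in>carrier (I_mf n W). y \<oplus>\<^bsub>I_mf n W\<^esub> x = \<zero>\<^bsub>I_mf n W\<^esub>"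
      by (intro bexI[of _ "\<lambda>S. - x S"]) (auto simp: unit_carrier_def)
  qed (auto simp: unit_carrier_def algebra_simps)
  fix \<omega> :: "'a ext" assume \<omega>: "\<omega> \<in> carrier (I_mf n W)"
  have eq: "\<omega> = (\<lambda>S. (if even (card S) then \<omega> S else 0) + (if odd (card S) then \<omega> S else 0))" by auto
  have ev: "(\<lambda>S. if even (card S) then \<omega> S else 0) \<in> evens (I_mf n W)"
    and od: "(\<lambda>S. if odd (card S) then \<omega> S else 0) \<in> odds (I_mf n W)"
    using \<omega> by (simp_all add: unit_carrier_filter)
  show "\<exists>a\<in>evens (I_mf n W). \<exists>b\<in>odds (I_mf n W). \<omega> = a \<oplus>\<^bsub>I_mf n W\<^esub> b"
    by (rule bexI[OF _ ev], rule bexI[OF _ od]) (simp only: I_simps, rule eq)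
  show "diff (I_mf n W) \<omega> \<in> carrier (I_mf n W)"
    using \<omega> I_diff_carrier[OF W] by simp
next
  fix \<omega> assume \<omega>: "\<omega> \<in> evens (I_mf n W)"
  then show "diff (I_mf n W) \<omega> \<in> odds (I_mf n W)"
    using koszul_diff0_even[of \<omega> n] koszul_diff1_even[of \<omega> n _ W] I_diff_carrier[OF W, of \<omega>]
    by (simp add: I_diff)
next
  fix \<omega> assume \<omega>: "\<omega> \<in> odds (I_mf n W)"
  then show "diff (I_mf n W) \<omega> \<in> evens (I_mf n W)"
    using koszul_diff0_odd[of \<omega> n] koszul_diff1_odd[of \<omega> n _ W] I_diff_carrier[OF W, of \<omega>]
    by (simp add: I_diff)
next
  fix \<omega> :: "'a ext" assume "\<omega> \<in> evens (I_mf n W)" "\<omega> \<in> odds (I_mf n W)"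
  then show "\<omega> = \<zero>\<^bsub>I_mf n W\<^esub>" by auto
next
  fix \<omega> \<eta> :: "'a ext" assume "\<omega> \<in> carrier (I_mf n W)" "\<eta> \<in> carrier (I_mf n W)"
  show "diff (I_mf n W) (\<omega> \<oplus>\<^bsub>I_mf n W\<^esub> \<eta>) = diff (I_mf n W) \<omega> \<oplus>\<^bsub>I_mf n W\<^esub> diff (I_mf n W) \<eta>"
    by (simp add: I_diff koszul_diff0_add koszul_diff1_add algebra_simps)
next
  fix r :: "'a mpoly" and \<omega> assume "r \<in> polys (n + n)" "\<omega> \<in> carrier (I_mf n W)"
  show "diff (I_mf n W) (r \<odot>\<^bsub>I_mf n W\<^esub> \<omega>) = r \<odot>\<^bsub>I_mf n W\<^esub> diff (I_mf n W) \<omega>"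
    by (simp add: I_diff koszul_diff0_smult koszul_diff1_smult algebra_simps)
qed (auto simp: distrib_left distrib_right mult.assoc)


section \<open>The algebra \<open>A\<^sub>G\<close>\<close>

locale symmetric_potential =
  fixes n :: nat and W :: "'k::comm_ring_1 mpoly" and G :: "('k mpoly \<Rightarrow> 'k mpoly) set"
  assumes W [simp]: "W \<in> polys n" and G: "symmetry_group n W G"
begin

abbreviation "A \<equiv> AG_mf n W G"
abbreviation "one\<^sub>G \<equiv> \<one>\<^bsub>BijGroup (polys n)\<^esub>"
abbreviation mult\<^sub>G (infixl \<open>\<cdot>\<close> 70) where "g \<cdot> h \<equiv> g \<otimes>\<^bsub>BijGroup (polys n)\<^esub> h"

lemma finite_G [simp]: "finite G"
  using G by (simp add: symmetry_group_def)

lemmas ginv_closed [simp] = symmetry_ginv[OF G]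
lemmas one_closed [simp] = symmetry_one(1)[OF G]
lemmas mult_closed [simp] = symmetry_mult(1)[OF G]
lemmas ginv_polys [simp] = poly_endoD(1)[OF ginv_endo[OF G]]

lemma on_left_ginv_endo: "g \<in> G \<Longrightarrow> poly_endo (n + n) (on_left n (ginv n g))"
  by (rule on_left_endo[OF ginv_endo[OF G]])

lemma on_left_ginv_left: "g \<in> G \<Longrightarrow> f \<in> polys n \<Longrightarrow> on_left n (ginv n g) f = ginv n g f"
  by (rule on_left_left[OF ginv_endo[OF G]])

lemmas on_left_polys [simp] = poly_endoD(1)[OF on_left_ginv_endo]

lemma premf_gI: "g \<in> G \<Longrightarrow> premf (n + n) (gI n W g)"
  unfolding gI_def by (rule premf_twist[OF premf_I[OF W] on_left_ginv_endo])

lemma premf_A: "premf (n + n) A"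
  unfolding AG_mf_def by (rule premf_mf_dsum[OF premf_gI])

sublocale A: premf "n + n" A by (rule premf_A)

lemma gI_simps [simp]:
  "carrier (gI n W g) = unit_carrier n" "\<zero>\<^bsub>gI n W g\<^esub> = (\<lambda>S. 0)"
  "\<omega> \<oplus>\<^bsub>gI n W g\<^esub> \<eta> = (\<lambda>S. \<omega> S + \<eta> S)"
  "r \<odot>\<^bsub>gI n W g\<^esub> \<omega> = (\<lambda>S. on_left n (ginv n g) r * \<omega> S)"
  "evens (gI n W g) = evens (I_mf n W)" "odds (gI n W g) = odds (I_mf n W)"
  "diff (gI n W g) = diff (I_mf n W)"
  by (simp_all add: gI_def)

lemma A_simps:
  "carrier A = G \<rightarrow>\<^sub>E unit_carrier n" "\<zero>\<^bsub>A\<^esub> = (\<lambda>g\<in>G. \<lambda>S. 0)" "a \<oplus>\<^bsub>A\<^esub> b = (\<lambda>g\<in>G. \<lambda>S. a g S + b g S)"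
  "r \<odot>\<^bsub>A\<^esub> a = (\<lambda>g\<in>G. \<lambda>S. on_left n (ginv n g) r * a g S)"
  "evens A = G \<rightarrow>\<^sub>E evens (I_mf n W)" "odds A = G \<rightarrow>\<^sub>E odds (I_mf n W)"
  "diff A a = (\<lambda>g\<in>G. diff (I_mf n W) (a g))"
  by (simp_all add: AG_mf_def)

lemma A_component: "a \<in> carrier A \<Longrightarrow> g \<in> G \<Longrightarrow> a g \<in> unit_carrier n"
  by (auto simp: A_simps)

lemma A_eqI: "a \<in> carrier A \<Longrightarrow> b \<in> carrier A \<Longrightarrow> (\<And>g S. g \<in> G \<Longrightarrow> a g S = b g S) \<Longrightarrow> a = b"
  unfolding A_simps by (rule PiE_ext) auto

text \<open>The twist of the left action by g does not show, because g fixes W; the primed variables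
  are not twisted at all.\<close>

lemma A_diff_diff:
  assumes "a \<in> carrier A" shows "diff A (diff A a) = (W - primed n W) \<odot>\<^bsub>A\<^esub> a"
proof (rule A_eqI)
  have W2: "W \<in> polys (n + n)" by (rule polys_mono[OF W]) simp
  then show "diff A (diff A a) \<in> carrier A" "(W - primed n W) \<odot>\<^bsub>A\<^esub> a \<in> carrier A"
    using assms by simp_all
  fix g S assume g: "g \<in> G"
  have "on_left n (ginv n g) (W - primed n W) = on_left n (ginv n g) W - on_left n (ginv n g) (primed n W)"
    by (simp add: on_left_def)
  also have "\<dots> = W - primed n W"
    using g by (simp add: on_left_ginv_left on_left_primed ginv_W[OF G])
  finally show "diff A (diff A a) g S = ((W - primed n W) \<odot>\<^bsub>A\<^esub> a) g S"
    using g A_component[OF assms g] by (simp add: A_simps I_diff_diff)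
qed

text \<open>The augmentation I \<rightarrow> R on the summand at g. A left scalar r comes out as
  g^(-1) r and a primed scalar as itself, which matches the action on the twisted module gX in
  \<open>proj\<close>.\<close>

definition eps where "eps g a = collapse n (a g {})" for g :: "'k mpoly \<Rightarrow> 'k mpoly" and a :: "'k AG"

lemma eps_closed [simp]: "a \<in> carrier A \<Longrightarrow> g \<in> G \<Longrightarrow> eps g a \<in> polys n"
  unfolding eps_def by (rule collapse_polys) (rule unit_carrierD[OF A_component])

lemma eps_add: "g \<in> G \<Longrightarrow> eps g (a \<oplus>\<^bsub>A\<^esub> b) = eps g a + eps g b"
  by (simp add: eps_def A_simps)

lemma eps_smult: "g \<in> G \<Longrightarrow> eps g (r \<odot>\<^bsub>A\<^esub> a) = collapse n (on_left n (ginv n g) r) * eps g a"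
  by (simp add: eps_def A_simps)

lemma eps_left: "g \<in> G \<Longrightarrow> r \<in> polys n \<Longrightarrow> eps g (r \<odot>\<^bsub>A\<^esub> a) = ginv n g r * eps g a"
  by (simp add: eps_smult on_left_ginv_left collapse_left)

lemma eps_primed: "g \<in> G \<Longrightarrow> s \<in> polys n \<Longrightarrow> eps g (primed n s \<odot>\<^bsub>A\<^esub> a) = s * eps g a"
  by (simp add: eps_smult on_left_primed collapse_primed)

text \<open>In theta-degree zero only contractions contribute, and their factors x_i - x'_i collapse
  to zero.\<close>

lemma collapse_I_diff: "collapse n (diff (I_mf n W) \<omega> {}) = 0"
  by (simp add: I_diff koszul_diff0_def koszul_diff1_def theta_wedge_def collapse_sum)

lemma eps_diff: "g \<in> G \<Longrightarrow> eps g (diff A a) = 0"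
  by (simp add: eps_def A_simps collapse_I_diff)

lemma eps_odd: "a \<in> odds A \<Longrightarrow> g \<in> G \<Longrightarrow> eps g a = 0"
  by (auto simp: eps_def A_simps PiE_iff)

lemma eps_koszul: "a \<in> carrier A \<Longrightarrow> g \<in> G \<Longrightarrow> eps g (koszul A a) = eps g a"
  by (elim A.decompE) (simp add: A.koszul_add eps_add eps_odd)

section \<open>Componentwise operators and the filtration by theta-degree\<close>

definition A_op :: "('k ext \<Rightarrow> 'k ext) \<Rightarrow> 'k AG \<Rightarrow> 'k AG" where
  "A_op u a = (\<lambda>g\<in>G. u (a g))"

text \<open>A left scalar acts on the summand at g through the inverse of g and thus stays in
  \<open>polys n\<close>. Linearity over the left variables is all that can be asked here, since the
  contraction does not commute with primed scalars.\<close>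

lemma A_op_linear:
  assumes "\<And>\<omega>. \<omega> \<in> unit_carrier n \<Longrightarrow> u \<omega> \<in> unit_carrier n"
    and "\<And>\<omega> \<eta>. \<omega> \<in> unit_carrier n \<Longrightarrow> \<eta> \<in> unit_carrier n \<Longrightarrow> u (\<lambda>S. \<omega> S + \<eta> S) = (\<lambda>S. u \<omega> S + u \<eta> S)"
    and "\<And>r \<omega>. r \<in> polys n \<Longrightarrow> \<omega> \<in> unit_carrier n \<Longrightarrow> u (\<lambda>S. r * \<omega> S) = (\<lambda>S. r * u \<omega> S)"
  shows "is_linear n A A (A_op u)"
  unfolding is_linear_def
proof (intro conjI ballI)
  show "additive A A (A_op u)"
    by (rule additiveI) (auto simp: A_op_def A_simps PiE_iff assms(1,2))
  fix r :: "'k mpoly" and a assume "r \<in> polys n" "a \<in> carrier A"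
  then show "A_op u (r \<odot>\<^bsub>A\<^esub> a) = r \<odot>\<^bsub>A\<^esub> A_op u a"
    by (auto simp: A_op_def A_simps PiE_iff on_left_ginv_left assms(3))
qed

abbreviation "d0 \<equiv> A_op (koszul_diff0 n)"
abbreviation "d1 \<equiv> A_op (koszul_diff1 n W)"
abbreviation "contr \<equiv> A_op (koszul_contraction n)"

text \<open>The projector onto theta-degree at least j. A filtration given by projectors can be
  transported to \<open>A\<close> \<otimes> X along a basis.\<close>

definition trunc :: "nat \<Rightarrow> 'k ext \<Rightarrow> 'k ext" where
  "trunc j \<omega> = (\<lambda>S. if j \<le> card S then \<omega> S else 0)"

abbreviation "tau j \<equiv> A_op (trunc j)"

lemma trunc_carrier: "\<omega> \<in> unit_carrier n \<Longrightarrow> trunc j \<omega> \<in> unit_carrier n"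
  unfolding trunc_def by (rule unit_carrier_filter)

lemma d0_linear: "is_linear n A A d0"
  by (rule A_op_linear) (simp_all add: koszul_diff0_carrier koszul_diff0_add koszul_diff0_smult)

lemma d1_linear: "is_linear n A A d1"
  by (rule A_op_linear) (simp_all add: koszul_diff1_carrier koszul_diff1_add koszul_diff1_smult)

lemma contr_linear: "is_linear n A A contr"
  by (rule A_op_linear)
    (simp_all add: koszul_contraction_carrier koszul_contraction_add koszul_contraction_smult)

lemma tau_linear: "is_linear n A A (tau j)"
  by (rule A_op_linear, auto simp: trunc_carrier) (auto simp: trunc_def)

text \<open>Unlike the contraction, truncation is linear on both sides, since it only erases
  coefficients.\<close>

lemma tau_linear2: "is_linear (n + n) A A (tau j)"
  using tau_linear[of j] unfolding is_linear_def by (auto simp: A_op_def A_simps trunc_def intro!: restrict_ext ext)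

lemma A_diff: "a \<in> carrier A \<Longrightarrow> diff A a = d0 a \<oplus>\<^bsub>A\<^esub> d1 a"
  by (auto simp: A_op_def A_simps I_diff)

lemma contr_odd: "contr ` evens A \<subseteq> odds A" "contr ` odds A \<subseteq> evens A"
  by (auto simp: A_op_def A_simps PiE_iff koszul_contraction_carrier koszul_contraction_even
      koszul_contraction_odd)

lemma tau_even: "tau j ` evens A \<subseteq> evens A" "tau j ` odds A \<subseteq> odds A"
  by (auto simp: A_op_def A_simps PiE_iff trunc_carrier) (auto simp: trunc_def)

text \<open>A right inverse of the family of augmentations \<open>eps\<close>, placing prescribed
  polynomials in theta-degree zero.\<close>

definition unit_coeff :: "(('k mpoly \<Rightarrow> 'k mpoly) \<Rightarrow> 'k mpoly) \<Rightarrow> 'k AG" where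
  "unit_coeff c = (\<lambda>g\<in>G. \<lambda>S. if S = {} then c g else 0)"

lemma unit_coeff_closed [simp]:
  "(\<And>g. g \<in> G \<Longrightarrow> c g \<in> polys n) \<Longrightarrow> unit_coeff c \<in> carrier A"
  by (auto simp: unit_coeff_def A_simps unit_carrier_const)

lemma unit_coeff_even:
  "(\<And>g. g \<in> G \<Longrightarrow> c g \<in> polys n) \<Longrightarrow> unit_coeff c \<in> evens A"
  by (auto simp: unit_coeff_def A_simps unit_carrier_const)

lemma unit_coeff_add: "unit_coeff (\<lambda>g. c g + c' g) = unit_coeff c \<oplus>\<^bsub>A\<^esub> unit_coeff c'"
  by (auto simp: unit_coeff_def A_simps intro!: restrict_ext)

lemma unit_coeff_smult:
  "r \<in> polys n \<Longrightarrow> r \<odot>\<^bsub>A\<^esub> unit_coeff c = unit_coeff (\<lambda>g. ginv n g r * c g)"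
  by (auto simp: unit_coeff_def A_simps on_left_ginv_left intro!: restrict_ext)

lemma eps_unit_coeff: "g \<in> G \<Longrightarrow> c g \<in> polys n \<Longrightarrow> eps g (unit_coeff c) = c g"
  by (simp add: eps_def unit_coeff_def collapse_left)

lemma contr_homotopy:
  assumes "a \<in> carrier A"
  shows "(d0 (contr a) \<oplus>\<^bsub>A\<^esub> contr (d0 a)) \<oplus>\<^bsub>A\<^esub> unit_coeff (\<lambda>g. eps g a) = a"
proof (rule A_eqI[OF _ assms])
  show "(d0 (contr a) \<oplus>\<^bsub>A\<^esub> contr (d0 a)) \<oplus>\<^bsub>A\<^esub> unit_coeff (\<lambda>g. eps g a) \<in> carrier A"
    using assms is_linearD(2)[OF d0_linear] is_linearD(2)[OF contr_linear] by simp
  fix g S assume "g \<in> G"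
  then show "((d0 (contr a) \<oplus>\<^bsub>A\<^esub> contr (d0 a)) \<oplus>\<^bsub>A\<^esub> unit_coeff (\<lambda>g. eps g a)) g S = a g S"
    using koszul_contraction_homotopy[OF A_component[OF assms], of g S]
    by (auto simp: A_simps A_op_def unit_coeff_def eps_def)
qed

lemma eps_contr: "a \<in> carrier A \<Longrightarrow> g \<in> G \<Longrightarrow> eps g (contr a) = 0"
  by (simp add: eps_def A_op_def koszul_contraction_def)

lemma card_insert_Min:
  assumes "S \<subseteq> {..<n}" "S \<noteq> {}" shows "card S = Suc (card (S - {Min S}))"
  by (metis Min_in assms card_Suc_Diff1 finite_lessThan finite_subset)

text \<open>That the contraction raises the theta-degree is phrased as an identity of operators,
  because \<open>ext_left_comp\<close> carries such identities over to \<open>A\<close> \<otimes> X.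
  The same form is used for \<open>d1\<close> in \<open>tau_d1\<close>.\<close>

lemma tau_contr:
  assumes "a \<in> carrier A" shows "tau (Suc j) (contr (tau j a)) = contr (tau j a)"
proof -
  have "trunc (Suc j) (koszul_contraction n (trunc j \<omega>)) = koszul_contraction n (trunc j \<omega>)" for \<omega>
    by (rule ext) (auto simp: trunc_def koszul_contraction_def Min_less dest: card_insert_Min)
  then show ?thesis by (auto simp: A_op_def)
qed

lemma tau_d1:
  assumes "a \<in> carrier A" shows "tau (Suc j) (d1 (tau j a)) = d1 (tau j a)"
proof -
  have "trunc (Suc j) (koszul_diff1 n W (trunc j \<omega>)) = koszul_diff1 n W (trunc j \<omega>)"
    if "\<omega> \<in> unit_carrier n" for \<omega>
  proof (rule ext)
    fix S
    show "trunc (Suc j) (koszul_diff1 n W (trunc j \<omega>)) S = koszul_diff1 n W (trunc j \<omega>) S"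
    proof (cases "S \<subseteq> {..<n}")
      case True
      then have "finite S" using finite_subset by blast
      then have "\<not> Suc j \<le> card S \<Longrightarrow> i \<in> S \<Longrightarrow> \<not> j \<le> card (S - {i})" for i
        using card_Suc_Diff1[of S i] by linarith
      then have "\<not> Suc j \<le> card S \<Longrightarrow> theta_wedge i (trunc j \<omega>) S = 0" for i
        by (auto simp: theta_wedge_def trunc_def)
      then show ?thesis by (simp add: trunc_def[of "Suc j"] koszul_diff1_def)
    next
      case False
      then show ?thesis
        using unit_carrierD(2)[OF koszul_diff1_carrier[OF W trunc_carrier[OF that]]]
        by (simp add: trunc_def[of "Suc j"])
    qed
  qed
  then show ?thesis using A_component[OF assms] by (auto simp: A_op_def)
qed

lemma tau_0: "a \<in> carrier A \<Longrightarrow> tau 0 a = a"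
  by (auto simp: A_op_def trunc_def A_simps PiE_iff extensional_restrict)

text \<open>A set of indices below n has at most n elements, so the filtration stops at n +
  1.\<close>

lemma tau_top:
  assumes "a \<in> carrier A" shows "tau (Suc n) a = \<zero>\<^bsub>A\<^esub>"
proof -
  have "a g S = 0" if "g \<in> G" "Suc n \<le> card S" for g S
  proof -
    have "\<not> S \<subseteq> {..<n}" using that(2) card_mono[of "{..<n}" S] by auto
    then show ?thesis using unit_carrierD(2)[OF A_component[OF assms that(1)]] by simp
  qed
  then show ?thesis by (auto simp: A_op_def trunc_def A_simps intro!: restrict_ext)
qed

lemma tau_tau: "i \<le> j \<Longrightarrow> tau i (tau j a) = tau j a"
  by (auto simp: A_op_def trunc_def intro!: restrict_ext)

end

section \<open>Sums and homotopies of maps\<close>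

lemma (in premf) evens_finsum: "(\<And>i. i \<in> I \<Longrightarrow> f i \<in> evens X) \<Longrightarrow> finsum X f I \<in> evens X"
  by (induction I rule: infinite_finite_induct) (auto simp: Pi_def)

lemma (in premf) odds_finsum: "(\<And>i. i \<in> I \<Longrightarrow> f i \<in> odds X) \<Longrightarrow> finsum X f I \<in> odds X"
  by (induction I rule: infinite_finite_induct) (auto simp: Pi_def)

lemma (in premf) sum_smult:
  assumes "finite K" "\<And>k. k \<in> K \<Longrightarrow> c k \<in> polys N" "x \<in> carrier X"
  shows "(\<Sum>k\<in>K. c k) \<odot> x = (\<Oplus>\<^bsub>X\<^esub>k\<in>K. c k \<odot> x)"
  using assms
  by (induction K rule: finite_induct) (simp_all add: add_smult polys_sum mm.M.finsum_insert Pi_def)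

lemma homotopic_cong:
  assumes "\<And>m. m \<in> carrier X \<Longrightarrow> \<alpha> m = \<alpha>' m" "\<And>m. m \<in> carrier X \<Longrightarrow> \<beta> m = \<beta>' m"
  shows "homotopic n X Y \<alpha> \<beta> = homotopic n X Y \<alpha>' \<beta>'"
  using assms by (simp add: homotopic_def)

lemma homotopic_restrict [simp]:
  "homotopic n X Y (restrict \<alpha> (carrier X)) \<beta> = homotopic n X Y \<alpha> \<beta>"
  "homotopic n X Y \<alpha> (restrict \<beta> (carrier X)) = homotopic n X Y \<alpha> \<beta>"
  by (rule homotopic_cong; simp)+

lemma homotopic_refl':
  assumes "premf n X" "premf n Y" "is_mf_map n X Y \<alpha>" shows "homotopic n X Y \<alpha> \<alpha>"
  using homotopic_refl[OF assms(1,2) is_mf_map_restrict[OF assms(3,1)]] by simp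

lemma homotopic_sym':
  assumes "premf n X" "premf n Y" "is_mf_map n X Y \<alpha>" "is_mf_map n X Y \<beta>" "homotopic n X Y \<alpha> \<beta>"
  shows "homotopic n X Y \<beta> \<alpha>"
  using homotopic_sym[OF assms(1,2) is_mf_map_restrict[OF assms(3,1)] is_mf_map_restrict[OF assms(4,1)]] assms(5)
  by simp

lemma homotopic_trans':
  assumes "premf n X" "premf n Y" "is_mf_map n X Y \<alpha>" "is_mf_map n X Y \<beta>" "is_mf_map n X Y \<gamma>"
    "homotopic n X Y \<alpha> \<beta>" "homotopic n X Y \<beta> \<gamma>"
  shows "homotopic n X Y \<alpha> \<gamma>"
  using homotopic_trans[OF assms(1,2) is_mf_map_restrict[OF assms(3,1)] is_mf_map_restrict[OF assms(4,1)]
      is_mf_map_restrict[OF assms(5,1)]] assms(6,7) by simp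

lemma homotopic_comp':
  assumes "premf n X" "premf n Y" "premf n Z" "is_mf_map n X Y \<alpha>" "is_mf_map n X Y \<alpha>'"
    "is_mf_map n Y Z \<beta>" "is_mf_map n Y Z \<beta>'" "homotopic n X Y \<alpha> \<alpha>'" "homotopic n Y Z \<beta> \<beta>'"
  shows "homotopic n X Z (\<lambda>x. \<beta> (\<alpha> x)) (\<lambda>x. \<beta>' (\<alpha>' x))"
proof -
  let ?r = "\<lambda>f. restrict f (carrier X)" and ?s = "\<lambda>f. restrict f (carrier Y)"
  have "homotopic n X Z (compose (carrier X) (?s \<beta>) (?r \<alpha>)) (compose (carrier X) (?s \<beta>') (?r \<alpha>'))"
    by (rule homotopic_compose[OF assms(1-3)])
      (use assms in \<open>simp_all add: is_mf_map_restrict\<close>)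
  moreover have "\<And>m. m \<in> carrier X \<Longrightarrow> compose (carrier X) (?s \<beta>) (?r \<alpha>) m = \<beta> (\<alpha> m)"
    "\<And>m. m \<in> carrier X \<Longrightarrow> compose (carrier X) (?s \<beta>') (?r \<alpha>') m = \<beta>' (\<alpha>' m)"
    using is_linearD(2)[OF is_mf_mapD(1)[OF assms(4)]] is_linearD(2)[OF is_mf_mapD(1)[OF assms(5)]]
    by (simp_all add: compose_def)
  ultimately show ?thesis by (subst homotopic_cong[symmetric]) auto
qed

lemma is_mf_map_cong:
  fixes X :: "('k::comm_ring_1 mpoly, 'm) mf" and Y :: "('k mpoly, 'p) mf"
  assumes "premf n X" "\<And>m. m \<in> carrier X \<Longrightarrow> \<alpha> m = \<beta> m" "is_mf_map n X Y \<alpha>"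
  shows "is_mf_map n X Y \<beta>"
proof -
  interpret premf n X by fact
  have "\<beta> m \<in> carrier Y" if "m \<in> carrier X" for m
    using is_linearD(2)[OF is_mf_mapD(1)[OF assms(3)]] assms(2) that by metis
  then show ?thesis
    using assms(3) by (auto simp: is_mf_map_def is_linear_def additive_def image_subset_iff assms(2)[symmetric])
qed

lemma finsum_additive:
  assumes "abelian_group Y" "\<And>i. i \<in> I \<Longrightarrow> additive X Y (f i)"
  shows "additive X Y (\<lambda>x. \<Oplus>\<^bsub>Y\<^esub>i\<in>I. f i x)"
proof -
  interpret Y: abelian_group Y by fact
  note c = additive_closed[OF assms(2)]
  show ?thesis
  proof (rule additiveI)
    fix x y assume xy: "x \<in> carrier X" "y \<in> carrier X"
    then show "(\<Oplus>\<^bsub>Y\<^esub>i\<in>I. f i x) \<in> carrier Y" by (intro Y.finsum_closed) (auto simp: c)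
    have "(\<Oplus>\<^bsub>Y\<^esub>i\<in>I. f i (x \<oplus>\<^bsub>X\<^esub> y)) = (\<Oplus>\<^bsub>Y\<^esub>i\<in>I. f i x \<oplus>\<^bsub>Y\<^esub> f i y)"
      by (rule Y.finsum_cong') (use xy additive_add[OF assms(2)] in \<open>simp_all add: c\<close>)
    also have "\<dots> = (\<Oplus>\<^bsub>Y\<^esub>i\<in>I. f i x) \<oplus>\<^bsub>Y\<^esub> (\<Oplus>\<^bsub>Y\<^esub>i\<in>I. f i y)"
      by (rule Y.finsum_addf) (use xy in \<open>auto simp: c\<close>)
    finally show "(\<Oplus>\<^bsub>Y\<^esub>i\<in>I. f i (x \<oplus>\<^bsub>X\<^esub> y)) = (\<Oplus>\<^bsub>Y\<^esub>i\<in>I. f i x) \<oplus>\<^bsub>Y\<^esub> (\<Oplus>\<^bsub>Y\<^esub>i\<in>I. f i y)" .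
  qed
qed

lemma is_linear_finsum:
  fixes Y :: "('k::comm_ring_1 mpoly, 'm) mf"
  assumes Y: "premf n Y" and f: "\<And>i. i \<in> I \<Longrightarrow> is_linear n X Y (f i)"
  shows "is_linear n X Y (\<lambda>x. \<Oplus>\<^bsub>Y\<^esub>i\<in>I. f i x)"
  unfolding is_linear_def
proof (intro conjI ballI)
  interpret Y: premf n Y by fact
  show "additive X Y (\<lambda>x. \<Oplus>\<^bsub>Y\<^esub>i\<in>I. f i x)" by (rule finsum_additive[OF Y.ab is_linearD(1)[OF f]])
  fix r :: "'k mpoly" and a assume ra: "r \<in> polys n" "a \<in> carrier X"
  have "(\<Oplus>\<^bsub>Y\<^esub>i\<in>I. f i (r \<odot>\<^bsub>X\<^esub> a)) = (\<Oplus>\<^bsub>Y\<^esub>i\<in>I. r \<odot>\<^bsub>Y\<^esub> f i a)"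
    by (rule Y.mm.M.finsum_cong') (use ra is_linearD(2,4)[OF f] in simp_all)
  also have "\<dots> = r \<odot>\<^bsub>Y\<^esub> (\<Oplus>\<^bsub>Y\<^esub>i\<in>I. f i a)"
    by (rule additive_finsum[OF Y.ab Y.ab Y.smult_additive, symmetric]) (use ra is_linearD(2)[OF f] in auto)
  finally show "(\<Oplus>\<^bsub>Y\<^esub>i\<in>I. f i (r \<odot>\<^bsub>X\<^esub> a)) = r \<odot>\<^bsub>Y\<^esub> (\<Oplus>\<^bsub>Y\<^esub>i\<in>I. f i a)" .
qed

lemma is_mf_map_finsum:
  assumes X: "premf n X" and Y: "premf n Y" and f: "\<And>i. i \<in> I \<Longrightarrow> is_mf_map n X Y (f i)"
  shows "is_mf_map n X Y (\<lambda>x. \<Oplus>\<^bsub>Y\<^esub>i\<in>I. f i x)"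
  unfolding is_mf_map_def
proof (intro conjI ballI)
  interpret X: premf n X by fact
  interpret Y: premf n Y by fact
  show "is_linear n X Y (\<lambda>x. \<Oplus>\<^bsub>Y\<^esub>i\<in>I. f i x)" by (rule is_linear_finsum[OF Y is_mf_mapD(1)[OF f]])
  show "(\<lambda>x. \<Oplus>\<^bsub>Y\<^esub>i\<in>I. f i x) ` evens X \<subseteq> evens Y" "(\<lambda>x. \<Oplus>\<^bsub>Y\<^esub>i\<in>I. f i x) ` odds X \<subseteq> odds Y"
    using is_mf_mapD(2,3)[OF f] by (auto intro!: Y.evens_finsum Y.odds_finsum)
  fix x assume x: "x \<in> carrier X"
  have "(\<Oplus>\<^bsub>Y\<^esub>i\<in>I. f i (diff X x)) = (\<Oplus>\<^bsub>Y\<^esub>i\<in>I. diff Y (f i x))"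
    by (rule Y.mm.M.finsum_cong')
      (use x is_mf_mapD(4)[OF f] is_linearD(2)[OF is_mf_mapD(1)[OF f]] in simp_all)
  also have "\<dots> = diff Y (\<Oplus>\<^bsub>Y\<^esub>i\<in>I. f i x)"
    by (rule additive_finsum[OF Y.ab Y.ab Y.diff_additive, symmetric])
      (use x is_linearD(2)[OF is_mf_mapD(1)[OF f]] in auto)
  finally show "(\<Oplus>\<^bsub>Y\<^esub>i\<in>I. f i (diff X x)) = diff Y (\<Oplus>\<^bsub>Y\<^esub>i\<in>I. f i x)" .
qed

lemma is_homotopyI:
  "is_linear n X Y h \<Longrightarrow> h ` evens X \<subseteq> odds Y \<Longrightarrow> h ` odds X \<subseteq> evens Y \<Longrightarrow> is_homotopy n X Y h"
  by (simp add: is_homotopy_def is_linear_def)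

lemma homotopic_finsum:
  assumes X: "premf n X" and Y: "premf n Y" and f: "\<And>i. i \<in> I \<Longrightarrow> is_mf_map n X Y (f i)"
    and f': "\<And>i. i \<in> I \<Longrightarrow> is_mf_map n X Y (f' i)" and ho: "\<And>i. i \<in> I \<Longrightarrow> homotopic n X Y (f i) (f' i)"
  shows "homotopic n X Y (\<lambda>x. \<Oplus>\<^bsub>Y\<^esub>i\<in>I. f i x) (\<lambda>x. \<Oplus>\<^bsub>Y\<^esub>i\<in>I. f' i x)"
proof -
  interpret X: premf n X by fact
  interpret Y: premf n Y by fact
  note fc = is_linearD(2)[OF is_mf_mapD(1)[OF f]] and fc' = is_linearD(2)[OF is_mf_mapD(1)[OF f']]
  have "\<exists>h. is_homotopy n X Y h \<and>
      (\<forall>x\<in>carrier X. f' i x = f i x \<oplus>\<^bsub>Y\<^esub> (diff Y (h x) \<oplus>\<^bsub>Y\<^esub> h (diff X x)))" if "i \<in> I" for i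
    using homotopicE[OF X Y ho[OF that] fc[OF that] fc'[OF that]] by metis
  then obtain h where h: "\<And>i. i \<in> I \<Longrightarrow> is_homotopy n X Y (h i)"
    and e: "\<And>i x. i \<in> I \<Longrightarrow> x \<in> carrier X \<Longrightarrow>
      f' i x = f i x \<oplus>\<^bsub>Y\<^esub> (diff Y (h i x) \<oplus>\<^bsub>Y\<^esub> h i (diff X x))" by metis
  note lh = is_homotopy_linear[OF h] and hc = is_linearD(2)[OF is_homotopy_linear[OF h]]
  show ?thesis
  proof (rule homotopicI[OF X Y, of "\<lambda>x. \<Oplus>\<^bsub>Y\<^esub>i\<in>I. h i x"])
    show "is_homotopy n X Y (\<lambda>x. \<Oplus>\<^bsub>Y\<^esub>i\<in>I. h i x)"
    proof (rule is_homotopyI)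
      show "is_linear n X Y (\<lambda>x. \<Oplus>\<^bsub>Y\<^esub>i\<in>I. h i x)" by (rule is_linear_finsum[OF Y lh])
      show "(\<lambda>x. \<Oplus>\<^bsub>Y\<^esub>i\<in>I. h i x) ` evens X \<subseteq> odds Y" "(\<lambda>x. \<Oplus>\<^bsub>Y\<^esub>i\<in>I. h i x) ` odds X \<subseteq> evens Y"
        using h by (auto simp: is_homotopy_def image_subset_iff intro!: Y.evens_finsum Y.odds_finsum)
    qed
    fix x assume x: "x \<in> carrier X"
    show "(\<Oplus>\<^bsub>Y\<^esub>i\<in>I. f i x) \<in> carrier Y" by (rule Y.mm.M.finsum_closed) (use fc x in auto)
    have "(\<Oplus>\<^bsub>Y\<^esub>i\<in>I. f' i x) = (\<Oplus>\<^bsub>Y\<^esub>i\<in>I. f i x \<oplus>\<^bsub>Y\<^esub> (diff Y (h i x) \<oplus>\<^bsub>Y\<^esub> h i (diff X x)))"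
      by (rule Y.mm.M.finsum_cong') (use x e fc hc in simp_all)
    also have "\<dots> = (\<Oplus>\<^bsub>Y\<^esub>i\<in>I. f i x) \<oplus>\<^bsub>Y\<^esub> ((\<Oplus>\<^bsub>Y\<^esub>i\<in>I. diff Y (h i x)) \<oplus>\<^bsub>Y\<^esub> (\<Oplus>\<^bsub>Y\<^esub>i\<in>I. h i (diff X x)))"
      using x fc hc by (subst Y.mm.M.finsum_addf[symmetric]; (subst Y.mm.M.finsum_addf[symmetric])?; simp add: Pi_def)
    also have "(\<Oplus>\<^bsub>Y\<^esub>i\<in>I. diff Y (h i x)) = diff Y (\<Oplus>\<^bsub>Y\<^esub>i\<in>I. h i x)"
      by (rule additive_finsum[OF Y.ab Y.ab Y.diff_additive, symmetric]) (use x hc in auto)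
    finally show "(\<Oplus>\<^bsub>Y\<^esub>i\<in>I. f' i x) = (\<Oplus>\<^bsub>Y\<^esub>i\<in>I. f i x) \<oplus>\<^bsub>Y\<^esub>
        (diff Y (\<Oplus>\<^bsub>Y\<^esub>i\<in>I. h i x) \<oplus>\<^bsub>Y\<^esub> (\<Oplus>\<^bsub>Y\<^esub>i\<in>I. h i (diff X x)))" .
  qed
qed

lemma finsum_product:
  assumes "abelian_group Y" "finite H" "finite I" "\<And>g h. g \<in> H \<Longrightarrow> h \<in> I \<Longrightarrow> f g h \<in> carrier Y"
  shows "(\<Oplus>\<^bsub>Y\<^esub>g\<in>H. \<Oplus>\<^bsub>Y\<^esub>h\<in>I. f g h) = (\<Oplus>\<^bsub>Y\<^esub>k\<in>H \<times> I. f (fst k) (snd k))"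
proof -
  interpret Y: abelian_group Y by fact
  from assms(2,4) show ?thesis
  proof (induction H rule: finite_induct)
    case (insert g H)
    have e: "insert g H \<times> I = Pair g ` I \<union> H \<times> I" by auto
    have "(\<Oplus>\<^bsub>Y\<^esub>k\<in>insert g H \<times> I. f (fst k) (snd k)) =
        (\<Oplus>\<^bsub>Y\<^esub>k\<in>Pair g ` I. f (fst k) (snd k)) \<oplus>\<^bsub>Y\<^esub> (\<Oplus>\<^bsub>Y\<^esub>k\<in>H \<times> I. f (fst k) (snd k))"
      unfolding e by (rule Y.finsum_Un_disjoint) (use insert assms(3) in auto)
    also have "(\<Oplus>\<^bsub>Y\<^esub>k\<in>Pair g ` I. f (fst k) (snd k)) = (\<Oplus>\<^bsub>Y\<^esub>h\<in>I. f g h)"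
      by (subst Y.finsum_reindex) (use insert in \<open>auto simp: inj_on_def\<close>)
    also have "(\<Oplus>\<^bsub>Y\<^esub>h\<in>I. f g h) \<oplus>\<^bsub>Y\<^esub> (\<Oplus>\<^bsub>Y\<^esub>k\<in>H \<times> I. f (fst k) (snd k)) = (\<Oplus>\<^bsub>Y\<^esub>g\<in>insert g H. \<Oplus>\<^bsub>Y\<^esub>h\<in>I. f g h)"
      using insert by (subst Y.finsum_insert) (auto intro!: Y.finsum_closed)
    finally show ?case ..
  qed simp
qed

text \<open>Used with m(g, h) = gh to replace a sum over u in G and over all factorisations of u by
  a sum over pairs.\<close>

lemma finsum_fibres:
  assumes "abelian_group Y" "finite H" "finite K" "\<And>k. k \<in> K \<Longrightarrow> m k \<in> H" "\<And>k. k \<in> K \<Longrightarrow> f k \<in> carrier Y"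
  shows "(\<Oplus>\<^bsub>Y\<^esub>u\<in>H. \<Oplus>\<^bsub>Y\<^esub>k\<in>{k\<in>K. m k = u}. f k) = (\<Oplus>\<^bsub>Y\<^esub>k\<in>K. f k)"
proof -
  interpret Y: abelian_group Y by fact
  have "(\<Oplus>\<^bsub>Y\<^esub>u\<in>H'. \<Oplus>\<^bsub>Y\<^esub>k\<in>{k\<in>K. m k = u}. f k) = (\<Oplus>\<^bsub>Y\<^esub>k\<in>{k\<in>K. m k \<in> H'}. f k)" if "finite H'" for H'
    using that
  proof (induction H' rule: finite_induct)
    case (insert u H')
    have e: "{k\<in>K. m k \<in> insert u H'} = {k\<in>K. m k = u} \<union> {k\<in>K. m k \<in> H'}" by auto
    have "(\<Oplus>\<^bsub>Y\<^esub>k\<in>{k\<in>K. m k \<in> insert u H'}. f k) =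
        (\<Oplus>\<^bsub>Y\<^esub>k\<in>{k\<in>K. m k = u}. f k) \<oplus>\<^bsub>Y\<^esub> (\<Oplus>\<^bsub>Y\<^esub>k\<in>{k\<in>K. m k \<in> H'}. f k)"
      unfolding e by (rule Y.finsum_Un_disjoint) (use insert assms in auto)
    also have "\<dots> = (\<Oplus>\<^bsub>Y\<^esub>u\<in>insert u H'. \<Oplus>\<^bsub>Y\<^esub>k\<in>{k\<in>K. m k = u}. f k)"
      using insert assms by (subst Y.finsum_insert) (auto intro!: Y.finsum_closed)
    finally show ?case ..
  qed simp
  from this[OF assms(2)] have "(\<Oplus>\<^bsub>Y\<^esub>u\<in>H. \<Oplus>\<^bsub>Y\<^esub>k\<in>{k\<in>K. m k = u}. f k) = (\<Oplus>\<^bsub>Y\<^esub>k\<in>{k\<in>K. m k \<in> H}. f k)" .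
  also have "{k\<in>K. m k \<in> H} = K" using assms(4) by auto
  finally show ?thesis .
qed

lemma finsum_delta:
  assumes "abelian_group Y" "finite K" "k \<in> K" "f k \<in> carrier Y" "\<And>j. j \<in> K \<Longrightarrow> j \<noteq> k \<Longrightarrow> f j = \<zero>\<^bsub>Y\<^esub>"
  shows "finsum Y f K = f k"
proof -
  interpret Y: abelian_group Y by fact
  have fc: "f j \<in> carrier Y" if "j \<in> K" for j using assms(4,5) that by (cases "j = k") auto
  have "finsum Y f K = finsum Y (\<lambda>j. if k = j then f j else \<zero>\<^bsub>Y\<^esub>) K"
    by (rule Y.finsum_cong') (use assms fc in auto)
  also have "\<dots> = f k" by (rule Y.finsum_singleton) (use assms fc in auto)
  finally show ?thesis .
qed

section \<open>Free modules\<close>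

locale free_premf = premf n X for n :: nat and X :: "('k::comm_ring_1 mpoly, 'x) mf" +
  fixes B :: "'x set"
  assumes basis: "homogeneous_basis n X B"
begin

lemma B_carrier [simp]: "b \<in> B \<Longrightarrow> b \<in> carrier X"
  using basis by (auto simp: homogeneous_basis_def is_basis_def)

lemma B_parity: "b \<in> B \<Longrightarrow> b \<in> evens X \<or> b \<in> odds X"
  using basis by (auto simp: homogeneous_basis_def)

definition is_coef where
  "is_coef x c \<longleftrightarrow> c \<in> B \<rightarrow>\<^sub>E polys n \<and> finite {b\<in>B. c b \<noteq> 0} \<and>
     x = (\<Oplus>\<^bsub>X\<^esub>b\<in>{b\<in>B. c b \<noteq> 0}. c b \<odot>\<^bsub>X\<^esub> b)"

lemma is_coef_ex1: "x \<in> carrier X \<Longrightarrow> \<exists>!c. is_coef x c"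
  using basis by (simp add: homogeneous_basis_def is_basis_def is_coef_def)

definition coef where "coef x = (THE c. is_coef x c)"

lemma coef: "x \<in> carrier X \<Longrightarrow> is_coef x (coef x)"
  unfolding coef_def by (rule theI'[OF is_coef_ex1])

abbreviation "supp x \<equiv> {b\<in>B. coef x b \<noteq> 0}"

lemma coef_polys [simp]: "x \<in> carrier X \<Longrightarrow> b \<in> B \<Longrightarrow> coef x b \<in> polys n"
  and supp_finite [simp]: "x \<in> carrier X \<Longrightarrow> finite (supp x)"
  and coef_sum: "x \<in> carrier X \<Longrightarrow> (\<Oplus>\<^bsub>X\<^esub>b\<in>supp x. coef x b \<odot>\<^bsub>X\<^esub> b) = x"
  using coef[of x] by (auto simp: is_coef_def)

lemma coef_sum_superset:
  assumes "x \<in> carrier X" "finite S" "supp x \<subseteq> S" "S \<subseteq> B"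
  shows "(\<Oplus>\<^bsub>X\<^esub>b\<in>S. coef x b \<odot>\<^bsub>X\<^esub> b) = x"
proof -
  have "(\<Oplus>\<^bsub>X\<^esub>b\<in>supp x. coef x b \<odot>\<^bsub>X\<^esub> b) = (\<Oplus>\<^bsub>X\<^esub>b\<in>S. coef x b \<odot>\<^bsub>X\<^esub> b)"
    by (rule mm.M.add.finprod_mono_neutral_cong_left) (use assms in auto)
  then show ?thesis using coef_sum[OF assms(1)] by simp
qed

text \<open>S may be larger than the support, so the exact support of a sum or of a multiple never
  has to be computed.\<close>

lemma coef_unique:
  assumes c: "\<And>b. b \<in> B \<Longrightarrow> c b \<in> polys n" and S: "finite S" "S \<subseteq> B" "\<And>b. b \<in> B \<Longrightarrow> b \<notin> S \<Longrightarrow> c b = 0"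
    and x: "x = (\<Oplus>\<^bsub>X\<^esub>b\<in>S. c b \<odot>\<^bsub>X\<^esub> b)" and b: "b \<in> B"
  shows "coef x b = c b"
proof -
  let ?c = "restrict c B"
  have xc: "x \<in> carrier X" unfolding x by (rule mm.M.finsum_closed) (use c S in auto)
  have sub: "{b\<in>B. ?c b \<noteq> 0} \<subseteq> S" using S(3) by auto
  have "(\<Oplus>\<^bsub>X\<^esub>b\<in>{b\<in>B. ?c b \<noteq> 0}. ?c b \<odot>\<^bsub>X\<^esub> b) = (\<Oplus>\<^bsub>X\<^esub>b\<in>S. c b \<odot>\<^bsub>X\<^esub> b)"
    by (rule mm.M.add.finprod_mono_neutral_cong_left) (use c S sub in auto)
  then have "is_coef x ?c"
    unfolding is_coef_def using c x finite_subset[OF sub S(1)] by auto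
  then have "coef x = ?c" using is_coef_ex1[OF xc] coef[OF xc] by blast
  then show ?thesis using b by simp
qed

lemma coef_add:
  assumes "x \<in> carrier X" "y \<in> carrier X" "b \<in> B"
  shows "coef (x \<oplus>\<^bsub>X\<^esub> y) b = coef x b + coef y b"
proof (rule coef_unique[where S = "supp x \<union> supp y"])
  let ?S = "supp x \<union> supp y"
  have "(\<Oplus>\<^bsub>X\<^esub>b\<in>?S. (coef x b + coef y b) \<odot>\<^bsub>X\<^esub> b) = (\<Oplus>\<^bsub>X\<^esub>b\<in>?S. coef x b \<odot>\<^bsub>X\<^esub> b \<oplus>\<^bsub>X\<^esub> coef y b \<odot>\<^bsub>X\<^esub> b)"
    by (rule mm.M.finsum_cong') (use assms in \<open>auto simp: add_smult\<close>)
  also have "\<dots> = (\<Oplus>\<^bsub>X\<^esub>b\<in>?S. coef x b \<odot>\<^bsub>X\<^esub> b) \<oplus>\<^bsub>X\<^esub> (\<Oplus>\<^bsub>X\<^esub>b\<in>?S. coef y b \<odot>\<^bsub>X\<^esub> b)"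
    by (rule mm.M.finsum_addf) (use assms in auto)
  also have "\<dots> = x \<oplus>\<^bsub>X\<^esub> y"
    using coef_sum_superset[of x ?S] coef_sum_superset[of y ?S] assms by auto
  finally show "x \<oplus>\<^bsub>X\<^esub> y = (\<Oplus>\<^bsub>X\<^esub>b\<in>?S. (coef x b + coef y b) \<odot>\<^bsub>X\<^esub> b)" by simp
qed (use assms in auto)

lemma coef_smult:
  assumes "x \<in> carrier X" "r \<in> polys n" "b \<in> B"
  shows "coef (r \<odot>\<^bsub>X\<^esub> x) b = r * coef x b"
proof (rule coef_unique[where S = "supp x"])
  have "r \<odot>\<^bsub>X\<^esub> x = r \<odot>\<^bsub>X\<^esub> (\<Oplus>\<^bsub>X\<^esub>b\<in>supp x. coef x b \<odot>\<^bsub>X\<^esub> b)" using coef_sum[OF assms(1)] by simp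
  also have "\<dots> = (\<Oplus>\<^bsub>X\<^esub>b\<in>supp x. r \<odot>\<^bsub>X\<^esub> (coef x b \<odot>\<^bsub>X\<^esub> b))"
    by (rule additive_finsum[OF ab ab smult_additive]) (use assms in auto)
  also have "\<dots> = (\<Oplus>\<^bsub>X\<^esub>b\<in>supp x. (r * coef x b) \<odot>\<^bsub>X\<^esub> b)"
    by (rule mm.M.finsum_cong') (use assms in \<open>auto simp: smult_smult\<close>)
  finally show "r \<odot>\<^bsub>X\<^esub> x = (\<Oplus>\<^bsub>X\<^esub>b\<in>supp x. (r * coef x b) \<odot>\<^bsub>X\<^esub> b)" .
qed (use assms in auto)

lemma coef_basis:
  assumes "b \<in> B" "f \<in> polys n" "b' \<in> B"
  shows "coef (f \<odot>\<^bsub>X\<^esub> b) b' = (if b' = b then f else 0)"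
  by (rule coef_unique[where S = "{b}"]) (use assms in auto)

text \<open>Split the expansion of x according to whether the basis element lies in P. The other
  part has the opposite parity and so vanishes, and uniqueness of coordinates does the rest. The
  disjunction treats both parities at once.\<close>

lemma coef_parity:
  assumes "x \<in> evens X \<and> P = evens X \<or> x \<in> odds X \<and> P = odds X" "b \<in> B" "coef x b \<noteq> 0"
  shows "b \<in> P"
proof (rule ccontr)
  assume "b \<notin> P"
  have x: "x \<in> carrier X" using assms(1) by auto
  define S1 where "S1 = {b \<in> supp x. b \<in> P}"
  define S2 where "S2 = {b \<in> supp x. b \<notin> P}"
  have S: "supp x = S1 \<union> S2" "S1 \<inter> S2 = {}" by (auto simp: S1_def S2_def)
  have fin: "finite S1" "finite S2"
    by (rule finite_subset[OF _ supp_finite[OF x]]; auto simp: S1_def S2_def)+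
  let ?y = "\<Oplus>\<^bsub>X\<^esub>b\<in>S1. coef x b \<odot>\<^bsub>X\<^esub> b" and ?z = "\<Oplus>\<^bsub>X\<^esub>b\<in>S2. coef x b \<odot>\<^bsub>X\<^esub> b"
  have yc: "?y \<in> carrier X" "?z \<in> carrier X"
    by (rule mm.M.finsum_closed; use x in \<open>auto simp: S1_def S2_def\<close>)+
  have "(\<Oplus>\<^bsub>X\<^esub>b\<in>supp x. coef x b \<odot>\<^bsub>X\<^esub> b) = ?y \<oplus>\<^bsub>X\<^esub> ?z"
    unfolding S(1) by (rule mm.M.finsum_Un_disjoint[OF fin S(2)]) (use x in \<open>auto simp: S1_def S2_def\<close>)
  then have sum: "x = ?y \<oplus>\<^bsub>X\<^esub> ?z" using coef_sum[OF x] by simp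
  have "?z = \<zero>\<^bsub>X\<^esub>"
    using assms(1)
  proof (elim disjE conjE)
    assume e: "x \<in> evens X" "P = evens X"
    have "?y \<in> evens X" by (rule evens_finsum) (use e x in \<open>auto simp: S1_def\<close>)
    moreover have "b \<in> odds X" if "b \<in> S2" for b using that e B_parity[of b] by (auto simp: S2_def)
    then have "?z \<in> odds X" by (intro odds_finsum) (use x in \<open>auto simp: S2_def\<close>)
    ultimately show ?thesis using decomp_unique(2)[of ?y ?z x "\<zero>\<^bsub>X\<^esub>"] e sum x by auto
  next
    assume o: "x \<in> odds X" "P = odds X"
    have "?y \<in> odds X" by (rule odds_finsum) (use o x in \<open>auto simp: S1_def\<close>)
    moreover have "b \<in> evens X" if "b \<in> S2" for b using that o B_parity[of b] by (auto simp: S2_def)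
    then have "?z \<in> evens X" by (intro evens_finsum) (use x in \<open>auto simp: S2_def\<close>)
    moreover have "x = ?z \<oplus>\<^bsub>X\<^esub> ?y" using sum yc mm.M.a_comm by simp
    ultimately show ?thesis using decomp_unique(1)[of ?z ?y "\<zero>\<^bsub>X\<^esub>" x] o x by auto
  qed
  then have "x = ?y" using sum yc by simp
  also have "\<dots> = (\<Oplus>\<^bsub>X\<^esub>b\<in>S1. (if b \<in> S1 then coef x b else 0) \<odot>\<^bsub>X\<^esub> b)"
    by (rule mm.M.finsum_cong') (use x in \<open>auto simp: S1_def\<close>)
  finally have "coef x b = (if b \<in> S1 then coef x b else 0)"
    by (intro coef_unique[where S = S1]) (use fin x assms(2) in \<open>auto simp: S1_def\<close>)
  then show False using \<open>b \<notin> P\<close> assms(3) by (simp add: S1_def)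
qed

lemma coef_even: "x \<in> evens X \<Longrightarrow> b \<in> supp x \<Longrightarrow> b \<in> evens X"
  and coef_odd: "x \<in> odds X \<Longrightarrow> b \<in> supp x \<Longrightarrow> b \<in> odds X"
  using coef_parity[of x "evens X" b] coef_parity[of x "odds X" b] by blast+

end

lemma PR_ab: "abelian_group (PR n)"
  by (rule ring.axioms(1)[OF cring.axioms(1)[OF cring_PR]])

locale free_pair = tensor_pair n n Y X + FX: free_premf n X B
  for n :: nat and Y :: "('k::comm_ring_1 mpoly, 'y) mf" and X :: "('k mpoly, 'x) mf" and B
begin

text \<open>A basis identifies Y \<otimes> X with a direct sum of copies of Y, and v is applied in
  each coordinate. It is asked to be additive only, because coefficients enter through maps that are
  not linear in the primed variables.\<close>

definition ext_coef where
  "ext_coef v x = (\<Oplus>\<^bsub>T\<^esub>b\<in>FX.supp x. p (v (FX.coef x b)) b)"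

abbreviation "additive_coef \<equiv> additive (PR n) Y"

lemma additive_coefD:
  assumes "additive_coef v"
  shows "f \<in> polys n \<Longrightarrow> v f \<in> carrier Y" "f \<in> polys n \<Longrightarrow> g \<in> polys n \<Longrightarrow> v (f + g) = v f \<oplus>\<^bsub>Y\<^esub> v g"
    "v 0 = \<zero>\<^bsub>Y\<^esub>"
  using assms additive_zero[OF PR_ab Y.ab assms] by (auto simp: additive_def)

lemma ext_coef_superset:
  assumes "additive_coef v" "x \<in> carrier X" "finite S" "FX.supp x \<subseteq> S" "S \<subseteq> B"
  shows "ext_coef v x = (\<Oplus>\<^bsub>T\<^esub>b\<in>S. p (v (FX.coef x b)) b)"
  unfolding ext_coef_def
  by (rule T.add.finprod_mono_neutral_cong_left) (use assms additive_coefD[OF assms(1)] in auto)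

lemma ext_coef_closed: "additive_coef v \<Longrightarrow> x \<in> carrier X \<Longrightarrow> ext_coef v x \<in> carrier T"
  unfolding ext_coef_def by (rule T.finsum_closed) (auto simp: additive_coefD)

lemma ext_coef_add:
  assumes v: "additive_coef v" and x: "x \<in> carrier X" "x' \<in> carrier X"
  shows "ext_coef v (x \<oplus>\<^bsub>X\<^esub> x') = ext_coef v x \<oplus>\<^bsub>T\<^esub> ext_coef v x'"
proof -
  let ?S = "FX.supp x \<union> FX.supp x'"
  have S: "finite ?S" "FX.supp (x \<oplus>\<^bsub>X\<^esub> x') \<subseteq> ?S" using x by (auto simp: FX.coef_add)
  have "ext_coef v (x \<oplus>\<^bsub>X\<^esub> x') = (\<Oplus>\<^bsub>T\<^esub>b\<in>?S. p (v (FX.coef (x \<oplus>\<^bsub>X\<^esub> x') b)) b)"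
    by (rule ext_coef_superset) (use v x S in auto)
  also have "\<dots> = (\<Oplus>\<^bsub>T\<^esub>b\<in>?S. p (v (FX.coef x b)) b \<oplus>\<^bsub>T\<^esub> p (v (FX.coef x' b)) b)"
    by (rule T.finsum_cong') (use v x in \<open>auto simp: FX.coef_add additive_coefD[OF v] pure_add_left\<close>)
  also have "\<dots> = (\<Oplus>\<^bsub>T\<^esub>b\<in>?S. p (v (FX.coef x b)) b) \<oplus>\<^bsub>T\<^esub> (\<Oplus>\<^bsub>T\<^esub>b\<in>?S. p (v (FX.coef x' b)) b)"
    by (rule T.finsum_addf) (use x in \<open>auto simp: additive_coefD[OF v]\<close>)
  also have "\<dots> = ext_coef v x \<oplus>\<^bsub>T\<^esub> ext_coef v x'"
    using ext_coef_superset[OF v x(1) S(1)] ext_coef_superset[OF v x(2) S(1)] by auto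
  finally show ?thesis .
qed

lemma ext_coef_additive: "additive_coef v \<Longrightarrow> additive X T (ext_coef v)"
  by (rule additiveI) (simp_all add: ext_coef_closed ext_coef_add)

lemma ext_coef_plus:
  assumes v: "additive_coef v" "additive_coef v'" and x: "x \<in> carrier X"
  shows "ext_coef (\<lambda>f. v f \<oplus>\<^bsub>Y\<^esub> v' f) x = ext_coef v x \<oplus>\<^bsub>T\<^esub> ext_coef v' x"
proof -
  have "ext_coef (\<lambda>f. v f \<oplus>\<^bsub>Y\<^esub> v' f) x =
      (\<Oplus>\<^bsub>T\<^esub>b\<in>FX.supp x. p (v (FX.coef x b)) b \<oplus>\<^bsub>T\<^esub> p (v' (FX.coef x b)) b)"
    unfolding ext_coef_def
    by (rule T.finsum_cong') (use x in \<open>auto simp: additive_coefD[OF v(1)] additive_coefD[OF v(2)] pure_add_left\<close>)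
  also have "\<dots> = ext_coef v x \<oplus>\<^bsub>T\<^esub> ext_coef v' x"
    unfolding ext_coef_def
    by (rule T.finsum_addf) (use x in \<open>auto simp: additive_coefD[OF v(1)] additive_coefD[OF v(2)]\<close>)
  finally show ?thesis .
qed

lemma ext_coef_cong:
  assumes "\<And>f. f \<in> polys n \<Longrightarrow> v f = v' f" "additive_coef v'" "x \<in> carrier X"
  shows "ext_coef v x = ext_coef v' x"
  unfolding ext_coef_def
  by (rule T.finsum_cong') (use assms additive_coefD[OF assms(2)] in auto)

lemma ext_coef_smult:
  assumes v: "additive_coef v" and x: "x \<in> carrier X" and r: "r \<in> polys n"
  shows "ext_coef v (r \<odot>\<^bsub>X\<^esub> x) = ext_coef (\<lambda>f. v (r * f)) x"
proof -
  have "FX.supp (r \<odot>\<^bsub>X\<^esub> x) \<subseteq> FX.supp x" using x r by (auto simp: FX.coef_smult)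
  then have "ext_coef v (r \<odot>\<^bsub>X\<^esub> x) = (\<Oplus>\<^bsub>T\<^esub>b\<in>FX.supp x. p (v (FX.coef (r \<odot>\<^bsub>X\<^esub> x) b)) b)"
    by (intro ext_coef_superset) (use v x r in auto)
  also have "\<dots> = ext_coef (\<lambda>f. v (r * f)) x"
    unfolding ext_coef_def
    by (rule T.finsum_cong') (use x r in \<open>auto simp: FX.coef_smult additive_coefD[OF v]\<close>)
  finally show ?thesis .
qed

lemma ext_coef_basis:
  assumes v: "additive_coef v" and b: "b \<in> B" and f: "f \<in> polys n"
  shows "ext_coef v (f \<odot>\<^bsub>X\<^esub> b) = p (v f) b"
proof -
  have "ext_coef v (f \<odot>\<^bsub>X\<^esub> b) = (\<Oplus>\<^bsub>T\<^esub>b'\<in>{b}. p (v (FX.coef (f \<odot>\<^bsub>X\<^esub> b) b')) b')"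
    by (rule ext_coef_superset) (use assms in \<open>auto simp: FX.coef_basis split: if_splits\<close>)
  then show ?thesis using assms by (simp add: FX.coef_basis additive_coefD[OF v])
qed

lemma ext_coef_parity:
  "x \<in> evens X \<Longrightarrow> (\<And>f. f \<in> polys n \<Longrightarrow> v f \<in> evens Y) \<Longrightarrow> ext_coef v x \<in> evens T"
  "x \<in> odds X \<Longrightarrow> (\<And>f. f \<in> polys n \<Longrightarrow> v f \<in> evens Y) \<Longrightarrow> ext_coef v x \<in> odds T"
  "x \<in> evens X \<Longrightarrow> (\<And>f. f \<in> polys n \<Longrightarrow> v f \<in> odds Y) \<Longrightarrow> ext_coef v x \<in> odds T"
  "x \<in> odds X \<Longrightarrow> (\<And>f. f \<in> polys n \<Longrightarrow> v f \<in> odds Y) \<Longrightarrow> ext_coef v x \<in> evens T"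
proof -
  {
    assume x: "x \<in> evens X"
    then have b: "b \<in> evens X" "FX.coef x b \<in> polys n" if "b \<in> FX.supp x" for b
      using that FX.coef_even[OF x] by simp_all
    show "(\<And>f. f \<in> polys n \<Longrightarrow> v f \<in> evens Y) \<Longrightarrow> ext_coef v x \<in> evens T"
      unfolding ext_coef_def by (rule TT.evens_finsum) (simp add: b)
    show "(\<And>f. f \<in> polys n \<Longrightarrow> v f \<in> odds Y) \<Longrightarrow> ext_coef v x \<in> odds T"
      unfolding ext_coef_def by (rule TT.odds_finsum) (simp add: b)
  }
  {
    assume x: "x \<in> odds X"
    then have b: "b \<in> odds X" "FX.coef x b \<in> polys n" if "b \<in> FX.supp x" for b
      using that FX.coef_odd[OF x] by simp_all
    show "(\<And>f. f \<in> polys n \<Longrightarrow> v f \<in> evens Y) \<Longrightarrow> ext_coef v x \<in> odds T"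
      unfolding ext_coef_def by (rule TT.odds_finsum) (simp add: b)
    show "(\<And>f. f \<in> polys n \<Longrightarrow> v f \<in> odds Y) \<Longrightarrow> ext_coef v x \<in> evens T"
      unfolding ext_coef_def by (rule TT.evens_finsum) (simp add: b)
  }
qed

text \<open>Coefficients of the right factor can be moved to the left one, so the tensors y
  \<otimes> b with b in B already generate additively. This allows the comparison of maps that are
  not linear in the primed variables.\<close>

lemma basis_additive_eqI:
  assumes N: "abelian_group N" and f: "additive T N f" and g: "additive T N g" and t: "t \<in> carrier T"
    and eq: "\<And>y b. y \<in> carrier Y \<Longrightarrow> b \<in> B \<Longrightarrow> f (p y b) = g (p y b)"
  shows "f t = g t"
proof (rule tensor_additive_eqI[OF N f g t])
  fix y x assume yx: "y \<in> carrier Y" "x \<in> carrier X"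
  have "p y x = p y (\<Oplus>\<^bsub>X\<^esub>b\<in>FX.supp x. FX.coef x b \<odot>\<^bsub>X\<^esub> b)" using yx by (simp add: FX.coef_sum)
  also have "\<dots> = (\<Oplus>\<^bsub>T\<^esub>b\<in>FX.supp x. p y (FX.coef x b \<odot>\<^bsub>X\<^esub> b))"
    by (rule additive_finsum[OF X.ab T_ab pure_additive_right]) (use yx in auto)
  finally have e: "p y x = (\<Oplus>\<^bsub>T\<^esub>b\<in>FX.supp x. p y (FX.coef x b \<odot>\<^bsub>X\<^esub> b))" .
  have fs: "h (p y x) = (\<Oplus>\<^bsub>N\<^esub>b\<in>FX.supp x. h (p (primed n (FX.coef x b) \<odot>\<^bsub>Y\<^esub> y) b))"
    if h: "additive T N h" for h
  proof -
    interpret N: abelian_group N by (rule N)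
    have "h (p y x) = (\<Oplus>\<^bsub>N\<^esub>b\<in>FX.supp x. h (p y (FX.coef x b \<odot>\<^bsub>X\<^esub> b)))"
      unfolding e by (rule additive_finsum[OF T_ab N h]) (use yx in auto)
    also have "\<dots> = (\<Oplus>\<^bsub>N\<^esub>b\<in>FX.supp x. h (p (primed n (FX.coef x b) \<odot>\<^bsub>Y\<^esub> y) b))"
      by (rule N.finsum_cong') (use yx additive_closed[OF h] in \<open>auto simp: pure_balanced\<close>)
    finally show ?thesis .
  qed
  interpret N: abelian_group N by (rule N)
  show "f (p y x) = g (p y x)"
    unfolding fs[OF f] fs[OF g]
    by (rule N.finsum_cong') (use yx additive_closed[OF g] in \<open>auto simp: eq\<close>)
qed

text \<open>Replaces \<open>u \<otimes> 1\<close>, which is not defined when \<open>u\<close> is linear over the left action only.\<close>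

definition ext_left where
  "ext_left u = tensor_lift n Y X T (\<lambda>y. ext_coef (\<lambda>f. u (primed n f \<odot>\<^bsub>Y\<^esub> y)))"

lemma coef_additive:
  assumes "additive Y Y u" "y \<in> carrier Y" shows "additive_coef (\<lambda>f. u (primed n f \<odot>\<^bsub>Y\<^esub> y))"
  by (rule additiveI)
    (use assms in \<open>simp_all add: additive_closed[OF assms(1)] Y.add_smult additive_add[OF assms(1)]\<close>)

text \<open>The coefficient of x is moved to y before u is applied; this makes the construction
  balanced even when u does not commute with the primed action, at the price of depending on the
  basis.\<close>

lemma ext_left_balanced:
  assumes u: "additive Y Y u"
  shows "balanced n Y X T (\<lambda>y. ext_coef (\<lambda>f. u (primed n f \<odot>\<^bsub>Y\<^esub> y)))"
proof (rule balancedI)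
  fix y x assume y: "y \<in> carrier Y" and x: "x \<in> carrier X"
  show "ext_coef (\<lambda>f. u (primed n f \<odot>\<^bsub>Y\<^esub> y)) x \<in> carrier T"
    by (rule ext_coef_closed[OF coef_additive[OF u y] x])
  show "ext_coef (\<lambda>f. u (primed n f \<odot>\<^bsub>Y\<^esub> (y \<oplus>\<^bsub>Y\<^esub> y'))) x =
      ext_coef (\<lambda>f. u (primed n f \<odot>\<^bsub>Y\<^esub> y)) x \<oplus>\<^bsub>T\<^esub> ext_coef (\<lambda>f. u (primed n f \<odot>\<^bsub>Y\<^esub> y')) x"
    if y': "y' \<in> carrier Y" for y'
    unfolding ext_coef_plus[OF coef_additive[OF u y] coef_additive[OF u y'] x, symmetric]
    by (rule ext_coef_cong[OF _ additive_plus[OF Y.ab coef_additive[OF u y] coef_additive[OF u y']] x])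
      (use y y' in \<open>simp add: Y.smult_add additive_add[OF u]\<close>)
  show "ext_coef (\<lambda>f. u (primed n f \<odot>\<^bsub>Y\<^esub> y)) (x \<oplus>\<^bsub>X\<^esub> x') =
      ext_coef (\<lambda>f. u (primed n f \<odot>\<^bsub>Y\<^esub> y)) x \<oplus>\<^bsub>T\<^esub> ext_coef (\<lambda>f. u (primed n f \<odot>\<^bsub>Y\<^esub> y)) x'"
    if x': "x' \<in> carrier X" for x'
    by (rule ext_coef_add[OF coef_additive[OF u y] x x'])
  fix s :: "'k mpoly" assume s: "s \<in> polys n"
  have sy: "primed n s \<odot>\<^bsub>Y\<^esub> y \<in> carrier Y" using s y by simp
  have "ext_coef (\<lambda>f. u (primed n f \<odot>\<^bsub>Y\<^esub> y)) (s \<odot>\<^bsub>X\<^esub> x) =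
      ext_coef (\<lambda>f. u (primed n (s * f) \<odot>\<^bsub>Y\<^esub> y)) x"
    by (rule ext_coef_smult[OF coef_additive[OF u y] x s])
  also have "\<dots> = ext_coef (\<lambda>f. u (primed n f \<odot>\<^bsub>Y\<^esub> (primed n s \<odot>\<^bsub>Y\<^esub> y))) x"
    by (rule ext_coef_cong[OF _ coef_additive[OF u sy] x])
      (use s y in \<open>simp add: mult.commute flip: Y.smult_smult\<close>)
  finally show "ext_coef (\<lambda>f. u (primed n f \<odot>\<^bsub>Y\<^esub> (primed n s \<odot>\<^bsub>Y\<^esub> y))) x =
      ext_coef (\<lambda>f. u (primed n f \<odot>\<^bsub>Y\<^esub> y)) (s \<odot>\<^bsub>X\<^esub> x)" ..
qed

lemma ext_left:
  assumes u: "additive Y Y u"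
  shows ext_left_additive: "additive T T (ext_left u)"
    and ext_left_pure: "y \<in> carrier Y \<Longrightarrow> x \<in> carrier X \<Longrightarrow>
      ext_left u (p y x) = ext_coef (\<lambda>f. u (primed n f \<odot>\<^bsub>Y\<^esub> y)) x"
    and ext_left_basis: "y \<in> carrier Y \<Longrightarrow> b \<in> B \<Longrightarrow> ext_left u (p y b) = p (u y) b"
proof -
  note l = tensor_lift[OF T_ab ext_left_balanced[OF u], folded ext_left_def]
  show "additive T T (ext_left u)" by (rule l(1))
  show *: "y \<in> carrier Y \<Longrightarrow> x \<in> carrier X \<Longrightarrow>
      ext_left u (p y x) = ext_coef (\<lambda>f. u (primed n f \<odot>\<^bsub>Y\<^esub> y)) x" for x by (rule l(2))
  assume y: "y \<in> carrier Y" and b: "b \<in> B"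
  have "ext_left u (p y b) = ext_coef (\<lambda>f. u (primed n f \<odot>\<^bsub>Y\<^esub> y)) (1 \<odot>\<^bsub>X\<^esub> b)" using * y b by simp
  then show "ext_left u (p y b) = p (u y) b"
    using ext_coef_basis[OF coef_additive[OF u y] b, of 1] y by simp
qed

lemma ext_left_linear:
  assumes u: "is_linear n Y Y u" shows "is_linear n T T (ext_left u)"
  unfolding is_linear_def
proof (intro conjI ballI)
  note uD = is_linearD[OF u]
  show "additive T T (ext_left u)" by (rule ext_left_additive[OF uD(1)])
  fix r :: "'k mpoly" and t assume r: "r \<in> polys n" and t: "t \<in> carrier T"
  show "ext_left u (r \<odot>\<^bsub>T\<^esub> t) = r \<odot>\<^bsub>T\<^esub> ext_left u t"
  proof (rule basis_additive_eqI[OF T_ab _ _ t, of "\<lambda>t. ext_left u (r \<odot>\<^bsub>T\<^esub> t)" "\<lambda>t. r \<odot>\<^bsub>T\<^esub> ext_left u t"])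
    show "additive T T (\<lambda>t. ext_left u (r \<odot>\<^bsub>T\<^esub> t))"
      by (rule additive_compose[OF smult_additive[OF r] ext_left_additive[OF uD(1)]])
    show "additive T T (\<lambda>t. r \<odot>\<^bsub>T\<^esub> ext_left u t)"
      by (rule additive_compose[OF ext_left_additive[OF uD(1)] smult_additive[OF r]])
  qed (use r in \<open>simp add: smult_left ext_left_basis[OF uD(1)] uD\<close>)
qed

lemma ext_left_odd:
  assumes u: "additive Y Y u" and odd: "u ` evens Y \<subseteq> odds Y" "u ` odds Y \<subseteq> evens Y"
  shows "ext_left u ` evens T \<subseteq> odds T" "ext_left u ` odds T \<subseteq> evens T"
proof -
  note a = additive_add[OF ext_left_additive[OF u]]
  have e: "u (primed n f \<odot>\<^bsub>Y\<^esub> y) \<in> odds Y" if "f \<in> polys n" "y \<in> evens Y" for f y using that odd by auto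
  have o: "u (primed n f \<odot>\<^bsub>Y\<^esub> y) \<in> evens Y" if "f \<in> polys n" "y \<in> odds Y" for f y using that odd by auto
  have "ext_left u t \<in> odds T" if "t \<in> evens T" for t using that
    by (induction rule: evens_T_induct) (auto simp: a ext_left_pure[OF u] ext_coef_parity e o)
  then show "ext_left u ` evens T \<subseteq> odds T" by auto
  have "ext_left u t \<in> evens T" if "t \<in> odds T" for t using that
    by (induction rule: odds_T_induct) (auto simp: a ext_left_pure[OF u] ext_coef_parity e o)
  then show "ext_left u ` odds T \<subseteq> evens T" by auto
qed

lemma ext_left_eqI:
  assumes "additive Y Y u" "additive Y Y v" "t \<in> carrier T" "\<And>y. y \<in> carrier Y \<Longrightarrow> u y = v y"
  shows "ext_left u t = ext_left v t"
  by (rule basis_additive_eqI[OF T_ab ext_left_additive[OF assms(1)] ext_left_additive[OF assms(2)] assms(3)])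
    (simp add: ext_left_basis assms)

lemma ext_left_comp:
  assumes u: "additive Y Y u" and v: "additive Y Y v" and t: "t \<in> carrier T"
  shows "ext_left u (ext_left v t) = ext_left (\<lambda>y. u (v y)) t"
  by (rule basis_additive_eqI[OF T_ab additive_compose[OF ext_left_additive[OF v] ext_left_additive[OF u]]
        ext_left_additive[OF additive_compose[OF v u]] t])
    (simp add: ext_left_basis[OF u] ext_left_basis[OF v] ext_left_basis[OF additive_compose[OF v u]]
      additive_closed[OF v])

end


section \<open>Perturbation of a contraction\<close>

text \<open>
  Replacing \<open>h\<close> by \<open>h (2 - [d, h])\<close> squares the error \<open>[d, h] - 1\<close>, because \<open>[d, h]\<close> commutes with
  \<open>d\<close>; an error that raises a finite filtration therefore disappears after finitely many steps.
\<close>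

lemma contraction_perturbation:
  fixes T :: "('k::comm_ring_1 mpoly, 't) mf"
  assumes T: "premf n T" and W: "W \<in> polys n"
    and dd: "\<And>t. t \<in> carrier T \<Longrightarrow> diff T (diff T t) = W \<odot>\<^bsub>T\<^esub> t"
    and N: "N \<subseteq> carrier T" "\<And>s t. s \<in> N \<Longrightarrow> t \<in> N \<Longrightarrow> s \<ominus>\<^bsub>T\<^esub> t \<in> N"
      "\<And>s t. s \<in> N \<Longrightarrow> t \<in> N \<Longrightarrow> s \<oplus>\<^bsub>T\<^esub> t \<in> N" "\<And>t. t \<in> N \<Longrightarrow> diff T t \<in> N"
    and Fneg: "\<And>j t. t \<in> F j \<Longrightarrow> \<ominus>\<^bsub>T\<^esub> t \<in> F j" and Fmono: "\<And>i j. i \<le> j \<Longrightarrow> F j \<subseteq> F i"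
    and F0: "carrier T \<subseteq> F 0" and Ftop: "F k \<subseteq> {\<zero>\<^bsub>T\<^esub>}"
    and h0: "is_homotopy n T T h0" "\<And>t. t \<in> carrier T \<Longrightarrow> h0 t \<in> N"
    and err: "\<And>j t. t \<in> N \<Longrightarrow> t \<in> F j \<Longrightarrow> (diff T (h0 t) \<oplus>\<^bsub>T\<^esub> h0 (diff T t)) \<ominus>\<^bsub>T\<^esub> t \<in> F (Suc j)"
  obtains h where "is_homotopy n T T h" "\<And>t. t \<in> carrier T \<Longrightarrow> h t \<in> N"
    "\<And>t. t \<in> N \<Longrightarrow> diff T (h t) \<oplus>\<^bsub>T\<^esub> h (diff T t) = t"
proof -
  interpret T: premf n T by fact
  \<comment> \<open>The quadratic gain is recorded only as one further filtration step for each m,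
    which is enough to reach the top step k.\<close>
  have "\<exists>h. is_homotopy n T T h \<and> (\<forall>t\<in>carrier T. h t \<in> N) \<and>
      (\<forall>j. \<forall>t\<in>N. t \<in> F j \<longrightarrow> (diff T (h t) \<oplus>\<^bsub>T\<^esub> h (diff T t)) \<ominus>\<^bsub>T\<^esub> t \<in> F (j + Suc m))" for m
  proof (induction m)
    case 0
    then show ?case using h0 err by (intro exI[of _ h0]) simp
  next
    case (Suc m)
    then obtain h where h: "is_homotopy n T T h" and hN: "\<And>t. t \<in> carrier T \<Longrightarrow> h t \<in> N"
      and herr: "\<And>j t. t \<in> N \<Longrightarrow> t \<in> F j \<Longrightarrow>
        (diff T (h t) \<oplus>\<^bsub>T\<^esub> h (diff T t)) \<ominus>\<^bsub>T\<^esub> t \<in> F (j + Suc m)" by blast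
    note lh = is_linearD[OF is_homotopy_linear[OF h]]
    note hneg = additive_neg[OF T.ab T.ab lh(1)]
    have hpar: "t \<in> evens T \<Longrightarrow> h t \<in> odds T" "t \<in> odds T \<Longrightarrow> h t \<in> evens T" for t
      using h by (auto simp: is_homotopy_def)
    define c where "c t = diff T (h t) \<oplus>\<^bsub>T\<^esub> h (diff T t)" for t
    define \<nu> where "\<nu> t = c t \<ominus>\<^bsub>T\<^esub> t" for t
    define u where "u t = t \<ominus>\<^bsub>T\<^esub> \<nu> t" for t
    have hc: "h t \<in> carrier T" if "t \<in> carrier T" for t using lh(2) that .
    have cc [simp]: "c t \<in> carrier T" "\<nu> t \<in> carrier T" "u t \<in> carrier T" if "t \<in> carrier T" for t
      using that hc by (simp_all add: c_def \<nu>_def u_def)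
    have c_add: "c (s \<oplus>\<^bsub>T\<^esub> t) = c s \<oplus>\<^bsub>T\<^esub> c t" if "s \<in> carrier T" "t \<in> carrier T" for s t
      using that by (simp add: c_def lh T.diff_add hc T.ac)
    have c_neg: "c (\<ominus>\<^bsub>T\<^esub> t) = \<ominus>\<^bsub>T\<^esub> c t" if "t \<in> carrier T" for t
      using that by (simp add: c_def hneg T.diff_neg hc T.mm.M.minus_add)
    have c_smult: "c (r \<odot>\<^bsub>T\<^esub> t) = r \<odot>\<^bsub>T\<^esub> c t" if "r \<in> polys n" "t \<in> carrier T" for r t
      using that by (simp add: c_def lh T.diff_smult hc T.smult_add)
    \<comment> \<open>Both sides are dhd + Wh, because d squares to the scalar W and h commutes with
      scalars.\<close>
    have c_diff: "c (diff T t) = diff T (c t)" if "t \<in> carrier T" for t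
      using that W by (simp add: c_def T.diff_add hc dd lh T.ac)
    have cN: "c t \<in> N" "\<nu> t \<in> N" "u t \<in> N" if "t \<in> N" for t
    proof -
      have t: "t \<in> carrier T" using that N by auto
      show "c t \<in> N" unfolding c_def using t hN N(3,4) that by auto
      then show "\<nu> t \<in> N" unfolding \<nu>_def using N(2) that by auto
      then show "u t \<in> N" unfolding u_def using N(2) that by auto
    qed
    have u_add: "u (s \<oplus>\<^bsub>T\<^esub> t) = u s \<oplus>\<^bsub>T\<^esub> u t" if "s \<in> carrier T" "t \<in> carrier T" for s t
      using that by (simp add: u_def \<nu>_def c_add a_minus_def T.mm.M.minus_add T.ac)
    have u_smult: "u (r \<odot>\<^bsub>T\<^esub> t) = r \<odot>\<^bsub>T\<^esub> u t" if "r \<in> polys n" "t \<in> carrier T" for r t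
      using that by (simp add: u_def \<nu>_def c_smult a_minus_def T.smult_add T.smult_neg)
    have u_diff: "u (diff T t) = diff T (u t)" if "t \<in> carrier T" for t
      using that by (simp add: u_def \<nu>_def c_diff T.diff_minus)
    have u_par: "t \<in> evens T \<Longrightarrow> u t \<in> evens T" "t \<in> odds T \<Longrightarrow> u t \<in> odds T" for t
      by (simp_all add: u_def \<nu>_def c_def hpar)
    show ?case
    proof (intro exI[of _ "\<lambda>t. h (u t)"] conjI allI ballI impI)
      show "is_homotopy n T T (\<lambda>t. h (u t))"
        unfolding is_homotopy_def
      proof (intro conjI ballI)
        show "additive T T (\<lambda>t. h (u t))"
          by (rule additive_compose[OF additiveI lh(1)]) (simp_all add: u_add)
      qed (auto simp: u_smult lh hpar u_par)
      show "h (u t) \<in> N" if "t \<in> carrier T" for t using that by (simp add: hN)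
      fix j t assume t: "t \<in> N" "t \<in> F j"
      have tc: "t \<in> carrier T" using t N by auto
      have "\<nu> t \<in> F (j + Suc m)" using herr[OF t] by (simp add: \<nu>_def c_def)
      then have "\<nu> (\<nu> t) \<in> F (j + Suc m + Suc m)"
        using herr[OF cN(2)[OF t(1)], of "j + Suc m"] by (simp add: \<nu>_def[of "\<nu> t"] c_def[of "\<nu> t"])
      then have F: "\<ominus>\<^bsub>T\<^esub> \<nu> (\<nu> t) \<in> F (j + Suc (Suc m))"
        using Fneg Fmono[of "j + Suc (Suc m)" "j + Suc m + Suc m"] by auto
      have ct: "c t = t \<oplus>\<^bsub>T\<^esub> \<nu> t" using tc by (simp add: \<nu>_def T.ab_simps)
      \<comment> \<open>With c = 1 + \<nu> and u = 1 - \<nu> the new commutator is cu = 1 -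
        \<nu>\<nu>, so its error is the negative square of the old one.\<close>
      have "diff T (h (u t)) \<oplus>\<^bsub>T\<^esub> h (u (diff T t)) = c (u t)" using tc by (simp add: u_diff c_def)
      also have "\<dots> = c t \<oplus>\<^bsub>T\<^esub> \<ominus>\<^bsub>T\<^esub> c (\<nu> t)" unfolding u_def a_minus_def using tc by (simp add: c_add c_neg)
      also have "c (\<nu> t) = \<nu> t \<oplus>\<^bsub>T\<^esub> \<nu> (\<nu> t)" using tc by (simp add: \<nu>_def[of "\<nu> t"] T.ab_simps)
      finally have "diff T (h (u t)) \<oplus>\<^bsub>T\<^esub> h (u (diff T t)) \<ominus>\<^bsub>T\<^esub> t = \<ominus>\<^bsub>T\<^esub> \<nu> (\<nu> t)"
        unfolding ct using tc by (simp add: T.ab_simps)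
      then show "diff T (h (u t)) \<oplus>\<^bsub>T\<^esub> h (u (diff T t)) \<ominus>\<^bsub>T\<^esub> t \<in> F (j + Suc (Suc m))" using F by simp
    qed
  qed
  from this[of k] obtain h where h: "is_homotopy n T T h" "\<And>t. t \<in> carrier T \<Longrightarrow> h t \<in> N"
    and e: "\<And>j t. t \<in> N \<Longrightarrow> t \<in> F j \<Longrightarrow>
      (diff T (h t) \<oplus>\<^bsub>T\<^esub> h (diff T t)) \<ominus>\<^bsub>T\<^esub> t \<in> F (j + Suc k)" by blast
  show ?thesis
  proof (rule that[OF h])
    fix t assume t: "t \<in> N"
    then have tc: "t \<in> carrier T" using N by auto
    have hc: "h s \<in> carrier T" if "s \<in> carrier T" for s using h(2)[OF that] N(1) by auto
    have "(diff T (h t) \<oplus>\<^bsub>T\<^esub> h (diff T t)) \<ominus>\<^bsub>T\<^esub> t = \<zero>\<^bsub>T\<^esub>"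
      using e[OF t, of 0] F0 tc Ftop Fmono[of k "0 + Suc k"] by auto
    then show "diff T (h t) \<oplus>\<^bsub>T\<^esub> h (diff T t) = t"
      using tc hc by (subst (asm) T.minus_eq_iff) auto
  qed
qed

text \<open>The defect c = d\<iota> - \<iota>d takes values in N and satisfies dc = -cd, since both
  differentials square to W. As h contracts N, d(\<iota> - hc) = \<iota>d + hdc = (\<iota> -
  hc)d.\<close>

lemma section_correction:
  fixes T :: "('k::comm_ring_1 mpoly, 't) mf"
  assumes V: "premf n V" and T: "premf n T" and W: "W \<in> polys n"
    and ddV: "\<And>v. v \<in> carrier V \<Longrightarrow> diff V (diff V v) = W \<odot>\<^bsub>V\<^esub> v"
    and ddT: "\<And>t. t \<in> carrier T \<Longrightarrow> diff T (diff T t) = W \<odot>\<^bsub>T\<^esub> t"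
    and \<iota>: "is_linear n V T \<iota>" "\<iota> ` evens V \<subseteq> evens T" "\<iota> ` odds V \<subseteq> odds T"
    and N: "N \<subseteq> carrier T" "\<And>v. v \<in> carrier V \<Longrightarrow> diff T (\<iota> v) \<ominus>\<^bsub>T\<^esub> \<iota> (diff V v) \<in> N"
    and h: "is_homotopy n T T h" "\<And>t. t \<in> carrier T \<Longrightarrow> h t \<in> N"
      "\<And>t. t \<in> N \<Longrightarrow> diff T (h t) \<oplus>\<^bsub>T\<^esub> h (diff T t) = t"
  shows "is_mf_map n V T (\<lambda>v. \<iota> v \<ominus>\<^bsub>T\<^esub> h (diff T (\<iota> v) \<ominus>\<^bsub>T\<^esub> \<iota> (diff V v)))"
proof -
  interpret V: premf n V by fact
  interpret T: premf n T by fact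
  note lh = is_linearD[OF is_homotopy_linear[OF h(1)]]
  note hneg = additive_neg[OF T.ab T.ab lh(1)]
  have hpar: "t \<in> evens T \<Longrightarrow> h t \<in> odds T" "t \<in> odds T \<Longrightarrow> h t \<in> evens T" for t
    using h(1) by (auto simp: is_homotopy_def)
  have \<iota>par: "t \<in> evens V \<Longrightarrow> \<iota> t \<in> evens T" "t \<in> odds V \<Longrightarrow> \<iota> t \<in> odds T" for t
    using \<iota>(2,3) by auto
  note l\<iota> = is_linearD[OF \<iota>(1)]
  define c where "c v = diff T (\<iota> v) \<ominus>\<^bsub>T\<^esub> \<iota> (diff V v)" for v
  have cc [simp]: "c v \<in> carrier T" if "v \<in> carrier V" for v using that by (simp add: c_def l\<iota>(2))
  have c_diff: "c (diff V v) = \<ominus>\<^bsub>T\<^esub> diff T (c v)" if "v \<in> carrier V" for v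
    using that W by (simp add: c_def ddV ddT l\<iota> T.diff_add T.diff_neg T.ab_simps)
  have c_add: "c (v \<oplus>\<^bsub>V\<^esub> w) = c v \<oplus>\<^bsub>T\<^esub> c w" if "v \<in> carrier V" "w \<in> carrier V" for v w
    using that by (simp add: c_def l\<iota> V.diff_add T.diff_add T.ab_simps)
  have c_smult: "c (r \<odot>\<^bsub>V\<^esub> v) = r \<odot>\<^bsub>T\<^esub> c v" if "r \<in> polys n" "v \<in> carrier V" for r v
    using that by (simp add: c_def l\<iota> V.diff_smult T.diff_smult a_minus_def T.smult_add T.smult_neg)
  have c_par: "v \<in> evens V \<Longrightarrow> c v \<in> odds T" "v \<in> odds V \<Longrightarrow> c v \<in> evens T" for v
    by (simp_all add: c_def \<iota>par)
  show ?thesis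
    unfolding is_mf_map_def is_linear_def c_def[symmetric]
  proof (intro conjI ballI)
    show "additive V T (\<lambda>v. \<iota> v \<ominus>\<^bsub>T\<^esub> h (c v))"
      by (rule additiveI) (simp_all add: l\<iota> lh(2,3) c_add T.ab_simps)
    fix v assume v: "v \<in> carrier V"
    have "c v = diff T (h (c v)) \<oplus>\<^bsub>T\<^esub> h (diff T (c v))"
      using h(3)[of "c v"] N(2)[OF v] by (simp add: c_def)
    moreover have "diff T (\<iota> v) = \<iota> (diff V v) \<oplus>\<^bsub>T\<^esub> c v"
      using v by (simp add: c_def l\<iota>(2) T.ab_simps)
    ultimately have "diff T (\<iota> v) = \<iota> (diff V v) \<oplus>\<^bsub>T\<^esub> (diff T (h (c v)) \<oplus>\<^bsub>T\<^esub> h (diff T (c v)))" by simp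
    then show "\<iota> (diff V v) \<ominus>\<^bsub>T\<^esub> h (c (diff V v)) = diff T (\<iota> v \<ominus>\<^bsub>T\<^esub> h (c v))"
      using v by (simp add: c_diff hneg T.diff_add T.diff_neg l\<iota>(2) lh(2) T.ab_simps)
  qed (auto simp: l\<iota> lh c_smult a_minus_def T.smult_add T.smult_neg \<iota>par hpar c_par)
qed

text \<open>For such u the coefficients may be moved back across the tensor sign, so the
  construction no longer depends on the basis and is u \<otimes> 1.\<close>

lemma (in free_pair) ext_left_right_linear:
  assumes u: "is_linear (n + n) Y Y u" and y: "y \<in> carrier Y" and x: "x \<in> carrier X"
  shows "ext_left u (p y x) = p (u y) x"
proof -
  note uD = is_linearD[OF u]
  have "p (u y) x = p (u y) (\<Oplus>\<^bsub>X\<^esub>b\<in>FX.supp x. FX.coef x b \<odot>\<^bsub>X\<^esub> b)" using x by (simp add: FX.coef_sum)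
  also have "\<dots> = (\<Oplus>\<^bsub>T\<^esub>b\<in>FX.supp x. p (u y) (FX.coef x b \<odot>\<^bsub>X\<^esub> b))"
    by (rule additive_finsum[OF X.ab T_ab pure_additive_right]) (use x y uD(2) in auto)
  also have "\<dots> = (\<Oplus>\<^bsub>T\<^esub>b\<in>FX.supp x. p (u (primed n (FX.coef x b) \<odot>\<^bsub>Y\<^esub> y)) b)"
    by (rule T.finsum_cong') (use x y uD in \<open>simp_all add: pure_balanced\<close>)
  also have "\<dots> = ext_left u (p y x)"
    by (simp only: ext_left_pure[OF uD(1) y x] ext_coef_def)
  finally show ?thesis ..
qed

lemma (in free_pair) ext_coef_left:
  assumes v: "additive_coef v" and x: "x \<in> carrier X" and r: "r \<in> polys n"
  shows "r \<odot>\<^bsub>T\<^esub> ext_coef v x = ext_coef (\<lambda>f. r \<odot>\<^bsub>Y\<^esub> v f) x"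
proof -
  have "r \<odot>\<^bsub>T\<^esub> ext_coef v x = (\<Oplus>\<^bsub>T\<^esub>b\<in>FX.supp x. r \<odot>\<^bsub>T\<^esub> p (v (FX.coef x b)) b)"
    unfolding ext_coef_def
    by (rule additive_finsum[OF T_ab T_ab smult_additive[OF r]]) (use x additive_coefD[OF v] in auto)
  also have "\<dots> = ext_coef (\<lambda>f. r \<odot>\<^bsub>Y\<^esub> v f) x"
    unfolding ext_coef_def
    by (rule T.finsum_cong') (use x r additive_coefD[OF v] in \<open>simp_all add: smult_left\<close>)
  finally show ?thesis .
qed


section \<open>Modules over \<open>A\<^sub>G\<close> and their components\<close>

locale A_tensor = symmetric_potential n W G + X: premf n X
  for n :: nat and W :: "'k::comm_ring_1 mpoly" and G and X :: "('k mpoly, 'x) mf"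
begin

abbreviation "tw g \<equiv> twist (ginv n g) X"

lemma premf_tw: "g \<in> G \<Longrightarrow> premf n (tw g)"
  by (rule premf_twist[OF X.premf_axioms ginv_endo[OF G]])

sublocale AX: tensor_pair n n A X
  by unfold_locales simp

definition proj where "proj g = tensor_lift n A X X (\<lambda>a x. eps g a \<odot>\<^bsub>X\<^esub> x)"

lemma proj_balanced: "g \<in> G \<Longrightarrow> balanced n A X X (\<lambda>a x. eps g a \<odot>\<^bsub>X\<^esub> x)"
  by (rule balancedI)
    (simp_all add: eps_add eps_primed X.add_smult X.smult_add X.smult_smult X.smult_commute)

lemmas proj_additive = tensor_pair.tensor_lift_additive[OF AX.tensor_pair_axioms X.ab proj_balanced, folded proj_def]
lemmas proj_pure = tensor_pair.tensor_lift_pure[OF AX.tensor_pair_axioms X.ab proj_balanced, folded proj_def]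

lemma proj_closed [simp]: "g \<in> G \<Longrightarrow> t \<in> carrier AX.T \<Longrightarrow> proj g t \<in> carrier X"
  using additive_closed[OF proj_additive] .

text \<open>The augmentation kills the differential of I and, vanishing on odd elements, ignores the
  Koszul sign; only the differential of X survives.\<close>

lemma proj_mf_map:
  assumes g: "g \<in> G" shows "is_mf_map n AX.T (tw g) (proj g)"
  unfolding is_mf_map_def is_linear_def
proof (intro conjI ballI)
  note a = proj_additive[OF g]
  show "additive AX.T (tw g) (proj g)" using a by simp
  have "proj g t \<in> evens X" if "t \<in> evens AX.T" for t using that
    by (induction rule: AX.evens_T_induct) (simp_all add: g proj_pure eps_odd additive_add[OF a])
  then show "proj g ` evens AX.T \<subseteq> evens (tw g)" by auto
  have "proj g t \<in> odds X" if "t \<in> odds AX.T" for t using that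
    by (induction rule: AX.odds_T_induct) (simp_all add: g proj_pure eps_odd additive_add[OF a])
  then show "proj g ` odds AX.T \<subseteq> odds (tw g)" by auto
  fix t assume t: "t \<in> carrier AX.T"
  have "proj g (diff AX.T t) = diff X (proj g t)"
    by (rule AX.tensor_additive_eqI[OF X.ab additive_compose[OF AX.diff_T_additive a]
          additive_compose[OF a X.diff_additive] t])
      (simp add: AX.diff_pure additive_add[OF a] g proj_pure eps_diff eps_koszul X.diff_smult)
  then show "proj g (diff AX.T t) = diff (tw g) (proj g t)" by simp
  fix r :: "'k mpoly" assume r: "r \<in> polys n"
  have "proj g (r \<odot>\<^bsub>AX.T\<^esub> t) = ginv n g r \<odot>\<^bsub>X\<^esub> proj g t"
    by (rule AX.tensor_additive_eqI[OF X.ab additive_compose[OF AX.smult_additive[OF r] a]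
          additive_compose[OF a X.smult_additive] t])
      (use r g in \<open>simp_all add: AX.smult_left proj_pure eps_left X.smult_smult\<close>)
  then show "proj g (r \<odot>\<^bsub>AX.T\<^esub> t) = r \<odot>\<^bsub>tw g\<^esub> proj g t" by simp
qed

end

locale A_tensor_free = A_tensor n W G X + FX: free_premf n X B
  for n :: nat and W :: "'k::comm_ring_1 mpoly" and G and X :: "('k mpoly, 'x) mf" and B +
  assumes dd: "\<And>x. x \<in> carrier X \<Longrightarrow> diff X (diff X x) = W \<odot>\<^bsub>X\<^esub> x"
begin

sublocale AF: free_pair n A X B ..

abbreviation "T \<equiv> tensor n A X"
abbreviation "p \<equiv> pure n A X"

text \<open>The square contributes W - W' on \<open>A\<close> and W on X. The primed W moves across
  the tensor sign and cancels the latter, leaving W acting from the left.\<close>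

lemma T_diff_diff:
  assumes "t \<in> carrier T" shows "diff T (diff T t) = W \<odot>\<^bsub>T\<^esub> t"
proof (rule AX.tensor_additive_eqI[OF AX.T_ab additive_compose[OF AX.diff_T_additive AX.diff_T_additive]
      AX.smult_additive[OF W] assms])
  fix a x assume ax: "a \<in> carrier A" "x \<in> carrier X"
  have W2: "W \<in> polys (n + n)" by (rule polys_mono[OF W]) simp
  have "diff T (diff T (p a x)) = p (diff A (diff A a)) x \<oplus>\<^bsub>T\<^esub> p a (diff X (diff X x))"
    using ax by (simp add: AX.diff_pure AX.TT.diff_add A.koszul_diff AX.pure_neg_left AX.TT.ab_simps)
  also have "p (diff A (diff A a)) x = p (W \<odot>\<^bsub>A\<^esub> a) x \<oplus>\<^bsub>T\<^esub> \<ominus>\<^bsub>T\<^esub> p a (W \<odot>\<^bsub>X\<^esub> x)"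
    using ax W2 by (simp add: A_diff_diff A.diff_smult_eq a_minus_def AX.pure_add_left AX.pure_neg_left
        AX.pure_balanced)
  finally show "diff T (diff T (p a x)) = W \<odot>\<^bsub>T\<^esub> p a x"
    using ax W2 by (simp add: dd AX.smult_left AX.TT.ab_simps)
qed

text \<open>Places the coordinates of x in theta-degree zero of the summand at g. It is linear and
  split by \<open>proj\<close>, but in general it does not commute with the differentials; it is
  corrected in \<open>sections_exist\<close>.\<close>

definition incl where
  "incl g = AF.ext_coef (\<lambda>f. unit_coeff (\<lambda>h. if h = g then f else 0))"

lemma incl_coef_additive: "AF.additive_coef (\<lambda>f. unit_coeff (\<lambda>h. if h = g then f else 0))"
proof (rule additiveI)
  fix f f' :: "'k mpoly"
  have "(\<lambda>h. if h = g then f + f' else 0) = (\<lambda>h. (if h = g then f else 0) + (if h = g then f' else 0))"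
    by auto
  then show "unit_coeff (\<lambda>h. if h = g then f \<oplus>\<^bsub>PR n\<^esub> f' else 0) =
      unit_coeff (\<lambda>h. if h = g then f else 0) \<oplus>\<^bsub>A\<^esub> unit_coeff (\<lambda>h. if h = g then f' else 0)"
    by (simp only: PR_simps unit_coeff_add)
qed simp

lemma incl_additive: "additive X T (incl g)"
  unfolding incl_def by (rule AF.ext_coef_additive[OF incl_coef_additive])

lemma incl_linear:
  assumes g: "g \<in> G" shows "is_linear n (tw g) T (incl g)"
  unfolding is_linear_def
proof (intro conjI ballI)
  show "additive (tw g) T (incl g)" using incl_additive by simp
  fix r :: "'k mpoly" and x assume r: "r \<in> polys n" and "x \<in> carrier (tw g)"
  then have x: "x \<in> carrier X" by simp
  have "incl g (ginv n g r \<odot>\<^bsub>X\<^esub> x) =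
      AF.ext_coef (\<lambda>f. unit_coeff (\<lambda>h. if h = g then ginv n g r * f else 0)) x"
    unfolding incl_def by (rule AF.ext_coef_smult[OF incl_coef_additive x]) (use g r in simp)
  also have "(\<lambda>f. unit_coeff (\<lambda>h. if h = g then ginv n g r * f else 0)) =
      (\<lambda>f. r \<odot>\<^bsub>A\<^esub> unit_coeff (\<lambda>h. if h = g then f else 0))"
    using r by (simp add: unit_coeff_smult if_distrib cong: if_cong)
  also have "AF.ext_coef (\<lambda>f. r \<odot>\<^bsub>A\<^esub> unit_coeff (\<lambda>h. if h = g then f else 0)) x = r \<odot>\<^bsub>T\<^esub> incl g x"
    unfolding incl_def by (rule AF.ext_coef_left[OF incl_coef_additive x r, symmetric])
  finally show "incl g (r \<odot>\<^bsub>tw g\<^esub> x) = r \<odot>\<^bsub>T\<^esub> incl g x" by simp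
qed

lemma incl_parity: "incl g ` evens (tw g) \<subseteq> evens T" "incl g ` odds (tw g) \<subseteq> odds T"
  unfolding incl_def
  using AF.ext_coef_parity(1,2)[OF _ unit_coeff_even] by (simp_all add: image_subset_iff)

lemma proj_incl:
  assumes "g \<in> G" "h \<in> G" "x \<in> carrier X"
  shows "proj h (incl g x) = (if h = g then x else \<zero>\<^bsub>X\<^esub>)"
proof -
  have "proj h (incl g x) = (\<Oplus>\<^bsub>X\<^esub>b\<in>FX.supp x. proj h (p (unit_coeff (\<lambda>h. if h = g then FX.coef x b else 0)) b))"
    unfolding incl_def AF.ext_coef_def
    by (rule additive_finsum[OF AX.T_ab X.ab proj_additive[OF assms(2)]]) (use assms in auto)
  also have "\<dots> = (\<Oplus>\<^bsub>X\<^esub>b\<in>FX.supp x. (if h = g then FX.coef x b else 0) \<odot>\<^bsub>X\<^esub> b)"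
    by (rule X.mm.M.finsum_cong') (use assms in \<open>auto simp: proj_pure eps_unit_coeff\<close>)
  also have "\<dots> = (if h = g then x else \<zero>\<^bsub>X\<^esub>)"
  proof (cases "h = g")
    case False
    then have "(\<Oplus>\<^bsub>X\<^esub>b\<in>FX.supp x. (if h = g then FX.coef x b else 0) \<odot>\<^bsub>X\<^esub> b) = (\<Oplus>\<^bsub>X\<^esub>b\<in>FX.supp x. \<zero>\<^bsub>X\<^esub>)"
      by (intro X.mm.M.finsum_cong') auto
    then show ?thesis using False by (simp add: X.mm.M.finsum_zero)
  qed (use assms in \<open>simp add: FX.coef_sum\<close>)
  finally show ?thesis .
qed

lemma unit_coeff_finsum:
  assumes "\<And>g. g \<in> G \<Longrightarrow> c g \<in> polys n" "S \<subseteq> G"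
  shows "(\<Oplus>\<^bsub>A\<^esub>g\<in>S. unit_coeff (\<lambda>h. if h = g then c g else 0)) = unit_coeff (\<lambda>h. if h \<in> S then c h else 0)"
  using finite_subset[OF assms(2) finite_G] assms(2)
proof (induction S rule: finite_induct)
  case empty
  have "unit_coeff (\<lambda>h. 0) = \<zero>\<^bsub>A\<^esub>" by (simp add: unit_coeff_def A_simps)
  then show ?case by simp
next
  case (insert g S)
  have "(\<lambda>h. if h \<in> insert g S then c h else 0) = (\<lambda>h. (if h = g then c g else 0) + (if h \<in> S then c h else 0))"
    by (rule ext) (use insert.hyps(2) in auto)
  moreover have "(\<lambda>g. unit_coeff (\<lambda>h. if h = g then c g else 0)) \<in> S \<rightarrow> carrier A"
    "unit_coeff (\<lambda>h. if h = g then c g else 0) \<in> carrier A" using insert.prems assms(1) by auto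
  ultimately show ?case using insert by (simp add: unit_coeff_add)
qed

abbreviation "total_eps a \<equiv> unit_coeff (\<lambda>g. eps g a)"

lemma total_eps_additive: "additive A A total_eps"
proof (rule additiveI)
  fix a b assume "a \<in> carrier A" "b \<in> carrier A"
  have "total_eps (a \<oplus>\<^bsub>A\<^esub> b) = unit_coeff (\<lambda>g. eps g a + eps g b)"
    unfolding unit_coeff_def by (rule restrict_ext, rule ext) (simp add: eps_add)
  then show "total_eps (a \<oplus>\<^bsub>A\<^esub> b) = total_eps a \<oplus>\<^bsub>A\<^esub> total_eps b" by (simp only: unit_coeff_add)
qed simp

text \<open>Identifies the defect of the contraction on \<open>A\<close> \<otimes> X: it factors
  through the projections and hence vanishes on their common kernel.\<close>

lemma ext_total_eps:
  assumes t: "t \<in> carrier T"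
  shows "AF.ext_left total_eps t = (\<Oplus>\<^bsub>T\<^esub>g\<in>G. incl g (proj g t))"
proof (rule AF.basis_additive_eqI[OF AX.T_ab AF.ext_left_additive[OF total_eps_additive] _ t])
  have ip: "additive T T (\<lambda>t. incl g (proj g t))" if "g \<in> G" for g
    by (rule additive_compose[OF proj_additive[OF that] incl_additive])
  show "additive T T (\<lambda>t. \<Oplus>\<^bsub>T\<^esub>g\<in>G. incl g (proj g t))"
  proof (rule additiveI)
    fix s t assume st: "s \<in> carrier T" "t \<in> carrier T"
    then show "(\<Oplus>\<^bsub>T\<^esub>g\<in>G. incl g (proj g t)) \<in> carrier T" 
      by (intro AX.T.finsum_closed) (auto intro: additive_closed[OF ip])
    have "(\<Oplus>\<^bsub>T\<^esub>g\<in>G. incl g (proj g (s \<oplus>\<^bsub>T\<^esub> t))) = (\<Oplus>\<^bsub>T\<^esub>g\<in>G. incl g (proj g s) \<oplus>\<^bsub>T\<^esub> incl g (proj g t))"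
      by (rule AX.T.finsum_cong') (use st additive_add[OF ip] additive_closed[OF ip] in simp_all)
    also have "\<dots> = (\<Oplus>\<^bsub>T\<^esub>g\<in>G. incl g (proj g s)) \<oplus>\<^bsub>T\<^esub> (\<Oplus>\<^bsub>T\<^esub>g\<in>G. incl g (proj g t))"
      by (rule AX.T.finsum_addf) (use st additive_closed[OF ip] in auto)
    finally show "(\<Oplus>\<^bsub>T\<^esub>g\<in>G. incl g (proj g (s \<oplus>\<^bsub>T\<^esub> t))) =
        (\<Oplus>\<^bsub>T\<^esub>g\<in>G. incl g (proj g s)) \<oplus>\<^bsub>T\<^esub> (\<Oplus>\<^bsub>T\<^esub>g\<in>G. incl g (proj g t))" .
  qed
  fix a b assume a: "a \<in> carrier A" and b: "b \<in> B"
  have "(\<Oplus>\<^bsub>T\<^esub>g\<in>G. incl g (proj g (p a b))) = (\<Oplus>\<^bsub>T\<^esub>g\<in>G. p (unit_coeff (\<lambda>h. if h = g then eps g a else 0)) b)"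
    by (rule AX.T.finsum_cong')
      (use a b in \<open>simp_all add: proj_pure incl_def AF.ext_coef_basis[OF incl_coef_additive]\<close>)
  also have "\<dots> = p (\<Oplus>\<^bsub>A\<^esub>g\<in>G. unit_coeff (\<lambda>h. if h = g then eps g a else 0)) b"
    by (rule additive_finsum[OF A.ab AX.T_ab AX.pure_additive_left, symmetric]) (use a b in auto)
  also have "(\<Oplus>\<^bsub>A\<^esub>g\<in>G. unit_coeff (\<lambda>h. if h = g then eps g a else 0)) =
      unit_coeff (\<lambda>h. if h \<in> G then eps h a else 0)"
    by (rule unit_coeff_finsum) (use a in auto)
  also have "\<dots> = total_eps a" unfolding unit_coeff_def by (rule restrict_ext) simp
  finally show "AF.ext_left total_eps (p a b) = (\<Oplus>\<^bsub>T\<^esub>g\<in>G. incl g (proj g (p a b)))"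
    using a b by (simp add: AF.ext_left_basis[OF total_eps_additive])
qed

section \<open>The common kernel of the projections and its contraction\<close>

definition ker_proj where "ker_proj = {t \<in> carrier T. \<forall>g\<in>G. proj g t = \<zero>\<^bsub>X\<^esub>}"

text \<open>As fixed points of a projector, the steps of the filtration are given by equations,
  which can be propagated through compositions of extended operators.\<close>

definition filt where "filt j = {t \<in> carrier T. AF.ext_left (tau j) t = t}"

lemmas op_additive = is_linearD(1)[OF d0_linear] is_linearD(1)[OF d1_linear]
  is_linearD(1)[OF contr_linear] is_linearD(1)[OF tau_linear]

abbreviation "h0 \<equiv> AF.ext_left contr"
abbreviation "D0 \<equiv> AF.ext_left d0"
abbreviation "D1 \<equiv> AF.ext_left d1"

interpretation K: tensor_pairs n n A X A X ..

abbreviation "KX \<equiv> tensor_map n A X A X (koszul A) (diff X)"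

lemma diff_X_linear: "is_linear n X X (diff X)"
  by (simp add: is_linear_def X.diff_additive X.diff_smult)

lemmas KX_additive = K.tensor_map_additive[OF A.koszul_linear diff_X_linear]
lemmas KX_pure = K.tensor_map_pure[OF A.koszul_linear diff_X_linear]

text \<open>Sorted by theta-degree: \<open>D0\<close> lowers it, \<open>D1\<close> raises it, and
  the part coming from the differential of X keeps it.\<close>

lemma diff_split: "t \<in> carrier T \<Longrightarrow> diff T t = D0 t \<oplus>\<^bsub>T\<^esub> (D1 t \<oplus>\<^bsub>T\<^esub> KX t)"
  by (rule AF.basis_additive_eqI[OF AX.T_ab AX.diff_T_additive additive_plus[OF AX.T_ab
        AF.ext_left_additive[OF op_additive(1)] additive_plus[OF AX.T_ab
        AF.ext_left_additive[OF op_additive(2)] KX_additive]]])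
    (simp_all add: AX.diff_pure AF.ext_left_basis op_additive KX_pure A_diff AX.pure_add_left
      AX.TT.ac additive_closed[OF op_additive(1)] additive_closed[OF op_additive(2)])

lemma filt_carrier: "t \<in> filt j \<Longrightarrow> t \<in> carrier T"
  by (simp add: filt_def)

lemma filt_add: "s \<in> filt j \<Longrightarrow> t \<in> filt j \<Longrightarrow> s \<oplus>\<^bsub>T\<^esub> t \<in> filt j"
  by (simp add: filt_def additive_add[OF AF.ext_left_additive[OF op_additive(4)]])

lemma filt_neg: "t \<in> filt j \<Longrightarrow> \<ominus>\<^bsub>T\<^esub> t \<in> filt j"
  by (simp add: filt_def additive_neg[OF AX.T_ab AX.T_ab AF.ext_left_additive[OF op_additive(4)]])

lemma ext_left_closed: "additive A A u \<Longrightarrow> t \<in> carrier T \<Longrightarrow> AF.ext_left u t \<in> carrier T"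
  by (rule additive_closed[OF AF.ext_left_additive])

lemma filt_raise:
  assumes u: "additive A A u" and e: "\<And>a. a \<in> carrier A \<Longrightarrow> tau i (u (tau j a)) = u (tau j a)" and t: "t \<in> filt j"
  shows "AF.ext_left u t \<in> filt i"
proof -
  have tc: "t \<in> carrier T" and tt: "AF.ext_left (tau j) t = t" using t by (auto simp: filt_def)
  note uj = additive_compose[OF op_additive(4)[of j] u]
  have 1: "AF.ext_left u t = AF.ext_left (\<lambda>a. u (tau j a)) t"
    using AF.ext_left_comp[OF u op_additive(4) tc, of j] tt by simp
  then have "AF.ext_left (tau i) (AF.ext_left u t) = AF.ext_left (\<lambda>a. tau i (u (tau j a))) t"
    using AF.ext_left_comp[OF op_additive(4) uj tc] by simp
  also have "\<dots> = AF.ext_left (\<lambda>a. u (tau j a)) t"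
    by (rule AF.ext_left_eqI[OF additive_compose[OF uj op_additive(4)] uj tc e])
  finally show ?thesis using 1 ext_left_closed[OF u tc] by (simp add: filt_def)
qed

lemma ext_left_id: "t \<in> carrier T \<Longrightarrow> AF.ext_left (\<lambda>a. a) t = t"
  by (rule AF.basis_additive_eqI[OF AX.T_ab AF.ext_left_additive]) (auto simp: AF.ext_left_basis additive_def)

lemma filt_mono: "i \<le> j \<Longrightarrow> filt j \<subseteq> filt i"
proof
  fix t assume "i \<le> j" and t: "t \<in> filt j"
  have "AF.ext_left (\<lambda>a. a) t \<in> filt i"
    by (rule filt_raise[OF _ _ t]) (auto simp: additive_def tau_tau \<open>i \<le> j\<close>)
  then show "t \<in> filt i" using ext_left_id[OF filt_carrier[OF t]] by simp
qed

lemma filt_0: "carrier T \<subseteq> filt 0"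
proof
  fix t assume t: "t \<in> carrier T"
  have "AF.ext_left (tau 0) t = AF.ext_left (\<lambda>a. a) t"
    by (rule AF.ext_left_eqI[OF op_additive(4) _ t tau_0]) (auto simp: additive_def)
  then show "t \<in> filt 0" using t ext_left_id[OF t] by (simp add: filt_def)
qed

lemma filt_top: "filt (Suc n) \<subseteq> {\<zero>\<^bsub>T\<^esub>}"
proof
  fix t assume t: "t \<in> filt (Suc n)"
  have "AF.ext_left (tau (Suc n)) t = \<zero>\<^bsub>T\<^esub>"
    by (rule AF.basis_additive_eqI[OF AX.T_ab AF.ext_left_additive[OF op_additive(4)] _ filt_carrier[OF t]])
      (simp_all add: additive_def AF.ext_left_basis op_additive tau_top)
  then show "t \<in> {\<zero>\<^bsub>T\<^esub>}" using t by (simp add: filt_def)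
qed

text \<open>Truncation is linear on both sides, so it acts on tensors through the left factor alone;
  being even, it commutes with the parity sign there.\<close>

lemma filt_KX:
  assumes "t \<in> filt j" shows "KX t \<in> filt j"
proof -
  have tc: "t \<in> carrier T" and tt: "AF.ext_left (tau j) t = t" using assms by (auto simp: filt_def)
  have "AF.ext_left (tau j) (KX t) = KX (AF.ext_left (tau j) t)"
  proof (rule AX.tensor_additive_eqI[OF AX.T_ab additive_compose[OF KX_additive AF.ext_left_additive[OF op_additive(4)]]
          additive_compose[OF AF.ext_left_additive[OF op_additive(4)] KX_additive] tc])
    fix a x assume ax: "a \<in> carrier A" "x \<in> carrier X"
    have "koszul A (tau j a) = tau j (koszul A a)"
      by (rule koszul_even_map[OF premf_A premf_A op_additive(4) tau_even ax(1)])
    then show "AF.ext_left (tau j) (KX (p a x)) = KX (AF.ext_left (tau j) (p a x))"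
      using ax by (simp add: KX_pure AF.ext_left_right_linear[OF tau_linear2] is_linearD(2)[OF tau_linear])
  qed
  then show ?thesis using tc tt additive_closed[OF KX_additive tc] by (simp add: filt_def)
qed

lemma h0_homotopy: "is_homotopy n T T h0"
  unfolding is_homotopy_def
  using AF.ext_left_linear[OF contr_linear] AF.ext_left_odd[OF op_additive(3) contr_odd]
  by (simp add: is_linear_def)

lemma proj_h0: "g \<in> G \<Longrightarrow> t \<in> carrier T \<Longrightarrow> proj g (h0 t) = \<zero>\<^bsub>X\<^esub>"
  by (rule AF.basis_additive_eqI[OF X.ab additive_compose[OF AF.ext_left_additive[OF op_additive(3)] proj_additive]])
    (simp_all add: additive_zero_map[OF X.ab] AF.ext_left_basis op_additive proj_pure eps_contr additive_closed[OF op_additive(3)])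

text \<open>This is \<open>contr_homotopy\<close> carried from \<open>A\<close> to \<open>A\<close>
  \<otimes> X; all operators involved are extended from the left factor and can be compared on
  tensors with basis elements.\<close>

lemma h0_contraction:
  assumes t: "t \<in> carrier T"
  shows "(D0 (h0 t) \<oplus>\<^bsub>T\<^esub> h0 (D0 t)) \<oplus>\<^bsub>T\<^esub> AF.ext_left total_eps t = t"
proof -
  note a = AF.ext_left_additive[OF op_additive(1)] AF.ext_left_additive[OF op_additive(3)]
  show ?thesis
    by (rule AF.basis_additive_eqI[OF AX.T_ab additive_plus[OF AX.T_ab additive_plus[OF AX.T_ab
          additive_compose[OF a(2,1)] additive_compose[OF a(1,2)]]
          AF.ext_left_additive[OF total_eps_additive]] _ t])
      (simp_all add: additive_id AF.ext_left_basis op_additive total_eps_additive contr_homotopy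
        additive_closed[OF op_additive(1)] additive_closed[OF op_additive(3)]
        additive_closed[OF total_eps_additive] flip: AX.pure_add_left)
qed

text \<open>On the common kernel the leading part \<open>D0\<close> is contracted exactly by
  \<open>h0\<close>. The error is the graded commutator of \<open>h0\<close> with \<open>D1\<close>
  and with the part coming from the differential of X; it raises the filtration, which ends at n +
  1.\<close>

lemma contraction_exists:
  obtains h where "is_homotopy n T T h" "\<And>t. t \<in> carrier T \<Longrightarrow> h t \<in> ker_proj"
    "\<And>t. t \<in> ker_proj \<Longrightarrow> diff T (h t) \<oplus>\<^bsub>T\<^esub> h (diff T t) = t"
proof (rule contraction_perturbation[OF AX.premf_T W T_diff_diff, of ker_proj filt "Suc n" h0])
  show "ker_proj \<subseteq> carrier T" by (auto simp: ker_proj_def)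
  show "s \<ominus>\<^bsub>T\<^esub> t \<in> ker_proj" "s \<oplus>\<^bsub>T\<^esub> t \<in> ker_proj" if "s \<in> ker_proj" "t \<in> ker_proj" for s t
    using that by (auto simp: ker_proj_def additive_add[OF proj_additive]
        additive_neg[OF AX.T_ab X.ab proj_additive] a_minus_def)
  show "diff T t \<in> ker_proj" if "t \<in> ker_proj" for t
    using that is_mf_mapD(4)[OF proj_mf_map, of _ t] by (simp add: ker_proj_def)
  show "h0 t \<in> ker_proj" if "t \<in> carrier T" for t
    using that by (simp add: ker_proj_def proj_h0 ext_left_closed op_additive)
  fix j t assume t: "t \<in> ker_proj" "t \<in> filt j"
  note tc = filt_carrier[OF t(2)]
  have "(\<Oplus>\<^bsub>T\<^esub>g\<in>G. incl g (proj g t)) = (\<Oplus>\<^bsub>T\<^esub>g\<in>G. \<zero>\<^bsub>T\<^esub>)"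
    by (rule AX.T.finsum_cong')
      (use t in \<open>simp_all add: ker_proj_def additive_zero[OF X.ab AX.T_ab incl_additive]\<close>)
  then have "AF.ext_left total_eps t = \<zero>\<^bsub>T\<^esub>"
    by (simp add: ext_total_eps[OF tc] AX.T.finsum_zero)
  then have D0h: "D0 (h0 t) \<oplus>\<^bsub>T\<^esub> h0 (D0 t) = t"
    using h0_contraction[OF tc] tc by (simp add: ext_left_closed op_additive)
  have h0c: "h0 s \<in> carrier T" "D0 s \<in> carrier T" "D1 s \<in> carrier T" "KX s \<in> carrier T" if "s \<in> carrier T" for s
    using that by (simp_all add: ext_left_closed op_additive additive_closed[OF KX_additive])
  have h0f: "h0 s \<in> filt (Suc i)" if "s \<in> filt i" for s i
    by (rule filt_raise[OF op_additive(3) tau_contr that])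
  have D1f: "D1 s \<in> filt (Suc i)" if "s \<in> filt i" for s i
    by (rule filt_raise[OF op_additive(2) tau_d1 that])
  have h0a: "h0 (a \<oplus>\<^bsub>T\<^esub> b) = h0 a \<oplus>\<^bsub>T\<^esub> h0 b" if "a \<in> carrier T" "b \<in> carrier T" for a b
    by (rule additive_add[OF AF.ext_left_additive[OF op_additive(3)] that])
  define r where "r = (D1 (h0 t) \<oplus>\<^bsub>T\<^esub> KX (h0 t)) \<oplus>\<^bsub>T\<^esub> (h0 (D1 t) \<oplus>\<^bsub>T\<^esub> h0 (KX t))"
  have rc: "r \<in> carrier T" using tc by (simp add: r_def h0c)
  \<comment> \<open>Both operators raise the degree here, so these terms gain two steps, of which
    one is kept.\<close>
  have "D1 (h0 t) \<in> filt (Suc j)" "h0 (D1 t) \<in> filt (Suc j)"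
    using h0f[OF t(2)] D1f[OF t(2)] D1f[OF h0f[OF t(2)]] h0f[OF D1f[OF t(2)]] filt_mono[of "Suc j" "Suc (Suc j)"] by auto
  then have rf: "r \<in> filt (Suc j)"
    unfolding r_def using h0f[OF t(2)] h0f[OF filt_KX[OF t(2)]] by (intro filt_add) (auto intro: filt_KX)
  have "diff T (h0 t) \<oplus>\<^bsub>T\<^esub> h0 (diff T t) = (D0 (h0 t) \<oplus>\<^bsub>T\<^esub> h0 (D0 t)) \<oplus>\<^bsub>T\<^esub> r"
    using tc by (simp add: diff_split h0c h0a r_def AX.TT.ac)
  also have "\<dots> = t \<oplus>\<^bsub>T\<^esub> r" by (simp only: D0h)
  finally have "diff T (h0 t) \<oplus>\<^bsub>T\<^esub> h0 (diff T t) \<ominus>\<^bsub>T\<^esub> t = r"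
    using tc rc by (simp add: AX.TT.ab_simps)
  then show "diff T (h0 t) \<oplus>\<^bsub>T\<^esub> h0 (diff T t) \<ominus>\<^bsub>T\<^esub> t \<in> filt (Suc j)" using rf by simp
qed (use filt_neg filt_mono filt_0 filt_top h0_homotopy that in auto)

text \<open>Projecting a section returns the element strictly, while the composite in the other
  order is the identity up to homotopy. Strictness lets a family \<phi>_g be recovered from its sum
  by equalities of maps.\<close>

definition is_section where "is_section s \<longleftrightarrow> (\<forall>g\<in>G. is_mf_map n (tw g) T (s g)) \<and>
  (\<forall>g\<in>G. \<forall>h\<in>G. \<forall>x\<in>carrier X. proj h (s g x) = (if h = g then x else \<zero>\<^bsub>X\<^esub>)) \<and>
  homotopic n T T (\<lambda>t. \<Oplus>\<^bsub>T\<^esub>g\<in>G. s g (proj g t)) (\<lambda>t\<in>carrier T. t)"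

text \<open>The inverse up to homotopy of \<open>A\<^sub>G \<otimes> X \<simeq> \<Oplus>\<^sub>g \<^sub>gX\<close>.\<close>

lemma sections_exist: "\<exists>s. is_section s"
proof -
  obtain h where h: "is_homotopy n T T h" "\<And>t. t \<in> carrier T \<Longrightarrow> h t \<in> ker_proj"
    "\<And>t. t \<in> ker_proj \<Longrightarrow> diff T (h t) \<oplus>\<^bsub>T\<^esub> h (diff T t) = t"
    by (rule contraction_exists) blast
  have kc: "ker_proj \<subseteq> carrier T" by (auto simp: ker_proj_def)
  have incl_c [simp]: "incl g x \<in> carrier T" if "x \<in> carrier X" for g x by (rule additive_closed[OF incl_additive that])
  \<comment> \<open>The construction of \<open>section_correction\<close> for the inclusion at g,
    with the contraction of the kernel repairing its failure to commute with the
    differentials.\<close>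
  define s where "s g v = incl g v \<ominus>\<^bsub>T\<^esub> h (diff T (incl g v) \<ominus>\<^bsub>T\<^esub> incl g (diff X v))" for g v
  have in_ker: "diff T (incl g v) \<ominus>\<^bsub>T\<^esub> incl g (diff X v) \<in> ker_proj" if g: "g \<in> G" and v: "v \<in> carrier X" for g v
  proof -
    have "proj k (diff T (incl g v) \<ominus>\<^bsub>T\<^esub> incl g (diff X v)) = \<zero>\<^bsub>X\<^esub>" if k: "k \<in> G" for k
    proof -
      have "proj k (diff T (incl g v)) = diff X (proj k (incl g v))"
        using is_mf_mapD(4)[OF proj_mf_map[OF k], of "incl g v"] v by simp
      then show ?thesis
        using g k v by (simp add: additive_minus[OF AX.T_ab X.ab proj_additive] proj_incl)
          (simp add: a_minus_def X.mm.M.r_neg)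
    qed
    then show ?thesis using v by (simp add: ker_proj_def)
  qed
  have s_map: "is_mf_map n (tw g) T (s g)" if g: "g \<in> G" for g
  proof -
    have "is_mf_map n (tw g) T (\<lambda>v. incl g v \<ominus>\<^bsub>T\<^esub> h (diff T (incl g v) \<ominus>\<^bsub>T\<^esub> incl g (diff (tw g) v)))"
      by (rule section_correction[OF premf_tw[OF g] AX.premf_T W _ T_diff_diff incl_linear[OF g]
            incl_parity kc _ h])
        (use g dd in_ker in \<open>simp_all add: ginv_W[OF G]\<close>)
    then show ?thesis by (simp add: s_def[abs_def])
  qed
  have hk: "proj k (h t) = \<zero>\<^bsub>X\<^esub>" "h t \<in> carrier T" if "k \<in> G" "t \<in> carrier T" for k t
    using h(2)[OF that(2)] that(1) by (auto simp: ker_proj_def)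
  have hc: "h t \<in> carrier T" if "t \<in> carrier T" for t using h(2)[OF that] kc by auto
  \<comment> \<open>The correction has values in the kernel of the projections, so it does not
    disturb the strict splitting.\<close>
  have ps: "proj k (s g x) = (if k = g then x else \<zero>\<^bsub>X\<^esub>)" if "g \<in> G" "k \<in> G" "x \<in> carrier X" for g k x
    using that unfolding s_def
    by (simp add: additive_minus[OF AX.T_ab X.ab proj_additive] hk hc proj_incl) (simp add: a_minus_def)
  have sc [simp]: "s g x \<in> carrier T" if "x \<in> carrier X" for g x using that hc by (simp add: s_def)
  define q where "q t = (\<Oplus>\<^bsub>T\<^esub>g\<in>G. s g (proj g t))" for t
  have sp: "is_mf_map n T T (\<lambda>t. s g (proj g t))" if "g \<in> G" for g
    by (rule is_mf_map_comp[OF proj_mf_map[OF that] s_map[OF that]])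
  have qc [simp]: "q t \<in> carrier T" if "t \<in> carrier T" for t
    unfolding q_def using that by (intro AX.T.finsum_closed) auto
  have q: "is_mf_map n T T q"
    unfolding q_def[abs_def] by (rule is_mf_map_finsum[OF AX.premf_T AX.premf_T sp])
  have q_proj: "proj k (q t) = proj k t" if k: "k \<in> G" and t: "t \<in> carrier T" for k t
  proof -
    have "proj k (q t) = (\<Oplus>\<^bsub>X\<^esub>g\<in>G. proj k (s g (proj g t)))"
      unfolding q_def by (rule additive_finsum[OF AX.T_ab X.ab proj_additive[OF k]]) (use t in auto)
    also have "\<dots> = (\<Oplus>\<^bsub>X\<^esub>g\<in>G. if k = g then proj g t else \<zero>\<^bsub>X\<^esub>)"
      by (rule X.mm.M.finsum_cong') (use t k in \<open>auto simp: ps\<close>)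
    also have "\<dots> = proj k t" by (rule X.mm.M.finsum_singleton[OF k]) (use t in auto)
    finally show ?thesis .
  qed
  let ?r = "\<lambda>t. t \<ominus>\<^bsub>T\<^esub> q t"
  note qD = is_mf_mapD[OF q] is_linearD[OF is_mf_mapD(1)[OF q]]
  note lh = is_linearD[OF is_homotopy_linear[OF h(1)]]
  have "homotopic n T T q (\<lambda>t\<in>carrier T. t)"
  \<comment> \<open>The map 1 - q commutes with d and takes values in the kernel, so following it by
    the contraction gives the homotopy.\<close>
  proof (rule homotopicI[OF AX.premf_T AX.premf_T, of "\<lambda>t. h (?r t)"])
    show "is_homotopy n T T (\<lambda>t. h (?r t))"
      unfolding is_homotopy_def
    proof (intro conjI ballI)
      show "additive T T (\<lambda>t. h (?r t))"
        by (rule additive_compose[OF additiveI lh(1)]) (simp_all add: qD(9) AX.TT.ab_simps)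
      show "h (?r (r \<odot>\<^bsub>T\<^esub> t)) = r \<odot>\<^bsub>T\<^esub> h (?r t)" if "r \<in> polys n" "t \<in> carrier T" for r t
        using that by (simp add: lh(4)[symmetric] qD(10) a_minus_def AX.TT.smult_add AX.TT.smult_neg)
    qed (use h(1) qD(2,3) in \<open>auto simp: is_homotopy_def image_subset_iff\<close>)
    fix t assume t: "t \<in> carrier T"
    have "?r t \<in> ker_proj"
      using t by (simp add: ker_proj_def additive_minus[OF AX.T_ab X.ab proj_additive] q_proj)
        (simp add: a_minus_def X.mm.M.r_neg)
    moreover have "?r (diff T t) = diff T (?r t)" using t by (simp add: qD(4) AX.TT.diff_minus)
    ultimately have "diff T (h (?r t)) \<oplus>\<^bsub>T\<^esub> h (?r (diff T t)) = ?r t" using h(3) by simp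
    then show "(\<lambda>t\<in>carrier T. t) t = q t \<oplus>\<^bsub>T\<^esub> (diff T (h (?r t)) \<oplus>\<^bsub>T\<^esub> h (?r (diff T t)))"
      using t by (simp add: AX.TT.ab_simps)
  qed simp
  then have "is_section s"
    unfolding is_section_def using s_map ps by (simp add: q_def[abs_def])
  then show ?thesis by (rule exI[of is_section])
qed

end

section \<open>The structure maps of \<open>A\<^sub>G\<close>\<close>

lemma tensor_lift_cong:
  "(\<And>y x. y \<in> carrier Y \<Longrightarrow> x \<in> carrier X \<Longrightarrow> \<beta> y x = \<beta>' y x) \<Longrightarrow>
    tensor_lift n Y X N \<beta> = tensor_lift n Y X N \<beta>'"
  by (simp add: tensor_lift_def)

lemma lam_lift:
  assumes "premf m X" "n \<le> m" "W \<in> polys n"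
  shows lam_pure: "\<omega> \<in> unit_carrier n \<Longrightarrow> x \<in> carrier X \<Longrightarrow>
      lam n W X (pure n (I_mf n W) X \<omega> x) = collapse n (\<omega> {}) \<odot>\<^bsub>X\<^esub> x"
    and lam_additive: "additive (tensor n (I_mf n W) X) X (lam n W X)"
    and lam_ext: "lam n W X \<in> extensional (carrier (tensor n (I_mf n W) X))"
proof -
  interpret tensor_pair n m "I_mf n W" X
    by (intro tensor_pair.intro premf_I tensor_pair_axioms.intro) (use assms in auto)
  have c: "collapse n (\<omega> {}) \<in> polys n" if "\<omega> \<in> unit_carrier n" for \<omega>
    by (rule collapse_polys) (rule unit_carrierD[OF that])
  have "balanced n (I_mf n W) X X (\<lambda>\<omega> x. collapse n (\<omega> {}) \<odot>\<^bsub>X\<^esub> x)"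
    by (rule balancedI)
      (simp_all add: c X.add_smult X.smult_add X.smult_smult collapse_primed X.smult_commute)
  note l = tensor_lift[OF X.ab this, folded lam_def]
  show "\<omega> \<in> unit_carrier n \<Longrightarrow> x \<in> carrier X \<Longrightarrow>
      lam n W X (pure n (I_mf n W) X \<omega> x) = collapse n (\<omega> {}) \<odot>\<^bsub>X\<^esub> x" using l(2) by simp
  show "additive (tensor n (I_mf n W) X) X (lam n W X)"
    "lam n W X \<in> extensional (carrier (tensor n (I_mf n W) X))" using l by auto
qed

context symmetric_potential
begin

section \<open>The multiplication of A_G in components\<close>

lemma I_finsum:
  assumes "finite K" "\<And>k. k \<in> K \<Longrightarrow> f k \<in> unit_carrier n"
  shows "finsum (I_mf n W) f K = (\<lambda>S. \<Sum>k\<in>K. f k S)"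
proof -
  interpret I: premf "n + n" "I_mf n W" by (rule premf_I[OF W])
  show ?thesis using assms
    by (induction K rule: finite_induct) (simp_all add: I.mm.M.finsum_insert Pi_def)
qed

definition fibre where "fibre u = {k \<in> G \<times> G. fst k \<cdot> snd k = u}"

lemma fibre_finite [simp]: "finite (fibre u)"
  by (simp add: fibre_def)

lemma fibreD: "k \<in> fibre u \<Longrightarrow> fst k \<in> G" "k \<in> fibre u \<Longrightarrow> snd k \<in> G" "k \<in> fibre u \<Longrightarrow> fst k \<cdot> snd k = u"
  by (auto simp: fibre_def)

lemma fibre_sum_cong:
  assumes "\<And>g h. g \<in> G \<Longrightarrow> h \<in> G \<Longrightarrow> g \<cdot> h = u \<Longrightarrow> f (g, h) = f' (g, h)"
  shows "sum f (fibre u) = sum f' (fibre u)"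
  by (rule sum.cong) (use assms in \<open>auto simp: fibre_def\<close>)

text \<open>The collapsed coefficient of a acts through the left action of the summand at h, which
  is twisted; this is the origin of the inverse of h in the formula.\<close>

definition mu :: "'k AG \<Rightarrow> 'k AG \<Rightarrow> 'k AG" where
  "mu a b = (\<lambda>u\<in>G. \<lambda>S. \<Sum>k\<in>fibre u. ginv n (snd k) (eps (fst k) a) * b (snd k) S)"

lemma mu_term_closed:
  assumes "a \<in> carrier A" "b \<in> carrier A" "g \<in> G" "h \<in> G"
  shows "(\<lambda>S. ginv n h (eps g a) * b h S) \<in> unit_carrier n"
proof -
  have "ginv n h (eps g a) \<in> polys (n + n)" by (rule polys_mono[of _ n]) (use assms in auto)
  then show ?thesis using A_component[OF assms(2,4)] by simp
qed

lemma mu_eq: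
  assumes "a \<in> carrier A" "b \<in> carrier A"
  shows "(\<lambda>u\<in>G. finsum (I_mf n W) (\<lambda>(g, h). lam n W (gI n W h) (pure n (I_mf n W) (gI n W h) (a g) (b h)))
    {(g, h). g \<in> G \<and> h \<in> G \<and> g \<cdot> h = u}) = mu a b"
  unfolding mu_def
proof (rule restrict_ext)
  fix u assume "u \<in> G"
  have K: "{(g, h). g \<in> G \<and> h \<in> G \<and> g \<cdot> h = u} = fibre u" by (auto simp: fibre_def)
  have l: "lam n W (gI n W h) (pure n (I_mf n W) (gI n W h) (a g) (b h)) =
      (\<lambda>S. ginv n h (eps g a) * b h S)" if gh: "g \<in> G" "h \<in> G" for g h
  proof -
    have "lam n W (gI n W h) (pure n (I_mf n W) (gI n W h) (a g) (b h)) = eps g a \<odot>\<^bsub>gI n W h\<^esub> b h"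
      unfolding eps_def
      by (rule lam_pure[OF premf_gI[OF gh(2)] _ W]) (use A_component assms gh in auto)
    then show ?thesis using gh assms by (simp add: on_left_ginv_left)
  qed
  interpret I: premf "n + n" "I_mf n W" by (rule premf_I[OF W])
  have "finsum (I_mf n W) (\<lambda>(g, h). lam n W (gI n W h) (pure n (I_mf n W) (gI n W h) (a g) (b h))) (fibre u) =
      finsum (I_mf n W) (\<lambda>k S. ginv n (snd k) (eps (fst k) a) * b (snd k) S) (fibre u)"
    by (rule I.mm.M.finsum_cong')
      (use assms in \<open>auto simp: fibreD l split_def intro!: mu_term_closed dest: fibreD\<close>)
  also have "\<dots> = (\<lambda>S. \<Sum>k\<in>fibre u. ginv n (snd k) (eps (fst k) a) * b (snd k) S)"
    by (rule I_finsum) (use assms in \<open>auto intro!: mu_term_closed dest: fibreD\<close>)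
  finally show "finsum (I_mf n W) (\<lambda>(g, h). lam n W (gI n W h) (pure n (I_mf n W) (gI n W h) (a g) (b h)))
      {(g, h). g \<in> G \<and> h \<in> G \<and> g \<cdot> h = u} =
      (\<lambda>S. \<Sum>k\<in>fibre u. ginv n (snd k) (eps (fst k) a) * b (snd k) S)" by (simp only: K)
qed

lemma AG_mult_lift: "AG_mult n W G = tensor_lift n A A A mu"
  unfolding AG_mult_def Let_def by (rule tensor_lift_cong) (rule mu_eq)

lemmas ginv_hom = poly_endoD(2-5)[OF ginv_endo[OF G]]

lemma ginv_0 [simp]: "g \<in> G \<Longrightarrow> ginv n g 0 = 0"
  using ginv_hom(1)[of g 0] by simp

lemma mu_closed:
  assumes "a \<in> carrier A" "b \<in> carrier A" shows "mu a b \<in> carrier A"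
proof -
  have "(\<lambda>S. \<Sum>k\<in>fibre u. ginv n (snd k) (eps (fst k) a) * b (snd k) S) \<in> unit_carrier n" for u
  proof (rule unit_carrierI)
    show "(\<Sum>k\<in>fibre u. ginv n (snd k) (eps (fst k) a) * b (snd k) S) \<in> polys (n + n)" if "S \<subseteq> {..<n}" for S
      using unit_carrierD(1)[OF mu_term_closed[OF assms]] fibreD by (intro polys_sum) auto
    show "(\<Sum>k\<in>fibre u. ginv n (snd k) (eps (fst k) a) * b (snd k) S) = 0" if "\<not> S \<subseteq> {..<n}" for S
      using unit_carrierD(2)[OF mu_term_closed[OF assms] that] fibreD by (intro sum.neutral) auto
  qed
  then show ?thesis by (auto simp: mu_def A_simps)
qed

lemma mu_add_left:
  assumes "a \<in> carrier A" "a' \<in> carrier A"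
  shows "mu (a \<oplus>\<^bsub>A\<^esub> a') b = mu a b \<oplus>\<^bsub>A\<^esub> mu a' b"
proof -
  have "(\<Sum>k\<in>fibre u. ginv n (snd k) (eps (fst k) (a \<oplus>\<^bsub>A\<^esub> a')) * b (snd k) S) =
      (\<Sum>k\<in>fibre u. ginv n (snd k) (eps (fst k) a) * b (snd k) S) +
      (\<Sum>k\<in>fibre u. ginv n (snd k) (eps (fst k) a') * b (snd k) S)" for u S
    unfolding sum.distrib[symmetric]
    by (rule fibre_sum_cong) (use assms in \<open>simp add: eps_add ginv_hom distrib_right\<close>)
  then show ?thesis by (auto simp: mu_def A_simps(3) intro!: restrict_ext)
qed

lemma mu_add_right: "mu a (b \<oplus>\<^bsub>A\<^esub> b') = mu a b \<oplus>\<^bsub>A\<^esub> mu a b'"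
proof -
  have "(\<Sum>k\<in>fibre u. ginv n (snd k) (eps (fst k) a) * (b \<oplus>\<^bsub>A\<^esub> b') (snd k) S) =
      (\<Sum>k\<in>fibre u. ginv n (snd k) (eps (fst k) a) * b (snd k) S) +
      (\<Sum>k\<in>fibre u. ginv n (snd k) (eps (fst k) a) * b' (snd k) S)" for u S
    unfolding sum.distrib[symmetric]
    by (rule fibre_sum_cong) (simp add: A_simps(3) distrib_left)
  then show ?thesis by (auto simp: mu_def A_simps(3) intro!: restrict_ext)
qed

text \<open>For u = gh the twists at g and at h combine into the one at u, because the inverse of u
  is the inverse of h after that of g.\<close>

lemma mu_left:
  assumes "r \<in> polys n" "a \<in> carrier A"
  shows "mu (r \<odot>\<^bsub>A\<^esub> a) b = r \<odot>\<^bsub>A\<^esub> mu a b"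
proof -
  have "(\<Sum>k\<in>fibre u. ginv n (snd k) (eps (fst k) (r \<odot>\<^bsub>A\<^esub> a)) * b (snd k) S) =
      on_left n (ginv n u) r * (\<Sum>k\<in>fibre u. ginv n (snd k) (eps (fst k) a) * b (snd k) S)" if "u \<in> G" for u S
    unfolding sum_distrib_left
  proof (rule sum.cong[OF refl])
    fix k assume k: "k \<in> fibre u"
    note kG = fibreD(1,2)[OF k]
    have "ginv n (snd k) (ginv n (fst k) r) = ginv n u r"
      using ginv_mult[OF G kG assms(1)] fibreD(3)[OF k] by simp
    then show "ginv n (snd k) (eps (fst k) (r \<odot>\<^bsub>A\<^esub> a)) * b (snd k) S =
        on_left n (ginv n u) r * (ginv n (snd k) (eps (fst k) a) * b (snd k) S)"
      using kG assms that by (simp add: eps_left ginv_hom on_left_ginv_left)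
  qed
  then show ?thesis by (auto simp: mu_def A_simps(4) intro!: restrict_ext)
qed

lemma on_left_Var_right: "n \<le> i \<Longrightarrow> on_left n g (Var i) = Var i"
  by (simp add: on_left_def)

lemma mu_right:
  assumes "n \<le> i" shows "mu a (Var i \<odot>\<^bsub>A\<^esub> b) = Var i \<odot>\<^bsub>A\<^esub> mu a b"
proof -
  have "(\<Sum>k\<in>fibre u. ginv n (snd k) (eps (fst k) a) * (Var i \<odot>\<^bsub>A\<^esub> b) (snd k) S) =
      Var i * (\<Sum>k\<in>fibre u. ginv n (snd k) (eps (fst k) a) * b (snd k) S)" for u S
    unfolding sum_distrib_left
    by (rule fibre_sum_cong) (simp add: A_simps(4) on_left_Var_right assms)
  then show ?thesis by (auto simp: mu_def A_simps(4) on_left_Var_right assms intro!: restrict_ext)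
qed

lemma mu_balanced_eq:
  assumes "s \<in> polys n" "a \<in> carrier A"
  shows "mu (primed n s \<odot>\<^bsub>A\<^esub> a) b = mu a (s \<odot>\<^bsub>A\<^esub> b)"
proof -
  have "(\<Sum>k\<in>fibre u. ginv n (snd k) (eps (fst k) (primed n s \<odot>\<^bsub>A\<^esub> a)) * b (snd k) S) =
      (\<Sum>k\<in>fibre u. ginv n (snd k) (eps (fst k) a) * (s \<odot>\<^bsub>A\<^esub> b) (snd k) S)" for u S
  proof (rule sum.cong[OF refl])
    fix k assume k: "k \<in> fibre u"
    note kG = fibreD(1,2)[OF k]
    then show "ginv n (snd k) (eps (fst k) (primed n s \<odot>\<^bsub>A\<^esub> a)) * b (snd k) S =
        ginv n (snd k) (eps (fst k) a) * (s \<odot>\<^bsub>A\<^esub> b) (snd k) S"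
      using assms by (simp add: eps_primed ginv_hom A_simps(4)[of s] on_left_ginv_left)
  qed
  then show ?thesis by (auto simp: mu_def intro!: restrict_ext)
qed

lemma mu_balanced: "balanced n A A A mu"
  by (rule balancedI) (simp_all add: mu_closed mu_add_left mu_add_right mu_balanced_eq)

text \<open>The augmentations turn the product into that of a twisted group ring; this is all that
  an action on X sees of it.\<close>

lemma eps_mu:
  assumes "a \<in> carrier A" "b \<in> carrier A" "u \<in> G"
  shows "eps u (mu a b) = (\<Sum>k\<in>fibre u. ginv n (snd k) (eps (fst k) a) * eps (snd k) b)"
  unfolding eps_def[of u] mu_def using assms(3)
  by (simp add: collapse_sum) (rule fibre_sum_cong, use assms in \<open>simp add: collapse_left eps_def[of _ b]\<close>)

text \<open>The left argument enters only through its augmentations, which vanish on odd elements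
  and on images of the differential. Hence the Leibniz rule loses its sign and its first term, see
  \<open>mu_koszul\<close> and \<open>mu_diff_left\<close>.\<close>

lemma mu_odd_left:
  assumes "a \<in> odds A" shows "mu a b = \<zero>\<^bsub>A\<^esub>"
  unfolding mu_def A_simps(2)
  by (intro restrict_ext ext sum.neutral ballI) (simp add: eps_odd[OF assms] fibreD)

lemma mu_parity:
  assumes "a \<in> carrier A"
  shows "b \<in> evens A \<Longrightarrow> mu a b \<in> evens A" "b \<in> odds A \<Longrightarrow> mu a b \<in> odds A"
proof -
  {
    assume b: "b \<in> evens A"
    then have bc: "b \<in> carrier A" by simp
    have "b g S = 0" if "g \<in> G" "odd (card S)" for g S using b that by (auto simp: A_simps PiE_iff)
    then have "mu a b u S = 0" if "u \<in> G" "odd (card S)" for u S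
      using that by (auto simp: mu_def intro!: sum.neutral dest: fibreD)
    then show "mu a b \<in> evens A" using mu_closed[OF assms bc] by (auto simp: A_simps PiE_iff)
  }
  {
    assume b: "b \<in> odds A"
    then have bc: "b \<in> carrier A" by simp
    have "b g S = 0" if "g \<in> G" "even (card S)" for g S using b that by (auto simp: A_simps PiE_iff)
    then have "mu a b u S = 0" if "u \<in> G" "even (card S)" for u S
      using that by (auto simp: mu_def intro!: sum.neutral dest: fibreD)
    then show "mu a b \<in> odds A" using mu_closed[OF assms bc] by (auto simp: A_simps PiE_iff)
  }
qed

lemma mu_diff:
  assumes "a \<in> carrier A" "b \<in> carrier A" shows "diff A (mu a b) = mu a (diff A b)"
  unfolding A_simps(7)[of "mu a b"] mu_def[of a "diff A b"]
proof (rule restrict_ext)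
  fix u assume u: "u \<in> G"
  interpret I: premf "n + n" "I_mf n W" by (rule premf_I[OF W])
  have t: "(\<lambda>S. ginv n (snd k) (eps (fst k) a) * b (snd k) S) \<in> unit_carrier n" if "k \<in> fibre u" for k
    using that assms by (intro mu_term_closed) (auto dest: fibreD)
  have gp: "ginv n (snd k) (eps (fst k) a) \<in> polys (n + n)" if "k \<in> fibre u" for k
    by (rule polys_mono[of _ n]) (use that assms fibreD[OF that] in auto)
  have "mu a b u = finsum (I_mf n W) (\<lambda>k S. ginv n (snd k) (eps (fst k) a) * b (snd k) S) (fibre u)"
    using u t by (simp add: mu_def I_finsum)
  then have "diff (I_mf n W) (mu a b u) =
      finsum (I_mf n W) (\<lambda>k. diff (I_mf n W) (\<lambda>S. ginv n (snd k) (eps (fst k) a) * b (snd k) S)) (fibre u)"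
    using additive_finsum[OF I.ab I.ab I.diff_additive,
        of "fibre u" "\<lambda>k S. ginv n (snd k) (eps (fst k) a) * b (snd k) S"] t by simp
  also have "\<dots> = (\<lambda>S. \<Sum>k\<in>fibre u. diff (I_mf n W) (\<lambda>S. ginv n (snd k) (eps (fst k) a) * b (snd k) S) S)"
    by (rule I_finsum) (use t I_diff_carrier[OF W] in auto)
  also have "\<dots> = (\<lambda>S. \<Sum>k\<in>fibre u. ginv n (snd k) (eps (fst k) a) * diff A b (snd k) S)"
  proof (intro ext sum.cong refl)
    fix k S assume k: "k \<in> fibre u"
    have "diff (I_mf n W) (\<lambda>S. ginv n (snd k) (eps (fst k) a) * b (snd k) S) =
        (\<lambda>S. ginv n (snd k) (eps (fst k) a) * diff (I_mf n W) (b (snd k)) S)"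
      using I.diff_smult[of "b (snd k)" "ginv n (snd k) (eps (fst k) a)"] gp[OF k]
        A_component[OF assms(2) fibreD(2)[OF k]] by simp
    then show "diff (I_mf n W) (\<lambda>S. ginv n (snd k) (eps (fst k) a) * b (snd k) S) S =
        ginv n (snd k) (eps (fst k) a) * diff A b (snd k) S"
      using fibreD(2)[OF k] by (simp add: A_simps(7))
  qed
  finally show "diff (I_mf n W) (mu a b u) =
      (\<lambda>S. \<Sum>k\<in>fibre u. ginv n (snd k) (eps (fst k) a) * diff A b (snd k) S)" .
qed

lemma mu_koszul:
  assumes "a \<in> carrier A" shows "mu (koszul A a) b = mu a b"
  unfolding mu_def
  by (intro restrict_ext ext fibre_sum_cong) (simp add: eps_koszul[OF assms])

lemma mu_diff_left: "mu (diff A a) b = \<zero>\<^bsub>A\<^esub>"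
  unfolding mu_def A_simps(2)
  by (intro restrict_ext ext sum.neutral ballI) (simp add: eps_diff fibreD)

sublocale AA: tensor_pair n "n + n" A A
  by unfold_locales simp

lemmas AG_mult = AA.tensor_lift[OF A.ab mu_balanced, folded AG_mult_lift]

lemma AG_mult_mf_maps: "AG_mult n W G \<in> mf_maps (n + n) AA.T A"
proof (rule mf_maps_extI[OF AA.premf_T AG_mult(1,3)])
  fix t assume t: "t \<in> carrier AA.T"
  show "AG_mult n W G (r \<odot>\<^bsub>AA.T\<^esub> t) = r \<odot>\<^bsub>A\<^esub> AG_mult n W G t" if r: "r \<in> polys (n + n)" for r
    by (rule AA.additive_polys_commute[OF premf_A AG_mult(1) _ _ _ r t])
      (simp_all add: AG_mult(2) mu_left mu_right)
  show "AG_mult n W G (diff AA.T t) = diff A (AG_mult n W G t)"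
    by (rule AA.tensor_additive_eqI[OF A.ab additive_compose[OF AA.diff_T_additive AG_mult(1)]
          additive_compose[OF AG_mult(1) A.diff_additive] t])
      (simp add: AA.diff_pure additive_add[OF AG_mult(1)] AG_mult(2) mu_diff mu_koszul mu_diff_left mu_closed)
next
  show "AG_mult n W G t \<in> evens A" if "t \<in> evens AA.T" for t using that
    by (induction rule: AA.evens_T_induct)
      (simp_all add: AG_mult(2) additive_add[OF AG_mult(1)] mu_parity mu_odd_left)
  show "AG_mult n W G t \<in> odds A" if "t \<in> odds AA.T" for t using that
    by (induction rule: AA.odds_T_induct)
      (simp_all add: AG_mult(2) additive_add[OF AG_mult(1)] mu_parity mu_odd_left)
qed

abbreviation "I \<equiv> I_mf n W"
abbreviation "eta \<equiv> AG_incl n W G one\<^sub>G"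

lemma on_left_one_simp [simp]: "r \<in> polys (n + n) \<Longrightarrow> on_left n (ginv n one\<^sub>G) r = r"
  by (rule on_left_one)

lemma eta_mf_maps: "eta \<in> mf_maps (n + n) I A"
proof (rule mf_maps_extI[OF premf_I[OF W]])
  have z: "diff I (\<lambda>S. 0) = (\<lambda>S. 0)" using premf.diff_zero[OF premf_I[OF W]] by simp
  show "additive I A eta"
    by (rule additiveI) (auto simp: AG_incl_def A_simps intro!: restrict_ext ext)
  show "eta \<in> extensional (carrier I)" by (simp add: AG_incl_def)
  show "eta (r \<odot>\<^bsub>I\<^esub> a) = r \<odot>\<^bsub>A\<^esub> eta a" if "r \<in> polys (n + n)" "a \<in> carrier I" for r a
    using that by (auto simp: AG_incl_def A_simps intro!: restrict_ext ext)
  show "eta a \<in> evens A" if "a \<in> evens I" for a using that by (auto simp: AG_incl_def A_simps)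
  show "eta a \<in> odds A" if "a \<in> odds I" for a using that by (auto simp: AG_incl_def A_simps)
  show "eta (diff I m) = diff A (eta m)" if "m \<in> carrier I" for m
    using that I_diff_carrier[OF W, of m] z by (auto simp: AG_incl_def A_simps intro!: restrict_ext)
qed

lemma eps_eta: "\<omega> \<in> unit_carrier n \<Longrightarrow> g \<in> G \<Longrightarrow> eps g (eta \<omega>) = (if g = one\<^sub>G then collapse n (\<omega> {}) else 0)"
  by (simp add: eps_def AG_incl_def)

text \<open>The counit without its factor |G|. Tensored with X it maps \<open>A\<close> \<otimes> X
  to \<open>I\<close> \<otimes> X, which is how the sections yield a right inverse of
  \<lambda>.\<close>

lemma component_one_mf_map: "is_mf_map (n + n) A I (\<lambda>a. a one\<^sub>G)"
  by (auto simp: is_mf_map_def is_linear_def additive_def A_simps PiE_iff)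

end

section \<open>Actions of \<open>A\<^sub>G\<close>\<close>

context symmetric_potential
begin

lemma ginv_image: "g \<in> G \<Longrightarrow> ginv n g ` polys n = polys n"
proof (intro equalityI subsetI)
  fix p :: "'k mpoly" assume "g \<in> G" "p \<in> polys n"
  then show "p \<in> ginv n g ` polys n"
    using ginv_left[OF G] poly_endoD(1)[OF symmetry_endo[OF G]] by (metis image_eqI)
qed auto

lemmas twist_ginv_both = maps_twist_both[OF ginv_image]

lemma twist_ginv_mult:
  assumes "g \<in> G" "h \<in> G"
  shows "mf_maps n (twist (ginv n (g \<cdot> h)) X) Y = mf_maps n (twist (ginv n g) (twist (ginv n h) X)) Y"
    "homotopic n (twist (ginv n (g \<cdot> h)) X) Y = homotopic n (twist (ginv n g) (twist (ginv n h) X)) Y"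
    "hclass n (twist (ginv n (g \<cdot> h)) X) Y = hclass n (twist (ginv n g) (twist (ginv n h) X)) Y"
  unfolding twist_twist
  by (rule maps_twist_cong; rule ginv_mult[OF G assms]; assumption)+

lemma twist_ginv_one:
  "mf_maps n (twist (ginv n one\<^sub>G) X) Y = mf_maps n X Y"
  "homotopic n (twist (ginv n one\<^sub>G) X) Y = homotopic n X Y"
  "hclass n (twist (ginv n one\<^sub>G) X) Y = hclass n X Y"
proof -
  have i: "twist (\<lambda>r. r) X = X" by (simp add: twist_def)
  show "mf_maps n (twist (ginv n one\<^sub>G) X) Y = mf_maps n X Y"
    "homotopic n (twist (ginv n one\<^sub>G) X) Y = homotopic n X Y"
    "hclass n (twist (ginv n one\<^sub>G) X) Y = hclass n X Y"
    using maps_twist_cong[of n "ginv n one\<^sub>G" "\<lambda>r. r" X Y, OF ginv_one] by (simp_all add: i)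
qed

end

context A_tensor
begin

definition mor where "mor \<phi> = (\<lambda>t\<in>carrier AX.T. \<Oplus>\<^bsub>X\<^esub>g\<in>G. \<phi> g (proj g t))"

context
  fixes \<phi> :: "('k mpoly \<Rightarrow> 'k mpoly) \<Rightarrow> 'x \<Rightarrow> 'x"
  assumes \<phi>: "\<And>g. g \<in> G \<Longrightarrow> \<phi> g \<in> mf_maps n (tw g) X"
begin

lemmas act_is_mf_map = mf_maps_is_mf_map[OF \<phi>]

lemma act_additive: "g \<in> G \<Longrightarrow> additive X X (\<phi> g)"
  using is_linearD(1)[OF is_mf_mapD(1)[OF act_is_mf_map]] by simp

lemmas act_closed = additive_closed[OF act_additive]
  and act_zero = additive_zero[OF X.ab X.ab act_additive]

lemma act_smult: "g \<in> G \<Longrightarrow> r \<in> polys n \<Longrightarrow> x \<in> carrier X \<Longrightarrow> \<phi> g (ginv n g r \<odot>\<^bsub>X\<^esub> x) = r \<odot>\<^bsub>X\<^esub> \<phi> g x"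
  using is_linearD(4)[OF is_mf_mapD(1)[OF act_is_mf_map]] by simp

lemma mor_term: "g \<in> G \<Longrightarrow> is_mf_map n AX.T X (\<lambda>t. \<phi> g (proj g t))"
  by (rule is_mf_map_comp[OF proj_mf_map act_is_mf_map])

lemma mor_mf_maps: "mor \<phi> \<in> mf_maps n AX.T X"
  unfolding mor_def
  by (rule is_mf_map_restrict[OF is_mf_map_finsum[OF AX.premf_T X.premf_axioms mor_term] AX.premf_T])

lemma mor_additive: "additive AX.T X (mor \<phi>)"
  by (rule mf_maps_additive[OF mor_mf_maps])

lemma mor_pure:
  assumes "a \<in> carrier A" "x \<in> carrier X"
  shows "mor \<phi> (AX.p a x) = (\<Oplus>\<^bsub>X\<^esub>g\<in>G. \<phi> g (eps g a \<odot>\<^bsub>X\<^esub> x))"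
  unfolding mor_def
  by (simp add: assms AX.pure_closed) (rule X.mm.M.finsum_cong', use assms in \<open>simp_all add: proj_pure act_closed\<close>)

end

lemma mor_homotopic:
  assumes "\<And>g. g \<in> G \<Longrightarrow> \<phi> g \<in> mf_maps n (tw g) X" "\<And>g. g \<in> G \<Longrightarrow> \<phi>' g \<in> mf_maps n (tw g) X"
    and ho: "\<And>g. g \<in> G \<Longrightarrow> homotopic n (tw g) X (\<phi> g) (\<phi>' g)"
  shows "homotopic n AX.T X (mor \<phi>) (mor \<phi>')"
proof -
  note m = mf_maps_is_mf_map[OF assms(1)] mf_maps_is_mf_map[OF assms(2)]
  have "homotopic n AX.T X (\<lambda>t. \<Oplus>\<^bsub>X\<^esub>g\<in>G. \<phi> g (proj g t)) (\<lambda>t. \<Oplus>\<^bsub>X\<^esub>g\<in>G. \<phi>' g (proj g t))"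
  proof (rule homotopic_finsum[OF AX.premf_T X.premf_axioms mor_term[OF assms(1)] mor_term[OF assms(2)]])
    fix g assume g: "g \<in> G"
    show "homotopic n AX.T X (\<lambda>t. \<phi> g (proj g t)) (\<lambda>t. \<phi>' g (proj g t))"
      by (rule homotopic_comp'[OF AX.premf_T premf_tw[OF g] X.premf_axioms proj_mf_map[OF g] proj_mf_map[OF g]
        m(1)[OF g] m(2)[OF g] homotopic_refl'[OF AX.premf_T premf_tw[OF g] proj_mf_map[OF g]] ho[OF g]])
  qed
  then show ?thesis by (simp add: mor_def)
qed

lemma whisker_act:
  assumes X': "premf n X'" and \<phi>: "\<And>g. g \<in> G \<Longrightarrow> \<phi> g \<in> mf_maps n (tw g) X" and f: "f \<in> mf_maps n X X'"
    and t: "t \<in> carrier AX.T"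
  shows "f (mor \<phi> t) = (\<Oplus>\<^bsub>X'\<^esub>g\<in>G. f (\<phi> g (proj g t)))"
proof -
  interpret X': premf n X' by fact
  show ?thesis
    unfolding mor_def using t
    by (simp add: additive_finsum[OF X.ab X'.ab mf_maps_additive[OF f]] act_closed[OF \<phi>])
qed

end

context A_tensor_free
begin

definition sec where "sec = (SOME s. is_section s)"

lemma sec_props: "is_section sec"
  unfolding sec_def using sections_exist by (rule someI_ex[of is_section])

lemma sec_mf_map: "g \<in> G \<Longrightarrow> is_mf_map n (tw g) T (sec g)"
  and proj_sec: "g \<in> G \<Longrightarrow> h \<in> G \<Longrightarrow> x \<in> carrier X \<Longrightarrow> proj h (sec g x) = (if h = g then x else \<zero>\<^bsub>X\<^esub>)"
  and sec_total: "homotopic n T T (\<lambda>t. \<Oplus>\<^bsub>T\<^esub>g\<in>G. sec g (proj g t)) (\<lambda>t. t)"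
  using sec_props by (simp_all add: is_section_def)

lemma sec_closed [simp]: "g \<in> G \<Longrightarrow> x \<in> carrier X \<Longrightarrow> sec g x \<in> carrier T"
  using is_linearD(2)[OF is_mf_mapD(1)[OF sec_mf_map]] by simp

lemma mor_sec:
  assumes \<phi>: "\<And>g. g \<in> G \<Longrightarrow> \<phi> g \<in> mf_maps n (tw g) X" and gx: "g \<in> G" "x \<in> carrier X"
  shows "mor \<phi> (sec g x) = \<phi> g x"
proof -
  have "mor \<phi> (sec g x) = (\<Oplus>\<^bsub>X\<^esub>h\<in>G. \<phi> h (proj h (sec g x)))" using gx by (simp add: mor_def)
  also have "\<dots> = \<phi> g (proj g (sec g x))"
    by (rule finsum_delta[OF X.ab])
      (use gx in \<open>simp_all add: proj_sec act_closed[OF \<phi>] act_zero[OF \<phi>]\<close>)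
  finally show ?thesis using gx by (simp add: proj_sec)
qed

text \<open>One direction evaluates on the sections, which pick out single components strictly; the
  other adds up the homotopies of the components.\<close>

lemma mor_homotopic_iff:
  assumes "\<And>g. g \<in> G \<Longrightarrow> \<phi> g \<in> mf_maps n (tw g) X" "\<And>g. g \<in> G \<Longrightarrow> \<phi>' g \<in> mf_maps n (tw g) X"
  shows "homotopic n T X (mor \<phi>) (mor \<phi>') \<longleftrightarrow> (\<forall>g\<in>G. homotopic n (tw g) X (\<phi> g) (\<phi>' g))"
proof (intro iffI ballI)
  fix g assume ho: "homotopic n T X (mor \<phi>) (mor \<phi>')" and g: "g \<in> G"
  have "homotopic n (tw g) X (\<lambda>x. mor \<phi> (sec g x)) (\<lambda>x. mor \<phi>' (sec g x))"
    by (rule homotopic_comp'[OF premf_tw[OF g] AX.premf_T X.premf_axioms sec_mf_map[OF g] sec_mf_map[OF g]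
        mf_maps_is_mf_map[OF mor_mf_maps] mf_maps_is_mf_map[OF mor_mf_maps]
        homotopic_refl'[OF premf_tw[OF g] AX.premf_T sec_mf_map[OF g]] ho]) (use assms in auto)
  then show "homotopic n (tw g) X (\<phi> g) (\<phi>' g)"
    by (subst (asm) homotopic_cong[of _ _ "\<phi> g" _ "\<phi>' g"]) (use assms g in \<open>simp_all add: mor_sec\<close>)
qed (use mor_homotopic assms in blast)

text \<open>Restrict \<rho> along the sections. The sum of the sections after the projections is
  homotopic to the identity, so the components rebuild \<rho> up to homotopy.\<close>

lemma exists_mor:
  assumes \<rho>: "\<rho> \<in> mf_maps n T X"
  obtains \<phi> where "\<And>g. g \<in> G \<Longrightarrow> \<phi> g \<in> mf_maps n (tw g) X" "homotopic n T X (mor \<phi>) \<rho>"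
proof -
  define \<phi> where "\<phi> g = restrict (\<lambda>x. \<rho> (sec g x)) (carrier X)" for g
  have m: "\<phi> g \<in> mf_maps n (tw g) X" if "g \<in> G" for g
    using is_mf_map_restrict[OF is_mf_map_comp[OF sec_mf_map[OF that] mf_maps_is_mf_map[OF \<rho>]] premf_tw[OF that]]
    by (simp add: \<phi>_def)
  have sc: "is_mf_map n T T (\<lambda>t. \<Oplus>\<^bsub>T\<^esub>g\<in>G. sec g (proj g t))"
    by (rule is_mf_map_finsum[OF AX.premf_T AX.premf_T is_mf_map_comp[OF proj_mf_map sec_mf_map]])
  have "homotopic n T X (\<lambda>t. \<rho> (\<Oplus>\<^bsub>T\<^esub>g\<in>G. sec g (proj g t))) (\<lambda>t. \<rho> t)"
    by (rule homotopic_comp'[OF AX.premf_T AX.premf_T X.premf_axioms sc is_mf_map_id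
        mf_maps_is_mf_map[OF \<rho>] mf_maps_is_mf_map[OF \<rho>] sec_total
        homotopic_refl'[OF AX.premf_T X.premf_axioms mf_maps_is_mf_map[OF \<rho>]]])
  moreover have "mor \<phi> t = \<rho> (\<Oplus>\<^bsub>T\<^esub>g\<in>G. sec g (proj g t))" if "t \<in> carrier T" for t
  proof -
    have "\<rho> (\<Oplus>\<^bsub>T\<^esub>g\<in>G. sec g (proj g t)) = (\<Oplus>\<^bsub>X\<^esub>g\<in>G. \<rho> (sec g (proj g t)))"
      by (rule additive_finsum[OF AX.T_ab X.ab mf_maps_additive[OF \<rho>]]) (use that in auto)
    also have "\<dots> = (\<Oplus>\<^bsub>X\<^esub>g\<in>G. \<phi> g (proj g t))"
      by (rule X.mm.M.finsum_cong') (use that act_closed[OF m] in \<open>auto simp: \<phi>_def\<close>)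
    finally show ?thesis using that by (simp add: mor_def)
  qed
  ultimately have "homotopic n T X (mor \<phi>) \<rho>"
    by (subst homotopic_cong[of _ _ "\<lambda>t. \<rho> (\<Oplus>\<^bsub>T\<^esub>g\<in>G. sec g (proj g t))" _ \<rho>]) simp_all
  with m show ?thesis by (rule that)
qed

text \<open>A twist of X is again free, on the same basis, so everything proved for X applies to it;
  this is needed for the summands g(hX) of the double product.\<close>

lemma twist_free: "g \<in> G \<Longrightarrow> A_tensor_free n W G (tw g) B"
proof -
  assume g: "g \<in> G"
  have "is_basis (PR n) (tw g) B"
    by (rule is_basis_twist[OF _ X.premf_axioms, where \<tau> = g])
      (use FX.basis g ginv_left[OF G] ginv_right[OF G] poly_endoD(1)[OF symmetry_endo[OF G]]
        poly_endoD(3)[OF symmetry_endo[OF G g], of 0 0] in \<open>auto simp: homogeneous_basis_def\<close>)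
  then show ?thesis
    using FX.basis g ginv_W[OF G g] dd
    by (intro A_tensor_free.intro A_tensor.intro free_premf.intro free_premf_axioms.intro
        A_tensor_free_axioms.intro symmetric_potential_axioms premf_tw)
      (auto simp: homogeneous_basis_def)
qed

end

text \<open>An equivariant structure in terms of representatives. Invertibility of the \<phi>_g
  follows from the two laws, see \<open>rep_hiso\<close>.\<close>

definition (in symmetric_potential) is_rep where
  "is_rep X \<phi> \<longleftrightarrow> (\<forall>g\<in>G. \<phi> g \<in> mf_maps n (twist (ginv n g) X) X) \<and>
     homotopic n X X (\<phi> one\<^sub>G) (\<lambda>x. x) \<and>
     (\<forall>g\<in>G. \<forall>h\<in>G. homotopic n (twist (ginv n (g \<cdot> h)) X) X (\<phi> (g \<cdot> h)) (\<lambda>x. \<phi> g (\<phi> h x)))"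

context A_tensor_free
begin

section \<open>The unit law\<close>

sublocale IX: tensor_pair n n I X
  by (intro tensor_pair.intro premf_I[OF W] X.premf_axioms tensor_pair_axioms.intro) simp

sublocale eta: tensor_pairs n n I X A X ..
sublocale counit: tensor_pairs n n A X I X ..

lemmas lam_X_pure = lam_pure[OF X.premf_axioms order_refl W]
  and lam_X_additive = lam_additive[OF X.premf_axioms order_refl W]

lemma lam_X_mf_map: "is_mf_map n IX.T X (lam n W X)"
  unfolding is_mf_map_def is_linear_def
proof (intro conjI ballI)
  note a = lam_X_additive
  show "additive IX.T X (lam n W X)" by (rule a)
  have c [simp]: "collapse n (\<omega> {}) \<in> polys n" if "\<omega> \<in> unit_carrier n" for \<omega>
    by (rule collapse_polys) (rule unit_carrierD[OF that])
  have z: "\<omega> {} = 0" if "\<omega> \<in> odds I" for \<omega> using that by simp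
  have "lam n W X t \<in> evens X" if "t \<in> evens IX.T" for t using that
    by (induction rule: IX.evens_T_induct)
      (simp_all add: lam_X_pure additive_add[OF a] X.evens_smult z)
  then show "lam n W X ` evens IX.T \<subseteq> evens X" by auto
  have "lam n W X t \<in> odds X" if "t \<in> odds IX.T" for t using that
    by (induction rule: IX.odds_T_induct)
      (simp_all add: lam_X_pure additive_add[OF a] z)
  then show "lam n W X ` odds IX.T \<subseteq> odds X" by auto
  have k: "koszul I \<omega> {} = \<omega> {}" if w: "\<omega> \<in> carrier I" for \<omega>
  proof -
    obtain a b where a: "a \<in> evens I" and b: "b \<in> odds I" and e: "\<omega> = a \<oplus>\<^bsub>I\<^esub> b" by (rule IX.Y.decompE[OF w]) blast
    have "koszul I \<omega> = a \<oplus>\<^bsub>I\<^esub> \<ominus>\<^bsub>I\<^esub> b"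
      unfolding e IX.Y.koszul_add[OF IX.Y.evens_carrier[OF a] IX.Y.odds_carrier[OF b]]
        IX.Y.koszul_even[OF a] IX.Y.koszul_odd[OF b] ..
    then show ?thesis using z[OF b] z[OF IX.Y.odds_neg[OF b]] e by simp
  qed
  fix t assume t: "t \<in> carrier IX.T"
  show "lam n W X (diff IX.T t) = diff X (lam n W X t)"
    by (rule IX.tensor_additive_eqI[OF X.ab additive_compose[OF IX.diff_T_additive a]
          additive_compose[OF a X.diff_additive] t])
      (use k IX.Y.koszul_closed IX.Y.diff_closed in
        \<open>simp add: IX.diff_pure additive_add[OF a] lam_X_pure X.diff_smult collapse_I_diff\<close>)
  show "lam n W X (r \<odot>\<^bsub>IX.T\<^esub> t) = r \<odot>\<^bsub>X\<^esub> lam n W X t" if r: "r \<in> polys n" for r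
    by (rule IX.tensor_additive_eqI[OF X.ab additive_compose[OF IX.smult_additive[OF r] a]
          additive_compose[OF a X.smult_additive[OF r]] t])
      (use r in \<open>simp add: IX.smult_left lam_X_pure X.smult_smult collapse_left\<close>)
qed

text \<open>All augmentations of the unit map vanish except the one at the neutral element, so a
  single term of the sum remains.\<close>

lemma mor_eta:
  assumes \<phi>: "\<And>g. g \<in> G \<Longrightarrow> \<phi> g \<in> mf_maps n (tw g) X" and t: "t \<in> carrier IX.T"
  shows "mor \<phi> (eta.tm eta (\<lambda>x. x) t) = \<phi> one\<^sub>G (lam n W X t)"
proof -
  note l = is_mf_mapD(1)[OF mf_maps_is_mf_map[OF eta_mf_maps]]
  have idl: "is_linear n X X (\<lambda>x. x)" by (rule is_mf_mapD(1)[OF is_mf_map_id])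
  show ?thesis
  proof (rule IX.tensor_additive_eqI[OF X.ab
      additive_compose[OF eta.tensor_map_additive[OF l idl] mor_additive[OF \<phi>]]
      additive_compose[OF lam_X_additive act_additive[OF \<phi>, of "one\<^sub>G"]] t])
    fix \<omega> x assume wx: "\<omega> \<in> carrier I" "x \<in> carrier X"
    then have w: "\<omega> \<in> unit_carrier n" by simp
    have c: "collapse n (\<omega> {}) \<in> polys n" by (rule collapse_polys) (rule unit_carrierD[OF w])
    have ec: "eta \<omega> \<in> carrier A" using mf_maps_closed[OF eta_mf_maps] w by simp
    have "mor \<phi> (eta.tm eta (\<lambda>x. x) (IX.p \<omega> x)) = (\<Oplus>\<^bsub>X\<^esub>g\<in>G. \<phi> g (eps g (eta \<omega>) \<odot>\<^bsub>X\<^esub> x))"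
      using wx ec by (simp add: eta.tensor_map_pure[OF l idl] mor_pure[OF \<phi>])
    also have "\<dots> = \<phi> one\<^sub>G (eps one\<^sub>G (eta \<omega>) \<odot>\<^bsub>X\<^esub> x)"
      by (rule finsum_delta[OF X.ab])
        (use w wx c in \<open>simp_all add: eps_eta act_closed[OF \<phi>] act_zero[OF \<phi>]\<close>)
    finally show "mor \<phi> (eta.tm eta (\<lambda>x. x) (IX.p \<omega> x)) = \<phi> one\<^sub>G (lam n W X (IX.p \<omega> x))"
      using w wx by (simp add: eps_eta lam_X_pure)
  qed simp_all
qed

lemma lam_counit:
  assumes t: "t \<in> carrier T"
  shows "lam n W X (counit.tm (\<lambda>a. a one\<^sub>G) (\<lambda>x. x) t) = proj one\<^sub>G t"
proof -
  note l = is_mf_mapD(1)[OF component_one_mf_map]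
  have idl: "is_linear n X X (\<lambda>x. x)" by (rule is_mf_mapD(1)[OF is_mf_map_id])
  show ?thesis
    by (rule AX.tensor_additive_eqI[OF X.ab
      additive_compose[OF counit.tensor_map_additive[OF l idl] lam_X_additive]
      proj_additive[OF one_closed] t])
      (use is_linearD(2)[OF l] in \<open>simp add: counit.tensor_map_pure[OF l idl] lam_X_pure proj_pure eps_def\<close>)
qed

text \<open>By \<open>mor_eta\<close> the unit law compares \<phi>_e \<lambda> with \<lambda>. Since
  \<lambda> has a strict right inverse, it can be cancelled.\<close>

lemma unit_iff:
  assumes \<phi>: "\<And>g. g \<in> G \<Longrightarrow> \<phi> g \<in> mf_maps n (tw g) X"
  shows "homotopic n IX.T X (\<lambda>t. mor \<phi> (eta.tm eta (\<lambda>x. x) t)) (lam n W X) \<longleftrightarrow>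
    homotopic n X X (\<phi> one\<^sub>G) (\<lambda>x. x)"
proof -
  have p1: "is_mf_map n X X (\<phi> one\<^sub>G)"
    using mf_maps_is_mf_map \<phi>[of "one\<^sub>G"] by (simp add: twist_ginv_one)
  have e: "homotopic n IX.T X (\<lambda>t. mor \<phi> (eta.tm eta (\<lambda>x. x) t)) (lam n W X) \<longleftrightarrow>
      homotopic n IX.T X (\<lambda>t. \<phi> one\<^sub>G (lam n W X t)) (\<lambda>t. lam n W X t)"
    by (rule homotopic_cong) (simp_all add: mor_eta[OF \<phi>])
  \<comment> \<open>The right inverse of \<lambda>: the section at the neutral element, followed by
    the projection of \<open>A\<close> to its summand I.\<close>
  let ?\<kappa> = "\<lambda>x. counit.tm (\<lambda>a. a one\<^sub>G) (\<lambda>x. x) (sec one\<^sub>G x)"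
  have s: "is_mf_map n X T (sec one\<^sub>G)"
  proof (rule is_mf_map_cong[OF X.premf_axioms _ mf_maps_is_mf_map])
    show "restrict (sec one\<^sub>G) (carrier X) \<in> mf_maps n X T"
      using is_mf_map_restrict[OF sec_mf_map[OF one_closed] premf_tw[OF one_closed]] by (simp add: twist_ginv_one)
  qed simp
  have k: "is_mf_map n X IX.T ?\<kappa>"
    by (rule is_mf_map_comp[OF s counit.tensor_map_mf_map[OF component_one_mf_map is_mf_map_id]])
  have lk: "lam n W X (?\<kappa> x) = x" if "x \<in> carrier X" for x
    using that by (simp add: lam_counit proj_sec)
  show ?thesis
    unfolding e
  proof
    assume "homotopic n IX.T X (\<lambda>t. \<phi> one\<^sub>G (lam n W X t)) (\<lambda>t. lam n W X t)"
    from homotopic_comp'[OF X.premf_axioms IX.premf_T X.premf_axioms k k is_mf_map_comp[OF lam_X_mf_map p1]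
        lam_X_mf_map homotopic_refl'[OF X.premf_axioms IX.premf_T k] this]
    show "homotopic n X X (\<phi> one\<^sub>G) (\<lambda>x. x)"
      by (subst (asm) homotopic_cong[of _ _ "\<phi> one\<^sub>G" _ "\<lambda>x. x"]) (simp_all add: lk)
  next
    assume h: "homotopic n X X (\<phi> one\<^sub>G) (\<lambda>x. x)"
    show "homotopic n IX.T X (\<lambda>t. \<phi> one\<^sub>G (lam n W X t)) (\<lambda>t. lam n W X t)"
      by (rule homotopic_comp'[OF IX.premf_T X.premf_axioms X.premf_axioms lam_X_mf_map lam_X_mf_map p1
        is_mf_map_id homotopic_refl'[OF IX.premf_T X.premf_axioms lam_X_mf_map] h])
  qed
qed

section \<open>The associativity law\<close>

sublocale AAX: tensor_triple n A A X ..
sublocale mult: tensor_pairs n n "tensor n A A" X A X ..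

abbreviation "AAT \<equiv> tensor n (tensor n A A) X"

text \<open>The components \<open>\<^sub>g(\<^sub>hX)\<close> of \<open>A\<^sub>G \<otimes> A\<^sub>G \<otimes> X\<close>.\<close>

definition proj2 where
  "proj2 g h t = A_tensor.proj n W G (tw h) g (tensor_map n A T A (tw h) (\<lambda>a. a) (proj h) (AAX.assoc t))"

text \<open>The section at g is taken over the twisted module hX, which is free by
  \<open>twist_free\<close>.\<close>

definition sec2 where
  "sec2 g h x = AAX.unassoc (tensor_map n A (tw h) A T (\<lambda>a. a) (sec h) (A_tensor_free.sec n W G (tw h) g x))"

context
  fixes g h assumes g: "g \<in> G" and h: "h \<in> G"
begin

interpretation H: A_tensor_free n W G "tw h" B by (rule twist_free[OF h])
interpretation P: tensor_pairs n n A T A "tw h" ..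
interpretation S: tensor_pairs n n A "tw h" A T ..

lemma proj2_mf_map: "is_mf_map n AAT (twist (ginv n g) (tw h)) (proj2 g h)"
  unfolding proj2_def
  by (rule is_mf_map_comp[OF is_mf_map_comp[OF mf_maps_is_mf_map[OF AAX.assoc_mf_maps]
        P.tensor_map_mf_map[OF is_mf_map_id proj_mf_map[OF h]]] H.proj_mf_map[OF g]])

lemma sec2_mf_map: "is_mf_map n (twist (ginv n g) (tw h)) AAT (sec2 g h)"
  unfolding sec2_def
  by (rule is_mf_map_comp[OF is_mf_map_comp[OF H.sec_mf_map[OF g]
        S.tensor_map_mf_map[OF is_mf_map_id sec_mf_map[OF h]]] mf_maps_is_mf_map[OF AAX.unassoc_mf_maps]])

lemma proj2_pure:
  assumes "a \<in> carrier A" "b \<in> carrier A" "x \<in> carrier X"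
  shows "proj2 g h (AAX.L.p (AA.p a b) x) = ginv n h (eps g a) \<odot>\<^bsub>X\<^esub> (eps h b \<odot>\<^bsub>X\<^esub> x)"
  using assms g h
  by (simp add: proj2_def AAX.assoc_pure P.tensor_map_pure[OF is_mf_mapD(1)[OF is_mf_map_id]
      is_mf_mapD(1)[OF proj_mf_map[OF h]]] H.proj_pure proj_pure)

text \<open>Projecting the second factor undoes the section at h and gives zero for every other
  index; what is left is a section over hX followed by a projection.\<close>

lemma proj2_sec2:
  assumes k: "k \<in> G" "l \<in> G" and x: "x \<in> carrier X"
  shows "proj2 k l (sec2 g h x) = (if k = g \<and> l = h then x else \<zero>\<^bsub>X\<^esub>)"
proof -
  interpret L: A_tensor_free n W G "tw l" B by (rule twist_free[OF k(2)])
  interpret PL: tensor_pairs n n A T A "tw l" ..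
  interpret PS: tensor_pairs n n A "tw h" A "tw l" ..
  let ?y = "H.sec g x"
  have y: "?y \<in> carrier H.T" using g x by simp
  note il = is_mf_mapD(1)[OF is_mf_map_id] and hl = is_mf_mapD(1)[OF sec_mf_map[OF h]]
    and pl = is_mf_mapD(1)[OF proj_mf_map[OF k(2)]]
  let ?z = "tensor_map n A (tw h) A T (\<lambda>a. a) (sec h) ?y"
  have z: "?z \<in> carrier (tensor n A T)"
    by (rule additive_closed[OF S.tensor_map_additive[OF il hl] y])
  have "proj2 k l (sec2 g h x) = L.proj k (tensor_map n A T A (tw l) (\<lambda>a. a) (proj l) ?z)"
    using z by (simp add: proj2_def sec2_def AAX.assoc_unassoc)
  also have "\<dots> = (if l = h then H.proj k ?y else \<zero>\<^bsub>X\<^esub>)"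
  proof (rule H.AX.tensor_additive_eqI[OF X.ab _ _ y,
        of "\<lambda>y. L.proj k (tensor_map n A T A (tw l) (\<lambda>a. a) (proj l) (tensor_map n A (tw h) A T (\<lambda>a. a) (sec h) y))"
          "\<lambda>y. if l = h then H.proj k y else \<zero>\<^bsub>X\<^esub>"])
    show "additive H.T X (\<lambda>y. L.proj k (PL.tm (\<lambda>a. a) (proj l) (S.tm (\<lambda>a. a) (sec h) y)))"
      using additive_compose[OF additive_compose[OF S.tensor_map_additive[OF il hl] PL.tensor_map_additive[OF il pl]]
          L.proj_additive[OF k(1)]] by simp
    show "additive H.T X (\<lambda>y. if l = h then H.proj k y else \<zero>\<^bsub>X\<^esub>)"
      using H.proj_additive[OF k(1)] by (cases "l = h") (simp_all add: additive_zero_map[OF X.ab])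
  qed (use k h in \<open>simp_all add: PL.tensor_map_pure[OF il pl] S.tensor_map_pure[OF il hl] L.proj_pure H.proj_pure
         proj_sec\<close>)
  also have "\<dots> = (if k = g \<and> l = h then x else \<zero>\<^bsub>X\<^esub>)"
    using H.proj_sec[OF g k(1)] x by auto
  finally show ?thesis .
qed

end

text \<open>By \<open>eps_mu\<close> the augmentation at u of a product is a sum over factorisations
  of u; collecting all u gives a sum over pairs.\<close>

lemma mor_mult:
  assumes \<phi>: "\<And>g. g \<in> G \<Longrightarrow> \<phi> g \<in> mf_maps n (tw g) X" and t: "t \<in> carrier AAT"
  shows "mor \<phi> (mult.tm (AG_mult n W G) (\<lambda>x. x) t) =
    (\<Oplus>\<^bsub>X\<^esub>k\<in>G \<times> G. \<phi> (fst k \<cdot> snd k) (proj2 (fst k) (snd k) t))"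
proof -
  note ml = is_mf_mapD(1)[OF mf_maps_is_mf_map[OF AG_mult_mf_maps]] and il = is_mf_mapD(1)[OF is_mf_map_id]
  have pl: "additive AAT X (proj2 g h)" if "g \<in> G" "h \<in> G" for g h
    using is_linearD(1)[OF is_mf_mapD(1)[OF proj2_mf_map[OF that]]] by simp
  show ?thesis
  proof (rule AAX.L_eqI[OF X.ab additive_compose[OF mult.tensor_map_additive[OF ml il] mor_additive[OF \<phi>]]
      finsum_additive[OF X.ab] t])
    fix a b x assume abx: "a \<in> carrier A" "b \<in> carrier A" "x \<in> carrier X"
    have c: "ginv n (snd k) (eps (fst k) a) \<in> polys n" "eps (snd k) b \<in> polys n" if "k \<in> G \<times> G" for k
      using that abx by auto
    let ?c = "\<lambda>k. ginv n (snd k) (eps (fst k) a) * eps (snd k) b"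
    have kc: "?c k \<in> polys n" "fst k \<cdot> snd k \<in> G" if "k \<in> G \<times> G" for k
      using c[OF that] that by auto
    have "mor \<phi> (mult.tm (AG_mult n W G) (\<lambda>x. x) (AAX.L.p (AA.p a b) x)) = (\<Oplus>\<^bsub>X\<^esub>u\<in>G. \<phi> u (eps u (mu a b) \<odot>\<^bsub>X\<^esub> x))"
      using abx by (simp add: mult.tensor_map_pure[OF ml il] mor_pure[OF \<phi>] AG_mult(2) mu_closed)
    also have "\<dots> = (\<Oplus>\<^bsub>X\<^esub>u\<in>G. \<Oplus>\<^bsub>X\<^esub>k\<in>fibre u. \<phi> (fst k \<cdot> snd k) (?c k \<odot>\<^bsub>X\<^esub> x))"
    proof (rule X.mm.M.finsum_cong')
      fix u assume u: "u \<in> G"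
      have fk: "k \<in> G \<times> G" "fst k \<cdot> snd k = u" if "k \<in> fibre u" for k using that by (auto simp: fibre_def)
      have "\<phi> u (eps u (mu a b) \<odot>\<^bsub>X\<^esub> x) = \<phi> u (\<Oplus>\<^bsub>X\<^esub>k\<in>fibre u. ?c k \<odot>\<^bsub>X\<^esub> x)"
        using abx u kc fk by (subst eps_mu) (simp_all add: X.sum_smult)
      also have "\<dots> = (\<Oplus>\<^bsub>X\<^esub>k\<in>fibre u. \<phi> u (?c k \<odot>\<^bsub>X\<^esub> x))"
        by (rule additive_finsum[OF X.ab X.ab act_additive[OF \<phi> u]]) (use kc fk abx in auto)
      also have "\<dots> = (\<Oplus>\<^bsub>X\<^esub>k\<in>fibre u. \<phi> (fst k \<cdot> snd k) (?c k \<odot>\<^bsub>X\<^esub> x))"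
        by (rule X.mm.M.finsum_cong') (use kc fk abx u in \<open>auto simp: act_closed[OF \<phi>]\<close>)
      finally show "\<phi> u (eps u (mu a b) \<odot>\<^bsub>X\<^esub> x) = (\<Oplus>\<^bsub>X\<^esub>k\<in>fibre u. \<phi> (fst k \<cdot> snd k) (?c k \<odot>\<^bsub>X\<^esub> x))" .
    next
      show "(\<lambda>u. \<Oplus>\<^bsub>X\<^esub>k\<in>fibre u. \<phi> (fst k \<cdot> snd k) (?c k \<odot>\<^bsub>X\<^esub> x)) \<in> G \<rightarrow> carrier X"
        using kc abx by (auto intro!: X.mm.M.finsum_closed act_closed[OF \<phi>] simp: fibre_def)
    qed simp
    also have "\<dots> = (\<Oplus>\<^bsub>X\<^esub>k\<in>G \<times> G. \<phi> (fst k \<cdot> snd k) (?c k \<odot>\<^bsub>X\<^esub> x))"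
      unfolding fibre_def
      by (rule finsum_fibres[OF X.ab]) (use kc abx in \<open>auto intro!: act_closed[OF \<phi>]\<close>)
    also have "\<dots> = (\<Oplus>\<^bsub>X\<^esub>k\<in>G \<times> G. \<phi> (fst k \<cdot> snd k) (proj2 (fst k) (snd k) (AAX.L.p (AA.p a b) x)))"
      by (rule X.mm.M.finsum_cong')
        (use kc abx in \<open>auto intro!: act_closed[OF \<phi>] simp: proj2_pure X.smult_smult\<close>)
    finally show "mor \<phi> (mult.tm (AG_mult n W G) (\<lambda>x. x) (AAX.L.p (AA.p a b) x)) =
      (\<Oplus>\<^bsub>X\<^esub>k\<in>G \<times> G. \<phi> (fst k \<cdot> snd k) (proj2 (fst k) (snd k) (AAX.L.p (AA.p a b) x)))" .
  next
    fix k assume "k \<in> G \<times> G"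
    then have k: "fst k \<in> G" "snd k \<in> G" by auto
    show "additive AAT X (\<lambda>t. \<phi> (fst k \<cdot> snd k) (proj2 (fst k) (snd k) t))"
      by (rule additive_compose[OF pl[OF k] act_additive[OF \<phi> mult_closed[OF k]]])
  qed
qed

text \<open>The scalar \<open>eps g a\<close> passes through \<phi>_h at the cost of the inverse of
  h, which produces the same coefficient as in \<open>proj2_pure\<close>.\<close>

lemma mor_mor:
  assumes \<phi>: "\<And>g. g \<in> G \<Longrightarrow> \<phi> g \<in> mf_maps n (tw g) X" and t: "t \<in> carrier AAT"
  shows "mor \<phi> (tensor_map n A T A X (\<lambda>a. a) (mor \<phi>) (AAX.assoc t)) =
    (\<Oplus>\<^bsub>X\<^esub>k\<in>G \<times> G. \<phi> (fst k) (\<phi> (snd k) (proj2 (fst k) (snd k) t)))"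
proof -
  interpret M: tensor_pairs n n A T A X ..
  note ml = is_mf_mapD(1)[OF mf_maps_is_mf_map[OF mor_mf_maps[OF \<phi>]]] and il = is_mf_mapD(1)[OF is_mf_map_id]
  have pl: "additive AAT X (proj2 g h)" if "g \<in> G" "h \<in> G" for g h
    using is_linearD(1)[OF is_mf_mapD(1)[OF proj2_mf_map[OF that]]] by simp
  note cl = act_closed[OF \<phi>]
  show ?thesis
  proof (rule AAX.L_eqI[OF X.ab additive_compose[OF mf_maps_additive[OF AAX.assoc_mf_maps]
        additive_compose[OF M.tensor_map_additive[OF il ml] mor_additive[OF \<phi>]]] finsum_additive[OF X.ab] t])
    fix a b x assume abx: "a \<in> carrier A" "b \<in> carrier A" "x \<in> carrier X"
    have "mor \<phi> (tensor_map n A T A X (\<lambda>a. a) (mor \<phi>) (AAX.assoc (AAX.L.p (AA.p a b) x))) =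
        (\<Oplus>\<^bsub>X\<^esub>g\<in>G. \<phi> g (eps g a \<odot>\<^bsub>X\<^esub> (\<Oplus>\<^bsub>X\<^esub>h\<in>G. \<phi> h (eps h b \<odot>\<^bsub>X\<^esub> x))))"
    proof -
      have "(\<Oplus>\<^bsub>X\<^esub>h\<in>G. \<phi> h (eps h b \<odot>\<^bsub>X\<^esub> x)) \<in> carrier X"
        by (rule X.mm.M.finsum_closed) (use abx in \<open>auto intro!: cl\<close>)
      then show ?thesis
        using abx by (simp add: AAX.assoc_pure M.tensor_map_pure[OF il ml] mor_pure[OF \<phi>])
    qed
    also have "\<dots> = (\<Oplus>\<^bsub>X\<^esub>g\<in>G. \<Oplus>\<^bsub>X\<^esub>h\<in>G. \<phi> g (\<phi> h (ginv n h (eps g a) \<odot>\<^bsub>X\<^esub> (eps h b \<odot>\<^bsub>X\<^esub> x))))"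
    proof (rule X.mm.M.finsum_cong')
      fix g assume g: "g \<in> G"
      have "\<phi> g (eps g a \<odot>\<^bsub>X\<^esub> (\<Oplus>\<^bsub>X\<^esub>h\<in>G. \<phi> h (eps h b \<odot>\<^bsub>X\<^esub> x))) =
          (\<Oplus>\<^bsub>X\<^esub>h\<in>G. \<phi> g (eps g a \<odot>\<^bsub>X\<^esub> \<phi> h (eps h b \<odot>\<^bsub>X\<^esub> x)))"
        by (rule additive_finsum[OF X.ab X.ab additive_compose[OF X.smult_additive act_additive[OF \<phi> g]]])
          (use g abx cl in auto)
      also have "\<dots> = (\<Oplus>\<^bsub>X\<^esub>h\<in>G. \<phi> g (\<phi> h (ginv n h (eps g a) \<odot>\<^bsub>X\<^esub> (eps h b \<odot>\<^bsub>X\<^esub> x))))"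
        by (rule X.mm.M.finsum_cong') (use g abx in \<open>auto simp: act_smult[OF \<phi>] intro!: cl\<close>)
      finally show "\<phi> g (eps g a \<odot>\<^bsub>X\<^esub> (\<Oplus>\<^bsub>X\<^esub>h\<in>G. \<phi> h (eps h b \<odot>\<^bsub>X\<^esub> x))) = \<dots>" .
    qed (use abx in \<open>auto intro!: X.mm.M.finsum_closed cl\<close>)
    also have "\<dots> = (\<Oplus>\<^bsub>X\<^esub>k\<in>G \<times> G. \<phi> (fst k) (\<phi> (snd k)
        (ginv n (snd k) (eps (fst k) a) \<odot>\<^bsub>X\<^esub> (eps (snd k) b \<odot>\<^bsub>X\<^esub> x))))"
      by (rule finsum_product[OF X.ab]) (use abx in \<open>auto intro!: cl\<close>)
    also have "\<dots> = (\<Oplus>\<^bsub>X\<^esub>k\<in>G \<times> G. \<phi> (fst k) (\<phi> (snd k) (proj2 (fst k) (snd k) (AAX.L.p (AA.p a b) x))))"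
      by (rule X.mm.M.finsum_cong') (use abx in \<open>auto intro!: cl simp: proj2_pure\<close>)
    finally show "mor \<phi> (tensor_map n A T A X (\<lambda>a. a) (mor \<phi>) (AAX.assoc (AAX.L.p (AA.p a b) x))) = \<dots>" .
  next
    fix k assume "k \<in> G \<times> G"
    then have k: "fst k \<in> G" "snd k \<in> G" by auto
    show "additive AAT X (\<lambda>t. \<phi> (fst k) (\<phi> (snd k) (proj2 (fst k) (snd k) t)))"
      by (rule additive_compose[OF additive_compose[OF pl[OF k] act_additive[OF \<phi> k(2)]] act_additive[OF \<phi> k(1)]])
  qed
qed

text \<open>Both composites are sums of maps factoring through the components g(hX). Evaluation on
  \<open>sec2\<close> isolates one pair, and adding homotopies gives the converse.\<close>

lemma mult_iff:
  assumes \<phi>: "\<And>g. g \<in> G \<Longrightarrow> \<phi> g \<in> mf_maps n (tw g) X"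
  shows "homotopic n AAT X (\<lambda>t. mor \<phi> (mult.tm (AG_mult n W G) (\<lambda>x. x) t))
      (\<lambda>t. mor \<phi> (tensor_map n A T A X (\<lambda>a. a) (mor \<phi>) (AAX.assoc t))) \<longleftrightarrow>
    (\<forall>g\<in>G. \<forall>h\<in>G. homotopic n (tw (g \<cdot> h)) X (\<phi> (g \<cdot> h)) (\<lambda>x. \<phi> g (\<phi> h x)))"
proof -
  let ?tw2 = "\<lambda>g h. twist (ginv n g) (tw h)"
  let ?L = "\<lambda>t. \<Oplus>\<^bsub>X\<^esub>k\<in>G \<times> G. \<phi> (fst k \<cdot> snd k) (proj2 (fst k) (snd k) t)"
  let ?R = "\<lambda>t. \<Oplus>\<^bsub>X\<^esub>k\<in>G \<times> G. \<phi> (fst k) (\<phi> (snd k) (proj2 (fst k) (snd k) t))"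
  have e: "homotopic n AAT X (\<lambda>t. mor \<phi> (mult.tm (AG_mult n W G) (\<lambda>x. x) t))
      (\<lambda>t. mor \<phi> (tensor_map n A T A X (\<lambda>a. a) (mor \<phi>) (AAX.assoc t))) \<longleftrightarrow> homotopic n AAT X ?L ?R"
    by (rule homotopic_cong) (simp_all add: mor_mult[OF \<phi>] mor_mor[OF \<phi>])
  note cl = act_closed[OF \<phi>] and z = act_zero[OF \<phi>]
  have tw2: "premf n (?tw2 g h)" if "g \<in> G" "h \<in> G" for g h
    by (rule premf_twist[OF premf_tw[OF that(2)] ginv_endo[OF G that(1)]])
  have m1: "is_mf_map n (?tw2 g h) X (\<phi> (g \<cdot> h))" if "g \<in> G" "h \<in> G" for g h
    using mf_maps_is_mf_map \<phi>[OF mult_closed[OF that]] by (simp add: twist_ginv_mult[OF that])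
  have m2: "is_mf_map n (?tw2 g h) X (\<lambda>x. \<phi> g (\<phi> h x))" if "g \<in> G" "h \<in> G" for g h
    by (rule is_mf_map_comp[OF mf_maps_is_mf_map mf_maps_is_mf_map[OF \<phi>[OF that(1)]]])
      (use \<phi>[OF that(2)] in \<open>simp add: twist_ginv_both[OF that(1)]\<close>)
  have pm: "is_mf_map n AAT (?tw2 (fst k) (snd k)) (proj2 (fst k) (snd k))" if "k \<in> G \<times> G" for k
    using that by (auto intro: proj2_mf_map)
  have L1: "is_mf_map n AAT X (\<lambda>t. \<phi> (fst k \<cdot> snd k) (proj2 (fst k) (snd k) t))" if "k \<in> G \<times> G" for k
    using that by (intro is_mf_map_comp[OF pm m1]) auto
  have R1: "is_mf_map n AAT X (\<lambda>t. \<phi> (fst k) (\<phi> (snd k) (proj2 (fst k) (snd k) t)))" if "k \<in> G \<times> G" for k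
    using is_mf_map_comp[OF pm[OF that] m2] that by auto
  note LX = is_mf_map_finsum[OF AAX.L.premf_T X.premf_axioms L1]
    and RX = is_mf_map_finsum[OF AAX.L.premf_T X.premf_axioms R1]
  \<comment> \<open>On a section the double sum has one surviving term; the general f allows both
    sides of the law to be evaluated this way.\<close>
  have delta: "(\<Oplus>\<^bsub>X\<^esub>k\<in>G \<times> G. f k (if fst k = g \<and> snd k = h then x else \<zero>\<^bsub>X\<^esub>)) = f (g, h) x"
    if "g \<in> G" "h \<in> G" "x \<in> carrier X" "f (g, h) x \<in> carrier X" "\<And>k. k \<in> G \<times> G \<Longrightarrow> f k \<zero>\<^bsub>X\<^esub> = \<zero>\<^bsub>X\<^esub>" for f g h x
  proof -
    have "(\<Oplus>\<^bsub>X\<^esub>k\<in>G \<times> G. f k (if fst k = g \<and> snd k = h then x else \<zero>\<^bsub>X\<^esub>)) =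
        f (g, h) (if fst (g, h) = g \<and> snd (g, h) = h then x else \<zero>\<^bsub>X\<^esub>)"
    proof (rule finsum_delta[OF X.ab])
      fix k assume "k \<in> G \<times> G" "k \<noteq> (g, h)"
      then show "f k (if fst k = g \<and> snd k = h then x else \<zero>\<^bsub>X\<^esub>) = \<zero>\<^bsub>X\<^esub>"
        using that(5) by (subst if_not_P) (auto simp: prod_eq_iff)
    qed (use that in simp_all)
    then show ?thesis by simp
  qed
  show ?thesis
    unfolding e
  proof (intro iffI ballI)
    fix g h assume ho: "homotopic n AAT X ?L ?R" and g: "g \<in> G" and h: "h \<in> G"
    have "homotopic n (?tw2 g h) X (\<lambda>x. ?L (sec2 g h x)) (\<lambda>x. ?R (sec2 g h x))"
      by (rule homotopic_comp'[OF tw2[OF g h] AAX.L.premf_T X.premf_axioms sec2_mf_map[OF g h]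
          sec2_mf_map[OF g h] LX RX homotopic_refl'[OF tw2[OF g h] AAX.L.premf_T sec2_mf_map[OF g h]] ho])
    moreover have "?L (sec2 g h x) = \<phi> (g \<cdot> h) x" if x: "x \<in> carrier X" for x
    proof -
      have "?L (sec2 g h x) = (\<Oplus>\<^bsub>X\<^esub>k\<in>G \<times> G. \<phi> (fst k \<cdot> snd k) (if fst k = g \<and> snd k = h then x else \<zero>\<^bsub>X\<^esub>))"
        by (rule X.mm.M.finsum_cong') (use g h x in \<open>auto simp: proj2_sec2 z intro!: cl\<close>)
      then show ?thesis using delta[of g h x "\<lambda>k. \<phi> (fst k \<cdot> snd k)"] g h x by (auto simp: z cl)
    qed
    moreover have "?R (sec2 g h x) = \<phi> g (\<phi> h x)" if x: "x \<in> carrier X" for x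
    proof -
      have "?R (sec2 g h x) = (\<Oplus>\<^bsub>X\<^esub>k\<in>G \<times> G. \<phi> (fst k) (\<phi> (snd k) (if fst k = g \<and> snd k = h then x else \<zero>\<^bsub>X\<^esub>)))"
        by (rule X.mm.M.finsum_cong') (use g h x in \<open>auto simp: proj2_sec2 z intro!: cl\<close>)
      then show ?thesis using delta[of g h x "\<lambda>k x. \<phi> (fst k) (\<phi> (snd k) x)"] g h x by (auto simp: z cl)
    qed
    ultimately show "homotopic n (tw (g \<cdot> h)) X (\<phi> (g \<cdot> h)) (\<lambda>x. \<phi> g (\<phi> h x))"
      unfolding twist_ginv_mult[OF g h]
      by (subst (asm) homotopic_cong[of _ _ "\<phi> (g \<cdot> h)" _ "\<lambda>x. \<phi> g (\<phi> h x)"]) simp_all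
  next
    assume ho: "\<forall>g\<in>G. \<forall>h\<in>G. homotopic n (tw (g \<cdot> h)) X (\<phi> (g \<cdot> h)) (\<lambda>x. \<phi> g (\<phi> h x))"
    show "homotopic n AAT X ?L ?R"
    proof (rule homotopic_finsum[OF AAX.L.premf_T X.premf_axioms L1 R1])
      fix k assume k: "k \<in> G \<times> G"
      then have kG: "fst k \<in> G" "snd k \<in> G" by auto
      have h: "homotopic n (?tw2 (fst k) (snd k)) X (\<phi> (fst k \<cdot> snd k)) (\<lambda>x. \<phi> (fst k) (\<phi> (snd k) x))"
        using bspec[OF bspec[OF ho kG(1)] kG(2)] by (simp only: twist_ginv_mult(2)[OF kG])
      show "homotopic n AAT X (\<lambda>t. \<phi> (fst k \<cdot> snd k) (proj2 (fst k) (snd k) t))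
          (\<lambda>t. \<phi> (fst k) (\<phi> (snd k) (proj2 (fst k) (snd k) t)))"
        by (rule homotopic_comp'[OF AAX.L.premf_T tw2[OF kG] X.premf_axioms pm[OF k] pm[OF k] m1[OF kG] m2[OF kG]
          homotopic_refl'[OF AAX.L.premf_T tw2[OF kG] pm[OF k]] h])
    qed
  qed
qed

end

context A_tensor_free
begin

section \<open>Module maps and the module laws in terms of components\<close>

lemma hom_iff:
  assumes X': "A_tensor_free n W G X' B'" and f: "f \<in> mf_maps n X X'"
    and \<phi>: "\<And>g. g \<in> G \<Longrightarrow> \<phi> g \<in> mf_maps n (tw g) X"
    and \<psi>: "\<And>g. g \<in> G \<Longrightarrow> \<psi> g \<in> mf_maps n (twist (ginv n g) X') X'"
  shows "homotopic n T X' (\<lambda>t. f (mor \<phi> t)) (\<lambda>t. A_tensor.mor n W G X' \<psi> (tensor_map n A X A X' (\<lambda>a. a) f t)) \<longleftrightarrow>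
    (\<forall>g\<in>G. homotopic n (tw g) X' (\<lambda>x. f (\<phi> g x)) (\<lambda>x. \<psi> g (f x)))"
proof -
  interpret X': A_tensor_free n W G X' B' by (rule X')
  interpret P: tensor_pairs n n A X A X' ..
  note fm = mf_maps_is_mf_map[OF f]
  note fl = is_mf_mapD(1)[OF fm] and il = is_mf_mapD(1)[OF is_mf_map_id]
  have fc: "f x \<in> carrier X'" if "x \<in> carrier X" for x using mf_maps_closed[OF f that] .
  \<comment> \<open>The projections are natural in X: being linear, f commutes with multiplication
    by an augmentation.\<close>
  have pf: "X'.proj g (P.tm (\<lambda>a. a) f t) = f (proj g t)" if g: "g \<in> G" and t: "t \<in> carrier T" for g t
    by (rule AX.tensor_additive_eqI[OF X'.X.ab additive_compose[OF P.tensor_map_additive[OF il fl] X'.proj_additive[OF g]]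
        additive_compose[OF proj_additive[OF g] is_linearD(1)[OF fl]] t])
      (use g fc mf_maps_smult[OF f] in \<open>simp add: P.tensor_map_pure[OF il fl] X'.proj_pure proj_pure\<close>)
  have tc: "P.tm (\<lambda>a. a) f t \<in> carrier X'.T" if "t \<in> carrier T" for t
    by (rule additive_closed[OF P.tensor_map_additive[OF il fl] that])
  let ?L = "\<lambda>t. \<Oplus>\<^bsub>X'\<^esub>g\<in>G. f (\<phi> g (proj g t))" and ?R = "\<lambda>t. \<Oplus>\<^bsub>X'\<^esub>g\<in>G. \<psi> g (f (proj g t))"
  have R: "X'.mor \<psi> (P.tm (\<lambda>a. a) f t) = ?R t" if "t \<in> carrier T" for t
    using tc[OF that] unfolding X'.mor_def
    by simp (rule X'.X.mm.M.finsum_cong', use that fc in \<open>auto simp: pf X'.act_closed[OF \<psi>]\<close>)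
  have e: "homotopic n T X' (\<lambda>t. f (mor \<phi> t)) (\<lambda>t. X'.mor \<psi> (P.tm (\<lambda>a. a) f t)) \<longleftrightarrow> homotopic n T X' ?L ?R"
    by (rule homotopic_cong) (simp_all add: whisker_act[OF X'.X.premf_axioms \<phi> f] R)
  note pX' = X'.X.premf_axioms
  have l: "is_mf_map n (tw g) X' (\<lambda>x. f (\<phi> g x))" if "g \<in> G" for g
    by (rule is_mf_map_comp[OF mf_maps_is_mf_map[OF \<phi>[OF that]] fm])
  have r: "is_mf_map n (tw g) X' (\<lambda>x. \<psi> g (f x))" if "g \<in> G" for g
    by (rule is_mf_map_comp[OF mf_maps_is_mf_map mf_maps_is_mf_map[OF \<psi>[OF that]]])
      (use f in \<open>simp add: twist_ginv_both[OF that]\<close>)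
  note Lg = is_mf_map_comp[OF proj_mf_map l] and Rg = is_mf_map_comp[OF proj_mf_map r]
  note LX = is_mf_map_finsum[OF AX.premf_T pX' Lg] and RX = is_mf_map_finsum[OF AX.premf_T pX' Rg]
  show ?thesis
    unfolding e
  proof (intro iffI ballI)
    fix g assume ho: "homotopic n T X' ?L ?R" and g: "g \<in> G"
    have sum_sec: "(\<Oplus>\<^bsub>X'\<^esub>h\<in>G. u h (proj h (sec g x))) = u g x"
      if x: "x \<in> carrier X" and u: "\<And>h. h \<in> G \<Longrightarrow> additive X X' (u h)" for u x
      using finsum_delta[OF X'.X.ab, of G g "\<lambda>h. u h (proj h (sec g x))"] g x
      by (simp add: proj_sec additive_closed[OF u] additive_zero[OF X.ab X'.X.ab u])
    have "homotopic n (tw g) X' (\<lambda>x. ?L (sec g x)) (\<lambda>x. ?R (sec g x))"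
      by (rule homotopic_comp'[OF premf_tw[OF g] AX.premf_T pX' sec_mf_map[OF g] sec_mf_map[OF g]
        LX RX homotopic_refl'[OF premf_tw[OF g] AX.premf_T sec_mf_map[OF g]] ho])
    moreover have "?L (sec g x) = f (\<phi> g x)" if "x \<in> carrier X" for x
      by (rule sum_sec[OF that]) (use additive_compose[OF act_additive[OF \<phi>] is_linearD(1)[OF fl]] in auto)
    moreover have "?R (sec g x) = \<psi> g (f x)" if "x \<in> carrier X" for x
      by (rule sum_sec[OF that]) (use additive_compose[OF is_linearD(1)[OF fl] X'.act_additive[OF \<psi>]] in auto)
    ultimately show "homotopic n (tw g) X' (\<lambda>x. f (\<phi> g x)) (\<lambda>x. \<psi> g (f x))"
      by (subst (asm) homotopic_cong[of _ _ "\<lambda>x. f (\<phi> g x)" _ "\<lambda>x. \<psi> g (f x)"]) simp_all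
  next
    assume ho: "\<forall>g\<in>G. homotopic n (tw g) X' (\<lambda>x. f (\<phi> g x)) (\<lambda>x. \<psi> g (f x))"
    show "homotopic n T X' ?L ?R"
    proof (rule homotopic_finsum[OF AX.premf_T pX' Lg Rg])
      fix g assume g: "g \<in> G"
      show "homotopic n T X' (\<lambda>t. f (\<phi> g (proj g t))) (\<lambda>t. \<psi> g (f (proj g t)))"
        by (rule homotopic_comp'[OF AX.premf_T premf_tw[OF g] pX' proj_mf_map[OF g] proj_mf_map[OF g] l[OF g] r[OF g]
          homotopic_refl'[OF AX.premf_T premf_tw[OF g] proj_mf_map[OF g]] bspec[OF ho g]])
    qed
  qed
qed

text \<open>The module laws are equalities of homotopy classes. Written with representatives they
  become the homotopies treated in \<open>mult_iff\<close> and \<open>unit_iff\<close>.\<close>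

lemma module_Ob_iff:
  assumes \<phi>: "\<And>g. g \<in> G \<Longrightarrow> \<phi> g \<in> mf_maps n (tw g) X"
  shows "(X, hclass n T X (mor \<phi>)) \<in> Ob (left_modules n W (AG n W G) \<O>) \<longleftrightarrow> X \<in> \<O> \<and> is_rep X \<phi>"
proof -
  interpret M: tensor_pairs n n A T A X ..
  have m: "mor \<phi> \<in> mf_maps n T X" by (rule mor_mf_maps) (rule \<phi>)
  note pT = AX.premf_T and pX = X.premf_axioms and pL = AAX.L.premf_T and pR = AAX.R.premf_T
  note M1 = mult.tensor_map_mf_maps[OF mf_maps_is_mf_map[OF AG_mult_mf_maps] is_mf_map_id]
  note E1 = eta.tensor_map_mf_maps[OF mf_maps_is_mf_map[OF eta_mf_maps] is_mf_map_id]
  note M2 = M.tensor_map_mf_maps[OF is_mf_map_id mf_maps_is_mf_map[OF m]]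
  note as = AAX.assoc_mf_maps
  have "hcomp n AAT X (hclass n T X (mor \<phi>)) (whisker_right n (tensor n A A) A X (hclass (n + n) (tensor n A A) A (AG_mult n W G))) =
      hclass n AAT X (compose (carrier AAT) (mor \<phi>) (mult.tm (AG_mult n W G) (\<lambda>x. x)))"
    unfolding whisker_right_hclass[OF AA.premf_T premf_A pX AG_mult_mf_maps]
    by (rule hcomp_hclass[OF pL pT pX M1 m])
  moreover have "hcomp n AAT X (hcomp n AAX.R.T X (hclass n T X (mor \<phi>)) (whisker_left n A T X (hclass n T X (mor \<phi>))))
      (hclass n AAT AAX.R.T AAX.assoc) =
      hclass n AAT X (compose (carrier AAT) (compose (carrier AAX.R.T) (mor \<phi>) (M.tm (\<lambda>a. a) (mor \<phi>))) AAX.assoc)"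
    unfolding whisker_left_hclass[OF premf_A pT pX m] hcomp_hclass[OF pR pT pX M2 m]
    by (rule hcomp_hclass[OF pL pR pX as mf_maps_compose[OF pR M2 m]])
  moreover have "hcomp n IX.T X (hclass n T X (mor \<phi>)) (whisker_right n I A X (hclass (n + n) I A eta)) =
      hclass n IX.T X (compose (carrier IX.T) (mor \<phi>) (eta.tm eta (\<lambda>x. x)))"
    unfolding whisker_right_hclass[OF premf_I[OF W] premf_A pX eta_mf_maps]
    by (rule hcomp_hclass[OF IX.premf_T pT pX E1 m])
  moreover have "hclass n AAT X (compose (carrier AAT) (mor \<phi>) (mult.tm (AG_mult n W G) (\<lambda>x. x))) =
      hclass n AAT X (compose (carrier AAT) (compose (carrier AAX.R.T) (mor \<phi>) (M.tm (\<lambda>a. a) (mor \<phi>))) AAX.assoc) \<longleftrightarrow>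
      homotopic n AAT X (\<lambda>t. mor \<phi> (mult.tm (AG_mult n W G) (\<lambda>x. x) t)) (\<lambda>t. mor \<phi> (M.tm (\<lambda>a. a) (mor \<phi>) (AAX.assoc t)))"
    unfolding hclass_eq[OF pL pX mf_maps_compose[OF pL M1 m] mf_maps_compose[OF pL as mf_maps_compose[OF pR M2 m]]]
    by (rule homotopic_cong) (simp_all add: compose_def mf_maps_closed[OF as])
  moreover note mult_iff[of \<phi>] unit_iff[of \<phi>]
  moreover have "hclass n IX.T X (compose (carrier IX.T) (mor \<phi>) (eta.tm eta (\<lambda>x. x))) = hclass n IX.T X (lam n W X) \<longleftrightarrow>
      homotopic n IX.T X (\<lambda>t. mor \<phi> (eta.tm eta (\<lambda>x. x) t)) (lam n W X)"
    unfolding hclass_eq[OF IX.premf_T pX mf_maps_compose[OF IX.premf_T E1 m]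
        is_mf_map_ext[OF lam_X_mf_map IX.premf_T lam_ext[OF pX order_refl W]]]
    by (rule homotopic_cong) (simp_all add: compose_def)
  ultimately show ?thesis
    using \<phi> hHomI[OF m] by (simp add: left_modules_def AG_def Let_def is_rep_def) blast
qed

lemma module_Hom_iff:
  assumes X': "A_tensor_free n W G X' B'" and f: "f \<in> mf_maps n X X'"
    and \<phi>: "\<And>g. g \<in> G \<Longrightarrow> \<phi> g \<in> mf_maps n (tw g) X"
    and \<psi>: "\<And>g. g \<in> G \<Longrightarrow> \<psi> g \<in> mf_maps n (twist (ginv n g) X') X'"
  shows "hclass n X X' f \<in> Hom (left_modules n W (AG n W G) \<O>) (X, hclass n T X (mor \<phi>))
      (X', hclass n (tensor n A X') X' (A_tensor.mor n W G X' \<psi>)) \<longleftrightarrow>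
    (\<forall>g\<in>G. homotopic n (tw g) X' (\<lambda>x. f (\<phi> g x)) (\<lambda>x. \<psi> g (f x)))"
proof -
  interpret X': A_tensor_free n W G X' B' by (rule X')
  interpret P: tensor_pairs n n A X A X' ..
  note pT = AX.premf_T and pX = X.premf_axioms and pX' = X'.X.premf_axioms and pT' = X'.AX.premf_T
  have m: "mor \<phi> \<in> mf_maps n T X" by (rule mor_mf_maps) (rule \<phi>)
  have m': "X'.mor \<psi> \<in> mf_maps n X'.T X'" by (rule X'.mor_mf_maps) (rule \<psi>)
  note tf = P.tensor_map_mf_maps[OF is_mf_map_id mf_maps_is_mf_map[OF f]]
  have "hcomp n T X' (hclass n X X' f) (hclass n T X (mor \<phi>)) = hclass n T X' (compose (carrier T) f (mor \<phi>))"
    by (rule hcomp_hclass[OF pT pX pX' m f])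
  moreover have "hcomp n T X' (hclass n X'.T X' (X'.mor \<psi>)) (whisker_left n A X X' (hclass n X X' f)) =
      hclass n T X' (compose (carrier T) (X'.mor \<psi>) (P.tm (\<lambda>a. a) f))"
    unfolding whisker_left_hclass[OF premf_A pX pX' f] by (rule hcomp_hclass[OF pT pT' pX' tf m'])
  moreover have "hclass n T X' (compose (carrier T) f (mor \<phi>)) = hclass n T X' (compose (carrier T) (X'.mor \<psi>) (P.tm (\<lambda>a. a) f)) \<longleftrightarrow>
      homotopic n T X' (\<lambda>t. f (mor \<phi> t)) (\<lambda>t. X'.mor \<psi> (P.tm (\<lambda>a. a) f t))"
    unfolding hclass_eq[OF pT pX' mf_maps_compose[OF pT m f] mf_maps_compose[OF pT tf m']]
    by (rule homotopic_cong) (simp_all add: compose_def)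
  moreover have "homotopic n T X' (\<lambda>t. f (mor \<phi> t)) (\<lambda>t. X'.mor \<psi> (P.tm (\<lambda>a. a) f t)) \<longleftrightarrow>
      (\<forall>g\<in>G. homotopic n (tw g) X' (\<lambda>x. f (\<phi> g x)) (\<lambda>x. \<psi> g (f x)))"
    by (rule hom_iff[OF X' f]) (rule \<phi>, assumption, rule \<psi>, assumption)
  ultimately show ?thesis
    using hHomI[OF f] by (simp add: left_modules_def AG_def Let_def)
qed

end

section \<open>Equivariant objects\<close>

context symmetric_potential
begin

abbreviation "cls X \<phi> \<equiv> \<lambda>g\<in>G. hclass n (twist (ginv n g) X) X (\<phi> g)"

lemma ginv_inverse:
  assumes "g \<in> G"
  shows "g \<cdot> ginv n g = one\<^sub>G" "ginv n g \<cdot> g = one\<^sub>G"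
  unfolding ginv_def
  using group.r_inv[OF group_BijGroup symmetry_carrier[OF G assms]]
    group.l_inv[OF group_BijGroup symmetry_carrier[OF G assms]] by simp_all

text \<open>The inverse up to homotopy is \<phi> at the inverse of g, since the two laws make both
  composites homotopic to \<phi>_e and hence to the identity.\<close>

lemma rep_hiso:
  assumes X: "premf n X" and r: "is_rep X \<phi>" and g: "g \<in> G"
  shows "hiso n (twist (ginv n g) X) X (hclass n (twist (ginv n g) X) X (\<phi> g))"
proof -
  let ?tw = "\<lambda>g. twist (ginv n g) X"
  have \<phi>: "\<And>g. g \<in> G \<Longrightarrow> \<phi> g \<in> mf_maps n (?tw g) X"
    and e: "homotopic n X X (\<phi> one\<^sub>G) (\<lambda>x. x)"
    and m: "\<And>g h. g \<in> G \<Longrightarrow> h \<in> G \<Longrightarrow> homotopic n (?tw (g \<cdot> h)) X (\<phi> (g \<cdot> h)) (\<lambda>x. \<phi> g (\<phi> h x))"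
    using r by (auto simp: is_rep_def)
  let ?h = "ginv n g"
  have h: "?h \<in> G" using g by simp
  have pt: "premf n (?tw g)" by (rule premf_twist[OF X ginv_endo[OF G g]])
  \<comment> \<open>As far as maps can see, X is the twist by g of its twist by the inverse of g.
    Thus \<phi> at the inverse of g, twisted by g, is a map from X to gX.\<close>
  have t1: "mf_maps n X Y = mf_maps n (twist (ginv n g) (?tw ?h)) Y" for Y :: "('k mpoly, 'b) mf"
    using twist_ginv_mult(1)[OF g h] twist_ginv_one(1) by (metis ginv_inverse(1)[OF g])
  have b: "\<phi> ?h \<in> mf_maps n X (?tw g)"
    using \<phi>[OF h] by (simp only: t1 twist_ginv_both(1)[OF g])
  have pe: "is_mf_map n X X (\<phi> one\<^sub>G)" using mf_maps_is_mf_map[OF \<phi>[OF one_closed]] \<phi>[OF one_closed]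
    by (simp add: twist_ginv_one mf_maps_is_mf_map)
  have gh: "is_mf_map n X X (\<lambda>x. \<phi> g (\<phi> ?h x))"
    by (rule is_mf_map_comp[OF mf_maps_is_mf_map[OF b] mf_maps_is_mf_map[OF \<phi>[OF g]]])
  have hg: "is_mf_map n X X (\<lambda>x. \<phi> ?h (\<phi> g x))"
    using is_mf_map_restrict[OF is_mf_map_comp[OF mf_maps_is_mf_map[OF \<phi>[OF g]] mf_maps_is_mf_map[OF b]] pt]
      is_mf_map_cong[OF X, of "restrict (\<lambda>x. \<phi> ?h (\<phi> g x)) (carrier X)" "\<lambda>x. \<phi> ?h (\<phi> g x)" X]
    by (simp add: twist_ginv_both[OF g] mf_maps_is_mf_map)
  have "homotopic n X X (\<lambda>x. \<phi> g (\<phi> ?h x)) (\<lambda>x. x)"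
    using homotopic_trans'[OF X X gh pe is_mf_map_id homotopic_sym'[OF X X pe gh] e] m[OF g h]
    by (simp add: ginv_inverse[OF g] twist_ginv_one)
  moreover have "homotopic n X X (\<lambda>x. \<phi> ?h (\<phi> g x)) (\<lambda>x. x)"
    using homotopic_trans'[OF X X hg pe is_mf_map_id homotopic_sym'[OF X X pe hg] e] m[OF h g]
    by (simp add: ginv_inverse[OF g] twist_ginv_one)
  ultimately show ?thesis
    by (intro hisoI[OF pt X \<phi>[OF g] b])
      (simp_all add: compose_def twist_ginv_both[OF g])
qed

lemma equivariant_Ob_iff:
  assumes X: "premf n X" and \<phi>: "\<And>g. g \<in> G \<Longrightarrow> \<phi> g \<in> mf_maps n (twist (ginv n g) X) X"
  shows "(X, cls X \<phi>) \<in> Ob (equivariant n G \<O>) \<longleftrightarrow> X \<in> \<O> \<and> is_rep X \<phi>"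
proof -
  let ?tw = "\<lambda>g. twist (ginv n g) X"
  have pt: "premf n (?tw g)" if "g \<in> G" for g by (rule premf_twist[OF X ginv_endo[OF G that]])
  have e: "cls X \<phi> one\<^sub>G = hid n X \<longleftrightarrow> homotopic n X X (\<phi> one\<^sub>G) (\<lambda>x. x)"
    using \<phi>[OF one_closed] by (simp add: twist_ginv_one hid_def hclass_eq[OF X X] mf_maps_id[OF X])
  have m: "cls X \<phi> (g \<cdot> h) = hcomp n (?tw (g \<cdot> h)) X (cls X \<phi> g) (cls X \<phi> h) \<longleftrightarrow>
      homotopic n (?tw (g \<cdot> h)) X (\<phi> (g \<cdot> h)) (\<lambda>x. \<phi> g (\<phi> h x))" if g: "g \<in> G" and h: "h \<in> G" for g h
  proof -
    \<comment> \<open>The composite has to be formed on the iterated twist, where the class of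
      \<phi>_h is a map g(hX) \<rightarrow> gX; the classes out of it agree with those out of the
      twist by gh.\<close>
    let ?t = "twist (ginv n g) (?tw h)"
    have p2: "premf n ?t" by (rule premf_twist[OF pt[OF h] ginv_endo[OF G g]])
    have hh: "\<phi> h \<in> mf_maps n ?t (?tw g)" using \<phi>[OF h] by (simp add: twist_ginv_both[OF g])
    have gh: "\<phi> (g \<cdot> h) \<in> mf_maps n ?t X" using \<phi>[OF mult_closed[OF g h]] by (simp add: twist_ginv_mult[OF g h])
    have "hcomp n (?tw (g \<cdot> h)) X (cls X \<phi> g) (cls X \<phi> h) =
        hcomp n ?t X (hclass n (?tw g) X (\<phi> g)) (hclass n ?t (?tw g) (\<phi> h))"
      using g h by (simp add: hcomp_def twist_ginv_mult(3)[OF g h] twist_ginv_both(3)[OF g])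
    also have "\<dots> = hclass n ?t X (compose (carrier ?t) (\<phi> g) (\<phi> h))"
      by (rule hcomp_hclass[OF p2 pt[OF g] X hh \<phi>[OF g]])
    finally have "cls X \<phi> (g \<cdot> h) = hcomp n (?tw (g \<cdot> h)) X (cls X \<phi> g) (cls X \<phi> h) \<longleftrightarrow>
        homotopic n ?t X (\<phi> (g \<cdot> h)) (compose (carrier ?t) (\<phi> g) (\<phi> h))"
      using hclass_eq[OF p2 X gh mf_maps_compose[OF p2 hh \<phi>[OF g]]] g h
      by (simp add: twist_ginv_mult(3)[OF g h])
    then show ?thesis by (simp add: compose_def twist_ginv_mult(2)[OF g h] homotopic_def)
  qed
  show ?thesis
    unfolding equivariant_def Let_def using rep_hiso[OF X] \<phi> e m
    by (auto simp: is_rep_def)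
qed

lemma equivariant_Hom_iff:
  assumes X: "premf n X" and Y: "premf n Y"
    and \<phi>: "\<And>g. g \<in> G \<Longrightarrow> \<phi> g \<in> mf_maps n (twist (ginv n g) X) X"
    and \<psi>: "\<And>g. g \<in> G \<Longrightarrow> \<psi> g \<in> mf_maps n (twist (ginv n g) Y) Y"
    and f: "f \<in> mf_maps n X Y"
  shows "hclass n X Y f \<in> Hom (equivariant n G \<O>) (X, cls X \<phi>) (Y, cls Y \<psi>) \<longleftrightarrow>
    (\<forall>g\<in>G. homotopic n (twist (ginv n g) X) Y (\<lambda>x. f (\<phi> g x)) (\<lambda>x. \<psi> g (f x)))"
proof -
  let ?tX = "\<lambda>g. twist (ginv n g) X" and ?tY = "\<lambda>g. twist (ginv n g) Y"
  have "hcomp n (?tX g) Y (hclass n X Y f) (cls X \<phi> g) = hcomp n (?tX g) Y (cls Y \<psi> g) (hclass n X Y f) \<longleftrightarrow>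
      homotopic n (?tX g) Y (\<lambda>x. f (\<phi> g x)) (\<lambda>x. \<psi> g (f x))" if g: "g \<in> G" for g
  proof -
    have ptX: "premf n (?tX g)" and ptY: "premf n (?tY g)" by (rule premf_twist[OF _ ginv_endo[OF G g]]; fact)+
    have ft: "f \<in> mf_maps n (?tX g) (?tY g)" using f by (simp add: twist_ginv_both[OF g])
    have "hcomp n (?tX g) Y (hclass n X Y f) (cls X \<phi> g) = hclass n (?tX g) Y (compose (carrier (?tX g)) f (\<phi> g))"
      using hcomp_hclass[OF ptX X Y \<phi>[OF g] f] g by simp
    moreover have "hcomp n (?tX g) Y (cls Y \<psi> g) (hclass n X Y f) = hclass n (?tX g) Y (compose (carrier (?tX g)) (\<psi> g) f)"
      using hcomp_hclass[OF ptX ptY Y ft \<psi>[OF g]] g by (simp add: twist_ginv_both[OF g])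
    ultimately show ?thesis
      using hclass_eq[OF ptX Y mf_maps_compose[OF ptX \<phi>[OF g] f] mf_maps_compose[OF ptX ft \<psi>[OF g]]]
      by (simp add: compose_def homotopic_def)
  qed
  then show ?thesis using hHomI[OF f] by (simp add: equivariant_def Let_def)
qed

text \<open>Each structure map is a nonempty class, and any of its members generates it again; so
  one may pass to representatives and back.\<close>

lemma equivariant_rep:
  assumes X: "premf n X" and ob: "(X, \<alpha>) \<in> Ob (equivariant n G \<O>)"
  shows "\<And>g. g \<in> G \<Longrightarrow> (SOME f. f \<in> \<alpha> g) \<in> mf_maps n (twist (ginv n g) X) X"
    and "\<alpha> = cls X (\<lambda>g. SOME f. f \<in> \<alpha> g)"
proof -
  have ext: "\<alpha> \<in> extensional G" and ho: "\<And>g. g \<in> G \<Longrightarrow> \<alpha> g \<in> hHom n (twist (ginv n g) X) X"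
    using ob by (auto simp: equivariant_def Let_def hiso_def)
  have *: "(SOME f. f \<in> \<alpha> g) \<in> mf_maps n (twist (ginv n g) X) X \<and>
      \<alpha> g = hclass n (twist (ginv n g) X) X (SOME f. f \<in> \<alpha> g)" if g: "g \<in> G" for g
  proof -
    have pt: "premf n (twist (ginv n g) X)" by (rule premf_twist[OF X ginv_endo[OF G g]])
    obtain f where f: "f \<in> mf_maps n (twist (ginv n g) X) X" "\<alpha> g = hclass n (twist (ginv n g) X) X f"
      using ho[OF g] by (rule hHomE)
    define s where "s = (SOME f. f \<in> \<alpha> g)"
    have "f \<in> \<alpha> g" using hclass_self[OF pt X f(1)] f(2) by simp
    then have "s \<in> \<alpha> g" unfolding s_def by (rule someI[of "\<lambda>f. f \<in> \<alpha> g"])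
    then have "s \<in> mf_maps n (twist (ginv n g) X) X" "homotopic n (twist (ginv n g) X) X f s"
      unfolding f(2) by (simp_all add: hclass_def)
    then show ?thesis
      unfolding s_def[symmetric] using hclass_eq[OF pt X f(1), of s] f(2) by simp
  qed
  then show "\<And>g. g \<in> G \<Longrightarrow> (SOME f. f \<in> \<alpha> g) \<in> mf_maps n (twist (ginv n g) X) X" by blast
  show "\<alpha> = cls X (\<lambda>g. SOME f. f \<in> \<alpha> g)"
    by (rule extensionalityI[OF ext]) (use * in auto)
qed

end

section \<open>Equivalences of categories\<close>

lemma is_categoryD:
  assumes "is_category C"
  shows "x \<in> Ob C \<Longrightarrow> Idt C x \<in> Hom C x x"
    and "x \<in> Ob C \<Longrightarrow> y \<in> Ob C \<Longrightarrow> z \<in> Ob C \<Longrightarrow> f \<in> Hom C x y \<Longrightarrow> g \<in> Hom C y z \<Longrightarrow>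
      Cmp C x y z g f \<in> Hom C x z"
    and "x \<in> Ob C \<Longrightarrow> y \<in> Ob C \<Longrightarrow> f \<in> Hom C x y \<Longrightarrow> Cmp C x x y f (Idt C x) = f"
    and "x \<in> Ob C \<Longrightarrow> y \<in> Ob C \<Longrightarrow> f \<in> Hom C x y \<Longrightarrow> Cmp C x y y (Idt C y) f = f"
    and "w \<in> Ob C \<Longrightarrow> x \<in> Ob C \<Longrightarrow> y \<in> Ob C \<Longrightarrow> z \<in> Ob C \<Longrightarrow> f \<in> Hom C w x \<Longrightarrow> g \<in> Hom C x y \<Longrightarrow>
      h \<in> Hom C y z \<Longrightarrow> Cmp C w y z h (Cmp C w x y g f) = Cmp C w x z (Cmp C x y z h g) f"
  using assms unfolding is_category_def by blast+

text \<open>Lets the category laws for modules be inherited from the equivariant category along a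
  surjection on objects, Hom sets and operations being literally equal.\<close>

lemma is_category_transfer:
  assumes C: "is_category C" and f: "f ` Ob C = Ob D"
    and hom: "\<And>x y. x \<in> Ob C \<Longrightarrow> y \<in> Ob C \<Longrightarrow> Hom D (f x) (f y) = Hom C x y"
    and idt: "\<And>x. x \<in> Ob C \<Longrightarrow> Idt D (f x) = Idt C x"
    and cmp: "\<And>x y z. x \<in> Ob C \<Longrightarrow> y \<in> Ob C \<Longrightarrow> z \<in> Ob C \<Longrightarrow> Cmp D (f x) (f y) (f z) = Cmp C x y z"
  shows "is_category D"
  unfolding is_category_def f[symmetric] ball_simps
  using is_categoryD[OF C] by (simp add: hom idt cmp)

text \<open>The functor is f on objects and the identity on Hom sets, so full faithfulness is built
  into the hypotheses; a quasi-inverse needs only the choice of an isomorphism for each object of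
  D.\<close>

lemma equivalent_categoriesI:
  assumes C: "is_category C" and D: "is_category D" and f: "\<And>x. x \<in> Ob C \<Longrightarrow> f x \<in> Ob D"
    and hom: "\<And>x y. x \<in> Ob C \<Longrightarrow> y \<in> Ob C \<Longrightarrow> Hom D (f x) (f y) = Hom C x y"
    and idt: "\<And>x. x \<in> Ob C \<Longrightarrow> Idt D (f x) = Idt C x"
    and cmp: "\<And>x y z. x \<in> Ob C \<Longrightarrow> y \<in> Ob C \<Longrightarrow> z \<in> Ob C \<Longrightarrow> Cmp D (f x) (f y) (f z) = Cmp C x y z"
    and surj: "\<And>y. y \<in> Ob D \<Longrightarrow> \<exists>x\<in>Ob C. \<exists>t. iso_in D (f x) y t"
  shows "equivalent_categories C D"
proof -
  have "\<forall>y\<in>Ob D. \<exists>x t s. x \<in> Ob C \<and> t \<in> Hom D (f x) y \<and> s \<in> Hom D y (f x) \<and>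
      Cmp D (f x) y (f x) s t = Idt D (f x) \<and> Cmp D y (f x) y t s = Idt D y"
    using surj unfolding iso_in_def by blast
  then obtain h t s where h: "\<And>y. y \<in> Ob D \<Longrightarrow> h y \<in> Ob C"
    and t: "\<And>y. y \<in> Ob D \<Longrightarrow> t y \<in> Hom D (f (h y)) y"
    and s: "\<And>y. y \<in> Ob D \<Longrightarrow> s y \<in> Hom D y (f (h y))"
    and st: "\<And>y. y \<in> Ob D \<Longrightarrow> Cmp D (f (h y)) y (f (h y)) (s y) (t y) = Idt D (f (h y))"
    and ts: "\<And>y. y \<in> Ob D \<Longrightarrow> Cmp D y (f (h y)) y (t y) (s y) = Idt D y"
    by metis
  note fh = f[OF h]
  note Dcomp = is_categoryD(2)[OF D] and Didr = is_categoryD(3)[OF D] and Didl = is_categoryD(4)[OF D]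
    and Dassoc = is_categoryD(5)[OF D]
  \<comment> \<open>Conjugation by the chosen isomorphisms. By \<open>k_unique\<close> it is
    determined by the square t' k = g t, from which functoriality follows.\<close>
  define k where "k y y' g = Cmp D (f (h y)) y' (f (h y')) (s y') (Cmp D (f (h y)) y y' g (t y))" for y y' g
  have gt: "Cmp D (f (h y)) y y' g (t y) \<in> Hom D (f (h y)) y'"
    if "y \<in> Ob D" "y' \<in> Ob D" "g \<in> Hom D y y'" for y y' g
    using that by (intro Dcomp fh t)
  have k: "k y y' g \<in> Hom D (f (h y)) (f (h y'))" if "y \<in> Ob D" "y' \<in> Ob D" "g \<in> Hom D y y'" for y y' g
    unfolding k_def using that by (intro Dcomp[of _ y'] fh gt s)
  have tk: "Cmp D (f (h y)) (f (h y')) y' (t y') (k y y' g) = Cmp D (f (h y)) y y' g (t y)"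
    if y: "y \<in> Ob D" and y': "y' \<in> Ob D" and g: "g \<in> Hom D y y'" for y y' g
  proof -
    have "Cmp D (f (h y)) (f (h y')) y' (t y') (k y y' g) =
        Cmp D (f (h y)) y' y' (Cmp D y' (f (h y')) y' (t y') (s y')) (Cmp D (f (h y)) y y' g (t y))"
      unfolding k_def by (rule Dassoc[OF fh[OF y] y' fh[OF y'] y' gt[OF y y' g] s[OF y'] t[OF y']])
    then show ?thesis using Didl[OF fh[OF y] y' gt[OF y y' g]] by (simp add: ts[OF y'])
  qed
  have k_unique: "u = k y y' g"
    if y: "y \<in> Ob D" and y': "y' \<in> Ob D" and u: "u \<in> Hom D (f (h y)) (f (h y'))"
      and e: "Cmp D (f (h y)) (f (h y')) y' (t y') u = Cmp D (f (h y)) y y' g (t y)" for u y y' g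
  proof -
    have "u = Cmp D (f (h y)) (f (h y')) (f (h y')) (Cmp D (f (h y')) y' (f (h y')) (s y') (t y')) u"
      using Didl[OF fh[OF y] fh[OF y'] u] by (simp add: st[OF y'])
    also have "\<dots> = Cmp D (f (h y)) y' (f (h y')) (s y') (Cmp D (f (h y)) (f (h y')) y' (t y') u)"
      by (rule Dassoc[OF fh[OF y] fh[OF y'] y' fh[OF y'] u t[OF y'] s[OF y'], symmetric])
    finally show ?thesis by (simp add: e k_def)
  qed
  have "is_functor C D (f, \<lambda>x y g. g)"
    by (simp add: is_functor_def f hom idt cmp)
  moreover have "is_functor D C (h, k)"
    unfolding is_functor_def fst_conv snd_conv
  proof (intro conjI ballI)
    fix y assume y: "y \<in> Ob D"
    have "Idt D (f (h y)) = k y y (Idt D y)"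
      by (rule k_unique[OF y y is_categoryD(1)[OF D fh[OF y]]])
        (simp add: Didr[OF fh[OF y] y t[OF y]] Didl[OF fh[OF y] y t[OF y]])
    then show "k y y (Idt D y) = Idt C (h y)" using idt[OF h[OF y]] by simp
  next
    fix x y z u v assume x: "x \<in> Ob D" and y: "y \<in> Ob D" and z: "z \<in> Ob D"
      and u: "u \<in> Hom D x y" and v: "v \<in> Hom D y z"
    note fx = fh[OF x] and fy = fh[OF y] and fz = fh[OF z] and ku = k[OF x y u] and kv = k[OF y z v]
    have "Cmp D (f (h x)) (f (h z)) z (t z) (Cmp D (f (h x)) (f (h y)) (f (h z)) (k y z v) (k x y u)) =
        Cmp D (f (h x)) (f (h y)) z (Cmp D (f (h y)) (f (h z)) z (t z) (k y z v)) (k x y u)"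
      by (rule Dassoc[OF fx fy fz z ku kv t[OF z]])
    also have "\<dots> = Cmp D (f (h x)) y z v (Cmp D (f (h x)) (f (h y)) y (t y) (k x y u))"
      unfolding tk[OF y z v] by (rule Dassoc[OF fx fy y z ku t[OF y] v, symmetric])
    also have "\<dots> = Cmp D (f (h x)) x z (Cmp D x y z v u) (t x)"
      unfolding tk[OF x y u] by (rule Dassoc[OF fx x y z t[OF x] u v])
    finally have "Cmp D (f (h x)) (f (h y)) (f (h z)) (k y z v) (k x y u) = k x z (Cmp D x y z v u)"
      by (rule k_unique[OF x z Dcomp[OF fx fy fz ku kv]])
    then show "k x z (Cmp D x y z v u) = Cmp C (h x) (h y) (h z) (k y z v) (k x y u)"
      by (simp add: cmp h x y z)
  qed (use h k hom[OF h h] in simp_all)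
  moreover have "naturally_isomorphic C C (functor_comp (h, k) (f, \<lambda>x y g. g)) functor_id"
    unfolding naturally_isomorphic_def functor_comp_def functor_id_def fst_conv snd_conv
  proof (intro exI[of _ "\<lambda>x. t (f x)"] conjI ballI)
    fix x assume x: "x \<in> Ob C"
    then have hx: "h (f x) \<in> Ob C" and fx: "f x \<in> Ob D" by (simp_all add: h f)
    show "iso_in C (h (f x)) x (t (f x))"
      unfolding iso_in_def
      using t[OF fx] s[OF fx] st[OF fx] ts[OF fx] x hx by (auto simp: hom idt cmp)
    fix y u assume y: "y \<in> Ob C" and u: "u \<in> Hom C x y"
    then have "u \<in> Hom D (f x) (f y)" and hy: "h (f y) \<in> Ob C" using x by (simp_all add: hom h f)
    then show "Cmp C (h (f x)) (h (f y)) y (t (f y)) (k (f x) (f y) u) = Cmp C (h (f x)) x y u (t (f x))"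
      using tk[OF fx f[OF y]] x y hx by (simp add: cmp[symmetric])
  qed
  moreover have "naturally_isomorphic D D (functor_comp (f, \<lambda>x y g. g) (h, k)) functor_id"
    unfolding naturally_isomorphic_def functor_comp_def functor_id_def fst_conv snd_conv
  proof (intro exI[of _ t] conjI ballI)
    fix y assume y: "y \<in> Ob D"
    show "iso_in D (f (h y)) y (t y)"
      unfolding iso_in_def using t[OF y] s[OF y] st[OF y] ts[OF y] by blast
    fix z u assume "z \<in> Ob D" "u \<in> Hom D y z"
    then show "Cmp D (f (h y)) (f (h z)) z (t z) (k y z u) = Cmp D (f (h y)) y z u (t y)"
      by (rule tk[OF y])
  qed
  ultimately show ?thesis unfolding equivalent_categories_def using C D by blast
qed

section \<open>The equivalence\<close>

lemma HMF_premf: "X \<in> HMF n W \<Longrightarrow> premf n X"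
  by (simp add: HMF_def premf_def)

context symmetric_potential
begin

lemma HMF_free: assumes X: "X \<in> HMF n W" shows "\<exists>B. A_tensor_free n W G X B"
proof -
  obtain B where "homogeneous_basis n X B" using X by (auto simp: HMF_def)
  then have "A_tensor_free n W G X B"
    using X HMF_premf[OF X]
    by (intro A_tensor_free.intro A_tensor.intro free_premf.intro free_premf_axioms.intro
        A_tensor_free_axioms.intro symmetric_potential_axioms) (auto simp: HMF_def)
  then show ?thesis ..
qed

text \<open>Representatives of the structure maps are chosen arbitrarily; by
  \<open>mor_homotopic\<close> the class of the resulting action does not depend on the
  choice.\<close>

definition to_module where
  "to_module x = (fst x, hclass n (tensor n A (fst x)) (fst x) (A_tensor.mor n W G (fst x) (\<lambda>g. SOME f. f \<in> snd x g)))"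

context
  fixes \<O> :: "('k mpoly, 'x) mf set"
  assumes \<O>: "\<O> \<subseteq> HMF n W"
begin

abbreviation "EQ \<equiv> equivariant n G \<O>"
abbreviation "MOD \<equiv> left_modules n W (AG n W G) \<O>"

lemma EQ_carrier: "x \<in> Ob EQ \<Longrightarrow> fst x \<in> \<O>"
  by (auto simp: equivariant_def Let_def)

lemma EQ_premf: "x \<in> Ob EQ \<Longrightarrow> premf n (fst x)"
  using EQ_carrier \<O> HMF_premf by blast

lemma EQ_rep:
  assumes "x \<in> Ob EQ"
  shows "\<And>g. g \<in> G \<Longrightarrow> (SOME f. f \<in> snd x g) \<in> mf_maps n (twist (ginv n g) (fst x)) (fst x)"
    and "snd x = cls (fst x) (\<lambda>g. SOME f. f \<in> snd x g)"
    and "is_rep (fst x) (\<lambda>g. SOME f. f \<in> snd x g)"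
proof -
  have ob: "(fst x, snd x) \<in> Ob EQ" using assms by simp
  note p = EQ_premf[OF assms]
  show m: "\<And>g. g \<in> G \<Longrightarrow> (SOME f. f \<in> snd x g) \<in> mf_maps n (twist (ginv n g) (fst x)) (fst x)"
    by (rule equivariant_rep(1)[OF p ob])
  show e: "snd x = cls (fst x) (\<lambda>g. SOME f. f \<in> snd x g)" by (rule equivariant_rep(2)[OF p ob])
  have "(fst x, cls (fst x) (\<lambda>g. SOME f. f \<in> snd x g)) \<in> Ob EQ" using ob e by simp
  then show "is_rep (fst x) (\<lambda>g. SOME f. f \<in> snd x g)"
    using equivariant_Ob_iff[OF p, of "\<lambda>g. SOME f. f \<in> snd x g" \<O>] m by simp
qed

lemma to_module_Ob: assumes x: "x \<in> Ob EQ" shows "to_module x \<in> Ob MOD"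
proof -
  obtain B where "A_tensor_free n W G (fst x) B" using HMF_free EQ_carrier[OF x] \<O> by blast
  then show ?thesis
    unfolding to_module_def using EQ_rep[OF x] EQ_carrier[OF x]
    by (subst A_tensor_free.module_Ob_iff) auto
qed

text \<open>Both Hom sets consist of classes X \<rightarrow> Y subject to a condition, and both
  conditions unfold to homotopies between f \<phi>_g and \<psi>_g f.\<close>

lemma to_module_Hom:
  assumes x: "x \<in> Ob EQ" and y: "y \<in> Ob EQ"
  shows "Hom MOD (to_module x) (to_module y) = Hom EQ x y"
proof -
  let ?\<phi> = "\<lambda>x g. SOME f. f \<in> snd x g"
  obtain B where B: "A_tensor_free n W G (fst x) B" using HMF_free EQ_carrier[OF x] \<O> by blast
  obtain B' where B': "A_tensor_free n W G (fst y) B'" using HMF_free EQ_carrier[OF y] \<O> by blast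
  have sub: "Hom MOD (X, \<rho>) (Y, \<sigma>) \<subseteq> hHom n X Y" "Hom EQ (X, \<alpha>) (Y, \<beta>) \<subseteq> hHom n X Y" for X Y \<rho> \<sigma> \<alpha> \<beta>
    by (auto simp: left_modules_def equivariant_def Let_def)
  have "hclass n (fst x) (fst y) f \<in> Hom MOD (to_module x) (to_module y) \<longleftrightarrow>
      hclass n (fst x) (fst y) f \<in> Hom EQ x y" if f: "f \<in> mf_maps n (fst x) (fst y)" for f
  proof -
    have "hclass n (fst x) (fst y) f \<in> Hom MOD (to_module x) (to_module y) \<longleftrightarrow>
      (\<forall>g\<in>G. homotopic n (twist (ginv n g) (fst x)) (fst y) (\<lambda>m. f (?\<phi> x g m)) (\<lambda>m. ?\<phi> y g (f m)))"
      unfolding to_module_def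
      by (rule A_tensor_free.module_Hom_iff[OF B B' f EQ_rep(1)[OF x] EQ_rep(1)[OF y]])
    moreover have "hclass n (fst x) (fst y) f \<in> Hom EQ (fst x, cls (fst x) (?\<phi> x)) (fst y, cls (fst y) (?\<phi> y)) \<longleftrightarrow>
      (\<forall>g\<in>G. homotopic n (twist (ginv n g) (fst x)) (fst y) (\<lambda>m. f (?\<phi> x g m)) (\<lambda>m. ?\<phi> y g (f m)))"
      by (rule equivariant_Hom_iff[OF EQ_premf[OF x] EQ_premf[OF y] EQ_rep(1)[OF x] EQ_rep(1)[OF y] f])
    moreover have "(fst x, cls (fst x) (?\<phi> x)) = x" "(fst y, cls (fst y) (?\<phi> y)) = y"
      unfolding EQ_rep(2)[OF x, symmetric] EQ_rep(2)[OF y, symmetric] by simp_all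
    ultimately show ?thesis by simp
  qed
  moreover have "Hom MOD (to_module x) (to_module y) \<subseteq> hHom n (fst x) (fst y)" "Hom EQ x y \<subseteq> hHom n (fst x) (fst y)"
    using sub(1) sub(2)[of "fst x" "snd x" "fst y" "snd y"] by (simp_all add: to_module_def)
  ultimately show ?thesis by (auto simp: hHom_def)
qed

lemma to_module_surj: assumes y: "y \<in> Ob MOD" shows "\<exists>x\<in>Ob EQ. to_module x = y"
proof -
  obtain X \<rho> where y_eq: "y = (X, \<rho>)" by (cases y)
  have X: "X \<in> \<O>" and \<rho>: "\<rho> \<in> hHom n (tensor n A X) X"
    using y by (auto simp: y_eq left_modules_def AG_def Let_def)
  obtain B where "A_tensor_free n W G X B" using HMF_free X \<O> by blast
  then interpret A_tensor_free n W G X B .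
  note pT = AX.premf_T and pX = X.premf_axioms
  obtain r where r: "r \<in> mf_maps n T X" "\<rho> = hclass n T X r" using \<rho> by (rule hHomE)
  obtain \<phi> where \<phi>: "\<And>g. g \<in> G \<Longrightarrow> \<phi> g \<in> mf_maps n (tw g) X" and ho: "homotopic n T X (mor \<phi>) r"
    using exists_mor[OF r(1)] by blast
  have m: "mor \<phi> \<in> mf_maps n T X" by (rule mor_mf_maps) (rule \<phi>)
  have \<rho>_eq: "\<rho> = hclass n T X (mor \<phi>)" using hclass_eq[OF pT pX m r(1)] ho r(2) by simp
  have "is_rep X \<phi>" using y module_Ob_iff[of \<phi>] \<phi> by (simp add: y_eq \<rho>_eq)
  then have ob: "(X, cls X \<phi>) \<in> Ob EQ" using equivariant_Ob_iff[OF pX, of \<phi>] \<phi> X by simp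
  \<comment> \<open>\<open>to_module\<close> selects its own representatives, which can differ from
    \<phi>; they are homotopic to it, hence define the same action.\<close>
  let ?\<psi> = "\<lambda>g. SOME f. f \<in> cls X \<phi> g"
  have \<psi>: "?\<psi> g \<in> mf_maps n (tw g) X" if "g \<in> G" for g using EQ_rep(1)[OF ob that] by simp
  have "homotopic n (tw g) X (\<phi> g) (?\<psi> g)" if g: "g \<in> G" for g
  proof -
    have "cls X \<phi> g = cls X ?\<psi> g" using EQ_rep(2)[OF ob] by (metis fst_conv snd_conv)
    then have "hclass n (tw g) X (\<phi> g) = hclass n (tw g) X (?\<psi> g)" using g by simp
    then show ?thesis using hclass_eq[OF premf_tw[OF g] pX \<phi>[OF g] \<psi>[OF g]] by simp
  qed
  then have "homotopic n T X (mor \<phi>) (mor ?\<psi>)" using mor_homotopic_iff[of \<phi> ?\<psi>] \<phi> \<psi> by blast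
  moreover have "mor ?\<psi> \<in> mf_maps n T X" by (rule mor_mf_maps) (rule \<psi>)
  ultimately have "hclass n T X (mor ?\<psi>) = hclass n T X (mor \<phi>)" using hclass_eq[OF pT pX m] by blast
  then have "to_module (X, cls X \<phi>) = y" unfolding to_module_def y_eq \<rho>_eq fst_conv snd_conv by simp
  with ob show ?thesis by blast
qed

lemma to_module_Idt: "Idt MOD (to_module x) = Idt EQ x"
  by (simp add: left_modules_def equivariant_def Let_def to_module_def split_def)

lemma to_module_Cmp: "Cmp MOD (to_module x) (to_module y) (to_module z) = Cmp EQ x y z"
  by (simp add: left_modules_def equivariant_def Let_def to_module_def split_def fun_eq_iff)

lemma EQ_category: "is_category EQ"
proof -
  have idt: "Idt EQ x = hid n (fst x)" and cmp: "Cmp EQ x y z = (\<lambda>v u. hcomp n (fst x) (fst z) v u)" for x y z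
    by (auto simp: equivariant_def Let_def split_def fun_eq_iff)
  have hom: "u \<in> Hom EQ x y \<longleftrightarrow> u \<in> hHom n (fst x) (fst y) \<and> (\<forall>g\<in>G. hcomp n (twist (ginv n g) (fst x)) (fst y) u (snd x g) =
      hcomp n (twist (ginv n g) (fst x)) (fst y) (snd y g) u)" for x y u
    by (auto simp: equivariant_def Let_def split_def)
  have act: "snd x g \<in> hHom n (twist (ginv n g) (fst x)) (fst x)" if "x \<in> Ob EQ" "g \<in> G" for x g
    using that by (auto simp: equivariant_def Let_def hiso_def)
  have pt: "premf n (twist (ginv n g) (fst x))" if "x \<in> Ob EQ" "g \<in> G" for x g
    by (rule premf_twist[OF EQ_premf[OF that(1)] ginv_endo[OF G that(2)]])
  \<comment> \<open>Twisting source and target together changes neither composition nor Hom sets, so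
    associativity in the homotopy category applies to squares with twisted corners.\<close>
  have hc: "hcomp n (twist (ginv n g) X) (twist (ginv n g) Y) = hcomp n X Y" if "g \<in> G"
    for g and X Y :: "('k mpoly, 'x) mf"
    by (simp add: hcomp_def twist_ginv_both(3)[OF that] fun_eq_iff)
  have hH: "hHom n (twist (ginv n g) X) (twist (ginv n g) Y) = hHom n X Y" if "g \<in> G"
    for g and X Y :: "('k mpoly, 'x) mf"
    by (simp add: hHom_def twist_ginv_both[OF that])
  have hi: "hid n (twist (ginv n g) X) = hid n X" if "g \<in> G" for g and X :: "('k mpoly, 'x) mf"
    by (simp add: hid_def twist_ginv_both[OF that])
  show ?thesis
    unfolding is_category_def idt cmp
  proof (intro conjI ballI)
    fix x assume x: "x \<in> Ob EQ"
    note px = EQ_premf[OF x]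
    show "hid n (fst x) \<in> Hom EQ x x"
      unfolding hom
    proof (intro conjI ballI)
      fix g assume g: "g \<in> G"
      show "hcomp n (twist (ginv n g) (fst x)) (fst x) (hid n (fst x)) (snd x g) =
          hcomp n (twist (ginv n g) (fst x)) (fst x) (snd x g) (hid n (fst x))"
        using hcomp_hid[OF pt[OF x g] px act[OF x g]] by (simp add: hi[OF g])
    qed (rule hid_closed[OF px])
    fix y u assume y: "y \<in> Ob EQ" and u: "u \<in> Hom EQ x y"
    note py = EQ_premf[OF y]
    have uh: "u \<in> hHom n (fst x) (fst y)" using u by (simp add: hom)
    show "hcomp n (fst x) (fst y) u (hid n (fst x)) = u" "hcomp n (fst x) (fst y) (hid n (fst y)) u = u"
      by (rule hcomp_hid[OF px py uh])+
    fix z v assume z: "z \<in> Ob EQ" and v: "v \<in> Hom EQ y z"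
    note pz = EQ_premf[OF z]
    have vh: "v \<in> hHom n (fst y) (fst z)" using v by (simp add: hom)
    show "hcomp n (fst x) (fst z) v u \<in> Hom EQ x z"
      unfolding hom
    proof (intro conjI ballI)
      show "hcomp n (fst x) (fst z) v u \<in> hHom n (fst x) (fst z)" by (rule hcomp_closed[OF px py pz uh vh])
      fix g assume g: "g \<in> G"
      let ?t = "\<lambda>x. twist (ginv n g) (fst x)"
      note tx = pt[OF x g] and ty = pt[OF y g] and tz = pt[OF z g]
      have ut: "u \<in> hHom n (?t x) (?t y)" and vt: "v \<in> hHom n (?t y) (?t z)" using uh vh by (simp_all add: hH[OF g])
      have "hcomp n (?t x) (fst z) (hcomp n (fst x) (fst z) v u) (snd x g) =
          hcomp n (?t x) (fst z) v (hcomp n (?t x) (fst y) u (snd x g))"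
        by (rule hcomp_assoc[OF tx px py pz act[OF x g] uh vh, symmetric])
      also have "hcomp n (?t x) (fst y) u (snd x g) = hcomp n (?t x) (fst y) (snd y g) u" using u g by (simp add: hom)
      also have "hcomp n (?t x) (fst z) v (hcomp n (?t x) (fst y) (snd y g) u) =
          hcomp n (?t x) (fst z) (hcomp n (?t y) (fst z) v (snd y g)) u"
        by (rule hcomp_assoc[OF tx ty py pz ut act[OF y g] vh])
      also have "hcomp n (?t y) (fst z) v (snd y g) = hcomp n (?t y) (fst z) (snd z g) v" using v g by (simp add: hom)
      also have "hcomp n (?t x) (fst z) (hcomp n (?t y) (fst z) (snd z g) v) u =
          hcomp n (?t x) (fst z) (snd z g) (hcomp n (?t x) (?t z) v u)"
        by (rule hcomp_assoc[OF tx ty tz pz ut vt act[OF z g], symmetric])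
      finally show "hcomp n (?t x) (fst z) (hcomp n (fst x) (fst z) v u) (snd x g) =
          hcomp n (?t x) (fst z) (snd z g) (hcomp n (fst x) (fst z) v u)" by (simp add: hc[OF g])
    qed
    fix w q assume w: "w \<in> Ob EQ" and q: "q \<in> Hom EQ w x"
    show "hcomp n (fst w) (fst z) v (hcomp n (fst w) (fst y) u q) = hcomp n (fst w) (fst z) (hcomp n (fst x) (fst z) v u) q"
      by (rule hcomp_assoc[OF EQ_premf[OF w] px py pz _ uh vh]) (use q in \<open>simp add: hom\<close>)
  qed
qed

lemma MOD_category: "is_category MOD"
proof (rule is_category_transfer[OF EQ_category _ to_module_Hom to_module_Idt to_module_Cmp])
  show "to_module ` Ob EQ = Ob MOD" using to_module_Ob to_module_surj by (blast intro: sym)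
qed

lemma EQ_equivalent_MOD: "equivalent_categories EQ MOD"
proof (rule equivalent_categoriesI[OF EQ_category MOD_category to_module_Ob to_module_Hom to_module_Idt to_module_Cmp])
  fix y assume y: "y \<in> Ob MOD"
  then obtain x where x: "x \<in> Ob EQ" "to_module x = y" using to_module_surj by blast
  note c = is_categoryD[OF MOD_category]
  have "iso_in MOD y y (Idt MOD y)"
    unfolding iso_in_def using c(1)[OF y] c(3)[OF y y c(1)[OF y]] by blast
  then show "\<exists>x\<in>Ob EQ. \<exists>t. iso_in MOD (to_module x) y t" using x by blast
qed

end

end

section \<open>Transport of structure along homotopy equivalences\<close>

lemma homotopic_sandwich:
  assumes X: "premf n X" and Y: "premf n Y" and Z: "premf n Z" and V: "premf n V"
    and f: "is_mf_map n X Y f" and u: "is_mf_map n Y Z u" and u': "is_mf_map n Y Z u'" and g: "is_mf_map n Z V g"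
    and ho: "homotopic n Y Z u u'"
  shows "homotopic n X V (\<lambda>x. g (u (f x))) (\<lambda>x. g (u' (f x)))"
proof -
  have "homotopic n X Z (\<lambda>x. u (f x)) (\<lambda>x. u' (f x))"
    by (rule homotopic_comp'[OF X Y Z f f u u' homotopic_refl'[OF X Y f] ho])
  then show ?thesis
    by (rule homotopic_comp'[OF X Z V is_mf_map_comp[OF f u] is_mf_map_comp[OF f u'] g g _ homotopic_refl'[OF Z V g]])
qed

context symmetric_potential
begin

text \<open>The structure is conjugated by the equivalence. For the product law, ba is inserted
  between \<phi>_g and \<phi>_h, where it is homotopic to the identity.\<close>

lemma transport_rep:
  assumes X: "premf n X" and Y: "premf n Y" and rep: "is_rep Y \<phi>"
    and a: "a \<in> mf_maps n Y X" and b: "b \<in> mf_maps n X Y"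
    and ba: "homotopic n Y Y (\<lambda>y. b (a y)) (\<lambda>y. y)" and ab: "homotopic n X X (\<lambda>x. a (b x)) (\<lambda>x. x)"
    and \<psi>_def: "\<psi> = (\<lambda>g. \<lambda>x\<in>carrier X. a (\<phi> g (b x)))"
  shows "is_rep X \<psi>"
    and "g \<in> G \<Longrightarrow> homotopic n (twist (ginv n g) X) Y (\<lambda>x. b (\<psi> g x)) (\<lambda>x. \<phi> g (b x))"
    and "g \<in> G \<Longrightarrow> homotopic n (twist (ginv n g) Y) X (\<lambda>y. a (\<phi> g y)) (\<lambda>y. \<psi> g (a y))"
proof -
  let ?tX = "\<lambda>g. twist (ginv n g) X" and ?tY = "\<lambda>g. twist (ginv n g) Y"
  have \<phi>: "\<And>g. g \<in> G \<Longrightarrow> \<phi> g \<in> mf_maps n (?tY g) Y" and e: "homotopic n Y Y (\<phi> one\<^sub>G) (\<lambda>x. x)"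
    and m: "\<And>g h. g \<in> G \<Longrightarrow> h \<in> G \<Longrightarrow> homotopic n (?tY (g \<cdot> h)) Y (\<phi> (g \<cdot> h)) (\<lambda>x. \<phi> g (\<phi> h x))"
    using rep by (auto simp: is_rep_def)
  note \<phi>m = mf_maps_is_mf_map[OF \<phi>] and am = mf_maps_is_mf_map[OF a] and bm = mf_maps_is_mf_map[OF b]
  have tX: "premf n (?tX g)" and tY: "premf n (?tY g)" if "g \<in> G" for g
    by (rule premf_twist[OF _ ginv_endo[OF G that]]; fact)+
  have at: "is_mf_map n (?tY g) (?tX g) a" and bt: "is_mf_map n (?tX g) (?tY g) b" if "g \<in> G" for g
    by (rule mf_maps_is_mf_map, simp only: twist_ginv_both[OF that] a b)+
  have ac: "a y \<in> carrier X" if "y \<in> carrier Y" for y using mf_maps_closed[OF a that] .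
  have bc: "b x \<in> carrier Y" if "x \<in> carrier X" for x using mf_maps_closed[OF b that] .
  have \<phi>c: "\<phi> g y \<in> carrier Y" if "g \<in> G" "y \<in> carrier Y" for g y using mf_maps_closed[OF \<phi>[OF that(1)]] that(2) by simp
  have \<psi>_eq: "\<psi> g x = a (\<phi> g (b x))" if "x \<in> carrier X" for g x using that by (simp add: \<psi>_def)
  have \<psi>: "\<psi> g \<in> mf_maps n (?tX g) X" if g: "g \<in> G" for g
    using is_mf_map_restrict[OF is_mf_map_comp[OF is_mf_map_comp[OF bt[OF g] \<phi>m[OF g]] am] tX[OF g]]
    by (simp add: \<psi>_def)
  have bam: "is_mf_map n Y Y (\<lambda>y. b (a y))" and abm: "is_mf_map n X X (\<lambda>x. a (b x))"
    by (rule is_mf_map_comp[OF am bm] is_mf_map_comp[OF bm am])+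
  have bat: "is_mf_map n (?tY g) (?tY g) (\<lambda>y. b (a y))" if "g \<in> G" for g by (rule is_mf_map_comp[OF at[OF that] bt[OF that]])
  note id = is_mf_map_id
  have ba': "homotopic n (?tY g) (?tY g) (\<lambda>y. y) (\<lambda>y. b (a y))" if "g \<in> G" for g
    unfolding twist_ginv_both[OF that] by (rule homotopic_sym'[OF Y Y bam id ba])
  have "homotopic n X X (\<lambda>x. a (\<phi> one\<^sub>G (b x))) (\<lambda>x. x)"
  proof -
    have pe: "is_mf_map n Y Y (\<phi> one\<^sub>G)"
      by (rule mf_maps_is_mf_map) (use \<phi>[OF one_closed] in \<open>simp only: twist_ginv_one\<close>)
    have "homotopic n X X (\<lambda>x. a (\<phi> one\<^sub>G (b x))) (\<lambda>x. a (b x))"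
      by (rule homotopic_sandwich[OF X Y Y X bm pe id am e])
    from homotopic_trans'[OF X X is_mf_map_comp[OF is_mf_map_comp[OF bm pe] am] abm id this ab] show ?thesis .
  qed
  then have one: "homotopic n X X (\<psi> one\<^sub>G) (\<lambda>x. x)"
    by (subst homotopic_cong[of _ _ "\<lambda>x. a (\<phi> one\<^sub>G (b x))" _ "\<lambda>x. x"]) (simp_all add: \<psi>_eq)
  have mult: "homotopic n (?tX (g \<cdot> h)) X (\<psi> (g \<cdot> h)) (\<lambda>x. \<psi> g (\<psi> h x))" if g: "g \<in> G" and h: "h \<in> G" for g h
  proof -
    let ?tX2 = "twist (ginv n g) (?tX h)" and ?tY2 = "twist (ginv n g) (?tY h)"
    note gh = mult_closed[OF g h]
    have X2: "premf n ?tX2" and Y2: "premf n ?tY2"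
      by (rule premf_twist[OF tX[OF h] ginv_endo[OF G g]] premf_twist[OF tY[OF h] ginv_endo[OF G g]])+
    have b2: "is_mf_map n ?tX2 ?tY2 b"
      by (rule mf_maps_is_mf_map) (simp only: twist_ginv_both[OF g] twist_ginv_both[OF h] b)
    have \<phi>gh: "is_mf_map n ?tY2 Y (\<phi> (g \<cdot> h))"
      by (rule mf_maps_is_mf_map) (use \<phi>[OF gh] in \<open>simp only: twist_ginv_mult[OF g h]\<close>)
    have \<phi>h: "is_mf_map n ?tY2 (?tY g) (\<phi> h)"
      by (rule mf_maps_is_mf_map) (simp only: twist_ginv_both[OF g] \<phi>[OF h])
    note \<phi>hb = is_mf_map_comp[OF b2 \<phi>h] and a\<phi>g = is_mf_map_comp[OF \<phi>m[OF g] am]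
    have m2: "homotopic n ?tY2 Y (\<phi> (g \<cdot> h)) (\<lambda>x. \<phi> g (\<phi> h x))"
      using m[OF g h] by (simp only: twist_ginv_mult(2)[OF g h])
    have "homotopic n ?tX2 X (\<lambda>x. a (\<phi> (g \<cdot> h) (b x))) (\<lambda>x. a (\<phi> g (\<phi> h (b x))))"
      by (rule homotopic_sandwich[OF X2 Y2 Y X b2 \<phi>gh is_mf_map_comp[OF \<phi>h \<phi>m[OF g]] am m2])
    moreover have "homotopic n ?tX2 X (\<lambda>x. a (\<phi> g (\<phi> h (b x)))) (\<lambda>x. a (\<phi> g (b (a (\<phi> h (b x))))))"
      by (rule homotopic_sandwich[OF X2 tY[OF g] tY[OF g] X \<phi>hb id bat[OF g] a\<phi>g ba'[OF g]])
    ultimately have "homotopic n ?tX2 X (\<lambda>x. a (\<phi> (g \<cdot> h) (b x))) (\<lambda>x. a (\<phi> g (b (a (\<phi> h (b x))))))"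
      by (rule homotopic_trans'[OF X2 X is_mf_map_comp[OF is_mf_map_comp[OF b2 \<phi>gh] am]
          is_mf_map_comp[OF \<phi>hb a\<phi>g] is_mf_map_comp[OF is_mf_map_comp[OF \<phi>hb bat[OF g]] a\<phi>g]])
    then show ?thesis
      unfolding twist_ginv_mult(2)[OF g h]
      by (subst homotopic_cong[of _ _ "\<lambda>x. a (\<phi> (g \<cdot> h) (b x))" _ "\<lambda>x. a (\<phi> g (b (a (\<phi> h (b x)))))"])
        (simp_all add: \<psi>_eq ac bc \<phi>c h)
  qed
  show "is_rep X \<psi>" unfolding is_rep_def using \<psi> one mult by blast
  show "homotopic n (?tX g) Y (\<lambda>x. b (\<psi> g x)) (\<lambda>x. \<phi> g (b x))" if g: "g \<in> G"
  proof -
    have "homotopic n (?tX g) Y (\<lambda>x. b (a (\<phi> g (b x)))) (\<lambda>x. \<phi> g (b x))"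
      by (rule homotopic_sandwich[OF tX[OF g] Y Y Y is_mf_map_comp[OF bt[OF g] \<phi>m[OF g]] bam id id ba])
    then show ?thesis
      by (subst homotopic_cong[of _ _ "\<lambda>x. b (a (\<phi> g (b x)))" _ "\<lambda>x. \<phi> g (b x)"]) (simp_all add: \<psi>_eq)
  qed
  show "homotopic n (?tY g) X (\<lambda>y. a (\<phi> g y)) (\<lambda>y. \<psi> g (a y))" if g: "g \<in> G"
  proof -
    have "homotopic n (?tY g) X (\<lambda>y. a (\<phi> g y)) (\<lambda>y. a (\<phi> g (b (a y))))"
      by (rule homotopic_sandwich[OF tY[OF g] tY[OF g] tY[OF g] X id id bat[OF g] is_mf_map_comp[OF \<phi>m[OF g] am] ba'[OF g]])
    then show ?thesis
      by (subst homotopic_cong[of _ _ "\<lambda>y. a (\<phi> g y)" _ "\<lambda>y. a (\<phi> g (b (a y)))"]) (simp_all add: \<psi>_eq ac)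
  qed
qed

text \<open>Every module comes from an equivariant object of the larger class; its underlying
  factorisation is replaced by an isomorphic one from the smaller class, and the structure is
  transported along the isomorphism.\<close>

lemma to_module_essentially_surjective:
  assumes O1: "\<O>1 \<subseteq> HMF n W" and O2: "\<O>2 \<subseteq> \<O>1"
    and iso: "\<And>X. X \<in> \<O>1 \<Longrightarrow> \<exists>Y\<in>\<O>2. \<exists>\<Phi>. hiso n X Y \<Phi>"
    and y: "y \<in> Ob (left_modules n W (AG n W G) \<O>1)"
  shows "\<exists>x\<in>Ob (equivariant n G \<O>2). \<exists>t. iso_in (left_modules n W (AG n W G) \<O>1) (to_module x) y t"
proof -
  let ?E = "equivariant n G \<O>1" and ?M = "left_modules n W (AG n W G) \<O>1"
  obtain z where z: "z \<in> Ob ?E" and zy: "to_module z = y" using to_module_surj[OF O1 y] by blast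
  let ?Y = "fst z" and ?\<phi> = "\<lambda>g. SOME f. f \<in> snd z g"
  note Y = EQ_premf[OF O1 z] and \<phi> = EQ_rep(1)[OF O1 z] and rep = EQ_rep(3)[OF O1 z]
  have z_eq: "(?Y, cls ?Y ?\<phi>) = z" unfolding EQ_rep(2)[OF O1 z, symmetric] by simp
  obtain X \<Phi> where X2: "X \<in> \<O>2" and \<Phi>: "hiso n ?Y X \<Phi>" using iso[OF EQ_carrier[OF O1 z]] by blast
  have X1: "X \<in> \<O>1" using X2 O2 by blast
  have X: "premf n X" using X1 O1 HMF_premf by blast
  obtain a b where a: "a \<in> mf_maps n ?Y X" and b: "b \<in> mf_maps n X ?Y"
    and ba: "homotopic n ?Y ?Y (compose (carrier ?Y) b a) (\<lambda>m\<in>carrier ?Y. m)"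
    and ab: "homotopic n X X (compose (carrier X) a b) (\<lambda>m\<in>carrier X. m)"
    using hisoE[OF Y X \<Phi>] by metis
  have "homotopic n ?Y ?Y (\<lambda>y. b (a y)) (\<lambda>y. y)" "homotopic n X X (\<lambda>x. a (b x)) (\<lambda>x. x)"
    using ba ab by (simp_all add: compose_def)
  note tr = transport_rep[OF X Y rep a b this]
  define \<psi> where "\<psi> = (\<lambda>g. \<lambda>x\<in>carrier X. a (?\<phi> g (b x)))"
  note tr = tr[OF \<psi>_def]
  have \<psi>: "\<And>g. g \<in> G \<Longrightarrow> \<psi> g \<in> mf_maps n (twist (ginv n g) X) X" using tr(1) by (simp add: is_rep_def)
  let ?x = "(X, cls X \<psi>)"
  have x2: "?x \<in> Ob (equivariant n G \<O>2)" and x1: "?x \<in> Ob ?E"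
    using equivariant_Ob_iff[OF X \<psi>] tr(1) X1 X2 by simp_all
  have "hclass n X ?Y b \<in> Hom ?E ?x (?Y, cls ?Y ?\<phi>)"
    by (rule equivariant_Hom_iff[OF X Y \<psi> \<phi> b, THEN iffD2]) ((assumption | rule ballI, erule tr(2))+)
  then have t: "hclass n X ?Y b \<in> Hom ?E ?x z" by (simp only: z_eq)
  have "hclass n ?Y X a \<in> Hom ?E (?Y, cls ?Y ?\<phi>) ?x"
    by (rule equivariant_Hom_iff[OF Y X \<phi> \<psi> a, THEN iffD2]) ((assumption | rule ballI, erule tr(3))+)
  then have s: "hclass n ?Y X a \<in> Hom ?E z ?x" by (simp only: z_eq)
  have st: "hcomp n X X (hclass n ?Y X a) (hclass n X ?Y b) = hid n X"
    unfolding hid_def hcomp_hclass[OF X Y X b a] hclass_eq[OF X X mf_maps_compose[OF X b a] mf_maps_id[OF X]] by (rule ab)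
  have ts: "hcomp n ?Y ?Y (hclass n X ?Y b) (hclass n ?Y X a) = hid n ?Y"
    unfolding hid_def hcomp_hclass[OF Y X Y a b] hclass_eq[OF Y Y mf_maps_compose[OF Y a b] mf_maps_id[OF Y]] by (rule ba)
  have "iso_in ?M (to_module ?x) (to_module z) (hclass n X ?Y b)"
    unfolding iso_in_def to_module_Hom[OF O1 x1 z] to_module_Hom[OF O1 z x1] to_module_Cmp[OF O1] to_module_Idt[OF O1]
  proof (intro conjI bexI[OF _ s] t)
    show "Cmp ?E ?x z ?x (hclass n ?Y X a) (hclass n X ?Y b) = Idt ?E ?x"
      "Cmp ?E z ?x z (hclass n X ?Y b) (hclass n ?Y X a) = Idt ?E z"
      using st ts by (simp_all add: equivariant_def Let_def split_def)
  qed
  then show ?thesis using x2 zy by blast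
qed

end

section \<open>Finite rank factorisations as their own direct summands\<close>

definition zero_mf :: "('r, 'm) mf" where
  "zero_mf = \<lparr>carrier = {undefined}, monoid.mult = undefined, one = undefined, ring.zero = undefined,
     add = (\<lambda>_ _. undefined), module.smult = (\<lambda>_ _. undefined), evens = {undefined}, odds = {undefined},
     diff = (\<lambda>_. undefined)\<rparr>"

lemma zero_mf_simps [simp]:
  "carrier zero_mf = {undefined}" "\<zero>\<^bsub>zero_mf\<^esub> = undefined" "a \<oplus>\<^bsub>zero_mf\<^esub> b = undefined"
  "r \<odot>\<^bsub>zero_mf\<^esub> a = undefined" "evens zero_mf = {undefined}" "odds zero_mf = {undefined}"
  "diff zero_mf a = undefined"
  by (simp_all add: zero_mf_def)

text \<open>Every type contains \<open>undefined\<close>, so the zero factorisation exists in each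
  universe of elements; its basis is empty.\<close>

lemma zero_mf_HMF: "(zero_mf :: ('k::comm_ring_1 mpoly, 'm) mf) \<in> HMF n W"
proof -
  have "abelian_group (zero_mf :: ('k mpoly, 'm) mf)" by (rule abelian_groupI) auto
  then have "premf n (zero_mf :: ('k mpoly, 'm) mf)" by (rule premfI) auto
  then interpret premf n "zero_mf :: ('k mpoly, 'm) mf" .
  have "is_basis (PR n) (zero_mf :: ('k mpoly, 'm) mf) {}" by (auto simp: is_basis_def)
  then have "homogeneous_basis n (zero_mf :: ('k mpoly, 'm) mf) {}" by (simp add: homogeneous_basis_def)
  then show ?thesis
    unfolding HMF_def using mod evens odds decomp diff_linear by auto
qed

text \<open>Take Z = 0 and Y = X in the definition of a summand; the maps between X \<oplus> 0 and X
  are strictly inverse to each other.\<close>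

lemma hmf_subset_hmf_omega: "(hmf n W :: ('k::comm_ring_1 mpoly, 'm) mf set) \<subseteq> hmf_omega n W"
proof
  fix X :: "('k mpoly, 'm) mf" assume X: "X \<in> hmf n W"
  then have XH: "X \<in> HMF n W" by (simp add: hmf_def)
  note pX = HMF_premf[OF XH]
  let ?F = "\<lambda>b::bool. if b then X else zero_mf" and ?S = "mf_dsum UNIV (\<lambda>b::bool. if b then X else zero_mf)"
  have pF: "premf n (?F b)" for b using pX HMF_premf[OF zero_mf_HMF] by (cases b) auto
  have pS: "premf n ?S" by (rule premf_mf_dsum) (rule pF)
  interpret X: premf n X by (rule pX)
  let ?\<alpha> = "\<lambda>a\<in>carrier ?S. a True" and ?\<beta> = "\<lambda>x\<in>carrier X. \<lambda>b. if b then x else undefined"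
  have \<alpha>: "?\<alpha> \<in> mf_maps n ?S X"
  proof (rule is_mf_map_restrict[OF _ pS])
    have T: "a True \<in> C" if "a \<in> (\<Pi>\<^sub>E b\<in>UNIV. if b then C else D)" for a :: "bool \<Rightarrow> 'm" and C D
      using PiE_mem[OF that, of True] by simp
    show "is_mf_map n ?S X (\<lambda>a. a True)"
      by (auto simp: is_mf_map_def is_linear_def additive_def if_distrib[of carrier] if_distrib[of evens]
          if_distrib[of odds] dest: T)
  qed
  have \<beta>: "?\<beta> \<in> mf_maps n X ?S"
  proof (rule is_mf_map_restrict[OF _ pX])
    show "is_mf_map n X ?S (\<lambda>x b. if b then x else undefined)"
      by (simp add: is_mf_map_def is_linear_def additive_def image_subset_iff Pi_iff PiE_iff fun_eq_iff)
  qed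
  have "?\<beta> (?\<alpha> a) = a" if a: "a \<in> carrier ?S" for a
  proof
    have "a True \<in> carrier X" "a False = undefined"
      using PiE_mem[of a UNIV "\<lambda>b. carrier (?F b)" True] PiE_mem[of a UNIV "\<lambda>b. carrier (?F b)" False] a by simp_all
    then show "?\<beta> (?\<alpha> a) b = a b" for b using a by (cases b) (simp_all del: mf_dsum_simps)
  qed
  then have "compose (carrier ?S) ?\<beta> ?\<alpha> = (\<lambda>m\<in>carrier ?S. m)"
    unfolding compose_def by (rule restrict_ext)
  moreover have "compose (carrier X) ?\<alpha> ?\<beta> = (\<lambda>m\<in>carrier X. m)"
    unfolding compose_def
    by (rule restrict_ext) (use mf_maps_closed[OF \<beta>] in \<open>simp del: mf_dsum_simps\<close>)
  ultimately have "hiso n ?S X (hclass n ?S X ?\<alpha>)"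
    using hisoI[OF pS pX \<alpha> \<beta>] homotopic_refl[OF pS pS mf_maps_id[OF pS]] homotopic_refl[OF pX pX mf_maps_id[OF pX]]
    by simp
  then show "X \<in> hmf_omega n W" unfolding hmf_omega_def using XH X zero_mf_HMF by blast
qed

text \<open>Since \<open>hmf\<close> need not be idempotent complete, the equivalence is proved with
  either class of objects on both sides; the mixed form, with finite rank on the left and summands
  on the right, is proved when every such summand is isomorphic to a factorisation of finite
  rank.\<close>

theorem theorem7p2:
  fixes W :: "'k::comm_ring_1 mpoly" and n :: nat and G :: "('k mpoly \<Rightarrow> 'k mpoly) set"
  assumes k: "noetherian_Q_algebra TYPE('k)"
    and W: "potential n W"
    and G: "symmetry_group n W G"
  shows "equivalent_categories
           (equivariant n G (hmf_omega n W :: ('k mpoly, 'm) mf set))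
           (left_modules n W (AG n W G) (hmf_omega n W :: ('k mpoly, 'm) mf set))
       \<and> equivalent_categories
           (equivariant n G (hmf n W :: ('k mpoly, 'm) mf set))
           (left_modules n W (AG n W G) (hmf n W :: ('k mpoly, 'm) mf set))
       \<and> ((\<forall>X \<in> (hmf_omega n W :: ('k mpoly, 'm) mf set).
             \<exists>Y \<in> (hmf n W :: ('k mpoly, 'm) mf set). \<exists>\<Phi>. hiso n X Y \<Phi>) \<longrightarrow>
          equivalent_categories
           (equivariant n G (hmf n W :: ('k mpoly, 'm) mf set))
           (left_modules n W (AG n W G) (hmf_omega n W :: ('k mpoly, 'm) mf set)))"
proof (intro conjI impI)
  interpret symmetric_potential n W G
    by (rule symmetric_potential.intro[OF _ G]) (use W in \<open>simp add: potential_def\<close>)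
  let ?H = "hmf n W :: ('k mpoly, 'm) mf set" and ?Ho = "hmf_omega n W :: ('k mpoly, 'm) mf set"
  have H: "?H \<subseteq> HMF n W" and Ho: "?Ho \<subseteq> HMF n W" by (auto simp: hmf_def hmf_omega_def)
  have sub: "?H \<subseteq> ?Ho" by (rule hmf_subset_hmf_omega)
  show "equivalent_categories (equivariant n G ?Ho) (left_modules n W (AG n W G) ?Ho)"
    by (rule EQ_equivalent_MOD[OF Ho])
  show "equivalent_categories (equivariant n G ?H) (left_modules n W (AG n W G) ?H)"
    by (rule EQ_equivalent_MOD[OF H])
  assume iso: "\<forall>X\<in>?Ho. \<exists>Y\<in>?H. \<exists>\<Phi>. hiso n X Y \<Phi>"
  have ob: "x \<in> Ob (equivariant n G ?Ho)" if "x \<in> Ob (equivariant n G ?H)" for x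
    using that sub by (auto simp: equivariant_def Let_def)
  \<comment> \<open>The class of admissible objects enters the equivariant category only through
    \<open>Ob\<close>, so \<open>to_module\<close> keeps its properties when restricted to finite
    rank.\<close>
  have E: "Hom (equivariant n G ?Ho) = Hom (equivariant n G ?H)" "Idt (equivariant n G ?Ho) = Idt (equivariant n G ?H)"
    "Cmp (equivariant n G ?Ho) = Cmp (equivariant n G ?H)"
    by (simp_all add: equivariant_def Let_def)
  show "equivalent_categories (equivariant n G ?H) (left_modules n W (AG n W G) ?Ho)"
  proof (rule equivalent_categoriesI[OF EQ_category[OF H] MOD_category[OF Ho], of to_module])
    show "\<exists>x\<in>Ob (equivariant n G ?H). \<exists>t. iso_in (left_modules n W (AG n W G) ?Ho) (to_module x) y t"
      if "y \<in> Ob (left_modules n W (AG n W G) ?Ho)" for y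
      by (rule to_module_essentially_surjective[OF Ho sub _ that]) (use iso in blast)
  qed (simp_all add: to_module_Ob[OF Ho ob] to_module_Hom[OF Ho ob ob] to_module_Idt[OF Ho] to_module_Cmp[OF Ho] E)
qed

end
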